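(* Let $P=\mathbb P^{N-1}_{[x_1:\cdots:x_N]}$ be a projective space over an $F$-finite field $k$ of characteristic $p>0$, $S=k[x_1,\dots,x_N]$ with the standard grading, and $\mathfrak m=(x_1,\dots,x_N)$. Let $X\subseteq P$ be a complete intersection defined by a homogeneous regular sequence $f_1,\dots,f_m\in S$ with $\dim X\ge1$. Put $I=(f_1,\dots,f_m)$ and $f=f_1\cdots f_m$. (1) Define $\theta\colon v^\perp\to S$ by $F_*a\mapsto u(F_*(\Delta_1(f^{p-1})a))$, $I_1:=(I^{[p]}:I)$ and $I_{s+1}:=\theta(F_*I_s\cap v^\perp)+I_1$ for $s\ge 1$. Then $$\operatorname{ht}(X)=\inf\{n\mid I_n\nsubseteq\mathfrak m^{[p]}\}.$$ (2) Assume that $\deg(f)=N$. Let $\widetilde\Delta\in S$ be a representative of $\Delta_1(f^{p-1})$ which is homogeneous of degree $p(p-1)N$, and put $g_1:=f^{p-1}$, $g_n:=f^{p-1}\,\widetilde\Delta^{\,1+p+\cdots+p^{n-2}}$ for $n\ge2$. Then $$\operatorname{ht}(X)=\inf\{n\mid g_n\notin\mathfrak m^{[p^n]}\}.$$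
   Context: Quasi-$F$-split height: for an $\mathbb F_p$-scheme $X$ and $n\ge1$, let $W_n\mathcal O_X$ be the sheaf of ($p$-typical) Witt vectors of length $n$, $F\colon W_n\mathcal O_X\to F_*W_n\mathcal O_X$ the Frobenius and $R^{n-1}\colon W_n\mathcal O_X\to\mathcal O_X$ the restriction. $X$ is $n$-quasi-$F$-split if there is a $W_n\mathcal O_X$-module homomorphism $\phi\colon F_*W_n\mathcal O_X\to\mathcal O_X$ with $\phi\circ F=R^{n-1}$. $\operatorname{ht}(X)$ is the infimum of such $n$ ($\inf\emptyset=\infty$). Notation: $F_*S$ is $S$ with $S$-action $a\cdot F_*b=F_*(a^pb)$; $I^{[p^n]}$ is the ideal generated by $p^n$-th powers of elements of $I$. Let $y_1,\dots,y_s$ be a $p$-basis of $k$ (the $F_*(\prod y_i^{e_i})$, $0\le e_i\le p-1$, form a $k$-basis of $F_*k$). Write $v_1,\dots,v_d$ for the elements $y_1^{j_1}\cdots y_s^{j_s}x_1^{i_1}\cdots x_N^{i_N}$ with $0\le j_l,i_l\le p-1$; $F_*v_1,\dots,F_*v_d$ is an $S$-basis of $F_*S$. Put $v=v_d=(y_1\cdots y_sx_1\cdots x_N)^{p-1}$, let $u\in\operatorname{Hom}_S(F_*S,S)$ be the dual basis element of $F_*v$, and $v^\perp:=\ker(u)\subset F_*S$. A $p$-monomial is an element of the form $b^pv_i$. For $a\in S$ with a decomposition $a=a_1+\cdots+a_r$ into $p$-monomials, $\Delta_1(a)\in S/F(S)$, where $F(S)=\{b^p\mid b\in S\}$, is the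 class (independent of choices) of $$\sum_{\substack{0\le\alpha_1,\dots,\alpha_r\le p-1\\ \alpha_1+\cdots+\alpha_r=p}}\frac1p\binom{p}{\alpha_1,\dots,\alpha_r}a_1^{\alpha_1}\cdots a_r^{\alpha_r}.$$ If $a$ is homogeneous of degree $e$, $\Delta_1(a)$ has a representative homogeneous of degree $pe$. On $v^\perp$, $u(F_*(\Delta_1(f^{p-1})a))$ is independent of the chosen representative of $\Delta_1(f^{p-1})$. *)

theory Defs
  imports
    "HOL-Library.Cardinality"
    "HOL-Library.Extended_Nat"
    "HOL-Library.Poly_Mapping"
    "HOL-Algebra.Algebraic_Closure_Type"
    "HOL-Algebra.QuotRing"
    "HOL-Analysis.Abstract_Topology"
begin

section \<open>Witt vectors of finite length\<close>

text \<open>Integer polynomials in the variables $X_0, X_1, \dots$ (the \<^const>\<open>Inl\<close> indices) and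
  $Y_0, Y_1, \dots$ (the \<^const>\<open>Inr\<close> indices).\<close>

type_synonym witt_poly = "((nat + nat) \<Rightarrow>\<^sub>0 nat) \<Rightarrow>\<^sub>0 int"

definition witt_var :: "nat + nat \<Rightarrow> witt_poly" where
  "witt_var t = Poly_Mapping.single (Poly_Mapping.single t 1) 1"

definition ghost :: "nat \<Rightarrow> nat \<Rightarrow> (nat \<Rightarrow> witt_poly) \<Rightarrow> witt_poly" where
  "ghost p n S = (\<Sum>i\<le>n. of_nat p ^ i * S i ^ (p ^ (n - i)))"

text \<open>For prime \<open>p\<close> Witt's theorem gives existence and uniqueness of the following sequences.\<close>

definition witt_sum :: "nat \<Rightarrow> nat \<Rightarrow> witt_poly" where
  "witt_sum p = (THE S. \<forall>n. ghost p n S =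
     ghost p n (\<lambda>i. witt_var (Inl i)) + ghost p n (\<lambda>i. witt_var (Inr i)))"

definition witt_prod :: "nat \<Rightarrow> nat \<Rightarrow> witt_poly" where
  "witt_prod p = (THE S. \<forall>n. ghost p n S =
     ghost p n (\<lambda>i. witt_var (Inl i)) * ghost p n (\<lambda>i. witt_var (Inr i)))"

definition eval_int_poly :: "('a, 'b) ring_scheme \<Rightarrow> ('v \<Rightarrow> 'a) \<Rightarrow> (('v \<Rightarrow>\<^sub>0 nat) \<Rightarrow>\<^sub>0 int) \<Rightarrow> 'a" where
  "eval_int_poly R env Q =
     (\<Oplus>\<^bsub>R\<^esub>m\<in>Poly_Mapping.keys Q. [Poly_Mapping.lookup Q m] \<cdot>\<^bsub>R\<^esub>
        (\<Otimes>\<^bsub>R\<^esub>t\<in>Poly_Mapping.keys m. env t [^]\<^bsub>R\<^esub> Poly_Mapping.lookup m t))"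

definition witt_ring :: "nat \<Rightarrow> nat \<Rightarrow> 'a ring \<Rightarrow> 'a list ring" where
  "witt_ring p n R =
    \<lparr> carrier = {a. length a = n \<and> set a \<subseteq> carrier R},
      monoid.mult = (\<lambda>a b. map (\<lambda>i. eval_int_poly R (case_sum (nth a) (nth b)) (witt_prod p i)) [0..<n]),
      one = map (\<lambda>i. if i = 0 then \<one>\<^bsub>R\<^esub> else \<zero>\<^bsub>R\<^esub>) [0..<n],
      ring.zero = replicate n \<zero>\<^bsub>R\<^esub>,
      add = (\<lambda>a b. map (\<lambda>i. eval_int_poly R (case_sum (nth a) (nth b)) (witt_sum p i)) [0..<n]) \<rparr>"

text \<open>Over a ring of characteristic \<open>p\<close> the Witt vector Frobenius raises each component to the
  \<open>p\<close>-th power.\<close>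

definition witt_frob :: "nat \<Rightarrow> 'a ring \<Rightarrow> 'a list \<Rightarrow> 'a list" where
  "witt_frob p R a = map (\<lambda>c. c [^]\<^bsub>R\<^esub> p) a"


section \<open>Ringed spaces, dimension and quasi-F-split height\<close>

record ('a, 'b) ringed_space =
  spc :: "'a topology"
  sec :: "'a set \<Rightarrow> 'b ring"
  res :: "'a set \<Rightarrow> 'a set \<Rightarrow> 'b \<Rightarrow> 'b"  \<comment> \<open>\<open>res E U V\<close> maps sections over \<open>U\<close> to sections over \<open>V \<subseteq> U\<close>\<close>

definition irreducible_closedin :: "'a topology \<Rightarrow> 'a set \<Rightarrow> bool" where
  "irreducible_closedin T Z \<longleftrightarrow> closedin T Z \<and> Z \<noteq> {} \<and>
     (\<forall>A B. closedin T A \<and> closedin T B \<and> Z = A \<union> B \<longrightarrow> Z = A \<or> Z = B)"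

definition krull_dim :: "'a topology \<Rightarrow> enat" where
  "krull_dim T = Sup {enat n | n. \<exists>Z. (\<forall>i\<le>n. irreducible_closedin T (Z i)) \<and>
                                     (\<forall>i<n. Z i \<subset> Z (Suc i))}"

text \<open>Frobenius is the identity on the underlying space, so $F_*W_n\mathcal O_X$ has the same
  sections as $W_n\mathcal O_X$, with \<open>a\<close> acting on \<open>b\<close> as multiplication by the Frobenius of \<open>a\<close>;
  $W_n\mathcal O_X$ acts on $\mathcal O_X$ through the restriction $R^{n-1}$, the zeroth component.\<close>

definition witt_module_hom ::
    "nat \<Rightarrow> nat \<Rightarrow> ('a, 'b) ringed_space \<Rightarrow> ('a set \<Rightarrow> 'b list \<Rightarrow> 'b) \<Rightarrow> bool" where
  "witt_module_hom p n E \<psi> \<longleftrightarrow>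
     (\<forall>U. openin (spc E) U \<longrightarrow>
        (let A = sec E U; W = witt_ring p n A in
          \<psi> U \<in> carrier W \<rightarrow> carrier A \<and>
          (\<forall>b\<in>carrier W. \<forall>c\<in>carrier W. \<psi> U (b \<oplus>\<^bsub>W\<^esub> c) = \<psi> U b \<oplus>\<^bsub>A\<^esub> \<psi> U c) \<and>
          (\<forall>a\<in>carrier W. \<forall>b\<in>carrier W.
              \<psi> U (witt_frob p A a \<otimes>\<^bsub>W\<^esub> b) = (a ! 0) \<otimes>\<^bsub>A\<^esub> \<psi> U b) \<and>
          (\<forall>V. openin (spc E) V \<and> V \<subseteq> U \<longrightarrow>
             (\<forall>b\<in>carrier W. \<psi> V (map (res E U V) b) = res E U V (\<psi> U b)))))"

definition quasi_F_split :: "nat \<Rightarrow> nat \<Rightarrow> ('a, 'b) ringed_space \<Rightarrow> bool" where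
  "quasi_F_split p n E \<longleftrightarrow>
     (\<exists>\<psi>. witt_module_hom p n E \<psi> \<and>
        (\<forall>U. openin (spc E) U \<longrightarrow>
           (\<forall>a\<in>carrier (witt_ring p n (sec E U)). \<psi> U (witt_frob p (sec E U) a) = a ! 0)))"

definition qfs_height :: "nat \<Rightarrow> ('a, 'b) ringed_space \<Rightarrow> enat" where
  "qfs_height p E = Inf {enat n | n. n \<ge> 1 \<and> quasi_F_split p n E}"


section \<open>Proj of a graded ring\<close>

text \<open>\<open>G d\<close> is the set of homogeneous elements of degree \<open>d\<close> (including zero) of the graded
  ring \<open>R\<close>.\<close>

definition proj_points :: "'a ring \<Rightarrow> (nat \<Rightarrow> 'a set) \<Rightarrow> 'a set set" where
  "proj_points R G = {P. primeideal P R \<and> P = Idl\<^bsub>R\<^esub> (P \<inter> (\<Union>d. G d)) \<and>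
                        \<not> (\<Union>d\<in>{1..}. G d) \<subseteq> P}"

definition proj_top :: "'a ring \<Rightarrow> (nat \<Rightarrow> 'a set) \<Rightarrow> 'a set topology" where
  "proj_top R G = topology_generated_by {{P \<in> proj_points R G. h \<notin> P} | h d. h \<in> G d}"

text \<open>The homogeneous localization $R_{(P)}$: classes of pairs \<open>(a, b)\<close>, standing for $a/b$, of
  homogeneous elements of the same degree with \<open>b \<notin> P\<close>.\<close>

definition hfrac :: "(nat \<Rightarrow> 'a set) \<Rightarrow> 'a set \<Rightarrow> ('a \<times> 'a) set" where
  "hfrac G P = {(a, b). (\<exists>d. a \<in> G d \<and> b \<in> G d) \<and> b \<notin> P}"

definition hfrac_rel :: "'a ring \<Rightarrow> (nat \<Rightarrow> 'a set) \<Rightarrow> 'a set \<Rightarrow> (('a \<times> 'a) \<times> ('a \<times> 'a)) set" where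
  "hfrac_rel R G P = {((a, b), (c, d)). (a, b) \<in> hfrac G P \<and> (c, d) \<in> hfrac G P \<and>
     (\<exists>t e. t \<in> G e \<and> t \<notin> P \<and> t \<otimes>\<^bsub>R\<^esub> (a \<otimes>\<^bsub>R\<^esub> d) = t \<otimes>\<^bsub>R\<^esub> (c \<otimes>\<^bsub>R\<^esub> b))}"

definition hloc :: "'a ring \<Rightarrow> (nat \<Rightarrow> 'a set) \<Rightarrow> 'a set \<Rightarrow> ('a \<times> 'a) set ring" where
  "hloc R G P =
    \<lparr> carrier = hfrac G P // hfrac_rel R G P,
      monoid.mult = (\<lambda>x y. \<Union>(a, b)\<in>x. \<Union>(c, d)\<in>y. hfrac_rel R G P `` {(a \<otimes>\<^bsub>R\<^esub> c, b \<otimes>\<^bsub>R\<^esub> d)}),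
      one = hfrac_rel R G P `` {(\<one>\<^bsub>R\<^esub>, \<one>\<^bsub>R\<^esub>)},
      ring.zero = hfrac_rel R G P `` {(\<zero>\<^bsub>R\<^esub>, \<one>\<^bsub>R\<^esub>)},
      add = (\<lambda>x y. \<Union>(a, b)\<in>x. \<Union>(c, d)\<in>y.
        hfrac_rel R G P `` {((a \<otimes>\<^bsub>R\<^esub> d) \<oplus>\<^bsub>R\<^esub> (c \<otimes>\<^bsub>R\<^esub> b), b \<otimes>\<^bsub>R\<^esub> d)}) \<rparr>"

text \<open>A section assigns to each point of \<open>U\<close> a germ, and is locally given by one fraction.\<close>

definition proj_sections ::
    "'a ring \<Rightarrow> (nat \<Rightarrow> 'a set) \<Rightarrow> 'a set set \<Rightarrow> ('a set \<Rightarrow> ('a \<times> 'a) set) set" where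
  "proj_sections R G U = {s \<in> (\<Pi>\<^sub>E P\<in>U. carrier (hloc R G P)).
     \<forall>P\<in>U. \<exists>V a b. openin (proj_top R G) V \<and> P \<in> V \<and> V \<subseteq> U \<and>
        (\<forall>Q\<in>V. (a, b) \<in> hfrac G Q \<and> s Q = hfrac_rel R G Q `` {(a, b)})}"

definition Proj ::
    "'a ring \<Rightarrow> (nat \<Rightarrow> 'a set) \<Rightarrow> ('a set, 'a set \<Rightarrow> ('a \<times> 'a) set) ringed_space" where
  "Proj R G =
    \<lparr> spc = proj_top R G,
      sec = (\<lambda>U. \<lparr> carrier = proj_sections R G U,
                   monoid.mult = (\<lambda>s t. \<lambda>P\<in>U. s P \<otimes>\<^bsub>hloc R G P\<^esub> t P),
                   one = (\<lambda>P\<in>U. \<one>\<^bsub>hloc R G P\<^esub>),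
                   ring.zero = (\<lambda>P\<in>U. \<zero>\<^bsub>hloc R G P\<^esub>),
                   add = (\<lambda>s t. \<lambda>P\<in>U. s P \<oplus>\<^bsub>hloc R G P\<^esub> t P) \<rparr>),
      res = (\<lambda>U V s. restrict s V) \<rparr>"


section \<open>The polynomial ring\<close>

text \<open>The variables are indexed by a finite type \<open>'n\<close>, so that $N$ is \<open>CARD('n)\<close>.\<close>

type_synonym ('n, 'k) mpoly = "('n \<Rightarrow>\<^sub>0 nat) \<Rightarrow>\<^sub>0 'k"

abbreviation polyR :: "('n, 'k::field) mpoly ring" where
  "polyR \<equiv> ring_of_type_algebra"

definition var :: "'n \<Rightarrow> ('n, 'k::field) mpoly" where
  "var i = Poly_Mapping.single (Poly_Mapping.single i 1) 1"

definition mon_deg :: "('n::finite \<Rightarrow>\<^sub>0 nat) \<Rightarrow> nat" where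
  "mon_deg m = (\<Sum>i\<in>UNIV. Poly_Mapping.lookup m i)"

definition homog :: "nat \<Rightarrow> ('n::finite, 'k::field) mpoly set" where
  "homog d = {a. \<forall>m\<in>Poly_Mapping.keys a. mon_deg m = d}"

definition tot_deg :: "('n::finite, 'k::field) mpoly \<Rightarrow> nat" where
  "tot_deg a = Max (insert 0 (mon_deg ` Poly_Mapping.keys a))"

definition max_ideal :: "('n::finite, 'k::field) mpoly set" where
  "max_ideal = Idl\<^bsub>polyR\<^esub> (range var)"

definition frob_power :: "nat \<Rightarrow> ('n, 'k::field) mpoly set \<Rightarrow> ('n, 'k) mpoly set" where
  "frob_power q I = Idl\<^bsub>polyR\<^esub> {a ^ q | a. a \<in> I}"

definition colon :: "('n, 'k::field) mpoly set \<Rightarrow> ('n, 'k) mpoly set \<Rightarrow> ('n, 'k) mpoly set" where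
  "colon J I = {a. \<forall>b\<in>I. a * b \<in> J}"

definition regular_seq :: "('n, 'k::field) mpoly list \<Rightarrow> bool" where
  "regular_seq fs \<longleftrightarrow> Idl\<^bsub>polyR\<^esub> (set fs) \<noteq> UNIV \<and>
     (\<forall>i<length fs. \<forall>a. a * fs ! i \<in> Idl\<^bsub>polyR\<^esub> (set (take i fs)) \<longrightarrow>
                       a \<in> Idl\<^bsub>polyR\<^esub> (set (take i fs)))"

definition proj_subscheme where
  "proj_subscheme (I :: ('n::finite, 'k::field) mpoly set) =
     Proj (polyR Quot I) (\<lambda>d. (\<lambda>a. I +>\<^bsub>polyR\<^esub> a) ` homog d)"


section \<open>p-bases and the operator \<open>\<Delta>\<^sub>1\<close>\<close>

definition F_finite :: "nat \<Rightarrow> 'k::field itself \<Rightarrow> bool" where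
  "F_finite p _ \<longleftrightarrow> (\<exists>B::'k set. finite B \<and> (\<forall>c. \<exists>g. c = (\<Sum>b\<in>B. g b ^ p * b)))"

definition exps :: "nat \<Rightarrow> nat \<Rightarrow> nat list set" where
  "exps p s = {j. length j = s \<and> (\<forall>e\<in>set j. e < p)}"

definition list_mon :: "'k::field list \<Rightarrow> nat list \<Rightarrow> 'k" where
  "list_mon ys j = (\<Prod>l<length ys. ys ! l ^ (j ! l))"

definition p_basis :: "nat \<Rightarrow> 'k::field list \<Rightarrow> bool" where
  "p_basis p ys \<longleftrightarrow> (\<forall>c. \<exists>!g. (\<forall>j. j \<notin> exps p (length ys) \<longrightarrow> g j = 0) \<and>
      c = (\<Sum>j\<in>exps p (length ys). g j ^ p * list_mon ys j))"

definition frob_index :: "nat \<Rightarrow> 'k::field list \<Rightarrow> (nat list \<times> ('n::finite \<Rightarrow>\<^sub>0 nat)) set" where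
  "frob_index p ys = exps p (length ys) \<times> {m. \<forall>i. Poly_Mapping.lookup m i < p}"

definition frob_basis :: "'k::field list \<Rightarrow> nat list \<times> ('n::finite \<Rightarrow>\<^sub>0 nat) \<Rightarrow> ('n, 'k) mpoly" where
  "frob_basis ys = (\<lambda>(j, m). Poly_Mapping.single m (list_mon ys j))"

text \<open>Elements of $F_*S$ are represented by the underlying elements of $S$; thus the coordinates
  \<open>c\<close> of \<open>a\<close> in the basis $F_*v_i$ satisfy $a = \sum_i c_i^p v_i$.\<close>

definition frob_coord ::
    "nat \<Rightarrow> 'k::field list \<Rightarrow> ('n::finite, 'k) mpoly \<Rightarrow> nat list \<times> ('n \<Rightarrow>\<^sub>0 nat) \<Rightarrow> ('n, 'k) mpoly" where
  "frob_coord p ys a = (THE c. (\<forall>e. e \<notin> frob_index p ys \<longrightarrow> c e = 0) \<and>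
      a = (\<Sum>e\<in>frob_index p ys. c e ^ p * frob_basis ys e))"

definition frob_u :: "nat \<Rightarrow> 'k::field list \<Rightarrow> ('n::finite, 'k) mpoly \<Rightarrow> ('n, 'k) mpoly" where
  "frob_u p ys a =
     frob_coord p ys a (replicate (length ys) (p - 1), \<Sum>i\<in>UNIV. Poly_Mapping.single i (p - 1))"

definition v_perp :: "nat \<Rightarrow> 'k::field list \<Rightarrow> ('n::finite, 'k) mpoly set" where
  "v_perp p ys = {a. frob_u p ys a = 0}"

definition p_monomials :: "nat \<Rightarrow> 'k::field list \<Rightarrow> ('n::finite, 'k) mpoly set" where
  "p_monomials p ys = {b ^ p * frob_basis ys e | b e. e \<in> frob_index p ys}"

definition delta_sum :: "nat \<Rightarrow> ('n, 'k::field) mpoly list \<Rightarrow> ('n, 'k) mpoly" where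
  "delta_sum p as =
     (\<Sum>\<alpha> | length \<alpha> = length as \<and> (\<forall>t\<in>set \<alpha>. t \<le> p - 1) \<and> sum_list \<alpha> = p.
        of_nat (fact p div (\<Prod>t\<leftarrow>\<alpha>. fact t) div p) * (\<Prod>i<length as. as ! i ^ (\<alpha> ! i)))"

text \<open>The class $\Delta_1(a) \in S/F(S)$ as a set of elements of $S$. As the class does not depend on
  the decomposition of \<open>a\<close>, the union over all decompositions is a single coset of $F(S)$.\<close>

definition Delta1 :: "nat \<Rightarrow> 'k::field list \<Rightarrow> ('n::finite, 'k) mpoly \<Rightarrow> ('n, 'k) mpoly set" where
  "Delta1 p ys a = {delta_sum p as + c ^ p | as c. set as \<subseteq> p_monomials p ys \<and> sum_list as = a}"

text \<open>On \<open>v_perp\<close> the value does not depend on the representative \<open>d\<close>.\<close>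

definition theta ::
    "nat \<Rightarrow> 'k::field list \<Rightarrow> ('n::finite, 'k) mpoly \<Rightarrow> ('n, 'k) mpoly \<Rightarrow> ('n, 'k) mpoly" where
  "theta p ys f a = (THE c. \<exists>d\<in>Delta1 p ys (f ^ (p - 1)). c = frob_u p ys (d * a))"

text \<open>The sequence starts at index 1; the value at 0 is a dummy.\<close>

fun I_seq :: "nat \<Rightarrow> 'k::field list \<Rightarrow> ('n::finite, 'k) mpoly \<Rightarrow> ('n, 'k) mpoly set \<Rightarrow> nat
              \<Rightarrow> ('n, 'k) mpoly set" where
  "I_seq p ys f I 0 = {}"
| "I_seq p ys f I (Suc 0) = colon (frob_power p I) I"
| "I_seq p ys f I (Suc (Suc s)) =
     {a + b | a b. a \<in> theta p ys f ` (I_seq p ys f I (Suc s) \<inter> v_perp p ys) \<and>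
                   b \<in> colon (frob_power p I) I}"

end

theory Submission
  imports Defs
begin

text \<open>A quasi-\<open>F\<close>-splitting of height \<open>n\<close> of the projective scheme is the same as a \<open>p\<close>-inverse-linear
  functional on the graded module of homogeneous Witt vectors over the cone which kills the image of
  \<open>VF\<close> and preserves \<open>W(I)\<close>. One direction is localisation. For the other, the functional is glued from
  the local ones, and it takes values in the cone because a complete intersection of dimension at
  least 1 is defined by at most \<open>N - 2\<close> equations, so that its cone has depth at least 2.

  Let \<open>\<tau>\<close> be the additive lift of \<open>S\<close> to \<open>W(S) / VF(W(S))\<close> given by the Teichmueller
  representatives of \<open>p\<close>-monomials. Every Witt vector is \<open>\<Sum>V\<^sup>i \<tau>(a\<^sub>i)\<close>, so a functional is a
  sum of maps \<open>a \<mapsto> u\<^sup>i(g\<^sub>i a)\<close>, and \<open>VF\<close> is killed when \<open>u(g\<^sub>i) = 0\<close> for \<open>i \<ge> 2\<close>.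
  For \<open>x \<in> S\<close> the error \<open>V(y) = [x] - \<tau>(x)\<close> starts with \<open>\<Delta>\<^sub>1(x)\<close>, hence preservation of
  \<open>W(I)\<close> reads \<open>g\<^sub>i x + u(g\<^sub>i\<^sub>+\<^sub>1 \<Delta>\<^sub>1(x)) \<in> I\<close> modulo Frobenius powers for the generators \<open>x\<close>.
  By the colon ideals of regular sequences, \<open>g\<^sub>i\<close> is \<open>f\<close> to the power \<open>p\<^sup>i - p\<close> times some \<open>h\<^sub>i\<close>,
  where \<open>h\<^sub>i = \<theta>(h\<^sub>i\<^sub>+\<^sub>1)\<close> up to \<open>I\<^sub>1\<close>; this is the recursion of the ideals \<open>I\<^sub>n\<close>.\<close>

text \<open>In characteristic p one cannot divide by p, while the identities of Witt vectors needed
  here rest on such divisions, and many hold only up to the image of VF. They are therefore proved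
  for integer polynomials, where ghost components decide: equal ghosts give identities in every
  ring, and congruence of the n-th ghosts modulo p^(n+1) gives those special to characteristic p. On
  the geometric side, Witt polynomials are isobaric, so a Witt vector of sections is locally x / [s]
  with x a homogeneous Witt vector over the polynomial ring. All Witt calculus thus stays over that
  ring, modulo W(I). Denominators are made p-th powers so that an inverse Frobenius linear
  functional can release them. The bound on the number of equations comes from counting monomials,
  and depth 2 from Koszul complexes on powers of the variables. When deg(f) = N, the degree (p-1)N
  of f^(p-1) is the top degree of S/m^[p], so modulo m^[p] only constant multiples survive at each
  stage of the recursion; hence the single elements g_n decide.\<close>

abbreviation lookup where "lookup \<equiv> Poly_Mapping.lookup"
abbreviation keys where "keys \<equiv> Poly_Mapping.keys"
abbreviation single where "single \<equiv> Poly_Mapping.single"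

section \<open>Evaluation of integer polynomials\<close>

type_synonym 'v zpoly = "('v \<Rightarrow>\<^sub>0 nat) \<Rightarrow>\<^sub>0 int"

definition mon_ev :: "('v => 'a::comm_ring_1) => ('v \<Rightarrow>\<^sub>0 nat) => 'a" where
 "mon_ev env m = (\<Prod>t\<in>keys m. env t ^ lookup m t)"

text \<open>The counterpart of \<open>eval_int_poly\<close> for rings given by a type class;
  \<open>rp_eval\<close> relates the two on rings of sections.\<close>

definition ev :: "('v => 'a::comm_ring_1) => 'v zpoly => 'a" where
 "ev env Q = (\<Sum>m\<in>keys Q. of_int (lookup Q m) * mon_ev env m)"

definition zvar :: "'v => 'v zpoly" where
 "zvar t = single (single t 1) 1"

lemma mpoly_induct [case_names zero single add]:
 fixes Q :: "'m \<Rightarrow>\<^sub>0 'b::ab_group_add"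
 assumes "P 0" "!!m c. P (single m c)" "!!a b. P a ==> P b ==> P (a + b)" shows "P Q"
proof (induction Q rule: update_induct)
 case const
 show ?case using assms(1) .
next
 case (update f a b)
 have "Poly_Mapping.update a b f = f + single a b" by (rule poly_mapping_eqI)
   (use update in "auto simp: lookup_update lookup_add lookup_single when_def in_keys_iff")
 thus ?case using assms update by simp
qed

lemma mon_ev_superset: assumes "finite A" "keys m <= A" shows "mon_ev env m = (\<Prod>t\<in>A. env t ^ lookup m t)"
 unfolding mon_ev_def by (rule prod.mono_neutral_left) (use assms in "auto simp: in_keys_iff")

lemma mon_ev_0 [simp]: "mon_ev env 0 = 1" by (simp add: mon_ev_def)

lemma mon_ev_add: "mon_ev env (m + m') = mon_ev env m * mon_ev env m'"
proof -
 let ?A = "keys m \<union> keys m'"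
 have "keys (m + m') <= ?A" by (rule keys_add)
 thus ?thesis by (simp add: mon_ev_superset[of ?A] lookup_add power_add prod.distrib)
qed

lemma ev_superset: assumes "finite A" "keys Q <= A"
 shows "ev env Q = (\<Sum>m\<in>A. of_int (lookup Q m) * mon_ev env m)" unfolding ev_def
 by (rule sum.mono_neutral_left) (use assms in "auto simp: in_keys_iff")

lemma ev_0 [simp]: "ev env 0 = 0" by (simp add: ev_def)

lemma ev_single: "ev env (single m c) = of_int c * mon_ev env m" by (cases "c = 0") (auto simp: ev_def)

lemma ev_add: "ev env (Q + R) = ev env Q + ev env R"
proof -
 let ?A = "keys Q \<union> keys R"
 have "keys (Q + R) <= ?A" by (rule keys_add)
 thus ?thesis by (simp add: ev_superset[of ?A] lookup_add ring_distribs sum.distrib)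
qed

lemma shows ev_uminus: "ev env (- Q) = - ev env Q" and ev_diff: "ev env (Q - R) = ev env Q - ev env R"
  and ev_sum: "ev env (sum f A) = (\<Sum>x\<in>A. ev env (f x))"
 by (intro additive.minus additive.diff additive.sum additive.intro ev_add)+

lemma ev_1 [simp]: "ev env 1 = 1" using ev_single[of env 0 1] by simp

lemma ev_mult: "ev env (Q * R) = ev env Q * ev env R"
proof (induction Q rule: mpoly_induct)
 case (single m c)
 show ?case by (induction R rule: mpoly_induct)
   (auto simp: mult_single ev_single mon_ev_add ev_add algebra_simps)
qed (auto simp: ev_add algebra_simps)

lemma ev_power: "ev env (Q ^ n) = ev env Q ^ n" by (induction n) (auto simp: ev_mult)

lemma ev_prod: "ev env (prod f A) = (\<Prod>x\<in>A. ev env (f x))"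
 by (induction A rule: infinite_finite_induct) (auto simp: ev_mult)

lemma ev_of_nat [simp]: "ev env (of_nat n) = of_nat n" by (induction n) (auto simp: ev_add)

lemma ev_zvar [simp]: "ev env (zvar t) = env t" by (simp add: zvar_def ev_single mon_ev_def)

lemma ev_cong: assumes "!!m t. m \<in> keys Q ==> t \<in> keys m ==> env t = env' t" shows "ev env Q = ev env' Q"
 unfolding ev_def mon_ev_def using assms by (auto intro!: sum.cong prod.cong)

lemma mon_ev_hom: assumes "h 1 = 1" "!!a b. h (a * b) = h a * h b" shows "h (mon_ev env m) = mon_ev (%t. h (env t)) m"
proof -
 have pw: "h (a ^ n) = h a ^ n" for a n by (induction n) (auto simp: assms)
 have "h (prod f A) = (\<Prod>x\<in>A. h (f x))" for f :: "'c => _" and A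
  by (induction A rule: infinite_finite_induct) (auto simp: assms)
 thus ?thesis by (simp add: mon_ev_def pw)
qed

text \<open>Applied to two homomorphisms: evaluation itself (\<open>ev_comp\<close>), which
  specializes universal identities, and the p-th power map in characteristic p
  (\<open>ev_frob\<close>), which makes F additive.\<close>

lemma ev_hom:
 fixes h :: "'a::comm_ring_1 => 'b::comm_ring_1"
 assumes h1: "h 1 = 1" and hm: "!!a b. h (a * b) = h a * h b" and ha: "!!a b. h (a + b) = h a + h b"
 shows "h (ev env Q) = ev (%t. h (env t)) Q"
proof -
 have h0: "h 0 = 0" using ha[of 0 0] by simp
 have hneg: "h (- a) = - h a" for a by (intro additive.minus additive.intro ha)
 have hn: "h (of_nat n) = of_nat n" for n by (induction n) (auto simp: h0 h1 ha)
 have hi: "h (of_int n) = of_int n" for n by (cases n) (auto simp: hn hneg simp flip: of_nat_Suc)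
 show ?thesis by (induction Q rule: mpoly_induct) (auto simp: h0 ha ev_add ev_single hm hi mon_ev_hom[of h, OF h1 hm])
qed

lemma ev_comp: "ev env (ev E Q) = ev (%t. ev env (E t)) Q" by (rule ev_hom) (auto simp: ev_mult ev_add)

lemma ev_zvar_id: "ev zvar Q = Q"
proof (induction Q rule: mpoly_induct)
 case (single m c)
 have "mon_ev zvar m = single m (1::int)"
 proof (induction m rule: update_induct)
  case const
  thus ?case by simp
 next
  case (update f a b)
  have "Poly_Mapping.update a b f = f + single a b" by (rule poly_mapping_eqI)
    (use update in "auto simp: lookup_update lookup_add lookup_single when_def in_keys_iff")
  moreover have "zvar a ^ b = single (single a b) (1::int)" for b :: nat
   by (induction b) (auto simp: zvar_def mult_single simp flip: single_add)
  hence "mon_ev zvar (single a b) = single (single a b) (1::int)" using update by (auto simp: mon_ev_def)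
  ultimately show ?case using update by (simp add: mon_ev_add mult_single)
 qed
 moreover have "(of_int c :: 'a zpoly) = single 0 c" by (simp add: poly_mapping_eqI lookup_of_int lookup_single)
 ultimately show ?case by (simp add: ev_single mult_single)
qed (auto simp: ev_add)

section \<open>Ghost components and Dwork's lemma\<close>

definition gh :: "nat => nat => (nat => 'a::comm_ring_1) => 'a" where
 "gh p n S = (\<Sum>i\<le>n. of_nat p ^ i * S i ^ (p ^ (n - i)))"

text \<open>The lift of Frobenius to integer polynomials that fixes the coefficients; Dwork's
  congruences are relative to it.\<close>

definition zphi :: "nat => 'v zpoly => 'v zpoly" where
 "zphi p = ev (%t. zvar t ^ p)"

lemma prime_dvd_freshman:
 fixes a b :: "'a::comm_ring_1" assumes "prime p" shows "of_nat p dvd (a + b) ^ p - a ^ p - b ^ p"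
proof -
 have p: "p > 1" using assms prime_gt_1_nat by blast
 have "(a + b) ^ p = (\<Sum>k\<le>p. of_nat (p choose k) * a ^ k * b ^ (p - k))" by (rule binomial_ring)
 also have "{..p} = insert 0 (insert p {0<..<p})" using p by auto
 finally have "(a + b) ^ p - a ^ p - b ^ p = (\<Sum>k\<in>{0<..<p}. of_nat (p choose k) * a ^ k * b ^ (p - k))"
  using p by simp
 also have "of_nat p dvd \<dots>"
 proof (rule dvd_sum)
  fix k assume "k \<in> {0<..<p}"
  hence "p dvd p choose k" using assms by (intro dvd_choose_prime) auto
  then obtain c where "p choose k = p * c" by (rule dvdE)
  thus "of_nat p dvd (of_nat (p choose k) :: 'a) * a ^ k * b ^ (p - k)" by (simp add: mult.assoc)
 qed
 finally show ?thesis .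
qed

text \<open>In a^p - b^p = (a - b) * (sum of p terms), every term of the second factor is congruent
  to b^(p-1) modulo p, so the sum is a multiple of p and contributes one more power.\<close>

lemma dvd_power_diff_prime:
 fixes a b :: "'a::comm_ring_1" assumes "of_nat p ^ Suc m dvd a - b" shows "of_nat p ^ Suc (Suc m) dvd a ^ p - b ^ p"
proof -
 have ab: "of_nat p dvd a - b" using assms by (metis dvd_mult_left power_Suc)
 have pw: "of_nat p dvd a ^ i - b ^ i" for i by (subst power_diff_sumr2) (use ab in simp)
 have "of_nat p dvd (\<Sum>i<p. b ^ (p - Suc i) * (a ^ i - b ^ i)) + (\<Sum>i<p. b ^ (p - 1))"
  by (rule dvd_add[OF dvd_sum[OF dvd_mult[OF pw]]]) simp
 also have "\<dots> = (\<Sum>i<p. b ^ (p - Suc i) * a ^ i)" unfolding sum.distrib[symmetric]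
  by (rule sum.cong) (auto simp: algebra_simps simp flip: power_add)
 finally show ?thesis using mult_dvd_mono[OF assms] by (subst power_diff_sumr2) (simp only: power_Suc2[of _ "Suc m"])
qed

lemma dvd_power_diff_prime_power:
 fixes a b :: "'a::comm_ring_1" assumes "of_nat p dvd a - b" shows "of_nat p ^ Suc k dvd a ^ (p ^ k) - b ^ (p ^ k)"
proof (induction k)
 case (Suc k)
 show ?case using dvd_power_diff_prime[OF Suc] by (simp add: power_mult[symmetric] mult.commute)
qed (use assms in simp)

lemma lookup_of_nat_mult:
 "lookup (of_nat n * (a :: ('m::monoid_add \<Rightarrow>\<^sub>0 'b::comm_ring_1))) m = of_nat n * lookup a m"
 by (induction n) (auto simp: lookup_add algebra_simps)

lemma zpoly_cancel:
 fixes a b :: "'v zpoly" assumes "of_nat p ^ n * a = of_nat p ^ n * b" "p > 0" shows "a = b"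
proof (rule poly_mapping_eqI)
 fix m
 have "lookup (of_nat (p ^ n) * a) m = lookup (of_nat (p ^ n) * b) m" using assms by simp
 thus "lookup a m = lookup b m" using assms(2) by (simp add: lookup_of_nat_mult del: of_nat_power)
qed

lemma zpoly_dvd_cancel:
 fixes a :: "'v zpoly" assumes "of_nat p ^ (n + m) dvd of_nat p ^ n * a" "p > 0" shows "of_nat p ^ m dvd a"
proof -
 obtain c where "of_nat p ^ n * a = of_nat p ^ (n + m) * c" using assms(1) by (auto elim: dvdE)
 hence "of_nat p ^ n * a = of_nat p ^ n * (of_nat p ^ m * c)" by (simp add: power_add mult.assoc)
 from zpoly_cancel[OF this assms(2)] show ?thesis by simp
qed

lemma zphi_simps [simp]:
 "zphi p 0 = 0" "zphi p 1 = 1" "zphi p (a + b) = zphi p a + zphi p b" "zphi p (a * b) = zphi p a * zphi p b"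
 "zphi p (a - b) = zphi p a - zphi p b" "zphi p (- a) = - zphi p a" "zphi p (a ^ n) = zphi p a ^ n"
 "zphi p (of_nat n) = of_nat n" "zphi p (sum f A) = (\<Sum>x\<in>A. zphi p (f x))" "zphi p (zvar t) = zvar t ^ p"
 "zphi p (prod f A) = (\<Prod>x\<in>A. zphi p (f x))"
 by (simp_all add: zphi_def ev_add ev_mult ev_diff ev_uminus ev_power ev_sum ev_prod)

text \<open>The property is closed under sums because the p-th power is additive modulo p. This
  leaves integer multiples of a monomial, where repeated addition proves Fermat's congruence for the
  coefficient.\<close>

lemma zphi_lift:
 fixes a :: "'v zpoly" assumes p: "prime p" shows "of_nat p dvd zphi p a - a ^ p"
proof -
 have p0: "p > 0" using p prime_gt_0_nat by blast
 have add: "of_nat p dvd zphi p (a + b) - (a + b) ^ p"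
  if "of_nat p dvd zphi p a - a ^ p" "of_nat p dvd zphi p b - b ^ p" for a b :: "'v zpoly"
  using dvd_diff[OF dvd_add[OF that] prime_dvd_freshman[OF p, of a b]] by (simp add: algebra_simps)
 have zero: "of_nat p dvd zphi p (0 :: 'v zpoly) - 0 ^ p" using p0 by (simp add: power_0_left)
 show ?thesis
 proof (induction a rule: mpoly_induct)
  case (single m c)
  have mon: "mon_ev zvar m = single m 1" using ev_zvar_id[of "single m 1"] by (simp add: ev_single)
  have M: "zphi p (mon_ev zvar m :: 'v zpoly) = mon_ev zvar m ^ p"
   unfolding mon_ev_def by (simp add: prod_power_distrib flip: power_mult) (simp add: mult.commute)
  have nat: "of_nat p dvd zphi p (of_nat k * mon_ev zvar m :: 'v zpoly) - (of_nat k * mon_ev zvar m) ^ p" for k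
  proof (induction k)
   case 0 show ?case using zero by simp
  next
   case (Suc k)
   have "of_nat p dvd zphi p (mon_ev zvar m :: 'v zpoly) - mon_ev zvar m ^ p" by (simp add: M)
   from add[OF this Suc] show ?case by (simp add: algebra_simps)
  qed
  \<comment> \<open>Additivity modulo p is applied to b + (- b) = 0, so p = 2 and odd p are treated
    alike.\<close>
  have neg': "of_nat p dvd zphi p (- b) - (- b) ^ p" if "of_nat p dvd zphi p b - b ^ p" for b :: "'v zpoly"
  proof -
   have "(0::'v zpoly) ^ p = 0" using p0 by (simp add: power_0_left)
   hence "of_nat p dvd - (b ^ p + (- b) ^ p)" using prime_dvd_freshman[OF p, of b "- b"]
    by (simp only: add.right_inverse) (simp add: algebra_simps)
   from dvd_diff[OF this that] have "of_nat p dvd - (b ^ p + (- b) ^ p) - (zphi p b - b ^ p)" .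
   also have "- (b ^ p + (- b) ^ p) - (zphi p b - b ^ p) = zphi p (- b) - (- b) ^ p" by simp
   finally show ?thesis .
  qed
  have "single m c = of_int c * mon_ev zvar m" using ev_zvar_id[of "single m c"] by (simp add: ev_single)
  moreover have "of_nat p dvd zphi p (of_int c * mon_ev zvar m :: 'v zpoly) - (of_int c * mon_ev zvar m) ^ p"
  proof (cases c)
   case (nonneg k) thus ?thesis using nat by simp
  next
   case (neg k)
   show ?thesis using neg'[OF nat[of "Suc k"]] neg by (simp only: of_int_minus of_int_of_nat_eq mult_minus_left)
  qed
  ultimately show ?case by simp
 qed (use add zero in auto)
qed

text \<open>Dwork's criterion for a sequence to consist of ghost components; \<open>dwork_gh\<close>
  and \<open>dwork_imp_gh\<close> are the two directions.\<close>

definition dwork :: "nat => (nat => 'v zpoly) => bool" where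
 "dwork p w \<longleftrightarrow> (\<forall>n. of_nat p ^ Suc n dvd w (Suc n) - zphi p (w n))"

lemma gh_Suc: "gh p (Suc n) S = (\<Sum>i\<le>n. of_nat p ^ i * (S i ^ p) ^ (p ^ (n - i))) + of_nat p ^ Suc n * S (Suc n)"
proof -
 have "(S i ^ p) ^ (p ^ (n - i)) = S i ^ p ^ (Suc n - i)" if "i \<le> n" for i
  using that by (simp add: Suc_diff_le power_mult)
 thus ?thesis by (simp add: gh_def)
qed

lemma gh_Suc_shift: "gh p (Suc n) S = S 0 ^ (p ^ Suc n) + of_nat p * gh p n (%i. S (Suc i))"
 unfolding gh_def by (subst sum.atMost_Suc_shift) (simp add: sum_distrib_left mult.assoc)

lemma gh_0 [simp]: "gh p 0 S = S 0" by (simp add: gh_def)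

text \<open>\<open>S i ^ p\<close> and \<open>zphi p (S i)\<close> agree modulo p, hence their
  p^(n-i)-th powers modulo p^(n-i+1); the weight p^i restores p^(n+1). The sum on the left is the
  ghost component n + 1 without its last term.\<close>

lemma gh_zphi_step:
 fixes S :: "nat => 'v zpoly" assumes "prime p"
 shows "of_nat p ^ Suc n dvd (\<Sum>i\<le>n. of_nat p ^ i * (S i ^ p) ^ (p ^ (n - i))) - zphi p (gh p n S)"
proof -
 have "of_nat p ^ Suc n dvd of_nat p ^ i * (S i ^ p) ^ (p ^ (n - i)) - of_nat p ^ i * zphi p (S i) ^ (p ^ (n - i))"
  if "i \<le> n" for i
 proof -
  have "of_nat p dvd S i ^ p - zphi p (S i)" 
   using dvd_minus_iff[THEN iffD2, OF zphi_lift[OF assms, of "S i"]] by (simp only: minus_diff_eq)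
  from dvd_power_diff_prime_power[OF this, of "n - i"]
  have "of_nat p ^ i * of_nat p ^ Suc (n - i) dvd of_nat p ^ i * ((S i ^ p) ^ (p ^ (n - i)) - zphi p (S i) ^ (p ^ (n - i)))"
   by (rule mult_dvd_mono[OF dvd_refl])
  thus ?thesis using that by (simp add: algebra_simps flip: power_add power_Suc)
 qed
 hence "of_nat p ^ Suc n dvd (\<Sum>i\<le>n. of_nat p ^ i * (S i ^ p) ^ (p ^ (n - i)) - of_nat p ^ i * zphi p (S i) ^ (p ^ (n - i)))"
  by (intro dvd_sum) auto
 thus ?thesis by (simp add: gh_def sum_subtractf)
qed

lemma dwork_gh: "prime p ==> dwork p (%n. gh p n S)" unfolding dwork_def
proof
 fix n assume "prime p"
 from gh_zphi_step[OF this, of n S]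
 have "of_nat p ^ Suc n dvd (\<Sum>i\<le>n. of_nat p ^ i * (S i ^ p) ^ (p ^ (n - i))) - zphi p (gh p n S) + of_nat p ^ Suc n * S (Suc n)"
  by (rule dvd_add) simp
 thus "of_nat p ^ Suc n dvd gh p (Suc n) S - zphi p (gh p n S)" by (simp add: gh_Suc algebra_simps)
qed

lemma dwork_add: "dwork p v ==> dwork p w ==> dwork p (%n. v n + w n)"
 unfolding dwork_def by (simp add: add_diff_add dvd_add del: power_Suc)

lemma dwork_uminus: "dwork p v ==> dwork p (%n. - v n)"
 unfolding dwork_def by (simp only: zphi_simps minus_diff_minus dvd_minus_iff) simp

lemma dwork_mult: assumes "dwork p v" "dwork p w" shows "dwork p (%n. v n * w n)" unfolding dwork_def
proof
 fix n
 have "v (Suc n) * w (Suc n) - zphi p (v n * w n) =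
  v (Suc n) * (w (Suc n) - zphi p (w n)) + (v (Suc n) - zphi p (v n)) * zphi p (w n)" by (simp add: algebra_simps)
 thus "of_nat p ^ Suc n dvd v (Suc n) * w (Suc n) - zphi p (v n * w n)"
  using dvd_add[OF dvd_mult[of _ _ "v (Suc n)"] dvd_mult2[of _ _ "zphi p (w n)"]] assms unfolding dwork_def by auto
qed

text \<open>The ghost equation is solved for its last term by dividing by p^n. The choice is
  meaningful only if the quotient exists, which \<open>dwork_imp_gh\<close> proves component by
  component.\<close>

fun dwork_seq :: "nat => (nat => 'v zpoly) => nat => 'v zpoly" where
 "dwork_seq p w n = (SOME s. of_nat p ^ n * s = w n - (\<Sum>i\<in>{..<n}. of_nat p ^ i * dwork_seq p w i ^ (p ^ (n - i))))"

declare dwork_seq.simps [simp del]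

lemma dwork_imp_gh: assumes p: "prime p" and w: "dwork p w" shows "\<exists>S. \<forall>n. gh p n S = w n"
proof -
 let ?S = "dwork_seq p w"
 have split: "gh p n ?S = (\<Sum>i<n. of_nat p ^ i * ?S i ^ (p ^ (n - i))) + of_nat p ^ n * ?S n" for n
  by (simp add: gh_def flip: lessThan_Suc_atMost)
 have "gh p n ?S = w n" for n
 proof (induction n)
  case 0
  have "?S 0 = w 0" by (subst dwork_seq.simps) simp
  thus ?case by simp
 next
  case (Suc n)
  let ?r = "\<Sum>i<Suc n. of_nat p ^ i * ?S i ^ (p ^ (Suc n - i))"
  have "of_nat p ^ Suc n dvd w (Suc n) - zphi p (gh p n ?S)" using w Suc unfolding dwork_def by simp
  from dvd_diff[OF this gh_zphi_step[OF p, of n ?S]]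
  have "of_nat p ^ Suc n dvd w (Suc n) - (\<Sum>i\<le>n. of_nat p ^ i * (?S i ^ p) ^ (p ^ (n - i)))" by simp
  also have "(\<Sum>i\<le>n. of_nat p ^ i * (?S i ^ p) ^ (p ^ (n - i))) = ?r" unfolding lessThan_Suc_atMost
   by (rule sum.cong) (auto simp: Suc_diff_le power_mult)
  finally obtain s where "w (Suc n) - ?r = of_nat p ^ Suc n * s" by (rule dvdE)
  hence "of_nat p ^ Suc n * ?S (Suc n) = w (Suc n) - ?r" by (subst dwork_seq.simps) (rule someI[of _ s], simp)
  thus ?case unfolding split[of "Suc n"] by simp
 qed
 thus ?thesis by blast
qed

text \<open>By strong induction the earlier terms of the two ghosts agree modulo p^(n+1), so p^(n+1)
  divides p^n (S n - T n), and p^n cancels over the integers.\<close>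

lemma gh_cong_imp_cong:
 fixes S T :: "nat => 'v zpoly" assumes p: "p > 0" and c: "!!n. of_nat p ^ Suc n dvd gh p n S - gh p n T"
 shows "of_nat p dvd S n - T n"
proof (induction n rule: less_induct)
 case (less n)
 have "of_nat p ^ Suc n dvd of_nat p ^ i * S i ^ (p ^ (n - i)) - of_nat p ^ i * T i ^ (p ^ (n - i))"
  if "i < n" for i
 proof -
  from dvd_power_diff_prime_power[OF less[OF that], of "n - i"]
  have "of_nat p ^ i * of_nat p ^ Suc (n - i) dvd of_nat p ^ i * (S i ^ (p ^ (n - i)) - T i ^ (p ^ (n - i)))"
   by (rule mult_dvd_mono[OF dvd_refl])
  thus ?thesis using that by (simp add: algebra_simps flip: power_add power_Suc)
 qed
 hence "of_nat p ^ Suc n dvd (\<Sum>i<n. of_nat p ^ i * S i ^ (p ^ (n - i)) - of_nat p ^ i * T i ^ (p ^ (n - i)))"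
  by (intro dvd_sum) auto
 from dvd_diff[OF c[of n] this]
 have "of_nat p ^ (n + 1) dvd of_nat p ^ n * (S n - T n)"
  by (simp add: gh_def sum_subtractf algebra_simps flip: lessThan_Suc_atMost)
 from zpoly_dvd_cancel[OF this p] show ?case by simp
qed

lemma gh_inj:
 fixes S T :: "nat => 'v zpoly" assumes p: "p > 0" and c: "!!n. gh p n S = gh p n T" shows "S = T"
proof
 fix n show "S n = T n"
 proof (induction n rule: less_induct)
  case (less n)
  hence "(\<Sum>i<n. of_nat p ^ i * S i ^ (p ^ (n - i))) = (\<Sum>i<n. of_nat p ^ i * T i ^ (p ^ (n - i)))"
   by (intro sum.cong) auto
  with c[of n] have "of_nat p ^ n * S n = of_nat p ^ n * T n" by (simp add: gh_def flip: lessThan_Suc_atMost)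
  from zpoly_cancel[OF this p] show ?case .
 qed
qed

lemma ev_gh: "ev env (gh p n S) = gh p n (%i. ev env (S i))" by (simp add: gh_def ev_sum ev_mult ev_power)

lemma ghost_eq_gh: "ghost p n S = gh p n S" by (simp add: ghost_def gh_def)

lemma witt_var_eq_zvar: "witt_var = zvar" by (rule ext) (simp add: witt_var_def zvar_def)

lemma assumes p: "prime p"
 shows gh_witt_sum: "gh p n (witt_sum p) = gh p n (%i. zvar (Inl i)) + gh p n (%i. zvar (Inr i))"
  and gh_witt_prod: "gh p n (witt_prod p) = gh p n (%i. zvar (Inl i)) * gh p n (%i. zvar (Inr i))"
proof -
 have p0: "p > 0" using p prime_gt_0_nat by blast
 let ?v = "%n. gh p n (%i. zvar (Inl i)) :: witt_poly" and ?w = "%n. gh p n (%i. zvar (Inr i)) :: witt_poly"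
 have uniq: "\<exists>!S. \<forall>n. gh p n S = w n" if dw: "dwork p w" for w :: "nat => witt_poly"
 proof -
  obtain S where S: "\<forall>n. gh p n S = w n" using dwork_imp_gh[OF p dw] by blast
  show ?thesis
  proof (rule ex1I[of _ S])
   fix T assume "\<forall>n. gh p n T = w n"
   thus "T = S" using S by (intro gh_inj[OF p0]) auto
  qed (use S in blast)
 qed
 have "\<forall>n. ghost p n (witt_sum p) = ghost p n (%i. witt_var (Inl i)) + ghost p n (%i. witt_var (Inr i))"
  unfolding witt_sum_def unfolding ghost_eq_gh witt_var_eq_zvar
  by (rule theI'[OF uniq[OF dwork_add[OF dwork_gh[OF p] dwork_gh[OF p]]]])
 thus "gh p n (witt_sum p) = ?v n + ?w n" by (simp add: ghost_eq_gh witt_var_eq_zvar)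
 have "\<forall>n. ghost p n (witt_prod p) = ghost p n (%i. witt_var (Inl i)) * ghost p n (%i. witt_var (Inr i))"
  unfolding witt_prod_def unfolding ghost_eq_gh witt_var_eq_zvar
  by (rule theI'[OF uniq[OF dwork_mult[OF dwork_gh[OF p] dwork_gh[OF p]]]])
 thus "gh p n (witt_prod p) = ?v n * ?w n" by (simp add: ghost_eq_gh witt_var_eq_zvar)
qed

section \<open>Witt addition and multiplication over a commutative ring\<close>

definition wadd :: "nat => (nat => 'a::comm_ring_1) => (nat => 'a) => nat => 'a" where
 "wadd p a b i = ev (case_sum a b) (witt_sum p i)"

definition wmul :: "nat => (nat => 'a::comm_ring_1) => (nat => 'a) => nat => 'a" where
 "wmul p a b i = ev (case_sum a b) (witt_prod p i)"

lemma gh_wadd: "prime p ==> gh p n (wadd p a b) = gh p n a + gh p n b"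
 using arg_cong[OF gh_witt_sum[of p n], of "ev (case_sum a b)"] by (simp add: ev_gh ev_add wadd_def[abs_def])

lemma gh_wmul: "prime p ==> gh p n (wmul p a b) = gh p n a * gh p n b"
 using arg_cong[OF gh_witt_prod[of p n], of "ev (case_sum a b)"] by (simp add: ev_gh ev_mult wmul_def[abs_def])

lemma ev_wadd: "ev env (wadd p a b i) = wadd p (%i. ev env (a i)) (%i. ev env (b i)) i"
 unfolding wadd_def ev_comp by (rule ev_cong) (simp split: sum.splits)

lemma ev_wmul: "ev env (wmul p a b i) = wmul p (%i. ev env (a i)) (%i. ev env (b i)) i"
 unfolding wmul_def ev_comp by (rule ev_cong) (simp split: sum.splits)

section \<open>Isobaric polynomials\<close>

definition mwt :: "('v => nat) => ('v \<Rightarrow>\<^sub>0 nat) => nat" where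
 "mwt \<omega> m = (\<Sum>t\<in>keys m. lookup m t * \<omega> t)"

text \<open>Used with two kinds of weights: p^i on the variables of index i, which controls degrees,
  and the indicator of index > n with total weight 0, which says that no variable of index > n
  occurs.\<close>

definition isob :: "('v => nat) => nat => 'v zpoly => bool" where
 "isob \<omega> w Q \<longleftrightarrow> (\<forall>m\<in>keys Q. mwt \<omega> m = w)"

lemma mwt_superset: assumes "finite A" "keys m <= A" shows "mwt \<omega> m = (\<Sum>t\<in>A. lookup m t * \<omega> t)"
 unfolding mwt_def by (rule sum.mono_neutral_left) (use assms in "auto simp: in_keys_iff")

lemma mwt_0 [simp]: "mwt \<omega> 0 = 0" by (simp add: mwt_def)

lemma mwt_add: "mwt \<omega> (m + m') = mwt \<omega> m + mwt \<omega> m'"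
proof -
 let ?A = "keys m \<union> keys m'"
 have "keys (m + m') <= ?A" by (rule keys_add)
 thus ?thesis by (simp add: mwt_superset[of ?A] lookup_add ring_distribs sum.distrib)
qed

lemma isob_0 [simp]: "isob \<omega> w 0" by (simp add: isob_def)

lemma isob_1 [simp]: "isob \<omega> 0 1" by (simp add: isob_def)

lemma isob_add: "isob \<omega> w P ==> isob \<omega> w Q ==> isob \<omega> w (P + Q)"
 unfolding isob_def using keys_add[of P Q] by blast

lemma isob_uminus: "isob \<omega> w P ==> isob \<omega> w (- P)" unfolding isob_def by simp

lemma isob_diff: "isob \<omega> w P ==> isob \<omega> w Q ==> isob \<omega> w (P - Q)"
 using isob_add[of \<omega> w P "- Q"] isob_uminus[of \<omega> w Q] by simp

lemma isob_mult: "isob \<omega> v P ==> isob \<omega> w Q ==> isob \<omega> (v + w) (P * Q)"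
 unfolding isob_def using keys_mult[of P Q] by (auto simp: mwt_add)

lemma isob_power: "isob \<omega> w P ==> isob \<omega> (n * w) (P ^ n)" by (induction n) (auto intro: isob_mult)

lemma isob_of_nat: "isob \<omega> 0 (of_nat n)" by (induction n) (auto intro: isob_add)

lemma isob_sum: "(!!x. x \<in> A ==> isob \<omega> w (f x)) ==> isob \<omega> w (sum f A)"
 by (induction A rule: infinite_finite_induct) (auto intro: isob_add)

lemma isob_zvar [simp]: "isob \<omega> (\<omega> t) (zvar t)" by (simp add: isob_def zvar_def mwt_def)

lemma isob_of_nat_mult_iff: "p > 0 ==> isob \<omega> w (of_nat p * Q) \<longleftrightarrow> isob \<omega> w Q"
proof -
 assume "p > 0"
 hence "keys (of_nat p * Q) = keys Q" by (auto simp: in_keys_iff lookup_of_nat_mult)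
 thus ?thesis by (simp add: isob_def)
qed

lemma isob_gh: assumes "!!i. i \<le> n ==> isob \<omega> (v i) (S i)" "!!i. i \<le> n ==> p ^ (n - i) * v i = v n"
 shows "isob \<omega> (v n) (gh p n S)" unfolding gh_def
proof (rule isob_sum)
 fix i assume i: "i \<in> {..n}"
 have "isob \<omega> (0 + p ^ (n - i) * v i) (of_nat (p ^ i) * S i ^ (p ^ (n - i)))"
  by (intro isob_mult isob_of_nat isob_power assms) (use i in auto)
 thus "isob \<omega> (v n) (of_nat p ^ i * S i ^ (p ^ (n - i)))" using assms(2) i by simp
qed

text \<open>The term p^n S n is the ghost minus earlier terms, and multiplication by p^n does not
  change the support. The range is bounded by k because weights that count indices above k are
  controlled only for ghosts up to k.\<close>

lemma isob_gh_imp: assumes p: "p > 0" and gh: "!!n. n \<le> k ==> isob \<omega> (v n) (gh p n S)"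
  and v: "!!i n. i \<le> n ==> n \<le> k ==> p ^ (n - i) * v i = v n" shows "n \<le> k ==> isob \<omega> (v n) (S n)"
proof (induction n rule: less_induct)
 case (less n)
 have "isob \<omega> (v n) (\<Sum>i<n. of_nat p ^ i * S i ^ (p ^ (n - i)))"
 proof (rule isob_sum)
  fix i assume i: "i \<in> {..<n}"
  have "isob \<omega> (0 + p ^ (n - i) * v i) (of_nat (p ^ i) * S i ^ (p ^ (n - i)))"
   by (intro isob_mult isob_of_nat isob_power less) (use i less in auto)
  thus "isob \<omega> (v n) (of_nat p ^ i * S i ^ (p ^ (n - i)))" using v i less by simp
 qed
 from isob_diff[OF gh this] less.prems have "isob \<omega> (v n) (of_nat (p ^ n) * S n)"
  by (simp add: gh_def flip: lessThan_Suc_atMost)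
 thus ?case using p isob_of_nat_mult_iff[of "p ^ n" \<omega> "v n" "S n"] by simp
qed

definition widx :: "nat + nat => nat" where "widx t = case_sum id id t"

lemma widx_simps [simp]: "widx (Inl i) = i" "widx (Inr i) = i" by (auto simp: widx_def)

text \<open>The ghosts of a product are products of two isobaric polynomials, hence the weight 2
  p^n.\<close>

lemma assumes p: "prime p" shows isob_witt_sum: "isob (%t. p ^ widx t) (p ^ n) (witt_sum p n)"
  and isob_witt_prod: "isob (%t. p ^ widx t) (2 * p ^ n) (witt_prod p n)"
  and index_witt_sum: "isob (%t. if widx t > n then 1 else 0) 0 (witt_sum p n)"
  and index_witt_prod: "isob (%t. if widx t > n then 1 else 0) 0 (witt_prod p n)"
proof -
 have p0: "p > 0" using p prime_gt_0_nat by blast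
 let ?l = "%i. zvar (Inl i) :: witt_poly" and ?r = "%i. zvar (Inr i) :: witt_poly"
 let ?\<omega> = "%t::nat+nat. p ^ widx t" and ?\<iota> = "%t::nat+nat. if widx t > n then 1 else (0::nat)"
 have w: "isob ?\<omega> (p ^ k) (gh p k ?l)" "isob ?\<omega> (p ^ k) (gh p k ?r)" for k
  by (rule isob_gh[where v = "%k. p ^ k"];
    use isob_zvar[of ?\<omega> "Inl _"] isob_zvar[of ?\<omega> "Inr _"] in "auto simp flip: power_add")+
 have i: "isob ?\<iota> 0 (gh p k ?l)" "isob ?\<iota> 0 (gh p k ?r)" if "k \<le> n" for k
 proof -
  have "isob ?\<iota> 0 (?l i)" "isob ?\<iota> 0 (?r i)" if "i \<le> k" for i
   using isob_zvar[of ?\<iota> "Inl i"] isob_zvar[of ?\<iota> "Inr i"] that `k \<le> n` by auto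
  thus "isob ?\<iota> 0 (gh p k ?l)" "isob ?\<iota> 0 (gh p k ?r)"
   using isob_gh[where v = "%_. 0" and \<omega> = ?\<iota> and n = k and p = p] by auto
 qed
 show "isob ?\<omega> (p ^ n) (witt_sum p n)" by (rule isob_gh_imp[where v = "%k. p ^ k" and k = n, OF p0])
   (auto simp: gh_witt_sum[OF p] intro: isob_add w simp flip: power_add)
 show "isob ?\<omega> (2 * p ^ n) (witt_prod p n)"
 proof (rule isob_gh_imp[where v = "%k. 2 * p ^ k" and k = n, OF p0])
  show "isob ?\<omega> (2 * p ^ k) (gh p k (witt_prod p))" for k
   using isob_mult[OF w(1)[of k] w(2)[of k]] by (simp add: gh_witt_prod[OF p] mult_2)
 qed (auto simp flip: power_add)
 show "isob ?\<iota> 0 (witt_sum p n)" by (rule isob_gh_imp[where v = "%k. 0" and k = n, OF p0])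
   (auto simp: gh_witt_sum[OF p] intro: isob_add i)
 show "isob ?\<iota> 0 (witt_prod p n)"
 proof (rule isob_gh_imp[where v = "%k. 0" and k = n, OF p0])
  show "isob ?\<iota> 0 (gh p k (witt_prod p))" if "k \<le> n" for k
   using isob_mult[OF i(1)[OF that] i(2)[OF that]] by (simp add: gh_witt_prod[OF p])
 qed auto
qed

lemma isob_index_imp: assumes "isob (%t. if widx t > n then 1 else 0) 0 Q" "m \<in> keys Q" "t \<in> keys m"
 shows "widx t \<le> n"
proof (rule ccontr)
 assume "\<not> widx t \<le> n"
 moreover have "lookup m t * (if widx t > n then 1 else 0) = 0" using assms by (auto simp: isob_def mwt_def)
 ultimately show False using assms by (simp add: in_keys_iff)
qed

lemma wadd_cong: assumes "prime p" "!!j. j \<le> i ==> a j = a' j" "!!j. j \<le> i ==> b j = b' j"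
 shows "wadd p a b i = wadd p a' b' i" unfolding wadd_def
proof (rule ev_cong)
 fix m t assume "m \<in> keys (witt_sum p i)" "t \<in> keys m"
 from isob_index_imp[OF index_witt_sum[OF assms(1)] this] show "case_sum a b t = case_sum a' b' t"
  using assms by (cases t) auto
qed

section \<open>The group of Witt vectors\<close>

text \<open>Negation is not componentwise for p = 2, so it too is taken from Dwork's lemma.\<close>

definition wneg_poly :: "nat => nat => nat zpoly" where
 "wneg_poly p = (SOME S. \<forall>n. gh p n S = - gh p n zvar)"

definition wneg :: "nat => (nat => 'a::comm_ring_1) => nat => 'a" where
 "wneg p a i = ev a (wneg_poly p i)"

lemma gh_wneg_poly: "prime p ==> gh p n (wneg_poly p) = - gh p n zvar"
proof -
 assume p: "prime p"
 have "\<forall>n. gh p n (wneg_poly p) = - gh p n zvar"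
  unfolding wneg_poly_def by (rule someI_ex[OF dwork_imp_gh[OF p dwork_uminus[OF dwork_gh[OF p]]]])
 thus ?thesis by blast
qed

lemma gh_wneg: "prime p ==> gh p n (wneg p a) = - gh p n a"
 using arg_cong[OF gh_wneg_poly[of p n], of "ev a"] by (simp add: ev_gh ev_uminus wneg_def[abs_def])

lemma ev_wneg: "ev env (wneg p a i) = wneg p (%i. ev env (a i)) i" unfolding wneg_def ev_comp ..

lemma isob_wneg_poly: assumes p: "prime p" shows "isob (%t. p ^ t) (p ^ n) (wneg_poly p n)"
proof (rule isob_gh_imp[where v = "%k. p ^ k" and k = n])
 show "isob (%t. p ^ t) (p ^ k) (gh p k (wneg_poly p))" for k unfolding gh_wneg_poly[OF p]
  by (intro isob_uminus isob_gh[where v = "%k. p ^ k"]) (auto simp flip: power_add)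
qed (use p prime_gt_0_nat in "auto simp flip: power_add")

text \<open>Identities of Witt vectors are verified in polynomial rings over the integers, where the
 ghost components determine a sequence, and then transported by evaluation.\<close>

lemma wadd_universal:
 fixes a b c :: "nat => 'a::comm_ring_1" assumes p: "prime p"
 shows wadd_assoc: "wadd p (wadd p a b) c = wadd p a (wadd p b c)" and wadd_comm: "wadd p a b = wadd p b a"
  and wadd_0: "wadd p (%_. 0) a = a" and wadd_wneg: "wadd p (wneg p a) a = (%_. 0)"
proof -
 have p0: "p > 0" using p prime_gt_0_nat by blast
 define env where "env = (%(j::nat, i). if j = 0 then a i else if j = 1 then b i else c i)"
 define Z :: "nat => nat => (nat \<times> nat) zpoly" where "Z = (%j i. zvar (j, i))"
 have Z: "(%i. ev env (Z 0 i)) = a" "(%i. ev env (Z 1 i)) = b" "(%i. ev env (Z 2 i)) = c"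
  by (auto simp: Z_def env_def)
 have gh0: "gh p n (%_. 0) = 0" for n using p0 by (simp add: gh_def power_0_left)
 note I = gh_inj[OF p0] and G = gh_wadd[OF p] gh_wneg[OF p] gh0
 have "wadd p (wadd p (Z 0) (Z 1)) (Z 2) = wadd p (Z 0) (wadd p (Z 1) (Z 2))" by (rule I) (simp add: G)
 from arg_cong[OF this, of "%s i. ev env (s i)"] show "wadd p (wadd p a b) c = wadd p a (wadd p b c)"
  by (simp add: ev_wadd Z del: One_nat_def)
 have "wadd p (Z 0) (Z 1) = wadd p (Z 1) (Z 0)" by (rule I) (simp add: G)
 from arg_cong[OF this, of "%s i. ev env (s i)"] show "wadd p a b = wadd p b a"
  by (simp add: ev_wadd Z del: One_nat_def)
 have "wadd p (%_. 0) (Z 0) = Z 0" by (rule I) (simp add: G)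
 from arg_cong[OF this, of "%s i. ev env (s i)"] show "wadd p (%_. 0) a = a" by (simp add: ev_wadd Z del: One_nat_def)
 have "wadd p (wneg p (Z 0)) (Z 0) = (%_. 0)" by (rule I) (simp add: G)
 from arg_cong[OF this, of "%s i. ev env (s i)"] show "wadd p (wneg p a) a = (%_. 0)"
  by (simp add: ev_wadd ev_wneg Z del: One_nat_def)
qed

text \<open>The prime is the characteristic of the base ring; in the other case the componentwise
 structure is a dummy.\<close>

datatype 'a witt = Witt (wc: "nat => 'a")

instantiation witt :: (comm_ring_1) ab_group_add
begin

definition "0 = Witt (%_. 0)"
definition "a + b = Witt (if prime CHAR('a) then wadd CHAR('a) (wc a) (wc b) else (%i. wc a i + wc b i))"
definition "- a = Witt (if prime CHAR('a) then wneg CHAR('a) (wc a) else (%i. - wc a i))"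
definition "a - b = a + - (b :: 'a witt)"

instance
proof
 fix a b c :: "'a witt"
 show "a + b + c = a + (b + c)" by (auto simp: plus_witt_def wadd_assoc add.assoc)
 show "a + b = b + a" using wadd_comm[of "CHAR('a)" "wc a" "wc b"] by (auto simp: plus_witt_def add.commute)
 show "0 + a = a" by (auto simp: plus_witt_def zero_witt_def wadd_0)
 show "- a + a = 0" by (auto simp: plus_witt_def zero_witt_def uminus_witt_def wadd_wneg)
 show "a - b = a + - b" by (simp add: minus_witt_def)
qed

end

definition wev :: "('v => 'a::comm_ring_1) => (nat => 'v zpoly) => 'a witt" where
 "wev env S = Witt (%i. ev env (S i))"

lemma wc_wev [simp]: "wc (wev env S) i = ev env (S i)" by (simp add: wev_def)

lemma wc_0 [simp]: "wc 0 i = 0" by (simp add: zero_witt_def)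

text \<open>Lifts a sum in characteristic p to a sequence over the integers, where its ghost
  components are visible.\<close>

lemma wev_sum_ex:
 fixes env :: "'v => 'a::comm_ring_1" assumes p: "prime p" "CHAR('a) = p"
 shows "\<exists>S. (\<forall>n. gh p n S = (\<Sum>k\<in>K. gh p n (c k))) & wev env S = (\<Sum>k\<in>K. wev env (c k))"
proof (induction K rule: infinite_finite_induct)
 case (infinite K)
 thus ?case using p prime_gt_0_nat[of p]
  by (intro exI[of _ "%_. 0"]) (auto simp: gh_def power_0_left zero_witt_def wev_def)
next
 case empty
 thus ?case using p prime_gt_0_nat[of p]
  by (intro exI[of _ "%_. 0"]) (auto simp: gh_def power_0_left zero_witt_def wev_def)
next
 case (insert k K)
 then obtain S where S: "\<forall>n. gh p n S = (\<Sum>k\<in>K. gh p n (c k))" "wev env S = (\<Sum>k\<in>K. wev env (c k))" by blast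
 have "wev env (wadd p (c k) S) = wev env (c k) + wev env S" using p by (simp add: plus_witt_def wev_def ev_wadd)
 thus ?case using insert S by (intro exI[of _ "wadd p (c k) S"]) (simp add: gh_wadd[OF p(1)])
qed

lemma ev_cong_dvd:
 fixes env :: "'v => 'a::comm_ring_1" assumes "CHAR('a) = p" "of_nat p dvd a - b" shows "ev env a = ev env b"
proof -
 obtain c where "a - b = of_nat p * c" using assms(2) by (rule dvdE)
 hence "ev env a - ev env b = of_nat CHAR('a) * ev env c" using assms(1) by (simp add: ev_mult flip: ev_diff)
 thus ?thesis by simp
qed

text \<open>Congruence of the \<open>n\<close>-th ghost components modulo \<open>p\<^sup>n\<^sup>+\<^sup>1\<close> for all \<open>n\<close> is
 congruence of the components modulo \<open>p\<close>, so this verifies identities special to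
 characteristic \<open>p\<close>.\<close>

lemma wev_sum_eqI:
 fixes env :: "'v => 'a::comm_ring_1" assumes p: "prime p" "CHAR('a) = p"
  and c: "!!n. of_nat p ^ Suc n dvd (\<Sum>k\<in>K. gh p n (c k)) - (\<Sum>l\<in>L. gh p n (d l))"
 shows "(\<Sum>k\<in>K. wev env (c k)) = (\<Sum>l\<in>L. wev env (d l))"
proof -
 from wev_sum_ex[OF p, where K = K and c = c and env = env] obtain S where
  S: "\<forall>n. gh p n S = (\<Sum>k\<in>K. gh p n (c k))" "wev env S = (\<Sum>k\<in>K. wev env (c k))" by blast
 from wev_sum_ex[OF p, where K = L and c = d and env = env] obtain T where
  T: "\<forall>n. gh p n T = (\<Sum>l\<in>L. gh p n (d l))" "wev env T = (\<Sum>l\<in>L. wev env (d l))" by blast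
 have "of_nat p dvd S n - T n" for n by (rule gh_cong_imp_cong) (use p c S T prime_gt_0_nat[of p] in auto)
 hence "wev env S = wev env T" using ev_cong_dvd[OF p(2)] by (auto simp: wev_def fun_eq_iff)
 thus ?thesis using S T by simp
qed

lemma wc_add: 
 fixes x y :: "'a::comm_ring_1 witt" assumes "prime CHAR('a)" shows "wc (x + y) = wadd CHAR('a) (wc x) (wc y)"
 using assms by (simp add: plus_witt_def)

lemma wc_uminus: 
 fixes x :: "'a::comm_ring_1 witt" assumes "prime CHAR('a)" shows "wc (- x) = wneg CHAR('a) (wc x)"
 using assms by (simp add: uminus_witt_def)

section \<open>Verschiebung, Frobenius and scaling\<close>

definition wV :: "'a::comm_ring_1 witt => 'a witt" where
 "wV x = Witt (case_nat 0 (wc x))"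

definition wF :: "'a::comm_ring_1 witt => 'a witt" where
 "wF x = Witt (%i. wc x i ^ CHAR('a))"

text \<open>Multiplication by the Teichmueller representative [c], written out on
  components.\<close>

definition wscale :: "'a::comm_ring_1 => 'a witt => 'a witt" where
 "wscale c x = Witt (%i. c ^ (CHAR('a) ^ i) * wc x i)"

definition teich :: "'a::comm_ring_1 => 'a witt" where
 "teich c = Witt (%i. if i = 0 then c else 0)"

text \<open>Inverse to V on Witt vectors with vanishing zeroth component; in general not
  additive.\<close>

definition wshift :: "'a::comm_ring_1 witt => 'a witt" where
 "wshift x = Witt (%i. wc x (Suc i))"

definition wtimes :: "'a::comm_ring_1 witt => 'a witt => 'a witt" where
 "wtimes x y = Witt (wmul CHAR('a) (wc x) (wc y))"

lemma wc_simps [simp]: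
 "wc (wV x) 0 = 0" "wc (wV x) (Suc i) = wc x i" "wc (wF x) i = wc x i ^ CHAR('a)"
 "wc (wscale c x) i = c ^ (CHAR('a) ^ i) * wc x i" "wc (teich c) 0 = c" "wc (teich c) (Suc i) = 0"
 "wc (wshift x) i = wc x (Suc i)"
 for x :: "'a::comm_ring_1 witt" by (simp_all add: wV_def wF_def wscale_def teich_def wshift_def)

lemma witt_eqI: "(!!i. wc x i = wc y i) ==> x = y" by (cases x; cases y) auto

lemma witt_eqI_nat: "wc x 0 = wc y 0 ==> (!!i. wc x (Suc i) = wc y (Suc i)) ==> x = y"
 by (rule witt_eqI) (metis not0_implies_Suc)

lemma gh_V: "gh p n (case_nat 0 S) = (case n of 0 => 0 | Suc m => of_nat p * gh p m S)" if "p > 0"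
 using that by (cases n) (simp_all add: gh_Suc_shift power_0_left)

lemma gh_F: "gh p n (%i. S i ^ p) = gh p (Suc n) S - of_nat p ^ Suc n * S (Suc n)"
proof -
 have "gh p n (%i. S i ^ p) = (\<Sum>i\<le>n. of_nat p ^ i * (S i ^ p) ^ (p ^ (n - i)))" by (simp add: gh_def)
 thus ?thesis by (simp only: gh_Suc) simp
qed

text \<open>In characteristic p, VF is multiplication by p: the ghosts of VF(S) and of p S differ by
  p^(n+1) S n, which the criterion \<open>wev_sum_eqI\<close> ignores.\<close>

lemma gh_VF: assumes "p > 0" shows "gh p n (case_nat 0 (%i. S i ^ p)) = of_nat p * gh p n S - of_nat p ^ Suc n * S n"
proof (cases n)
 case (Suc m)
 show ?thesis using assms by (simp only: Suc gh_V gh_F nat.case) (simp add: algebra_simps)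
qed (use assms in "simp add: power_0_left")

lemma gh_scale: "gh p n (%i. c ^ (p ^ i) * S i) = c ^ (p ^ n) * gh p n S"
proof -
 have "(c ^ p ^ i) ^ p ^ (n - i) = c ^ (p ^ n)" if "i \<le> n" for i using that by (simp flip: power_mult power_add)
 thus ?thesis by (simp add: gh_def power_mult_distrib sum_distrib_left mult_ac)
qed

lemma gh_teich: "p > 0 ==> gh p n (%i. if i = 0 then c else 0) = c ^ (p ^ n)"
 by (cases n) (simp_all add: gh_Suc_shift, simp add: gh_def power_0_left)

lemma wev_add_eqI:
 fixes env :: "'v => 'a::comm_ring_1" assumes p: "prime p" "CHAR('a) = p"
  and c: "!!n. of_nat p ^ Suc n dvd gh p n c - (gh p n d + gh p n e)" shows "wev env c = wev env d + wev env e"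
 using wev_sum_eqI[OF p, where K = "{True}" and L = "{True, False}" and c = "%_. c"
   and d = "%b. if b then d else e" and env = env] c by simp

lemma wV_0 [simp]: "wV (0 :: 'a::comm_ring_1 witt) = 0" by (rule witt_eqI_nat) auto

lemma wscale_0 [simp]: "wscale a (0 :: 'a::comm_ring_1 witt) = 0" by (intro witt_eqI) auto

lemma wV_wshift: "wc x 0 = 0 ==> wV (wshift x) = x" by (rule witt_eqI_nat) auto

lemma wscale_teich: "wscale a (teich b) = teich (a * (b :: 'a::comm_ring_1))" by (rule witt_eqI_nat) auto

lemma wscale_V:
 fixes x :: "'a::comm_ring_1 witt" shows "wscale a (wV x) = wV (wscale (a ^ CHAR('a)) x)"
 by (rule witt_eqI_nat) (auto simp flip: power_mult)

lemma wscale_wscale: "wscale a (wscale b x) = wscale (a * b) (x :: 'a::comm_ring_1 witt)"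
 by (rule witt_eqI) (auto simp: power_mult_distrib)

context
 fixes p :: nat assumes p: "prime p"
begin

lemma p_pos: "p > 0" using p prime_gt_0_nat by blast

lemma freshman: "CHAR('a) = p ==> (a + b) ^ p = a ^ p + (b::'a::comm_ring_1) ^ p"
proof -
 assume c: "CHAR('a) = p"
 obtain t where "(a + b) ^ p - a ^ p - b ^ p = of_nat CHAR('a) * t"
  using prime_dvd_freshman[OF p, of a b] c by (auto elim: dvdE)
 thus ?thesis by (simp add: algebra_simps)
qed

lemma ev_frob: "CHAR('a) = p ==> ev env Q ^ p = ev (%t. env t ^ p :: 'a::comm_ring_1) Q"
 by (rule ev_hom[of "%a. a ^ p"]) (auto simp: freshman power_mult_distrib)

lemma wF_add:
 fixes x y :: "'a::comm_ring_1 witt" assumes "CHAR('a) = p" shows "wF (x + y) = wF x + wF y"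
 by (rule witt_eqI) (simp add: assms p wc_add wadd_def ev_frob, rule ev_cong, simp add: assms split: sum.splits)

text \<open>All four are checked on ghost components of universal vectors. The last one comes from F
  x = [x_0^p] + p x' with x' the shift of x, and p = VF; for a functional that kills VF it reduces
  linearity over F(W) to linearity over Teichmueller elements.\<close>

lemma
 fixes x y :: "'a::comm_ring_1 witt" assumes c: "CHAR('a) = p" shows wV_add: "wV (x + y) = wV x + wV y"
  and wscale_add: "wscale a (x + y) = wscale a x + wscale a y" and wdecomp: "x = teich (wc x 0) + wV (wshift x)"
  and wtimes_F: "wtimes (wF x) y = wscale (wc x 0 ^ p) y + wV (wF (wtimes (wshift x) y))"
proof -
 define env where "env = (%(j::nat, i). if j = 0 then wc x i else if j = 1 then wc y i else a)"
 define Z :: "nat => nat => (nat \<times> nat) zpoly" where "Z = (%j i. zvar (j, i))"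
 have Z: "ev env (Z 0 i) = wc x i" "ev env (Z (Suc 0) i) = wc y i" "ev env (Z 2 i) = a" for i
  by (auto simp: Z_def env_def)
 note E = wev_add_eqI[OF p c, of _ _ _ env]
 have "wev env (case_nat 0 (wadd p (Z 0) (Z 1))) = wev env (case_nat 0 (Z 0)) + wev env (case_nat 0 (Z 1))"
  by (rule E) (auto simp: gh_V[OF p_pos] gh_wadd[OF p] algebra_simps split: nat.splits)
 moreover have "wev env (case_nat 0 (wadd p (Z 0) (Z 1))) = wV (x + y)"
  by (rule witt_eqI_nat) (auto simp: ev_wadd Z wc_add p c)
 moreover have "wev env (case_nat 0 (Z 0)) = wV x" "wev env (case_nat 0 (Z 1)) = wV y"
  by (auto intro!: witt_eqI_nat simp: Z)
 ultimately show "wV (x + y) = wV x + wV y" by simp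
 let ?s = "%S i. Z 2 0 ^ (p ^ i) * S i"
 have "wev env (?s (wadd p (Z 0) (Z 1))) = wev env (?s (Z 0)) + wev env (?s (Z 1))"
  by (rule E) (simp only: gh_scale gh_wadd[OF p] distrib_left diff_self dvd_0_right)
 moreover have "wev env (?s (wadd p (Z 0) (Z 1))) = wscale a (x + y)"
  by (rule witt_eqI) (auto simp: ev_mult ev_power ev_wadd Z wc_add p c)
 moreover have "wev env (?s (Z 0)) = wscale a x" "wev env (?s (Z 1)) = wscale a y"
  by (auto intro!: witt_eqI simp: Z ev_mult ev_power c)
 ultimately show "wscale a (x + y) = wscale a x + wscale a y" by simp
 have "wev env (Z 0) = wev env (%i. if i = 0 then Z 0 0 else 0) + wev env (case_nat 0 (%i. Z 0 (Suc i)))"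
 proof (rule E)
  fix n show "of_nat p ^ Suc n dvd gh p n (Z 0) -
    (gh p n (%i. if i = 0 then Z 0 0 else 0) + gh p n (case_nat 0 (%i. Z 0 (Suc i))))"
   by (cases n) (simp_all add: gh_V[OF p_pos] gh_teich[OF p_pos] gh_Suc_shift[of p _ "Z 0"])
 qed
 moreover have "wev env (Z 0) = x" by (rule witt_eqI) (simp add: Z)
 moreover have "wev env (%i. if i = 0 then Z 0 0 else 0) = teich (wc x 0)"
  "wev env (case_nat 0 (%i. Z 0 (Suc i))) = wV (wshift x)" by (auto intro!: witt_eqI_nat simp: Z)
 ultimately show "x = teich (wc x 0) + wV (wshift x)" by simp
 let ?M = "wmul p (%i. Z 0 (Suc i)) (Z 1)"
 have "wev env (wmul p (%i. Z 0 i ^ p) (Z 1)) =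
  wev env (%i. (Z 0 0 ^ p) ^ (p ^ i) * Z 1 i) + wev env (case_nat 0 (%i. ?M i ^ p))"
 proof (rule E)
  fix n
  have "gh p n (wmul p (%i. Z 0 i ^ p) (Z 1)) -
   (gh p n (%i. (Z 0 0 ^ p) ^ (p ^ i) * Z 1 i) + gh p n (case_nat 0 (%i. ?M i ^ p))) =
   (Z 0 0 ^ (p ^ Suc n) + of_nat p * gh p n (%i. Z 0 (Suc i)) - of_nat p ^ Suc n * Z 0 (Suc n)) * gh p n (Z 1)
   - ((Z 0 0 ^ p) ^ (p ^ n) * gh p n (Z 1) + (of_nat p * (gh p n (%i. Z 0 (Suc i)) * gh p n (Z 1)) - of_nat p ^ Suc n * ?M n))"
   by (simp only: gh_wmul[OF p] gh_F gh_scale gh_VF[OF p_pos] gh_Suc_shift)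
  also have "\<dots> = of_nat p ^ Suc n * (?M n - Z 0 (Suc n) * gh p n (Z 1))"
   by (simp add: algebra_simps flip: power_mult)
  finally show "of_nat p ^ Suc n dvd gh p n (wmul p (%i. Z 0 i ^ p) (Z 1)) -
   (gh p n (%i. (Z 0 0 ^ p) ^ (p ^ i) * Z 1 i) + gh p n (case_nat 0 (%i. ?M i ^ p)))" by simp
 qed
 moreover have "wev env (wmul p (%i. Z 0 i ^ p) (Z 1)) = wtimes (wF x) y"
  by (rule witt_eqI) (simp add: ev_wmul ev_power Z wtimes_def wF_def c)
 moreover have "wev env (%i. (Z 0 0 ^ p) ^ (p ^ i) * Z 1 i) = wscale (wc x 0 ^ p) y"
  by (rule witt_eqI) (simp add: ev_mult ev_power Z c)
 moreover have "wev env (case_nat 0 (%i. ?M i ^ p)) = wV (wF (wtimes (wshift x) y))"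
  by (rule witt_eqI_nat) (simp_all add: ev_wmul ev_power Z wtimes_def wshift_def c)
 ultimately show "wtimes (wF x) y = wscale (wc x 0 ^ p) y + wV (wF (wtimes (wshift x) y))" by simp
qed

lemma wF_0 [simp]: "CHAR('a) = p ==> wF (0 :: 'a::comm_ring_1 witt) = 0"
 using p_pos by (intro witt_eqI) (auto simp: power_0_left)

lemma wF_V: "CHAR('a) = p ==> wF (wV x) = wV (wF (x :: 'a::comm_ring_1 witt))"
 using p_pos by (intro witt_eqI_nat) (auto simp: power_0_left)

lemma wscale_F: "CHAR('a) = p ==> wscale (a ^ p) (wF x) = wF (wscale a (x :: 'a::comm_ring_1 witt))"
 by (rule witt_eqI) (auto simp: power_mult_distrib mult.commute simp flip: power_mult)

lemma
 fixes f :: "'b => 'a::comm_ring_1 witt" assumes c: "CHAR('a) = p"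
 shows wV_diff: "wV (x - y) = wV x - (wV y :: 'a witt)" and wV_sum: "wV (sum f A) = (\<Sum>k\<in>A. wV (f k))"
  and wF_diff: "wF (x - y) = wF x - (wF y :: 'a witt)" and wF_sum: "wF (sum f A) = (\<Sum>k\<in>A. wF (f k))"
  and wscale_diff: "wscale a (x - y) = wscale a x - wscale a y"
  and wscale_sum: "wscale a (sum f A) = (\<Sum>k\<in>A. wscale a (f k))"
proof -
 have "additive (wV :: 'a witt => _)" "additive (wF :: 'a witt => _)" "additive (wscale a)"
  by (rule additive.intro, rule wV_add[OF c] wF_add[OF c] wscale_add[OF c])+
 note h = this[THEN additive.diff] this[THEN additive.sum]
 show "wV (x - y) = wV x - (wV y :: 'a witt)" "wF (x - y) = wF x - (wF y :: 'a witt)"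
  "wscale a (x - y) = wscale a x - wscale a y" "wV (sum f A) = (\<Sum>k\<in>A. wV (f k))"
  "wF (sum f A) = (\<Sum>k\<in>A. wF (f k))" "wscale a (sum f A) = (\<Sum>k\<in>A. wscale a (f k))" by (rule h)+
qed

lemma wc_0_add: "CHAR('a) = p ==> wc (x + y) 0 = wc x 0 + wc (y :: 'a::comm_ring_1 witt) 0"
 using gh_wadd[OF p, of 0 "wc x" "wc y"] by (simp add: wc_add p)

lemma wc_0_uminus: "CHAR('a) = p ==> wc (- x) 0 = - wc (x :: 'a::comm_ring_1 witt) 0"
 using gh_wneg[OF p, of 0 "wc x"] by (simp add: wc_uminus p)

lemma wc_0_diff: "CHAR('a) = p ==> wc (x - y) 0 = wc x 0 - wc (y :: 'a::comm_ring_1 witt) 0"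
 using wc_0_add[of x "- y"] wc_0_uminus[of y] by simp

lemma wc_0_sum: "CHAR('a) = p ==> wc (sum f A) 0 = (\<Sum>k\<in>A. wc (f k :: 'a::comm_ring_1 witt) 0)"
 by (induction A rule: infinite_finite_induct) (auto simp: wc_0_add)

end

section \<open>Multinomial coefficients\<close>

text \<open>The multinomial coefficient as a product of binomials, which makes it integral from the
  start.\<close>

fun mcoef :: "nat list => nat" where
 "mcoef [] = 1"
| "mcoef (t # \<beta>) = ((t + sum_list \<beta>) choose t) * mcoef \<beta>"

definition mpr :: "'a::comm_ring_1 list => nat list => 'a" where
 "mpr as \<alpha> = (\<Prod>i<length as. as ! i ^ (\<alpha> ! i))"

definition compos :: "nat => nat => nat list set" where
 "compos r k = {\<alpha>. length \<alpha> = r & sum_list \<alpha> = k}"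

lemma mcoef_fact: "mcoef \<alpha> * (\<Prod>t\<leftarrow>\<alpha>. fact t) = fact (sum_list \<alpha>)"
proof (induction \<alpha>)
 case (Cons t \<beta>)
 have "mcoef (t # \<beta>) * (\<Prod>t\<leftarrow>t # \<beta>. fact t) = fact t * (mcoef \<beta> * (\<Prod>t\<leftarrow>\<beta>. fact t)) * ((t + sum_list \<beta>) choose t)"
  by simp
 also have "\<dots> = fact t * fact (sum_list \<beta>) * ((t + sum_list \<beta>) choose t)" by (simp only: Cons.IH)
 also have "\<dots> = fact (t + sum_list \<beta>)" using binomial_fact_lemma[of t "t + sum_list \<beta>"] by simp
 finally show ?case by simp
qed simp

lemma mpr_Cons: "mpr (a # as) (t # \<alpha>) = a ^ t * mpr as \<alpha>"
 by (simp add: mpr_def prod.lessThan_Suc_shift del: prod.lessThan_Suc)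

lemma compos_0: "compos 0 k = (if k = 0 then {[]} else {})" by (auto simp: compos_def)

lemma compos_Suc: "compos (Suc r) k = (%(t, \<beta>). t # \<beta>) ` (SIGMA t:{..k}. compos r (k - t))"
proof
 show "compos (Suc r) k <= (%(t, \<beta>). t # \<beta>) ` (SIGMA t:{..k}. compos r (k - t))"
 proof
  fix \<alpha> assume "\<alpha> \<in> compos (Suc r) k"
  then obtain t \<beta> where "\<alpha> = t # \<beta>" "length \<beta> = r" "t + sum_list \<beta> = k"
   by (cases \<alpha>) (auto simp: compos_def)
  hence "(t, \<beta>) \<in> (SIGMA t:{..k}. compos r (k - t))" by (auto simp: compos_def)
  thus "\<alpha> \<in> (%(t, \<beta>). t # \<beta>) ` (SIGMA t:{..k}. compos r (k - t))"
   using `\<alpha> = t # \<beta>` by force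
 qed
qed (auto simp: compos_def)

lemma finite_compos [simp]: "finite (compos r k)" by (induction r arbitrary: k) (auto simp: compos_0 compos_Suc)

lemma multinomial:
 "(sum_list as) ^ k = (\<Sum>\<alpha>\<in>compos (length as) k. of_nat (mcoef \<alpha>) * mpr as \<alpha>)" for as :: "'a::comm_ring_1 list"
proof (induction as arbitrary: k)
 case Nil
 thus ?case by (auto simp: compos_0 mpr_def power_0_left)
next
 case (Cons a as)
 have inj: "inj_on (%(t, \<beta>). t # \<beta>) (SIGMA t:{..k}. compos (length as) (k - t))" by (auto simp: inj_on_def)
 have "(sum_list (a # as)) ^ k = (\<Sum>t\<le>k. of_nat (k choose t) * a ^ t * sum_list as ^ (k - t))"
  by (simp add: binomial_ring)
 also have "\<dots> = (\<Sum>t\<le>k. \<Sum>\<beta>\<in>compos (length as) (k - t). of_nat (k choose t) * a ^ t * (of_nat (mcoef \<beta>) * mpr as \<beta>))"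
  by (simp only: Cons.IH sum_distrib_left)
 also have "\<dots> = (\<Sum>(t, \<beta>)\<in>(SIGMA t:{..k}. compos (length as) (k - t)). of_nat (k choose t) * a ^ t * (of_nat (mcoef \<beta>) * mpr as \<beta>))"
  by (rule sum.Sigma) auto
 also have "\<dots> = (\<Sum>\<alpha>\<in>compos (Suc (length as)) k. of_nat (mcoef \<alpha>) * mpr (a # as) \<alpha>)"
  unfolding compos_Suc sum.reindex[OF inj] by (rule sum.cong) (auto simp: mpr_Cons compos_def mult_ac)
 finally show ?case by simp
qed

definition dexps :: "nat => nat => nat list set" where
 "dexps p r = {\<alpha>. length \<alpha> = r & (\<forall>t\<in>set \<alpha>. t \<le> p - 1) & sum_list \<alpha> = p}"

definition dsum :: "nat => 'a::comm_ring_1 list => 'a" where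
 "dsum p as = (\<Sum>\<alpha>\<in>dexps p (length as). of_nat (mcoef \<alpha> div p) * mpr as \<alpha>)"

lemma sum_list_le_nth: "i < length (\<alpha> :: nat list) ==> \<alpha> ! i = sum_list \<alpha> ==> j < length \<alpha> ==> j \<noteq> i ==> \<alpha> ! j = 0"
proof -
 assume a: "i < length \<alpha>" "\<alpha> ! i = sum_list \<alpha>" "j < length \<alpha>" "j \<noteq> i"
 have "sum_list \<alpha> = \<alpha> ! i + (\<Sum>k\<in>{0..<length \<alpha>} - {i}. \<alpha> ! k)"
  unfolding sum_list_sum_nth using a by (subst sum.remove[of _ i]) auto
 hence "(\<Sum>k\<in>{0..<length \<alpha>} - {i}. \<alpha> ! k) = 0" using a by simp
 thus ?thesis using a by auto
qed

lemma dsum_mult_p: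
 fixes as :: "'a::comm_ring_1 list" assumes p: "prime p"
 shows "of_nat p * dsum p as = sum_list as ^ p - (\<Sum>i<length as. as ! i ^ p)"
proof -
 let ?r = "length as" let ?u = "%i. (replicate ?r 0)[i := p]"
 have p1: "p > 1" using p prime_gt_1_nat by blast
 \<comment> \<open>p divides its own factorial but none of the factorials of the entries, which are
   smaller than p.\<close>
 have dvd: "p dvd mcoef \<alpha>" if "\<alpha> \<in> dexps p ?r" for \<alpha>
 proof -
  have "p dvd mcoef \<alpha> * (\<Prod>t\<leftarrow>\<alpha>. fact t)"
   unfolding mcoef_fact using that p by (auto simp: dexps_def prime_dvd_fact_iff)
  moreover have "\<not> p dvd (\<Prod>t\<leftarrow>\<alpha>. fact t)" if "\<forall>t\<in>set \<alpha>. t \<le> p - 1" for \<alpha>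
   using that p p1 by (induction \<alpha>) (auto simp: prime_dvd_mult_iff prime_dvd_fact_iff)
  ultimately show ?thesis using that p by (auto simp: prime_dvd_mult_iff dexps_def)
 qed
 \<comment> \<open>An entry exceeding p - 1 equals p and forces all others to vanish; these
   compositions account for the pure p-th powers.\<close>
 have un: "compos ?r p = dexps p ?r \<union> ?u ` {..<?r}"
 proof
  show "compos ?r p <= dexps p ?r \<union> ?u ` {..<?r}"
  proof
   fix \<alpha> assume a: "\<alpha> \<in> compos ?r p"
   show "\<alpha> \<in> dexps p ?r \<union> ?u ` {..<?r}"
   proof (cases "\<forall>t\<in>set \<alpha>. t \<le> p - 1")
    case False
    then obtain i where i: "i < ?r" "\<not> \<alpha> ! i \<le> p - 1" using a by (auto simp: compos_def in_set_conv_nth)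
    have "\<alpha> ! i \<le> p" using a i by (auto simp: compos_def intro!: member_le_sum_list)
    hence ip: "\<alpha> ! i = p" using i by simp
    have "\<alpha> = ?u i"
     by (rule nth_equalityI) (use a i ip sum_list_le_nth[of i \<alpha>] in "auto simp: compos_def nth_list_update")
    thus ?thesis using i by blast
   qed (use a in "auto simp: compos_def dexps_def")
  qed
  have "sum_list (?u i) = p" if "i < ?r" for i using that by (simp add: sum_list_update sum_list_replicate)
  thus "dexps p ?r \<union> ?u ` {..<?r} <= compos ?r p" by (auto simp: dexps_def compos_def)
 qed
 have fin: "finite (dexps p ?r)" by (rule finite_subset[OF _ finite_compos[of ?r p]]) (use un in auto)
 have inj: "inj_on ?u {..<?r}"
 proof (rule inj_onI)
  fix i j assume ij: "i \<in> {..<?r}" "j \<in> {..<?r}" "?u i = ?u j"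
  have "?u i ! i = p" "?u j ! i = (if i = j then p else 0)" using ij(1,2) by (auto simp: nth_list_update)
  thus "i = j" using ij(3) p1 by (cases "i = j") auto
 qed
 have disj: "dexps p ?r \<inter> ?u ` {..<?r} = {}"
 proof -
  have "?u i ~: dexps p ?r" if "i < ?r" for i
  proof
   assume "?u i \<in> dexps p ?r"
   moreover have "p \<in> set (?u i)" using set_update_memI[of i "replicate ?r 0" p] that by simp
   ultimately have "p \<le> p - 1" unfolding dexps_def by blast
   thus False using p1 by simp
  qed
  thus ?thesis by auto
 qed
 have m1: "mcoef (?u i) = 1" if "i < ?r" for i
 proof -
  have "(\<Prod>t\<leftarrow>?u i. fact t :: nat) = (\<Prod>j\<in>{0..<?r}. if j = i then fact p else 1)"
   unfolding prod.list_conv_set_nth by (rule prod.cong) (auto simp: nth_list_update)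
  also have "\<dots> = fact p" using that by simp
  finally have "mcoef (?u i) * fact p = fact p" using mcoef_fact[of "?u i"] that by (simp add: sum_list_update sum_list_replicate)
  thus ?thesis by simp
 qed
 have m2: "mpr as (?u i) = as ! i ^ p" if "i < ?r" for i
 proof -
  have "mpr as (?u i) = (\<Prod>j<?r. if j = i then as ! i ^ p else 1)"
   unfolding mpr_def by (rule prod.cong) (auto simp: nth_list_update)
  thus ?thesis using that by simp
 qed
 have "sum_list as ^ p = (\<Sum>\<alpha>\<in>dexps p ?r. of_nat (mcoef \<alpha>) * mpr as \<alpha>) + (\<Sum>\<alpha>\<in>?u ` {..<?r}. of_nat (mcoef \<alpha>) * mpr as \<alpha>)"
  unfolding multinomial un by (rule sum.union_disjoint) (use fin disj in auto)
 also have "(\<Sum>\<alpha>\<in>?u ` {..<?r}. of_nat (mcoef \<alpha>) * mpr as \<alpha>) = (\<Sum>i<?r. as ! i ^ p)"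
  unfolding sum.reindex[OF inj] by (rule sum.cong) (auto simp: m1 m2)
 also have "(\<Sum>\<alpha>\<in>dexps p ?r. of_nat (mcoef \<alpha>) * mpr as \<alpha>) = of_nat p * dsum p as"
  unfolding dsum_def sum_distrib_left
 proof (rule sum.cong)
  fix \<alpha> assume "\<alpha> \<in> dexps p ?r"
  hence "mcoef \<alpha> = p * (mcoef \<alpha> div p)" using dvd by simp
  hence "of_nat (mcoef \<alpha>) = (of_nat (p * (mcoef \<alpha> div p)) :: 'a)" by (rule arg_cong)
  hence "of_nat (mcoef \<alpha>) = (of_nat p * of_nat (mcoef \<alpha> div p) :: 'a)" by (simp only: of_nat_mult)
  thus "of_nat (mcoef \<alpha>) * mpr as \<alpha> = of_nat p * (of_nat (mcoef \<alpha> div p) * mpr as \<alpha>)"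
   by (simp add: mult.assoc)
 qed simp
 finally show ?thesis by simp
qed

lemma finite_dexps [simp]: "finite (dexps p r)"
 by (rule finite_subset[OF _ finite_compos[of r p]]) (auto simp: dexps_def compos_def)

lemma delta_sum_eq: "delta_sum p as = dsum p as"
proof -
 have "fact p div (\<Prod>t\<leftarrow>\<alpha>. fact t) div p = mcoef \<alpha> div p" if "sum_list \<alpha> = p" for \<alpha>
 proof -
  have "(\<Prod>t\<leftarrow>\<alpha>. fact t :: nat) > 0" by (induction \<alpha>) auto
  thus ?thesis unfolding mcoef_fact[of \<alpha>, unfolded that, symmetric] by simp
 qed
 thus ?thesis unfolding delta_sum_def dsum_def dexps_def mpr_def by (intro sum.cong) auto
qed

section \<open>The error term of the Teichmueller lift\<close>

text \<open>\<open>P\<close> and \<open>Q\<close> are the ghost components of two lifts of the same element.  If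
 \<open>P n - Q n = p * e n\<close> then \<open>dd e P p\<close> is \<open>(P^p - Q^p - p * P^(p-1) * (P - Q)) / p^2\<close>.\<close>

definition dd :: "'a::comm_ring_1 => 'a => nat => 'a" where
 "dd e P p = - (\<Sum>k\<in>{2..p}. of_nat (p choose k) * (- 1) ^ k * of_nat p ^ (k - 2) * e ^ k * P ^ (p - k))"

lemma dd_mult:
 fixes P Q e :: "'a::comm_ring_1" assumes "P - Q = of_nat p * e" "p \<ge> 2"
 shows "of_nat p ^ 2 * dd e P p = P ^ p - Q ^ p - of_nat p * P ^ (p - 1) * (P - Q)"
proof -
 let ?g = "%k. of_nat (p choose k) * (- (of_nat p * e)) ^ k * P ^ (p - k)"
 have Q: "Q = - (of_nat p * e) + P" using assms(1) by (simp add: algebra_simps)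
 have "Q ^ p = (\<Sum>k\<le>p. ?g k)" unfolding Q by (rule binomial_ring)
 also have "{..p} = insert 0 (insert 1 {2..p})" using assms(2) by auto
 also have "(\<Sum>k\<in>insert 0 (insert 1 {2..p}). ?g k) = P ^ p - of_nat p * (of_nat p * e) * P ^ (p - 1) + (\<Sum>k\<in>{2..p}. ?g k)"
  by simp
 also have "(\<Sum>k\<in>{2..p}. ?g k) = - (of_nat p ^ 2 * dd e P p)"
  unfolding dd_def sum_negf[symmetric] sum_distrib_left mult_minus_right unfolding minus_minus sum_negf
 proof (rule sum.cong)
  fix k assume "k \<in> {2..p}"
  then obtain j where "k = 2 + j" by (auto simp: le_iff_add)
  hence "of_nat p ^ k = (of_nat p ^ 2 * of_nat p ^ (k - 2) :: 'a)" by (simp add: power2_eq_square mult.assoc)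
  hence "(- (of_nat p * e)) ^ k = (- 1) ^ k * (of_nat p ^ 2 * of_nat p ^ (k - 2)) * e ^ k"
   by (subst power_minus) (simp only: power_mult_distrib mult.assoc)
  thus "of_nat (p choose k) * (- (of_nat p * e)) ^ k * P ^ (p - k) =
   (of_nat p)\<^sup>2 * (of_nat (p choose k) * (- 1) ^ k * of_nat p ^ (k - 2) * e ^ k * P ^ (p - k))"
   by (simp add: mult_ac)
 qed simp
 finally show ?thesis by (simp add: assms(1) algebra_simps)
qed

lemma dvd_mult_diff:
 fixes a b c d m :: "'a::comm_ring_1" assumes "m dvd a - b" "m dvd c - d" shows "m dvd a * c - b * d"
proof -
 have "a * c - b * d = (a - b) * c + b * (c - d)" by (simp add: algebra_simps)
 thus ?thesis using assms by simp
qed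

lemma dvd_power_diff: 
 fixes a b :: "'a::comm_ring_1" shows "m dvd a - b ==> m dvd a ^ k - b ^ k"
 by (induction k) (auto intro: dvd_mult_diff)

text \<open>For odd p every coefficient of \<open>dd\<close> is divisible by p, which supplies the
  missing power. For p = 2 the only coefficient is a unit and the power is gained by squaring e,
  which works for n > 0.\<close>

lemma dd_cong:
 fixes P P' e e' :: "'a::comm_ring_1"
 assumes p: "prime p" and e: "of_nat p ^ n dvd e - e'" and P: "of_nat p ^ Suc n dvd P - P'" and "p = 2 ==> n > 0"
 shows "of_nat p ^ Suc n dvd dd e P p - dd e' P' p"
proof -
 have p2: "p \<ge> 2" using p prime_ge_2_nat by blast
 let ?m = "of_nat p ^ Suc n :: 'a"
 let ?c = "%k. of_nat (p choose k) * (- 1) ^ k * of_nat p ^ (k - 2) :: 'a"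
 have t: "?m dvd ?c k * (e ^ k * P ^ (p - k) - e' ^ k * P' ^ (p - k))" if k: "k \<in> {2..p}" for k
 proof (cases "p = 2")
  case True
  hence "k = 2" using k by simp
  obtain m where "n = Suc m" using assms(4) True by (cases n) auto
  hence "?m dvd e ^ p - e' ^ p" using dvd_power_diff_prime[of p m e e'] e by simp
  thus ?thesis using True `k = 2` by simp
 next
  case False
  have "of_nat p dvd ?c k"
  proof (cases "k = p")
   case True
   hence "k - 2 = Suc (k - 3)" using p2 False by simp
   hence "of_nat p ^ (k - 2) = of_nat p * (of_nat p ^ (k - 3) :: 'a)" by (simp only: power_Suc)
   thus ?thesis by simp
  next
   case False
   hence "p dvd p choose k" using k p p2 by (intro dvd_choose_prime) auto
   then obtain c where "p choose k = p * c" by (rule dvdE)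
   thus ?thesis by simp
  qed
  moreover have "of_nat p ^ n dvd e ^ k * P ^ (p - k) - e' ^ k * P' ^ (p - k)"
   using e P by (intro dvd_mult_diff dvd_power_diff) (auto intro: dvd_trans[OF le_imp_power_dvd])
  ultimately show ?thesis by (simp add: mult_dvd_mono)
 qed
 have "dd e P p - dd e' P' p = - (\<Sum>k\<in>{2..p}. ?c k * (e ^ k * P ^ (p - k) - e' ^ k * P' ^ (p - k)))"
  unfolding dd_def by (simp add: right_diff_distrib sum_subtractf mult.assoc)
 also have "?m dvd \<dots>" unfolding dvd_minus_iff using t by (intro dvd_sum) auto
 finally show ?thesis .
qed

text \<open>Over the integers let P = (sum of x_i)^(p^n), Q = sum of x_i^(p^n) and Q' = sum of
  x_i^(p^(n+1)). The ghost of the error is (P^p - Q') / p. Its part (Q^p - Q') / p is the ghost of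
  the sum of Teichmueller monomials, by \<open>dsum_mult_p\<close>. In the other part (P^p - Q^p) /
  p, the linear term P^(p-1) (P - Q) is the ghost of the scaled V term, and the rest, p times
  \<open>dd\<close>, is that of VF z up to p^(n+1).\<close>

theorem teich_error:
 fixes as :: "'a::comm_ring_1 list" assumes p: "prime p" and c: "CHAR('a) = p"
 defines "f \<equiv> sum_list as" and "r \<equiv> length as"
 defines "y \<equiv> wshift (teich f - (\<Sum>i<r. teich (as ! i)))"
 shows "\<exists>z. y = (\<Sum>(\<alpha>, t)\<in>(SIGMA \<alpha>:dexps p r. {..<mcoef \<alpha> div p}). teich (mpr as \<alpha>)) + wV (wscale (f ^ (p\<^sup>2 - p)) y) + wV (wF z)"
proof -
 have p0: "p > 0" and p2: "p \<ge> 2" using p prime_gt_0_nat prime_ge_2_nat by auto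
 define xs where "xs = map zvar [0..<r]"
 define ft where "ft = (sum_list xs :: nat zpoly)"
 define env where "env = (%i. as ! i)"
 define P where "P = (%n. ft ^ (p ^ n))"
 define Q where "Q = (%n. \<Sum>i<r. zvar i ^ (p ^ n) :: nat zpoly)"
 let ?t = "%c i. if i = (0::nat) then c else 0"
 let ?\<Lambda> = "SIGMA \<alpha>:dexps p r. {..<mcoef \<alpha> div p}"
 have xs: "length xs = r" "!!i. i < r ==> xs ! i = zvar i" by (auto simp: xs_def)
 have ft: "ft = (\<Sum>i<r. zvar i)" by (simp add: ft_def xs_def sum_list_sum_nth atLeast0LessThan)
 have ev_ft: "ev env ft = f" unfolding ft f_def by (simp add: ev_sum env_def sum_list_sum_nth r_def atLeast0LessThan)
 have ev_mpr: "ev env (mpr xs \<alpha>) = mpr as \<alpha>" for \<alpha>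
  by (simp add: mpr_def ev_prod ev_power xs env_def) (simp add: xs_def r_def)
 have wev_t: "wev env (?t a) = teich (ev env a)" for a by (rule witt_eqI_nat) auto
 have Pgh: "gh p n (?t ft) = P n" for n by (simp add: gh_teich[OF p0] P_def)
 obtain B where B: "\<forall>n. gh p n B = (\<Sum>i<r. gh p n (?t (zvar i)))"
  and wB: "wev env B = (\<Sum>i<r. wev env (?t (zvar i)))"
  using wev_sum_ex[OF p c, where K = "{..<r}" and c = "%i. ?t (zvar i)" and env = env] by blast
 have Bgh: "gh p n B = Q n" for n using B by (simp add: gh_teich[OF p0] Q_def)
 obtain D where D: "\<forall>n. gh p n D = (\<Sum>x\<in>?\<Lambda>. gh p n (?t (mpr xs (fst x))))"
  and wD: "wev env D = (\<Sum>x\<in>?\<Lambda>. wev env (?t (mpr xs (fst x))))"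
  using wev_sum_ex[OF p c, where K = "?\<Lambda>" and c = "%x. ?t (mpr xs (fst x))" and env = env] by blast
 have phiQ: "zphi p (Q n) = Q (Suc n)" for n by (simp add: Q_def flip: power_mult)
 have phiP: "of_nat p ^ Suc n dvd P (Suc n) - zphi p (P n)" for n
  using dwork_gh[OF p, of "?t ft"] by (simp add: dwork_def Pgh)
 have "dwork p (%n. P n - Q n)" using phiP by (auto simp: dwork_def phiQ)
 then obtain T where T: "\<forall>n. gh p n T = P n - Q n" using dwork_imp_gh[OF p] by blast
 define Y where "Y = (%i. T (Suc i))"
 have T0: "T 0 = 0" using T[rule_format, of 0] by (simp add: P_def Q_def ft)
 have Ygh: "of_nat p * gh p n Y = P (Suc n) - Q (Suc n)" for n
  using T[rule_format, of "Suc n"] T0 p0 by (simp add: gh_Suc_shift Y_def power_0_left)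
 have "wev env (?t ft) = wev env B + wev env T" by (rule wev_add_eqI[OF p c]) (simp add: Pgh Bgh T)
 hence wT: "wev env T = teich f - (\<Sum>i<r. teich (as ! i))" by (simp add: wB wev_t ev_ft) (simp add: env_def)
 have wY: "wev env Y = y" unfolding y_def wT[symmetric] by (rule witt_eqI) (simp add: Y_def)
 define e where "e = (%n. case n of 0 => 0 | Suc m => gh p m Y)"
 have e: "P n - Q n = of_nat p * e n" for n by (cases n) (simp_all add: e_def Ygh, simp add: P_def Q_def ft)
 \<comment> \<open>For p = 2 the value 0 of \<open>dd\<close> at n = 0 would break Dwork's
   congruence with d 1 = - (e 1)^2, so - e 1 replaces it. At n = 0 ghosts matter only modulo p,
   where p * d 0 is invisible.\<close>
 define d where "d = (%n. if n = 0 then (if p = 2 then - e 1 else 0) else dd (e n) (P n) p)"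
 \<comment> \<open>Dividing P n - Q n by p costs one power, so \<open>e\<close> obeys the congruence
   only modulo p^n; \<open>dd_cong\<close> regains it.\<close>
 have ephi: "of_nat p ^ n dvd e (Suc n) - zphi p (e n)" for n
 proof -
  have "of_nat p * (e (Suc n) - zphi p (e n)) = (P (Suc n) - zphi p (P n))"
   using e[of "Suc n"] arg_cong[OF e[of n], of "zphi p"] by (simp add: phiQ algebra_simps)
  hence "of_nat p ^ (1 + n) dvd of_nat p ^ 1 * (e (Suc n) - zphi p (e n))" using phiP[of n] by simp
  from zpoly_dvd_cancel[OF this p0] show ?thesis .
 qed
 have zdd: "zphi p (dd a b p) = dd (zphi p a) (zphi p b) p" for a b :: "nat zpoly" by (simp add: dd_def)
 have e0: "e 0 = 0" by (simp add: e_def)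
 have dd0: "dd 0 b p = (0 :: nat zpoly)" for b unfolding dd_def by (simp add: power_0_left)
 have "dwork p d" unfolding dwork_def
 proof
  fix n
  show "of_nat p ^ Suc n dvd d (Suc n) - zphi p (d n)"
  proof (cases "p = 2 & n = 0")
   case True
   have two: "{2..2} = {2::nat}" by auto
   have "d (Suc n) = - (e 1 ^ p)" "d n = - e 1" using True by (simp_all add: d_def dd_def two)
   moreover have "of_nat p dvd - (e 1 ^ p) + zphi p (e 1)" using zphi_lift[OF p, of "e 1"] by (simp add: algebra_simps)
   ultimately show ?thesis using True by simp
  next
   case False
   have "zphi p (d n) = dd (zphi p (e n)) (zphi p (P n)) p"
    using False by (cases "n = 0") (auto simp: d_def zdd e0 dd0)
   thus ?thesis using dd_cong[OF p ephi phiP, of n] False by (simp add: d_def)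
  qed
 qed
 then obtain z where z: "\<forall>n. gh p n z = d n" using dwork_imp_gh[OF p] by blast
 let ?s = "case_nat 0 (%i. (ft ^ (p\<^sup>2 - p)) ^ (p ^ i) * Y i)"
 have pp: "p\<^sup>2 - p = p * (p - 1)" by (simp add: power2_eq_square right_diff_distrib')
 have sgh: "gh p n ?s = P n ^ (p - 1) * (P n - Q n)" for n
 proof (cases n)
  case (Suc m)
  have "gh p n ?s = of_nat p * ((ft ^ (p\<^sup>2 - p)) ^ (p ^ m) * gh p m Y)" by (simp add: Suc gh_V[OF p0] gh_scale)
  also have "\<dots> = (ft ^ (p\<^sup>2 - p)) ^ (p ^ m) * (P n - Q n)" by (simp add: Ygh[of m, folded Suc, symmetric] mult_ac)
  also have "(ft ^ (p\<^sup>2 - p)) ^ (p ^ m) = P n ^ (p - 1)"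
   unfolding P_def pp Suc by (simp add: mult_ac flip: power_mult)
  finally show ?thesis .
 qed (use T[rule_format, of 0] T0 in simp)
 have Dgh: "of_nat p * gh p n D = Q n ^ p - Q (Suc n)" for n
 proof -
  have "gh p n D = (\<Sum>(\<alpha>, t)\<in>?\<Lambda>. mpr xs \<alpha> ^ (p ^ n))"
   using D by (simp add: gh_teich[OF p0] case_prod_unfold)
  also have "\<dots> = (\<Sum>\<alpha>\<in>dexps p r. \<Sum>t<mcoef \<alpha> div p. mpr xs \<alpha> ^ (p ^ n))"
   by (rule sum.Sigma[symmetric]) auto
  also have "\<dots> = (\<Sum>\<alpha>\<in>dexps p r. of_nat (mcoef \<alpha> div p) * mpr (map (%x. x ^ (p ^ n)) xs) \<alpha>)"
   by (rule sum.cong) (auto simp: mpr_def prod_power_distrib mult.commute[of _ "p ^ n"] simp flip: power_mult intro!: prod.cong)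
  also have "\<dots> = dsum p (map (%x. x ^ (p ^ n)) xs)" by (simp add: dsum_def xs)
  finally have "of_nat p * gh p n D = sum_list (map (%x. x ^ (p ^ n)) xs) ^ p - (\<Sum>i<r. (map (%x. x ^ (p ^ n)) xs ! i) ^ p)"
   by (simp only: dsum_mult_p[OF p] length_map xs)
  also have "sum_list (map (%x. x ^ (p ^ n)) xs) = Q n" by (simp add: xs_def sum_list_sum_nth Q_def atLeast0LessThan)
  also have "(\<Sum>i<r. (map (%x. x ^ (p ^ n)) xs ! i) ^ p) = Q (Suc n)"
   unfolding Q_def by (rule sum.cong) (auto simp: xs mult.commute simp flip: power_mult)
  finally show ?thesis .
 qed
 have main: "gh p n Y - (gh p n D + gh p n ?s) = of_nat p * dd (e n) (P n) p" for n
 proof -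
  have "of_nat p * (gh p n Y - (gh p n D + gh p n ?s)) = P n ^ p - Q n ^ p - of_nat p * P n ^ (p - 1) * (P n - Q n)"
   unfolding right_diff_distrib distrib_left Ygh Dgh sgh
   by (simp add: P_def mult.commute algebra_simps flip: power_mult)
  also have "\<dots> = of_nat p * (of_nat p * dd (e n) (P n) p)"
   using dd_mult[OF e p2, of n] by (simp add: power2_eq_square mult.assoc)
  finally have "of_nat p ^ 1 * (gh p n Y - (gh p n D + gh p n ?s)) = of_nat p ^ 1 * (of_nat p * dd (e n) (P n) p)" by simp
  from zpoly_cancel[OF this p0] show ?thesis .
 qed
 have "(\<Sum>k\<in>{()}. wev env Y) = (\<Sum>l\<in>{0,1,2::nat}. wev env (if l = 0 then D else if l = 1 then ?s else case_nat 0 (%i. z i ^ p)))"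
 proof (rule wev_sum_eqI[OF p c])
  fix n
  have "of_nat p ^ Suc n dvd of_nat p * dd (e n) (P n) p - of_nat p * d n + of_nat p ^ Suc n * z n"
  proof (cases n)
   case 0
   have "dd (e 0) (P 0) p = 0" by (simp add: e0 dd0)
   thus ?thesis by (simp add: 0)
  qed (simp add: d_def)
  also have "of_nat p * dd (e n) (P n) p - of_nat p * d n + of_nat p ^ Suc n * z n =
   gh p n Y - (gh p n D + gh p n ?s) - gh p n (case_nat 0 (%i. z i ^ p))"
   unfolding main gh_VF[OF p0] z[rule_format] by (simp add: algebra_simps)
  finally show "of_nat p ^ Suc n dvd (\<Sum>k\<in>{()}. gh p n Y) -
    (\<Sum>l\<in>{0,1,2::nat}. gh p n (if l = 0 then D else if l = 1 then ?s else case_nat 0 (%i. z i ^ p)))"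
   by (simp add: diff_diff_eq add.assoc)
 qed
 hence "y = wev env D + (wev env ?s + wev env (case_nat 0 (%i. z i ^ p)))" by (simp add: wY)
 moreover have "wev env ?s = wV (wscale (f ^ (p\<^sup>2 - p)) y)"
  unfolding wY[symmetric] by (rule witt_eqI_nat) (auto simp: ev_mult ev_power ev_ft c)
 moreover have "wev env (case_nat 0 (%i. z i ^ p)) = wV (wF (wev env z))"
  by (rule witt_eqI_nat) (auto simp: ev_power c)
 moreover have "wev env D = (\<Sum>(\<alpha>, t)\<in>?\<Lambda>. teich (mpr as \<alpha>))"
  by (simp add: wD wev_t ev_mpr case_prod_unfold)
 ultimately show ?thesis by (intro exI[of _ "wev env z"]) (simp add: add.assoc)
qed

section \<open>Ideals and Frobenius powers\<close>

inductive_set igen :: "'a::comm_ring_1 set => 'a set" for G where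
 igen_0: "0 \<in> igen G"
| igen_mult: "x \<in> G ==> r * x \<in> igen G"
| igen_add: "a \<in> igen G ==> b \<in> igen G ==> a + b \<in> igen G"

definition is_ideal :: "'a::comm_ring_1 set => bool" where
 "is_ideal J \<longleftrightarrow> 0 \<in> J & (\<forall>a\<in>J. \<forall>b\<in>J. a + b \<in> J) & (\<forall>a\<in>J. \<forall>r. r * a \<in> J)"

lemma is_idealD: assumes "is_ideal J"
 shows "0 \<in> J" "a \<in> J ==> b \<in> J ==> a + b \<in> J" "a \<in> J ==> r * a \<in> J" "a \<in> J ==> a * r \<in> J"
  "a \<in> J ==> - a \<in> J" "a \<in> J ==> b \<in> J ==> a - b \<in> J"
proof -
 show "0 \<in> J" "a \<in> J ==> b \<in> J ==> a + b \<in> J" and m: "a \<in> J ==> r * a \<in> J" for a b r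
  using assms by (auto simp: is_ideal_def)
 thus "a \<in> J ==> a * r \<in> J" by (simp add: mult.commute)
 show n: "a \<in> J ==> - a \<in> J" for a using m[of a "-1"] by simp
 show "a \<in> J ==> b \<in> J ==> a - b \<in> J"
  using n[of b] assms unfolding is_ideal_def by (metis diff_conv_add_uminus)
qed

lemma is_ideal_sum: "is_ideal J ==> (!!k. k \<in> K ==> f k \<in> J) ==> sum f K \<in> J"
 by (induction K rule: infinite_finite_induct) (auto intro: is_idealD)

lemma is_ideal_igen [simp]: "is_ideal (igen G)"
proof -
 have "r * a \<in> igen G" if "a \<in> igen G" for a r using that
 proof (induction)
  case (igen_mult x s)
  have "(r * s) * x \<in> igen G" by (rule igen.igen_mult[OF igen_mult])
  thus ?case by (simp add: mult.assoc)
 qed (auto intro: igen.intros simp: distrib_left)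
 thus ?thesis by (auto simp: is_ideal_def intro: igen.intros)
qed

lemma igen_superset: "x \<in> G ==> x \<in> igen G" using igen_mult[of x G 1] by simp

lemma igen_least: "is_ideal J ==> G <= J ==> igen G <= J"
proof
 fix x assume J: "is_ideal J" "G <= J" and "x \<in> igen G"
 from this(3) show "x \<in> J" by induction (use J in "auto intro: is_idealD")
qed

lemma igen_mono: "G <= H ==> igen G <= igen H" by (rule igen_least) (auto intro: igen_superset)

lemma igen_ideal: "is_ideal J ==> igen J = J" using igen_least[of J J] igen_superset by blast

definition fpow :: "nat => 'a::comm_ring_1 set => 'a set" where
 "fpow q J = igen {a ^ q | a. a \<in> J}"

lemma is_ideal_fpow [simp]: "is_ideal (fpow q J)" by (simp add: fpow_def)

lemma fpow_mem: "a \<in> J ==> a ^ q \<in> fpow q J" unfolding fpow_def by (rule igen_superset) auto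

lemma fpow_1: "is_ideal J ==> fpow 1 J = J" by (simp add: fpow_def igen_ideal)

section \<open>Witt vectors with components in an ideal\<close>

lemma ev_cong_ideal: assumes J: "is_ideal J" and "!!t. env t - env' t \<in> J" shows "ev env Q - ev env' Q \<in> J"
proof -
 have m: "a * c - b * d \<in> J" if "a - b \<in> J" "c - d \<in> J" for a b c d
 proof -
  have "a * c - b * d = (a - b) * c + b * (c - d)" by (simp add: algebra_simps)
  thus ?thesis using that J by (auto intro: is_idealD)
 qed
 have pw: "env t ^ n - env' t ^ n \<in> J" for t n by (induction n) (use J assms(2) in "auto intro: m is_idealD")
 have mon: "mon_ev env x - mon_ev env' x \<in> J" for x
 proof -
  have "(\<Prod>t\<in>A. env t ^ lookup x t) - (\<Prod>t\<in>A. env' t ^ lookup x t) \<in> J" for A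
   by (induction A rule: infinite_finite_induct) (use J in "auto intro: m pw is_idealD")
  thus ?thesis by (simp add: mon_ev_def)
 qed
 show ?thesis
 proof (induction Q rule: mpoly_induct)
  case (add a b)
  from is_idealD(2)[OF J this] show ?case by (simp add: ev_add algebra_simps)
 qed (use J mon in "auto simp: ev_single is_idealD simp flip: right_diff_distrib")
qed

definition wideal :: "'a::comm_ring_1 set => 'a witt set" where
 "wideal J = {x. \<forall>i. wc x i \<in> J}"

lemma wadd_cong_ideal: assumes J: "is_ideal J" and "!!i. a i - a' i \<in> J" "!!i. b i - b' i \<in> J"
 shows "wadd p a b i - wadd p a' b' i \<in> J" unfolding wadd_def
 by (rule ev_cong_ideal[OF J]) (use assms in "auto split: sum.splits")

text \<open>Sums are integer polynomials in the components, which respect congruence modulo J; the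
  comparison is with 0 + 0 = 0 and with y - y = 0.\<close>

lemma
 fixes x y :: "'a::comm_ring_1 witt" assumes p: "prime CHAR('a)" and J: "is_ideal J"
 shows wideal_add: "x \<in> wideal J ==> y \<in> wideal J ==> x + y \<in> wideal J"
  and wideal_diffI: "(!!i. wc x i - wc y i \<in> J) ==> x - y \<in> wideal J"
  and wideal_diff: "x \<in> wideal J ==> y \<in> wideal J ==> x - y \<in> wideal J"
proof -
 have 0: "wadd CHAR('a) (wc 0) (wc 0) = wc (0 :: 'a witt)" using wc_add[OF p, of 0 0] by simp
 show "x + y \<in> wideal J" if "x \<in> wideal J" "y \<in> wideal J" for x y
  using wadd_cong_ideal[OF J, of "wc x" "wc 0" "wc y" "wc 0" "CHAR('a)"] that by (simp add: wideal_def wc_add p 0)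
 show *: "x - y \<in> wideal J" if "!!i. wc x i - wc y i \<in> J" for x y
  using wadd_cong_ideal[where a = "wc x" and a' = "wc y" and b = "wc (- y)" and b' = "wc (- y)"
    and p = "CHAR('a)", OF J] that is_idealD(1)[OF J]
   wc_add[OF p, of x "- y"] wc_add[OF p, of y "- y", symmetric] by (simp add: wideal_def)
 show "x - y \<in> wideal J" if "x \<in> wideal J" "y \<in> wideal J"
  by (rule *) (use that J in "auto simp: wideal_def intro: is_idealD")
qed

lemma wideal_sum:
 fixes f :: "'b => 'a::comm_ring_1 witt" assumes "prime CHAR('a)" "is_ideal J" "!!k. k \<in> K ==> f k \<in> wideal J"
 shows "sum f K \<in> wideal J"
proof -
 have "0 \<in> wideal J" using is_idealD(1)[OF assms(2)] by (simp add: wideal_def)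
 thus ?thesis using assms(3) by (induction K rule: infinite_finite_induct) (auto intro: wideal_add[OF assms(1,2)])
qed

section \<open>Rings with a generator of the dual of Frobenius\<close>

text \<open>\<open>v\<close> is a basis of F_*S, \<open>u\<close> generates its dual, and
  \<open>vd\<close> is dual to \<open>v\<close> under the pairing u(a b). The axiom
  \<open>prod\<close> makes the p-monomials closed under multiplication; \<open>e0\<close> indexes
  the basis element 1.\<close>

locale frob_dual =
 fixes p :: nat and u :: "'a::comm_ring_1 => 'a" and E :: "'e set" and e0 :: 'e and v vd :: "'e => 'a"
 assumes prime: "prime p" and char: "CHAR('a) = p" and fin: "finite E" and e0: "e0 \<in> E" "v e0 = 1"
  and u_add: "u (a + b) = u a + u b" and u_pow: "u (a ^ p * b) = a * u b"
  and dual: "e \<in> E ==> e' \<in> E ==> u (v e * vd e') = (if e = e' then 1 else 0)"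
  and expand: "a = (\<Sum>e\<in>E. u (a * vd e) ^ p * v e)"
  and prod: "e \<in> E ==> e' \<in> E ==> \<exists>b. \<exists>e''\<in>E. v e * v e' = b ^ p * v e''"
begin

lemmas fr = freshman[OF prime char]
lemmas p_pos' = p_pos[OF prime]

lemma char_prime: "prime CHAR('a)" using prime char by simp

lemma fr_sum: "(sum f A) ^ p = (\<Sum>x\<in>A. (f x :: 'a) ^ p)"
 by (induction A rule: infinite_finite_induct) (use p_pos' in "auto simp: fr power_0_left")

lemma fr_minus: "(- a) ^ p = - (a ^ p :: 'a)"
 using fr[of a "- a"] p_pos' by (simp add: power_0_left eq_neg_iff_add_eq_0 add.commute)

lemma fr_pow: "(a + b) ^ (p ^ k) = a ^ (p ^ k) + (b :: 'a) ^ (p ^ k)"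
proof (induction k)
 case (Suc k)
 have "(a + b) ^ (p ^ Suc k) = ((a + b) ^ (p ^ k)) ^ p" by (simp add: mult.commute flip: power_mult)
 also have "\<dots> = a ^ (p ^ Suc k) + b ^ (p ^ Suc k)"
  by (simp add: Suc fr) (simp add: mult.commute flip: power_mult)
 finally show ?case .
qed simp

lemma u_0 [simp]: "u 0 = 0" using u_add[of 0 0] by simp

lemma
 shows u_uminus: "u (- a) = - u a" and u_diff: "u (a - b) = u a - u b" and u_sum: "u (sum f A) = (\<Sum>x\<in>A. u (f x))"
 by (intro additive.minus additive.diff additive.sum additive.intro u_add)+

lemma u_pow': "u (b * a ^ p) = u b * a" using u_pow[of a b] by (simp add: mult.commute)

lemma up_0 [simp]: "(u ^^ k) 0 = 0" by (induction k) auto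
lemma up_add: "(u ^^ k) (a + b) = (u ^^ k) a + (u ^^ k) b" by (induction k) (auto simp: u_add)
lemma up_diff: "(u ^^ k) (a - b) = (u ^^ k) a - (u ^^ k) b" by (induction k) (auto simp: u_diff)
lemma up_sum: "(u ^^ k) (sum f A) = (\<Sum>x\<in>A. (u ^^ k) (f x))" by (induction k) (auto simp: u_sum)

lemma up_pow: "(u ^^ k) (a ^ (p ^ k) * b) = a * (u ^^ k) b"
proof (induction k arbitrary: a)
 case (Suc k)
 have "a ^ (p ^ Suc k) * b = (a ^ p) ^ (p ^ k) * b" by (simp flip: power_mult)
 thus ?case using Suc[of "a ^ p"] by (simp add: u_pow)
qed simp

lemma up_fpow: assumes J: "is_ideal J" and a: "a \<in> fpow (p ^ k) J" shows "(u ^^ k) a \<in> J"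
 using a unfolding fpow_def
proof induction
 case (igen_mult x r)
 then obtain b where "x = b ^ (p ^ k)" "b \<in> J" by auto
 thus ?case using up_pow[of k b r] J by (simp add: mult.commute is_idealD)
qed (use J in "auto simp: up_add intro: is_idealD")

lemma up_fpow_add: assumes J: "is_ideal J" and a: "a \<in> fpow (p ^ (k + l)) J"
 shows "(u ^^ k) a \<in> fpow (p ^ l) J" using a unfolding fpow_def[of "p ^ (k + l)"]
proof induction
 case (igen_mult x r)
 then obtain b where b: "x = b ^ (p ^ (k + l))" "b \<in> J" by auto
 have "x = (b ^ (p ^ l)) ^ (p ^ k)" by (simp add: b power_add mult.commute flip: power_mult)
 thus ?case using up_pow[of k "b ^ (p ^ l)" r] b fpow_mem[of b J "p ^ l"] by (simp add: mult.commute is_idealD)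
qed (auto simp: up_add intro: is_idealD[OF is_ideal_fpow])

lemma fpow_pow: assumes "(a :: 'a) \<in> fpow q J" shows "a ^ p \<in> fpow (q * p) J"
 using assms unfolding fpow_def[of q]
proof induction
 case (igen_mult x r)
 then obtain b where b: "x = b ^ q" "b \<in> J" by auto
 hence "x ^ p = b ^ (q * p)" by (simp add: power_mult)
 thus ?case using b fpow_mem[of b J "q * p"] by (simp add: power_mult_distrib is_idealD)
qed (use p_pos' in "auto simp: fr power_0_left intro: is_idealD[OF is_ideal_fpow]")

text \<open>For the converse, the coordinates u(g * vd e) of g satisfy the same condition with k
  lowered by one, since \<open>u\<close> absorbs p-th powers; their p-th powers, in the expansion of
  g, give one more Frobenius power.\<close>

lemma fpow_iff_up: assumes "is_ideal J"
 shows "g \<in> fpow (p ^ k) J \<longleftrightarrow> (\<forall>a. (u ^^ k) (g * a) \<in> J)"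
proof
 assume "g \<in> fpow (p ^ k) J"
 thus "\<forall>a. (u ^^ k) (g * a) \<in> J" using up_fpow[OF assms] by (auto intro: is_idealD[OF is_ideal_fpow])
next
 assume "\<forall>a. (u ^^ k) (g * a) \<in> J"
 thus "g \<in> fpow (p ^ k) J"
 proof (induction k arbitrary: g)
  case 0
  thus ?case using fpow_1[OF assms] by (metis (no_types) funpow_0 mult_1_right power_0)
 next
  case (Suc k)
  have m: "u (g * a) \<in> fpow (p ^ k) J" for a
  proof (rule Suc.IH, rule allI)
   fix b
   have "(u ^^ k) (u (g * a) * b) = (u ^^ Suc k) (g * (a * b ^ p))"
    using u_pow'[of "g * a" b] by (simp add: funpow_swap1 mult.assoc)
   thus "(u ^^ k) (u (g * a) * b) \<in> J" using Suc.prems by metis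
  qed
  have "u (g * vd e) ^ p * v e \<in> fpow (p ^ Suc k) J" for e
   using fpow_pow[OF m, of "vd e"] by (auto simp: mult.commute intro: is_idealD[OF is_ideal_fpow])
  hence "(\<Sum>e\<in>E. u (g * vd e) ^ p * v e) \<in> fpow (p ^ Suc k) J" by (intro is_ideal_sum) auto
  thus ?case using expand[of g] by simp
 qed
qed

subsection \<open>The additive lift\<close>

definition pmon :: "'a set" where "pmon = {b ^ p * v e | b e. e \<in> E}"

definition tau :: "'a => 'a witt" where "tau a = (\<Sum>e\<in>E. teich (u (a * vd e) ^ p * v e))"

definition errw :: "'a => 'a witt" where "errw a = wshift (teich a - tau a)"

lemma pmon_mult: "a \<in> pmon ==> b \<in> pmon ==> a * b \<in> pmon"
proof -
 assume "a \<in> pmon" "b \<in> pmon"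
 then obtain c d e e' where a: "a = c ^ p * v e" "b = d ^ p * v e'" "e \<in> E" "e' \<in> E" by (auto simp: pmon_def)
 from prod[OF a(3,4)] obtain h e'' where "v e * v e' = h ^ p * v e''" "e'' \<in> E" by blast
 moreover have "a * b = (c * d) ^ p * (v e * v e')" unfolding a by (simp add: power_mult_distrib mult_ac)
 ultimately have "a * b = (c * d * h) ^ p * v e''" by (simp add: power_mult_distrib mult.assoc)
 thus ?thesis using `e'' \<in> E` by (auto simp: pmon_def)
qed

lemma pmon_pow_p: "a ^ p \<in> pmon" unfolding pmon_def using e0 by (auto intro!: exI[of _ a] exI[of _ e0])

lemma pmon_power: "a \<in> pmon ==> a ^ k \<in> pmon"
 by (induction k) (use pmon_pow_p[of 1] in "auto intro: pmon_mult")

lemma pmon_prod: "(!!x. x \<in> A ==> f x \<in> pmon) ==> prod f A \<in> pmon"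
 by (induction A rule: infinite_finite_induct) (use pmon_pow_p[of 1] in "auto intro: pmon_mult")

lemma coord_pmon: "e \<in> E ==> e' \<in> E ==> u (b ^ p * v e * vd e') = (if e = e' then b else 0)"
 using u_pow[of b "v e * vd e'"] dual[of e e'] by (simp add: mult.assoc)

lemma teich_0 [simp]: "teich 0 = 0" by (rule witt_eqI_nat) auto

lemma tau_pmon: "a \<in> pmon ==> tau a = teich a"
proof -
 assume "a \<in> pmon"
 then obtain b e where a: "a = b ^ p * v e" "e \<in> E" by (auto simp: pmon_def)
 have "tau a = (\<Sum>e'\<in>E. if e = e' then teich (b ^ p * v e) else 0)"
  unfolding tau_def a(1) by (rule sum.cong) (use a p_pos' in "auto simp: coord_pmon power_0_left")
 thus ?thesis using a fin by simp
qed

lemma tau_0 [simp]: "tau 0 = 0" using p_pos' by (simp add: tau_def power_0_left)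

lemma wc_tau_0 [simp]: "wc (tau a) 0 = a" using expand[of a] by (simp add: tau_def wc_0_sum[OF prime char])

lemma tau_scale: "tau (s ^ p * a) = wscale (s ^ p) (tau a)"
 unfolding tau_def wscale_sum[OF prime char] wscale_teich mult.assoc u_pow by (simp add: power_mult_distrib mult_ac)

lemmas wV_add' = wV_add[OF prime char] and wF_add' = wF_add[OF prime char] and wscale_add' = wscale_add[OF prime char]
 and wV_diff' = wV_diff[OF prime char] and wF_diff' = wF_diff[OF prime char] and wscale_diff' = wscale_diff[OF prime char]
 and wdecomp' = wdecomp[OF prime char] and wF_0' = wF_0[OF prime char] and wscale_0' = wscale_0[where 'a = 'a]
 and wF_V' = wF_V[OF prime char] and wscale_F' = wscale_F[OF prime char] and wV_sum' = wV_sum[OF prime char] 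
 and wF_sum' = wF_sum[OF prime char] and wscale_sum' = wscale_sum[OF prime char]
 and wscale_V' = wscale_V[where 'a = 'a, unfolded char]
 and wc_0_add' = wc_0_add[OF prime char] and wc_0_diff' = wc_0_diff[OF prime char] and wc_0_sum' = wc_0_sum[OF prime char]

lemma wF_teich: "wF (teich a) = teich (a ^ p :: 'a)"
 using p_pos' by (intro witt_eqI_nat) (auto simp: char power_0_left)

text \<open>On one coordinate, [c^p v] + [d^p v] is [v] F([c] + [d]), and [c] + [d] = [c + d] + V z;
  as F V = V F, the error lies in the image of VF.\<close>

lemma tau_add: "\<exists>z. tau a + tau b = tau (a + b) + wV (wF z)"
proof -
 define c where "c = (%e. u (a * vd e))"
 define d where "d = (%e. u (b * vd e))"
 define z where "z = (%e. wshift (teich (c e) + teich (d e)))"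
 have *: "teich (c e ^ p * v e) + teich (d e ^ p * v e) = teich ((c e + d e) ^ p * v e) + wV (wF (wscale (v e) (z e)))" for e
 proof -
  have "teich (c e) + teich (d e) = teich (c e + d e) + wV (z e)"
   using wdecomp'[of "teich (c e) + teich (d e)"] by (simp add: wc_0_add' z_def)
  hence "wscale (v e) (wF (teich (c e) + teich (d e))) = wscale (v e) (wF (teich (c e + d e) + wV (z e)))" by simp
  thus ?thesis by (simp add: wF_add' wF_teich wscale_add' wscale_teich mult.commute wF_V' wscale_V' wscale_F')
 qed
 have "tau a + tau b = (\<Sum>e\<in>E. teich ((c e + d e) ^ p * v e) + wV (wF (wscale (v e) (z e))))"
  unfolding *[symmetric] by (simp add: tau_def c_def d_def sum.distrib)
 also have "\<dots> = tau (a + b) + wV (wF (\<Sum>e\<in>E. wscale (v e) (z e)))"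
  by (simp add: sum.distrib tau_def c_def d_def u_add distrib_right wV_sum' wF_sum')
 finally show ?thesis by blast
qed

lemma sum_teich_pmon:
 "(!!k. k \<in> K ==> b k \<in> pmon) ==> \<exists>z. (\<Sum>k\<in>K. teich (b k)) = tau (\<Sum>k\<in>K. b k) + wV (wF z)"
proof (induction K rule: infinite_finite_induct)
 case (insert k K)
 then obtain z where z: "(\<Sum>k\<in>K. teich (b k)) = tau (\<Sum>k\<in>K. b k) + wV (wF z)" by auto
 obtain w where w: "tau (b k) + tau (\<Sum>k\<in>K. b k) = tau (b k + (\<Sum>k\<in>K. b k)) + wV (wF w)"
  using tau_add by blast
 have "(\<Sum>k\<in>insert k K. teich (b k)) = tau (b k) + tau (\<Sum>k\<in>K. b k) + wV (wF z)"
  using insert by (simp add: z tau_pmon add.assoc)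
 also have "\<dots> = tau (\<Sum>k\<in>insert k K. b k) + wV (wF (w + z))"
  using insert by (simp add: w wV_add' wF_add' add.assoc)
 finally show ?case by blast
qed (auto intro!: exI[of _ 0] simp: wF_0')

lemma tau_errw: "teich a = tau a + wV (errw a)"
 using wV_wshift[of "teich a - tau a"] by (simp add: errw_def wc_0_diff')

text \<open>The coordinates in an arbitrary but fixed order, so that \<open>delta\<close> is one
  fixed representative of the class in \<open>Delta1\<close>.\<close>

definition delta_list :: "'a => 'a list" where
 "delta_list a = map (%e. u (a * vd e) ^ p * v e) (SOME es. distinct es & set es = E)"

definition delta :: "'a => 'a" where "delta a = dsum p (delta_list a)"

lemma delta_list: shows "set (delta_list a) <= pmon" and "sum_list (delta_list a) = a"
  and "(\<Sum>i<length (delta_list a). teich (delta_list a ! i)) = tau a"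
proof -
 define es where "es = (SOME es. distinct es & set es = E)"
 have es: "distinct es" "set es = E"
  using someI_ex[of "%es. distinct es & set es = E"] finite_distinct_list[OF fin] by (auto simp: es_def)
 show "set (delta_list a) <= pmon" using es by (auto simp: delta_list_def pmon_def simp flip: es_def)
 show "sum_list (delta_list a) = a"
  using es expand[of a] by (simp add: delta_list_def sum_list_distinct_conv_sum_set flip: es_def)
 have "(\<Sum>i<length (delta_list a). teich (delta_list a ! i)) = sum_list (map teich (delta_list a))"
  by (simp add: sum_list_sum_nth atLeast0LessThan)
 also have "\<dots> = tau a"
  using es by (simp add: delta_list_def o_def sum_list_distinct_conv_sum_set tau_def flip: es_def)
 finally show "(\<Sum>i<length (delta_list a). teich (delta_list a ! i)) = tau a" .
qed

text \<open>Multinomial monomials in p-monomials are again p-monomials, so their Teichmueller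
  representatives add up to tau of their sum modulo VF, and \<open>teich_error\<close> turns into a
  recursion for the error.\<close>

lemma errw_eq: "\<exists>z. errw f = tau (delta f) + wV (wscale (f ^ (p\<^sup>2 - p)) (errw f)) + wV (wF z)"
proof -
 let ?as = "delta_list f"
 let ?\<Lambda> = "SIGMA \<alpha>:dexps p (length ?as). {..<mcoef \<alpha> div p}"
 from teich_error[OF prime char, of ?as] obtain z where
  z: "errw f = (\<Sum>(\<alpha>, t)\<in>?\<Lambda>. teich (mpr ?as \<alpha>)) + wV (wscale (f ^ (p\<^sup>2 - p)) (errw f)) + wV (wF z)"
  unfolding delta_list errw_def[symmetric] by blast
 have "mpr ?as \<alpha> \<in> pmon" for \<alpha>
  unfolding mpr_def by (intro pmon_prod pmon_power) (auto intro: subsetD[OF delta_list(1) nth_mem])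
 then obtain w where w: "(\<Sum>x\<in>?\<Lambda>. teich (mpr ?as (fst x))) = tau (\<Sum>x\<in>?\<Lambda>. mpr ?as (fst x)) + wV (wF w)"
  using sum_teich_pmon[of ?\<Lambda> "%x. mpr ?as (fst x)"] by blast
 have "(\<Sum>x\<in>?\<Lambda>. mpr ?as (fst x)) = (\<Sum>(\<alpha>, t)\<in>?\<Lambda>. mpr ?as \<alpha>)" by (simp add: case_prod_unfold)
 also have "\<dots> = (\<Sum>\<alpha>\<in>dexps p (length ?as). \<Sum>t<mcoef \<alpha> div p. mpr ?as \<alpha>)"
  by (rule sum.Sigma[symmetric]) auto
 also have "\<dots> = delta f" by (simp add: delta_def dsum_def)
 finally have S: "(\<Sum>(\<alpha>, t)\<in>?\<Lambda>. teich (mpr ?as \<alpha>)) = tau (delta f) + wV (wF w)"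
  using w by (simp add: case_prod_unfold)
 have "errw f = tau (delta f) + wV (wscale (f ^ (p\<^sup>2 - p)) (errw f)) + wV (wF (w + z))"
  by (rule trans[OF z]) (simp only: S wF_add' wV_add' add_ac)
 thus ?thesis by blast
qed

end

section \<open>Homomorphisms on Witt vectors\<close>

lemma set_tlD: "x \<in> set (tl xs) ==> x \<in> set xs" by (cases xs) auto

context frob_dual
begin

text \<open>On x = sum of V^i tau(a_i), i starting at 0, this is the sum of u^(i+1)(g_i a_i): list
  position i carries the exponent i + 1.\<close>

fun Psi :: "'a list => 'a witt => 'a" where
 "Psi [] x = 0"
| "Psi (g # gs) x = u (g * wc x 0) + u (Psi gs (wshift (x - tau (wc x 0))))"

definition Psi_hom :: "'a list => bool" where
 "Psi_hom gs \<longleftrightarrow> (\<forall>x y. Psi gs (x + y) = Psi gs x + Psi gs y) &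
   (\<forall>a x. Psi gs (wscale (a ^ p) x) = a * Psi gs x) & (\<forall>x. Psi gs (wV (wF x)) = 0)"

lemma Psi_homD: assumes "Psi_hom gs"
 shows "Psi gs (x + y) = Psi gs x + Psi gs y" "Psi gs (wscale (a ^ p) x) = a * Psi gs x"
  "Psi gs (wV (wF x)) = 0" "Psi gs 0 = 0" "Psi gs (- x) = - Psi gs x" "Psi gs (x - y) = Psi gs x - Psi gs y"
  "Psi gs (sum f K) = (\<Sum>k\<in>K. Psi gs (f k))"
proof -
 show a: "Psi gs (x + y) = Psi gs x + Psi gs y" for x y using assms by (auto simp: Psi_hom_def)
 show 0: "Psi gs 0 = 0" using a[of 0 0] by simp
 show "Psi gs (- x) = - Psi gs x" "Psi gs (x - y) = Psi gs x - Psi gs y" "Psi gs (sum f K) = (\<Sum>k\<in>K. Psi gs (f k))"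
  by (intro additive.minus additive.diff additive.sum additive.intro a)+
qed (use assms in "auto simp: Psi_hom_def")

lemma wshift_0 [simp]: "wshift (0 :: 'b::comm_ring_1 witt) = 0" by (rule witt_eqI) simp

lemma wshift_V [simp]: "wshift (wV x) = (x :: 'b::comm_ring_1 witt)" by (rule witt_eqI) simp

lemma Psi_tau_V: "Psi (g # gs) (tau a + wV y) = u (g * a) + u (Psi gs y)" by (simp add: wc_0_add')

lemma Psi_eq: "x = tau a + wV y ==> Psi (g # gs) x = u (g * a) + u (Psi gs y)" using Psi_tau_V by simp

lemma witt_tau: "\<exists>y. x = tau (wc x 0) + wV y"
 by (rule exI[of _ "wshift (x - tau (wc x 0))"]) (simp add: wV_wshift wc_0_diff')

text \<open>The defect of additivity of tau is VF z, of which the tail sees F z once V is removed.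
  So the tail must kill the whole image of F, while g itself is unrestricted.\<close>

lemma Psi_hom_step: assumes h: "Psi_hom gs" and F: "!!x. Psi gs (wF x) = 0" shows "Psi_hom (g # gs)"
 unfolding Psi_hom_def
proof (intro conjI allI)
 fix x y :: "'a witt"
 obtain x' where x: "x = tau (wc x 0) + wV x'" using witt_tau by blast
 obtain y' where y: "y = tau (wc y 0) + wV y'" using witt_tau by blast
 obtain z where z: "tau (wc x 0) + tau (wc y 0) = tau (wc x 0 + wc y 0) + wV (wF z)" using tau_add by blast
 have "x + y = (tau (wc x 0) + tau (wc y 0)) + wV (x' + y')" by (subst x, subst y) (simp add: wV_add' add_ac)
 also have "\<dots> = tau (wc x 0 + wc y 0) + wV (wF z + (x' + y'))" by (simp only: z wV_add' add_ac)
 finally have "Psi (g # gs) (x + y) = u (g * (wc x 0 + wc y 0)) + u (Psi gs (wF z + (x' + y')))"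
  by (simp only: Psi_tau_V)
 also have "\<dots> = u (g * wc x 0) + u (Psi gs x') + (u (g * wc y 0) + u (Psi gs y'))"
  by (simp add: Psi_homD[OF h] F distrib_left u_add)
 also have "u (g * wc x 0) + u (Psi gs x') = Psi (g # gs) x" by (rule Psi_eq[OF x, symmetric])
 also have "u (g * wc y 0) + u (Psi gs y') = Psi (g # gs) y" by (rule Psi_eq[OF y, symmetric])
 finally show "Psi (g # gs) (x + y) = Psi (g # gs) x + Psi (g # gs) y" .
next
 fix a and x :: "'a witt"
 obtain x' where x: "x = tau (wc x 0) + wV x'" using witt_tau by blast
 have "wscale (a ^ p) x = tau (a ^ p * wc x 0) + wV (wscale ((a ^ p) ^ p) x')"
  by (subst x) (simp only: wscale_add' tau_scale wscale_V')
 hence "Psi (g # gs) (wscale (a ^ p) x) = u (g * (a ^ p * wc x 0)) + u (a ^ p * Psi gs x')"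
  by (simp only: Psi_tau_V Psi_homD[OF h])
 also have "\<dots> = a * (u (g * wc x 0) + u (Psi gs x'))" by (simp add: u_pow distrib_left mult.left_commute[of g])
 also have "u (g * wc x 0) + u (Psi gs x') = Psi (g # gs) x" by (rule Psi_eq[OF x, symmetric])
 finally show "Psi (g # gs) (wscale (a ^ p) x) = a * Psi (g # gs) x" .
next
 fix x
 have "wV (wF x) = tau 0 + wV (wF x)" by simp
 thus "Psi (g # gs) (wV (wF x)) = 0" using Psi_tau_V[of g gs 0 "wF x"] by (simp add: F)
qed

text \<open>F x is tau of a p-th power c^p plus VF of the shift of x, and u(g c^p) = c u(g) =
  0.\<close>

lemma Psi_F: assumes "\<forall>g\<in>set gs. u g = 0" shows "Psi_hom gs & (\<forall>x. Psi gs (wF x) = 0)" using assms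
proof (induction gs)
 case (Cons g gs)
 hence h: "Psi_hom (g # gs)" by (intro Psi_hom_step) auto
 have "Psi (g # gs) (wF x) = 0" for x
 proof -
  have "wF x = teich (wc x 0 ^ p) + wV (wF (wshift x))" by (subst wdecomp') (simp add: wF_add' wF_teich wF_V')
  also have "teich (wc x 0 ^ p) = tau (wc x 0 ^ p)" by (rule tau_pmon[OF pmon_pow_p, symmetric])
  also have "\<dots> = tau (wc x 0 ^ p) + wV 0" by simp
  finally show ?thesis using Cons h by (simp only: Psi_homD[OF h] Psi_tau_V) (simp add: u_pow' Psi_homD(4))
 qed
 with h show ?case by blast
qed (auto simp: Psi_hom_def)

lemma Psi_hom: "\<forall>g\<in>set (tl gs). u g = 0 ==> Psi_hom gs"
 using Psi_F[of "tl gs"] Psi_hom_step[of "tl gs" "hd gs"] Psi_F[of gs] by (cases gs) auto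

lemma Psi_V: "Psi (g # gs) (wV x) = u (Psi gs x)" using Psi_tau_V[of g gs 0 x] by simp

text \<open>Multiplying [f] = tau(f) + V(errw f) by [b] sends tau(f) to tau(f b) up to VF because b
  is a p-monomial, and turns the error into V([b^p] errw f), from which b is extracted.\<close>

lemma Psi_teich: assumes gs: "\<forall>g\<in>set gs. u g = 0" and b: "b \<in> pmon"
 shows "Psi (g # gs) (teich (f * b)) = u (b * (g * f + Psi gs (errw f)))"
proof -
 note h = Psi_F[OF gs, THEN conjunct1] and F = Psi_F[OF gs, THEN conjunct2, rule_format]
 have e: "u (f * vd e) ^ p * v e * b \<in> pmon" if "e \<in> E" for e
  using that b by (intro pmon_mult[of "u (f * vd e) ^ p * v e"]) (auto simp: pmon_def)
 obtain z where "(\<Sum>e\<in>E. teich (u (f * vd e) ^ p * v e * b)) = tau (\<Sum>e\<in>E. u (f * vd e) ^ p * v e * b) + wV (wF z)"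
  using sum_teich_pmon[of E "%e. u (f * vd e) ^ p * v e * b"] e by blast
 moreover have "(\<Sum>e\<in>E. teich (u (f * vd e) ^ p * v e * b)) = wscale b (tau f)"
  by (simp add: tau_def wscale_sum' wscale_teich mult.commute)
 moreover have "(\<Sum>e\<in>E. u (f * vd e) ^ p * v e * b) = f * b"
  using expand[of f] by (simp flip: sum_distrib_right)
 ultimately have z: "wscale b (tau f) = tau (f * b) + wV (wF z)" by simp
 have "teich (f * b) = wscale b (tau f + wV (errw f))" by (simp add: wscale_teich mult.commute flip: tau_errw)
 also have "\<dots> = tau (f * b) + wV (wF z + wscale (b ^ p) (errw f))"
  by (simp add: wscale_add' z wscale_V' wV_add' add.assoc)
 finally have "Psi (g # gs) (teich (f * b)) = u (g * (f * b)) + u (b * Psi gs (errw f))"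
  by (simp only: Psi_tau_V Psi_homD[OF h] F) simp
 thus ?thesis by (simp add: u_add[symmetric] algebra_simps)
qed

text \<open>\<open>errw_eq\<close> feeds the error back into itself, scaled by f^(p^2-p) =
  (f^(p-1))^p; hence the factor f^(p-1) outside.\<close>

lemma Psi_errw: assumes gs: "\<forall>g\<in>set gs. u g = 0"
 shows "Psi (g # gs) (errw f) = u (g * delta f) + u (f ^ (p - 1) * Psi gs (errw f))"
proof -
 note h = Psi_F[OF gs, THEN conjunct1] and F = Psi_F[OF gs, THEN conjunct2, rule_format]
 obtain z where "errw f = tau (delta f) + wV (wscale (f ^ (p\<^sup>2 - p)) (errw f)) + wV (wF z)"
  using errw_eq by blast
 hence "errw f = tau (delta f) + wV (wscale ((f ^ (p - 1)) ^ p) (errw f) + wF z)"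
  by (simp add: wV_add' add.assoc power2_eq_square left_diff_distrib' flip: power_mult)
 hence "Psi (g # gs) (errw f) = u (g * delta f) + u (Psi gs (wscale ((f ^ (p - 1)) ^ p) (errw f) + wF z))"
  by (rule Psi_eq)
 thus ?thesis by (simp only: Psi_homD[OF h] F) simp
qed

lemma pmon_span: "\<exists>b. a = (\<Sum>e\<in>E. b e) & (\<forall>e\<in>E. b e \<in> pmon)"
 using expand[of a] by (intro exI[of _ "%e. u (a * vd e) ^ p * v e"]) (auto simp: pmon_def)

lemma igen_pmon_span: assumes "a \<in> igen (set fs)"
 shows "\<exists>K j b. finite (K :: nat set) & a = (\<Sum>k\<in>K. j k * b k) & (\<forall>k\<in>K. j k \<in> set fs & b k \<in> pmon)"
 using assms
proof induction
 case igen_0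
 show ?case by (intro exI[of _ "{}"]) auto
next
 case (igen_mult x r)
 obtain b where b: "r = (\<Sum>e\<in>E. b e)" "\<forall>e\<in>E. b e \<in> pmon" using pmon_span by blast
 obtain h where h: "bij_betw h {0..<card E} E" using ex_bij_betw_nat_finite[OF fin] by blast
 have "r * x = (\<Sum>e\<in>E. x * b e)" by (subst mult.commute) (simp add: b(1) sum_distrib_left)
 also have "\<dots> = (\<Sum>k\<in>{0..<card E}. x * b (h k))" using sum.reindex_bij_betw[OF h, of "%e. x * b e"] by simp
 finally have "r * x = (\<Sum>k\<in>{0..<card E}. (%_. x) k * (%k. b (h k)) k)" .
 moreover have "\<forall>k\<in>{0..<card E}. (%_. x) k \<in> set fs & (%k. b (h k)) k \<in> pmon"
  using b igen_mult bij_betwE[OF h] by auto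
 ultimately show ?case by (intro exI[of _ "{0..<card E}"] exI[of _ "%_. x"] exI[of _ "%k. b (h k)"]) simp
next
 case (igen_add a1 a2)
 then obtain K j b L j' b' where K: "finite (K :: nat set)" "a1 = (\<Sum>k\<in>K. j k * b k)" "\<forall>k\<in>K. j k \<in> set fs & b k \<in> pmon"
  and L: "finite (L :: nat set)" "a2 = (\<Sum>k\<in>L. j' k * b' k)" "\<forall>k\<in>L. j' k \<in> set fs & b' k \<in> pmon" by blast
 \<comment> \<open>Even and odd indices keep the two index sets disjoint.\<close>
 let ?M = "(%k. 2 * k) ` K \<union> (%k. 2 * k + 1) ` L"
 let ?j = "%k. if even k then j (k div 2) else j' (k div 2)" and ?b = "%k. if even k then b (k div 2) else b' (k div 2)"
 have "(\<Sum>k\<in>?M. ?j k * ?b k) = (\<Sum>k\<in>(%k. 2 * k) ` K. ?j k * ?b k) + (\<Sum>k\<in>(%k. 2 * k + 1) ` L. ?j k * ?b k)"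
  by (rule sum.union_disjoint) (use K L in "auto, presburger")
 also have "\<dots> = a1 + a2" unfolding K(2) L(2) by (subst (1 2) sum.reindex) (auto simp: inj_on_def)
 finally have "a1 + a2 = (\<Sum>k\<in>?M. ?j k * ?b k)" ..
 moreover have "\<forall>k\<in>?M. ?j k \<in> set fs & ?b k \<in> pmon" using K L by auto
 moreover have "finite ?M" using K L by auto
 ultimately show ?case by (intro exI[of _ ?M] exI[of _ ?j] exI[of _ ?b]) (intro conjI)
qed

text \<open>k counts the applications of \<open>u\<close> outside \<open>Psi\<close>; passing to the
  tail trades one unit of i for one of k.\<close>

definition Psi_cond :: "'a list => 'a list => nat => nat => bool" where
 "Psi_cond fs gs i k \<longleftrightarrow> (\<forall>f\<in>set fs. gs ! i * f + Psi (drop (Suc i) gs) (errw f) \<in> fpow (p ^ Suc (i + k)) (igen (set fs)))"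

text \<open>The generators \<open>teich (f * b)\<close> with \<open>b\<close> a \<open>p\<close>-monomial suffice to test
 whether \<open>Psi\<close> preserves the ideal.\<close>

lemma Psi_wideal_imp: assumes gs: "\<forall>g\<in>set (tl gs). u g = 0"
  and x: "!!x. x \<in> wideal (igen (set fs)) ==> (u ^^ k) (Psi gs x) \<in> igen (set fs)" and i: "i < length gs"
 shows "Psi_cond fs gs i k" using assms
proof (induction gs arbitrary: i k)
 case (Cons g gs)
 note gs = Cons.prems(1) and x = Cons.prems(2)
 let ?I = "igen (set fs)"
 have gs': "\<forall>g\<in>set gs. u g = 0" using gs by simp
 show ?case
 proof (cases i)
  case 0
  show ?thesis unfolding Psi_cond_def
  proof
   fix f assume f: "f \<in> set fs"
   let ?X = "g * f + Psi gs (errw f)"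
   have P: "(u ^^ Suc k) (?X * b) \<in> ?I" if "b \<in> pmon" for b
   proof -
    have "f * b \<in> ?I" using f by (auto intro: is_idealD igen_superset)
    hence "teich (f * b) \<in> wideal ?I" unfolding wideal_def teich_def by (auto intro: igen.intros)
    from x[OF this] show ?thesis unfolding Psi_teich[OF gs' that] by (simp add: funpow_swap1 mult.commute)
   qed
   have "(u ^^ Suc k) (?X * a) \<in> ?I" for a
   proof -
    obtain b where b: "a = (\<Sum>e\<in>E. b e)" "\<forall>e\<in>E. b e \<in> pmon" using pmon_span by blast
    show ?thesis unfolding b(1) sum_distrib_left up_sum by (rule is_ideal_sum) (use P b in auto)
   qed
   thus "(g # gs) ! i * f + Psi (drop (Suc i) (g # gs)) (errw f) \<in> fpow (p ^ Suc (i + k)) ?I"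
    using fpow_iff_up[OF is_ideal_igen, of ?X "Suc k"] 0 by simp
  qed
 next
  case (Suc j)
  have "Psi_cond fs gs j (Suc k)"
  proof (rule Cons.IH)
   fix y assume y: "y \<in> wideal ?I"
   have "wc (wV y) l \<in> ?I" for l using y by (cases l) (auto simp: wideal_def intro: igen.intros)
   hence "wV y \<in> wideal ?I" by (simp add: wideal_def)
   from x[OF this] show "(u ^^ Suc k) (Psi gs y) \<in> ?I" by (simp only: Psi_V funpow_Suc_right o_apply)
  qed (use gs' Cons.prems Suc list.set_sel(2)[of gs] in "auto dest: set_tlD")
  thus ?thesis using Suc by (simp add: Psi_cond_def)
 qed
qed simp

text \<open>Subtracting Teichmueller elements [j b], with j a generator and b a p-monomial, that
  match the zeroth component leaves V of an element of W(I), on which the tail acts with one more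
  \<open>u\<close>.\<close>

lemma Psi_wideal: assumes gs: "\<forall>g\<in>set (tl gs). u g = 0"
  and c: "!!i. i < length gs ==> Psi_cond fs gs i k" and x: "x \<in> wideal (igen (set fs))"
 shows "(u ^^ k) (Psi gs x) \<in> igen (set fs)" using assms
proof (induction gs arbitrary: k x)
 case (Cons g gs)
 let ?I = "igen (set fs)"
 note gs = Cons.prems(1) and c = Cons.prems(2) and x = Cons.prems(3)
 have gs': "\<forall>g\<in>set gs. u g = 0" using gs by simp
 note h = Psi_hom[OF gs]
 have "wc x 0 \<in> ?I" using x by (simp add: wideal_def)
 from igen_pmon_span[OF this] obtain K j b where
  K: "finite (K :: nat set)" "wc x 0 = (\<Sum>k\<in>K. j k * b k)" "\<forall>k\<in>K. j k \<in> set fs & b k \<in> pmon"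
  by (elim exE conjE) (rule that; assumption)
 define y where "y = x - (\<Sum>k\<in>K. teich (j k * b k))"
 have t: "teich (j k * b k) \<in> wideal ?I" if "k \<in> K" for k
 proof -
  have "j k \<in> ?I" using that K by (auto intro: igen_superset)
  hence "j k * b k \<in> ?I" by (rule is_idealD(4)[OF is_ideal_igen])
  thus ?thesis unfolding wideal_def teich_def by (auto intro: igen.intros)
 qed
 have y: "y \<in> wideal ?I" unfolding y_def by (intro wideal_diff wideal_sum char_prime is_ideal_igen x t)
 have "wc y 0 = 0" by (simp add: y_def wc_0_diff' wc_0_sum' K(2))
 hence yV: "y = wV (wshift y)" by (simp add: wV_wshift)
 have y': "wshift y \<in> wideal ?I" using y by (auto simp: wideal_def)
 have "x = (\<Sum>k\<in>K. teich (j k * b k)) + wV (wshift y)" using yV by (simp add: y_def)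
 hence "Psi (g # gs) x = (\<Sum>l\<in>K. Psi (g # gs) (teich (j l * b l))) + Psi (g # gs) (wV (wshift y))"
  by (simp only: Psi_homD[OF h])
 hence eq: "(u ^^ k) (Psi (g # gs) x) = (\<Sum>l\<in>K. (u ^^ k) (Psi (g # gs) (teich (j l * b l)))) + (u ^^ k) (u (Psi gs (wshift y)))"
  by (simp only: up_add up_sum Psi_V)
 have A: "(u ^^ k) (u (Psi gs (wshift y))) \<in> ?I"
 proof -
  have "Psi_cond fs gs i (Suc k)" if "i < length gs" for i using c[of "Suc i"] that by (simp add: Psi_cond_def)
  hence "(u ^^ Suc k) (Psi gs (wshift y)) \<in> ?I"
   using Cons.IH[of "Suc k" "wshift y"] gs' y' by (auto dest: set_tlD)
  thus ?thesis by (simp only: funpow_Suc_right o_apply)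
 qed
 have B: "(u ^^ k) (Psi (g # gs) (teich (j l * b l))) \<in> ?I" if l: "l \<in> K" for l
 proof -
  have "g * j l + Psi gs (errw (j l)) \<in> fpow (p ^ Suc k) ?I" using c[of 0] l K by (auto simp: Psi_cond_def)
  hence "(u ^^ Suc k) ((g * j l + Psi gs (errw (j l))) * b l) \<in> ?I"
   using fpow_iff_up[OF is_ideal_igen, of _ "Suc k"] by blast
  moreover have bl: "b l \<in> pmon" using l K by blast
  ultimately show ?thesis unfolding Psi_teich[OF gs' bl] by (simp only: funpow_Suc_right o_apply mult.commute)
 qed
 show ?case unfolding eq by (rule is_idealD(2)[OF is_ideal_igen is_ideal_sum[OF is_ideal_igen B] A])
qed (use up_0 igen_0 in simp)

end

section \<open>Powers of regular sequences\<close>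

lemma igen_insert_iff: "x \<in> igen (insert g G) \<longleftrightarrow> (\<exists>t. x - t * g \<in> igen G)"
proof
 assume "x \<in> igen (insert g G)"
 thus "\<exists>t. x - t * g \<in> igen G"
 proof induction
  case igen_0 show ?case by (rule exI[of _ 0]) (simp add: igen.igen_0)
 next
  case (igen_mult x r)
  thus ?case
  proof (cases "x = g")
   case True thus ?thesis by (intro exI[of _ r]) (simp add: igen.igen_0)
  next
   case False thus ?thesis using igen_mult by (intro exI[of _ 0]) (auto intro: igen.igen_mult)
  qed
 next
  case (igen_add a b)
  then obtain s t where "a - s * g \<in> igen G" "b - t * g \<in> igen G" by blast
  from igen.igen_add[OF this] show ?case by (intro exI[of _ "s + t"]) (simp add: algebra_simps)
 qed
next
 assume "\<exists>t. x - t * g \<in> igen G"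
 then obtain t where t: "x - t * g \<in> igen G" by blast
 have "x - t * g \<in> igen (insert g G)" using t igen_mono[of G "insert g G"] by auto
 moreover have "t * g \<in> igen (insert g G)" by (rule igen.igen_mult) simp
 ultimately show "x \<in> igen (insert g G)" using igen.igen_add by fastforce
qed

definition Jx :: "(nat => 'a::comm_ring_1) => (nat => nat) => nat => 'a set" where
 "Jx f a j = igen ((%i. f i ^ a i) ` {..<j})"

lemma is_ideal_Jx [simp]: "is_ideal (Jx f a j)" by (simp add: Jx_def)

lemmas Jx_ideal = is_idealD[OF is_ideal_Jx]

lemma Jx_Suc_iff: "x \<in> Jx f a (Suc j) \<longleftrightarrow> (\<exists>t. x - t * f j ^ a j \<in> Jx f a j)"
 by (simp add: Jx_def lessThan_Suc igen_insert_iff)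

lemma Jx_gen: "i < j ==> a i \<le> n ==> f i ^ n \<in> Jx f a j"
proof -
 assume "i < j" "a i \<le> n"
 hence "f i ^ a i \<in> Jx f a j" unfolding Jx_def by (intro igen_superset) auto
 thus ?thesis using `a i \<le> n` Jx_ideal(3)[of "f i ^ a i" f a j "f i ^ (n - a i)"] by (simp flip: power_add)
qed

lemma Jx_mono: "(!!i. i < j ==> a' i \<le> a i) ==> Jx f a j <= Jx f a' j"
 unfolding Jx_def[of f a] by (rule igen_least) (auto intro: Jx_gen)

lemma Jx_cong: "(!!i. i < j ==> a' i = a i) ==> Jx f a j = Jx f a' j"
 using Jx_mono[of j a a' f] Jx_mono[of j a' a f] by auto

lemma Jx_split: assumes "x \<in> Jx f a j" "k < j"
 shows "\<exists>t. x - t * f k ^ a k \<in> igen ((%i. f i ^ a i) ` ({..<j} - {k}))"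
proof -
 have "(%i. f i ^ a i) ` {..<j} = insert (f k ^ a k) ((%i. f i ^ a i) ` ({..<j} - {k}))" using assms(2) by auto
 thus ?thesis using assms(1) by (simp add: Jx_def igen_insert_iff)
qed

lemma Jx_upd_mult: assumes "x \<in> Jx f (a(k := d)) j" "a k \<le> c + d" shows "f k ^ c * x \<in> Jx f a j"
 using assms(1) unfolding Jx_def[of f "a(k := d)"]
proof induction
 case (igen_mult x r)
 then obtain i where i: "x = f i ^ (a(k := d)) i" "i < j" by auto
 have "f k ^ c * x \<in> Jx f a j"
 proof (cases "i = k")
  case True
  hence "f k ^ c * x = f k ^ (c + d)" using i by (simp add: power_add)
  thus ?thesis using Jx_gen[of k j a "c + d" f] i True assms(2) by simp
 qed (use i Jx_gen[of i j a "a i" f] in "auto intro: Jx_ideal")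
 thus ?case using Jx_ideal(3)[of "f k ^ c * x" f a j r] by (simp add: mult.left_commute)
qed (auto intro: Jx_ideal simp: distrib_left)

context
 fixes f :: "nat => 'a::comm_ring_1" and m :: nat
 assumes reg: "!!j b. j < m ==> b * f j \<in> Jx f (%_. 1) j ==> b \<in> Jx f (%_. 1) j"
begin

text \<open>The two claims need a joint induction on j, since regularity in the given order says
  nothing directly about cancelling an earlier f_k. From b f_k^c = t f_j^(a_j) modulo the earlier
  powers, weakening f_k^(a_k) to f_k^c shows that t is a multiple of f_k^c; after subtracting it the
  claim for fewer generators applies.\<close>

lemma Jx_reg:
 shows "j \<le> m ==> (\<forall>a k c d b. (\<forall>i. a i \<ge> 1) --> k < j --> d \<ge> 1 --> a k = c + d -->
      b * f k ^ c \<in> Jx f a j --> b \<in> Jx f (a(k := d)) j)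
  & (j < m --> (\<forall>a b. (\<forall>i. a i \<ge> 1) --> b * f j \<in> Jx f a j --> b \<in> Jx f a j))"
proof (induction j)
 case 0
 have "Jx f a 0 = igen {}" for a by (simp add: Jx_def)
 thus ?case using reg[of 0] by simp
next
 case (Suc j)
 hence j: "j < m" "j \<le> m" by auto
 note IH = Suc.IH[OF j(2)]
 have col: "b \<in> Jx f (a(k := d)) j" if "\<forall>i. a i \<ge> 1" "k < j" "d \<ge> 1" "a k = c + d" "b * f k ^ c \<in> Jx f a j" for a k c d b
  using IH that by blast
 have nz: "b \<in> Jx f a j" if "\<forall>i. a i \<ge> 1" "b * f j ^ n \<in> Jx f a j" for a b n using that(2)
 proof (induction n arbitrary: b)
  case (Suc n)
  have "(b * f j) * f j ^ n \<in> Jx f a j" using Suc.prems by (simp add: mult.assoc)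
  from Suc.IH[OF this] show ?case using IH j(1) that(1) by blast
 qed simp
 have col': "b \<in> Jx f (a(k := d)) (Suc j)"
  if a: "\<forall>i. a i \<ge> 1" and k: "k < Suc j" and d: "d \<ge> 1" "a k = c + d" and b: "b * f k ^ c \<in> Jx f a (Suc j)" for a k c d b
 proof -
  from b obtain t where t: "b * f k ^ c - t * f j ^ a j \<in> Jx f a j" by (auto simp: Jx_Suc_iff)
  show ?thesis
  proof (cases "k = j")
   case True
   have eq: "b * f k ^ c - t * f j ^ a j = (b - t * f j ^ d) * f j ^ c"
    using True d by (simp add: power_add algebra_simps)
   from t[unfolded eq] have "b - t * f j ^ d \<in> Jx f a j" by (rule nz[OF a])
   moreover have "Jx f a j = Jx f (a(k := d)) j" by (rule Jx_cong) (use True in auto)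
   ultimately show ?thesis using True by (auto simp: Jx_Suc_iff)
  next
   case False
   hence k: "k < j" using k by simp
   show ?thesis
   proof (cases "c = 0")
    case True
    hence "a(k := d) = a" using d by auto
    thus ?thesis using b True by simp
   next
    case c0: False
    have "b * f k ^ c \<in> Jx f (a(k := c)) j" using Jx_gen[of k j "a(k := c)" c f] k by (auto intro: Jx_ideal)
    moreover have "b * f k ^ c - t * f j ^ a j \<in> Jx f (a(k := c)) j"
     by (rule subsetD[OF Jx_mono t]) (use d in auto)
    ultimately have "b * f k ^ c - (b * f k ^ c - t * f j ^ a j) \<in> Jx f (a(k := c)) j" by (rule Jx_ideal(6))
    hence "t * f j ^ a j \<in> Jx f (a(k := c)) j" by simp
    hence "t \<in> Jx f (a(k := c)) j" by (rule nz[rotated]) (use a c0 in auto)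
    from Jx_split[OF this k] obtain t' where
     "t - t' * f k ^ c \<in> igen ((%i. f i ^ (a(k := c)) i) ` ({..<j} - {k}))" by auto
    also have "(%i. f i ^ (a(k := c)) i) ` ({..<j} - {k}) = (%i. f i ^ a i) ` ({..<j} - {k})" by auto
    also have "igen \<dots> <= Jx f a j" unfolding Jx_def by (rule igen_mono) auto
    finally have t': "t - t' * f k ^ c \<in> Jx f a j" .
    have "(b - f j ^ a j * t') * f k ^ c = (b * f k ^ c - t * f j ^ a j) + (t - t' * f k ^ c) * f j ^ a j"
     by (simp add: algebra_simps)
    also have "\<dots> \<in> Jx f a j" using t t' by (auto intro: Jx_ideal)
    finally have "b - f j ^ a j * t' \<in> Jx f (a(k := d)) j" by (rule col[OF a k d])
    thus ?thesis using k by (auto simp: Jx_Suc_iff mult.commute intro!: exI[of _ t'])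
   qed
  qed
 qed
 \<comment> \<open>Induction on the total excess of the exponents over 1. Lowering one exponent to 1
   gives b = s f_k modulo the ideal, and \<open>col'\<close> shows that s satisfies the same
   hypothesis with exponent a_k - 1.\<close>
 have nz': "b \<in> Jx f a (Suc j)" if "Suc j < m" "\<forall>i. a i \<ge> 1" "b * f (Suc j) \<in> Jx f a (Suc j)" for a b
  using that(2,3)
 proof (induction "\<Sum>k<Suc j. a k - 1" arbitrary: a b rule: less_induct)
  case less
  note a = less.prems(1)
  show ?case
  proof (cases "\<forall>k<Suc j. a k = 1")
   case True
   hence "Jx f a (Suc j) = Jx f (%_. 1) (Suc j)" by (intro Jx_cong) auto
   thus ?thesis using reg[OF that(1)] less.prems by auto
  next
   case False
   then obtain k where k: "k < Suc j" "a k \<noteq> 1" by blast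
   hence ak: "a k \<ge> 2" using a[rule_format, of k] by linarith
   have dec: "(\<Sum>l<Suc j. (a(k := e)) l - 1) < (\<Sum>l<Suc j. a l - 1)" if "1 \<le> e" "e < a k" for e
    by (rule sum_strict_mono_ex1) (use that k in "auto intro!: bexI[of _ k]")
   have X: "b * f (Suc j) \<in> Jx f (a(k := 1)) (Suc j)" by (rule subsetD[OF Jx_mono less.prems(2)]) (use a in auto)
   have "b \<in> Jx f (a(k := 1)) (Suc j)" by (rule less.hyps[OF dec _ X]) (use a ak in auto)
   from Jx_split[OF this k(1)] obtain s where
    "b - s * f k \<in> igen ((%i. f i ^ (a(k := 1)) i) ` ({..<Suc j} - {k}))" by auto
   also have "(%i. f i ^ (a(k := 1)) i) ` ({..<Suc j} - {k}) = (%i. f i ^ a i) ` ({..<Suc j} - {k})" by auto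
   also have "igen \<dots> <= Jx f a (Suc j)" unfolding Jx_def by (rule igen_mono) auto
   finally have s: "b - s * f k \<in> Jx f a (Suc j)" .
   have "(s * f (Suc j)) * f k ^ 1 = b * f (Suc j) - (b - s * f k) * f (Suc j)" by (simp add: algebra_simps)
   also have "\<dots> \<in> Jx f a (Suc j)" using s less.prems by (auto intro: Jx_ideal)
   finally have X: "s * f (Suc j) \<in> Jx f (a(k := a k - 1)) (Suc j)"
    by (rule col'[OF a k(1), rotated 2]) (use ak in auto)
   have "s \<in> Jx f (a(k := a k - 1)) (Suc j)" by (rule less.hyps[OF dec _ X]) (use a ak in auto)
   from Jx_upd_mult[OF this, of 1] ak have "s * f k \<in> Jx f a (Suc j)" by (simp add: mult.commute)
   from Jx_ideal(2)[OF s this] show ?thesis by simp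
  qed
 qed
 show ?case using col' nz' by blast
qed

lemma Jx_colon: assumes "\<forall>i. a i \<ge> 1" "k < m" "d \<ge> 1" "a k = c + d" "b * f k ^ c \<in> Jx f a m"
 shows "b \<in> Jx f (a(k := d)) m" using Jx_reg[of m] assms by blast

lemma Jx_colon_prod:
 assumes q: "q \<ge> 1" and l: "l \<le> m" and b: "b * (\<Prod>k<l. f k ^ (q - 1)) \<in> Jx f (%_. q) m"
 shows "b \<in> Jx f (%k. if k < l then 1 else q) m" using l b
proof (induction l arbitrary: b)
 case (Suc l)
 have "b * f l ^ (q - 1) \<in> Jx f (%k. if k < l then 1 else q) m"
  by (rule Suc.IH) (use Suc.prems in "auto simp: mult_ac")
 hence "b \<in> Jx f ((%k. if k < l then 1 else q)(l := 1)) m"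
  by (rule Jx_colon[rotated -1]) (use q Suc.prems in auto)
 also have "(%k. if k < l then 1 else q)(l := 1) = (%k. if k < Suc l then 1 else q)" by (auto simp: less_Suc_eq)
 finally show ?case .
qed simp

text \<open>The factors f_l^(q-1) are split off one at a time: if c = s F modulo q-th powers, then s
  f_l lies in the ideal of first powers before l and q-th powers from l on, and cancelling f_l
  leaves f_l^(q-1) in place of f_l^q.\<close>

lemma Jx_colon_all: assumes q: "q \<ge> 1" and l: "l \<le> m" and c: "!!k. k < m ==> c * f k \<in> Jx f (%_. q) m"
 shows "\<exists>s. c - s * (\<Prod>k<l. f k ^ (q - 1)) \<in> Jx f (%_. q) m"
\<comment> \<open>The colon law is for exponents at least 1, and q - 1 will occur as one.\<close>
proof (cases "q = 1")
 case True
 thus ?thesis by (intro exI[of _ c]) (simp add: Jx_ideal)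
next
 case False
 hence q2: "q \<ge> 2" using q by simp
 show ?thesis using l
 proof (induction l)
  case 0 show ?case by (intro exI[of _ c]) (simp add: Jx_ideal)
 next
  case (Suc l)
  let ?F = "\<Prod>k<l. f k ^ (q - 1)" and ?a = "%k. if k < l then 1 else q"
  obtain s where s: "c - s * ?F \<in> Jx f (%_. q) m" using Suc by auto
  have "s * f l * ?F = c * f l - (c - s * ?F) * f l" by (simp add: algebra_simps)
  also have "\<dots> \<in> Jx f (%_. q) m" using s c[of l] Suc.prems by (auto intro: Jx_ideal)
  finally have "s * f l ^ 1 \<in> Jx f ?a m" using Jx_colon_prod[OF q, of l "s * f l"] Suc.prems by simp
  hence "s \<in> Jx f (?a(l := q - 1)) m" by (rule Jx_colon[rotated -1]) (use q2 Suc.prems in auto)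
  from Jx_split[OF this, of l] Suc.prems obtain t where
   t: "s - t * f l ^ (q - 1) \<in> igen ((%i. f i ^ (?a(l := q - 1)) i) ` ({..<m} - {l}))" by auto
  \<comment> \<open>Modulo q-th powers F kills the generators other than f_l: below l it supplies
    the missing f_i^(q-1), above l they are q-th powers already.\<close>
  have "?F * x \<in> Jx f (%_. q) m" if "x \<in> igen ((%i. f i ^ (?a(l := q - 1)) i) ` ({..<m} - {l}))" for x
   using that
  proof induction
   case (igen_mult x r)
   then obtain i where i: "i < m" "i \<noteq> l" "x = f i ^ ?a i" by auto
   have "?F * x \<in> Jx f (%_. q) m"
   proof (cases "i < l")
    case True
    have "?F = f i ^ (q - 1) * (\<Prod>k\<in>{..<l} - {i}. f k ^ (q - 1))" by (rule prod.remove) (use True in auto)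
    hence "?F * x = f i ^ q * (\<Prod>k\<in>{..<l} - {i}. f k ^ (q - 1))"
     using i True q by (simp add: mult_ac power_eq_if[of _ q])
    thus ?thesis using Jx_gen[of i m "%_. q" q f] i by (auto intro: Jx_ideal)
   next
    case False
    thus ?thesis using i Jx_gen[of i m "%_. q" q f] by (auto intro: Jx_ideal)
   qed
   thus ?case using Jx_ideal(3)[of "?F * x" f "%_. q" m r] by (simp add: mult.left_commute)
  qed (auto intro: Jx_ideal simp: distrib_left)
  from Jx_ideal(2)[OF s this[OF t]] have "c - t * (?F * f l ^ (q - 1)) \<in> Jx f (%_. q) m"
   by (simp add: algebra_simps)
  thus ?case by (intro exI[of _ t]) (simp add: mult_ac)
 qed
qed

end

definition reg_list :: "'a::comm_ring_1 list => bool" where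
 "reg_list fs \<longleftrightarrow> (\<forall>i<length fs. \<forall>a. a * fs ! i \<in> igen (set (take i fs)) --> a \<in> igen (set (take i fs)))"

lemma Jx_nth: "j \<le> length fs ==> Jx (nth fs) (%_. q) j = igen ((%x. x ^ q) ` set (take j fs))"
 unfolding Jx_def by (simp add: nth_image[symmetric] image_image lessThan_atLeast0)

context frob_dual
begin

lemma fpow_igen:
 fixes G :: "'a set" shows "fpow (p ^ k) (igen G) = igen ((%x. x ^ (p ^ k)) ` G)"
proof
 have "a ^ (p ^ k) \<in> igen ((%x. x ^ (p ^ k)) ` G)" if "a \<in> igen G" for a using that
 proof induction
  case (igen_mult x r)
  thus ?case by (auto simp: power_mult_distrib intro: igen.igen_mult)
 qed (use p_pos' in "auto simp: fr_pow power_0_left intro: igen.intros")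
 thus "fpow (p ^ k) (igen G) <= igen ((%x. x ^ (p ^ k)) ` G)" unfolding fpow_def by (intro igen_least) auto
 show "igen ((%x. x ^ (p ^ k)) ` G) <= fpow (p ^ k) (igen G)"
  by (rule igen_least) (auto intro: fpow_mem igen_superset)
qed

text \<open>The Frobenius power of I is generated by the powers of its generators
  (\<open>fpow_igen\<close>), so both are colon laws for powers of a regular sequence.\<close>

lemma
 fixes fs :: "'a list" assumes reg: "reg_list fs"
 shows colon_fpow: "(!!g. g \<in> set fs ==> c * g \<in> fpow (p ^ k) (igen (set fs))) ==>
   \<exists>s. c - s * prod_list fs ^ (p ^ k - 1) \<in> fpow (p ^ k) (igen (set fs))"
  and colon_fpow_power: "b * prod_list fs ^ (p ^ k - 1) \<in> fpow (p ^ k) (igen (set fs)) ==> b \<in> igen (set fs)"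
proof -
 let ?m = "length fs"
 have r: "b \<in> Jx (nth fs) (%_. 1) j" if "j < ?m" "b * fs ! j \<in> Jx (nth fs) (%_. 1) j" for j b
  using that reg by (simp add: Jx_nth reg_list_def)
 have F: "fpow (p ^ k) (igen (set fs)) = Jx (nth fs) (%_. p ^ k) ?m" by (simp add: fpow_igen Jx_nth)
 have P: "prod_list fs ^ n = (\<Prod>i<?m. fs ! i ^ n)" for n
  by (simp add: prod.list_conv_set_nth atLeast0LessThan prod_power_distrib)
 have q: "p ^ k \<ge> 1" using p_pos' by simp
 show "\<exists>s. c - s * prod_list fs ^ (p ^ k - 1) \<in> fpow (p ^ k) (igen (set fs))"
  if "!!g. g \<in> set fs ==> c * g \<in> fpow (p ^ k) (igen (set fs))"
  unfolding P F by (rule Jx_colon_all[OF r q]) (use that F in auto)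
 show "b \<in> igen (set fs)" if "b * prod_list fs ^ (p ^ k - 1) \<in> fpow (p ^ k) (igen (set fs))"
 proof -
  have "b \<in> Jx (nth fs) (%i. if i < ?m then 1 else p ^ k) ?m"
   by (rule Jx_colon_prod[OF r q]) (use that F P in auto)
  also have "\<dots> = Jx (nth fs) (%_. 1) ?m" by (rule Jx_cong) auto
  finally show ?thesis by (simp add: Jx_nth)
 qed
qed

lemma fpow_prod_mult:
 fixes fs :: "'a list" assumes x: "x \<in> fpow (p ^ k) (igen (set fs))"
 shows "prod_list fs ^ (p ^ (k + l) - p ^ k) * x \<in> fpow (p ^ (k + l)) (igen (set fs))"
 using x unfolding fpow_igen[of k]
proof induction
 case (igen_mult x r)
 then obtain g where g: "g \<in> set fs" "x = g ^ (p ^ k)" by auto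
 then obtain h where h: "prod_list fs = g * h" using prod_list_dvd[of g fs] by (auto elim: dvdE) 
 have le: "p ^ k \<le> p ^ (k + l)" using p_pos' by (intro power_increasing) auto
 have "prod_list fs ^ (p ^ (k + l) - p ^ k) * (r * x) = g ^ (p ^ (k + l) - p ^ k) * g ^ (p ^ k) * (h ^ (p ^ (k + l) - p ^ k) * r)"
  by (simp add: g h power_mult_distrib mult_ac)
 also have "\<dots> = g ^ (p ^ (k + l)) * (h ^ (p ^ (k + l) - p ^ k) * r)" using le by (simp flip: power_add)
 also have "\<dots> \<in> fpow (p ^ (k + l)) (igen (set fs))"
  using g by (intro is_idealD(4)[OF is_ideal_fpow] fpow_mem igen_superset)
 finally show ?case .
qed (auto intro: is_idealD[OF is_ideal_fpow] simp: distrib_left)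

end

section \<open>Leibniz rules for the delta operator\<close>

lemma ev_dsum: "ev env (dsum p xs) = dsum p (map (ev env) xs)"
 by (simp add: dsum_def mpr_def ev_sum ev_mult ev_prod ev_power)

lemma ideal_add_iff: "is_ideal J ==> e \<in> J ==> a + e \<in> J \<longleftrightarrow> a \<in> J"
 using is_idealD(2)[of J a e] is_idealD(6)[of J "a + e" e] by auto

definition list_prods :: "'a::comm_ring_1 list => 'a list => 'a list" where
 "list_prods as bs = concat (map (%x. map (%y. x * y) bs) as)"

lemma sum_list_list_prods: "(\<Sum>x\<leftarrow>list_prods as bs. g x) = (\<Sum>x\<leftarrow>as. \<Sum>y\<leftarrow>bs. g (x * y))"
 for g :: "'a::comm_ring_1 => 'b::comm_ring_1" by (induction as) (simp_all add: list_prods_def o_def)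

lemma sum_list_product: "(\<Sum>x\<leftarrow>as. \<Sum>y\<leftarrow>bs. g x * h y) = (\<Sum>x\<leftarrow>as. g x) * (\<Sum>y\<leftarrow>bs. h y)"
 for g h :: "'a::comm_ring_1 => 'b::comm_ring_1" by (induction as) (simp_all add: sum_list_const_mult distrib_right)

lemma dsum_mult_p': "prime p ==> of_nat p * dsum p as = sum_list as ^ p - (\<Sum>x\<leftarrow>as. x ^ p)"
 by (simp add: dsum_mult_p sum_list_sum_nth atLeast0LessThan)

text \<open>Over the integers p Delta(a) is a^p minus the sum of p-th powers, and sums of p-th
  powers multiply. Expanding leaves an extra term - p Delta(a) Delta(b), which vanishes in
  characteristic p.\<close>

lemma dsum_list_prods:
 fixes as bs :: "'a::comm_ring_1 list" assumes p: "prime p" and c: "CHAR('a) = p"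
 shows "dsum p (list_prods as bs) = sum_list as ^ p * dsum p bs + sum_list bs ^ p * dsum p as"
proof -
 define xs :: "(nat + nat) zpoly list" where "xs = map (zvar \<circ> Inl) [0..<length as]"
 define ys :: "(nat + nat) zpoly list" where "ys = map (zvar \<circ> Inr) [0..<length bs]"
 define env where "env = case_sum (nth as) (nth bs)"
 let ?x = "sum_list xs :: (nat + nat) zpoly" and ?y = "sum_list ys :: (nat + nat) zpoly"
 have m: "map (ev env) xs = as" "map (ev env) ys = bs" by (auto simp: xs_def ys_def env_def intro!: nth_equalityI)
 have ml: "map (ev env) (list_prods xs ys) = list_prods as bs"
  unfolding m[symmetric] by (simp add: list_prods_def map_concat o_def ev_mult)
 have sl: "sum_list (list_prods xs ys) = ?x * ?y"
  using sum_list_list_prods[of "%x. x" xs ys] sum_list_product[of "%x. x" "%x. x" ys xs] by simp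
 have sp: "(\<Sum>x\<leftarrow>list_prods xs ys. x ^ p) = (\<Sum>x\<leftarrow>xs. x ^ p) * (\<Sum>y\<leftarrow>ys. y ^ p)"
  by (simp only: sum_list_list_prods power_mult_distrib sum_list_product)
 have X: "(\<Sum>x\<leftarrow>xs. x ^ p) = ?x ^ p - of_nat p * dsum p xs" and Y: "(\<Sum>y\<leftarrow>ys. y ^ p) = ?y ^ p - of_nat p * dsum p ys"
  by (simp_all add: dsum_mult_p'[OF p])
 have "of_nat p * dsum p (list_prods xs ys) = of_nat p * (?x ^ p * dsum p ys + ?y ^ p * dsum p xs - of_nat p * dsum p xs * dsum p ys)"
  by (simp only: dsum_mult_p'[OF p, of "list_prods xs ys"] sl sp X Y power_mult_distrib) (simp add: algebra_simps)
 hence "of_nat p ^ 1 * dsum p (list_prods xs ys) = of_nat p ^ 1 * (?x ^ p * dsum p ys + ?y ^ p * dsum p xs - of_nat p * dsum p xs * dsum p ys)"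
  by simp
 from zpoly_cancel[OF this p_pos[OF p]]
 have "ev env (dsum p (list_prods xs ys)) = ev env (?x ^ p * dsum p ys + ?y ^ p * dsum p xs - of_nat p * dsum p xs * dsum p ys)"
  by simp
 moreover have "ev env ?x = sum_list as" "ev env ?y = sum_list bs"
 proof -
  have "ev env (sum_list zs) = sum_list (map (ev env) zs)" for zs by (induction zs) (auto simp: ev_add)
  thus "ev env ?x = sum_list as" "ev env ?y = sum_list bs" by (simp_all add: m)
 qed
 moreover have "of_nat p = (0 :: 'a)" using c by auto
 ultimately show ?thesis by (simp add: ev_dsum ml m ev_add ev_mult ev_diff ev_power)
qed

context frob_dual
begin

lemma wc_errw_0: "wc (errw f) 0 = delta f"
proof -
 obtain z where "errw f = tau (delta f) + wV (wscale (f ^ (p\<^sup>2 - p)) (errw f)) + wV (wF z)"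
  using errw_eq by blast
 from arg_cong[OF this, of "%x. wc x 0"] show ?thesis by (simp only: wc_0_add' wc_tau_0 wc_simps) simp
qed

text \<open>Two decompositions of one element into p-monomials lift to Witt vectors that differ by
  VF w, so the errors differ by F w, whose zeroth component is a p-th power. This is the
  independence of the class in \<open>Delta1\<close>.\<close>

lemma dsum_delta: assumes "set as <= pmon" shows "\<exists>c. dsum p as = delta (sum_list as) + c ^ p"
proof -
 let ?\<Lambda> = "SIGMA \<alpha>:dexps p (length as). {..<mcoef \<alpha> div p}"
 define y where "y = wshift (teich (sum_list as) - (\<Sum>i<length as. teich (as ! i)))"
 from teich_error[OF prime char, of as] obtain z where
  z: "y = (\<Sum>(\<alpha>, t)\<in>?\<Lambda>. teich (mpr as \<alpha>)) + wV (wscale (sum_list as ^ (p\<^sup>2 - p)) y) + wV (wF z)"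
  unfolding y_def by blast
 have "wc y 0 = (\<Sum>(\<alpha>, t)\<in>?\<Lambda>. mpr as \<alpha>)"
  by (subst z) (simp add: wc_0_add' wc_0_sum' case_prod_unfold)
 also have "\<dots> = (\<Sum>\<alpha>\<in>dexps p (length as). \<Sum>t<mcoef \<alpha> div p. mpr as \<alpha>)"
  by (rule sum.Sigma[symmetric]) auto
 also have "\<dots> = dsum p as" by (simp add: dsum_def)
 finally have y0: "wc y 0 = dsum p as" .
 obtain w where w: "(\<Sum>i<length as. teich (as ! i)) = tau (\<Sum>i<length as. as ! i) + wV (wF w)"
  using sum_teich_pmon[of "{..<length as}" "nth as"] assms nth_mem by blast
 have "(\<Sum>i<length as. as ! i) = sum_list as" by (simp add: sum_list_sum_nth atLeast0LessThan)
 hence "y = wshift (wV (errw (sum_list as)) - wV (wF w))" unfolding y_def w by (simp add: tau_errw algebra_simps)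
 also have "\<dots> = errw (sum_list as) - wF w" by (simp flip: wV_diff')
 finally have "dsum p as = delta (sum_list as) - wc w 0 ^ p" using y0 by (simp add: wc_0_diff' wc_errw_0 char)
 thus ?thesis by (intro exI[of _ "- wc w 0"]) (simp add: fr_minus)
qed

lemma delta_mult: "\<exists>c. delta (a * b) = a ^ p * delta b + b ^ p * delta a + c ^ p"
proof -
 let ?as = "delta_list a" and ?bs = "delta_list b"
 have "set (list_prods ?as ?bs) <= pmon"
  using delta_list(1)[of a] delta_list(1)[of b] by (auto simp: list_prods_def intro!: pmon_mult)
 from dsum_delta[OF this] obtain c where
  c: "dsum p (list_prods ?as ?bs) = delta (sum_list (list_prods ?as ?bs)) + c ^ p" by blast
 have "sum_list (list_prods ?as ?bs) = a * b"
  using sum_list_list_prods[of "%x. x" ?as ?bs] sum_list_product[of "%x. x" "%x. x" ?bs ?as]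
  by (simp add: delta_list(2))
 hence "delta (a * b) + c ^ p = a ^ p * delta b + b ^ p * delta a"
  using c dsum_list_prods[OF prime char, of ?as ?bs] by (simp add: delta_list(2) delta_def)
 hence "delta (a * b) = a ^ p * delta b + b ^ p * delta a + (- c) ^ p" by (simp add: fr_minus algebra_simps)
 thus ?thesis by blast
qed

lemma delta_power: "\<exists>c. delta (a ^ Suc k) = of_nat (Suc k) * a ^ (p * k) * delta a + c ^ p"
proof (induction k)
 case 0
 show ?case using p_pos' by (intro exI[of _ 0]) (simp add: power_0_left)
next
 case (Suc k)
 then obtain c where c: "delta (a ^ Suc k) = of_nat (Suc k) * a ^ (p * k) * delta a + c ^ p" by blast
 obtain d where d: "delta (a * a ^ Suc k) = a ^ p * delta (a ^ Suc k) + (a ^ Suc k) ^ p * delta a + d ^ p"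
  using delta_mult by blast
 have "delta (a ^ Suc (Suc k)) = of_nat (Suc (Suc k)) * a ^ (p * Suc k) * delta a + (a * c + d) ^ p"
  using d unfolding c by (simp add: fr power_mult_distrib power_add algebra_simps flip: power_mult)
 thus ?case by blast
qed

text \<open>\<open>theta\<close> computed with the fixed representative \<open>delta\<close>; the
  two agree on the kernel of \<open>u\<close> by \<open>theta_eq\<close>.\<close>

definition th :: "'a => 'a => 'a" where
 "th f h = u (delta (f ^ (p - 1)) * h)"

lemma u_delta_cong: "u h = 0 ==> u ((d + c ^ p) * h) = u (d * h)" by (simp add: distrib_right u_add u_pow)

lemma th_add: "th f (a + b) = th f a + th f b" by (simp add: th_def distrib_left u_add)

lemma th_pow: "th f (s ^ p * a) = s * th f a"
 using u_pow[of s "delta (f ^ (p - 1)) * a"] by (simp add: th_def mult.left_commute)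

lemma p_pred: "(of_nat (p - 1) :: 'a) = - 1"
proof -
 have "(of_nat p :: 'a) = 0" using of_nat_CHAR[where 'a = 'a] unfolding char .
 moreover have "Suc (p - 1) = p" using p_pos' by simp
 ultimately have "(of_nat (Suc (p - 1)) :: 'a) = 0" by simp
 thus ?thesis by (simp add: eq_neg_iff_add_eq_0 add.commute)
qed

lemma delta_factor:
 "\<exists>c. delta ((x * g) ^ (p - 1)) = (x ^ (p - 1)) ^ p * delta (g ^ (p - 1)) - (g ^ (p - 1) * x ^ (p - 2)) ^ p * delta x + c ^ p"
proof -
 obtain c where c: "delta (x ^ (p - 1) * g ^ (p - 1)) = (x ^ (p - 1)) ^ p * delta (g ^ (p - 1)) + (g ^ (p - 1)) ^ p * delta (x ^ (p - 1)) + c ^ p"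
  using delta_mult by blast
 have "Suc (p - 2) = p - 1" using prime prime_ge_2_nat[of p] by simp
 then obtain d where d: "delta (x ^ (p - 1)) = - 1 * x ^ (p * (p - 2)) * delta x + d ^ p"
  using delta_power[of x "p - 2"] p_pred by metis
 show ?thesis unfolding power_mult_distrib[of x g] c d
  by (intro exI[of _ "g ^ (p - 1) * d + c"]) (simp add: fr power_mult_distrib algebra_simps flip: power_mult)
qed

text \<open>Connects theta, built from Delta_1(f^(p-1)), with the terms u(Delta_1(x) h) that
  preservation of W(I) imposes for a generator x dividing f. It is the Leibniz rule for (x g)^(p-1),
  where the coefficient p - 1 becomes -1, multiplied by x.\<close>

lemma th_factor: assumes h: "u h = 0"
 shows "\<exists>s. x * th (x * g) h = x ^ p * s - (x * g) ^ (p - 1) * u (delta x * h)"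
proof -
 have p2: "p \<ge> 2" using prime prime_ge_2_nat by blast
 have "th (x * g) h = u (((x ^ (p - 1)) ^ p * delta (g ^ (p - 1)) - (g ^ (p - 1) * x ^ (p - 2)) ^ p * delta x) * h)"
  using delta_factor[of x g] u_delta_cong[OF h] unfolding th_def by metis
 also have "\<dots> = x ^ (p - 1) * u (delta (g ^ (p - 1)) * h) - (g ^ (p - 1) * x ^ (p - 2)) * u (delta x * h)"
  by (simp only: left_diff_distrib u_diff mult.assoc[of "_ ^ p"] u_pow)
 finally have E: "th (x * g) h = x ^ (p - 1) * u (delta (g ^ (p - 1)) * h) - g ^ (p - 1) * x ^ (p - 2) * u (delta x * h)" .
 have "x * th (x * g) h = x ^ Suc (p - 1) * u (delta (g ^ (p - 1)) * h) - (g ^ (p - 1) * x ^ Suc (p - 2)) * u (delta x * h)"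
  unfolding E by (simp only: right_diff_distrib power_Suc mult_ac)
 moreover have "Suc (p - 1) = p" "Suc (p - 2) = p - 1" using p2 by auto
 ultimately show ?thesis by (intro exI[of _ "u (delta (g ^ (p - 1)) * h)"]) (simp add: power_mult_distrib mult.commute)
qed

section \<open>The Fedder type criterion\<close>

definition col :: "'a set => 'a set" where
 "col I = {a. \<forall>b\<in>I. a * b \<in> fpow p I}"

fun Is :: "'a => 'a set => nat => 'a set" where
 "Is f I 0 = {}"
| "Is f I (Suc 0) = col I"
| "Is f I (Suc (Suc s)) = {a + b | a b. a \<in> th f ` (Is f I (Suc s) \<inter> {h. u h = 0}) & b \<in> col I}"

lemma is_ideal_col: "is_ideal (col I)" unfolding is_ideal_def col_def
 by (auto simp: distrib_right mult.assoc intro: is_idealD[OF is_ideal_fpow])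

lemma is_ideal_Is: "is_ideal (Is f I (Suc s))"
proof (induction s)
 case 0 show ?case using is_ideal_col by simp
next
 case (Suc s)
 show ?case unfolding is_ideal_def
 proof (intro conjI ballI allI)
  have "0 = th f 0 + 0" by (simp add: th_def)
  thus "0 \<in> Is f I (Suc (Suc s))"
   using is_idealD(1)[OF Suc] is_idealD(1)[OF is_ideal_col[of I]] by (auto intro!: exI[of _ 0] image_eqI[of _ _ 0])
 next
  fix a b assume "a \<in> Is f I (Suc (Suc s))" "b \<in> Is f I (Suc (Suc s))"
  then obtain h c h' c' where a: "a = th f h + c" "h \<in> Is f I (Suc s)" "u h = 0" "c \<in> col I"
   and b: "b = th f h' + c'" "h' \<in> Is f I (Suc s)" "u h' = 0" "c' \<in> col I" by auto
  have "a + b = th f (h + h') + (c + c')" by (simp add: a b th_add)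
  moreover have "h + h' \<in> Is f I (Suc s)" "c + c' \<in> col I" "u (h + h') = 0"
   using a b is_idealD(2)[OF Suc] is_idealD(2)[OF is_ideal_col] by (auto simp: u_add)
  ultimately show "a + b \<in> Is f I (Suc (Suc s))" by auto
 next
  fix a r assume "a \<in> Is f I (Suc (Suc s))"
  then obtain h c where a: "a = th f h + c" "h \<in> Is f I (Suc s)" "u h = 0" "c \<in> col I" by auto
  have "r * a = th f (r ^ p * h) + r * c" by (simp add: a th_pow distrib_left)
  moreover have "r ^ p * h \<in> Is f I (Suc s)" "r * c \<in> col I" "u (r ^ p * h) = 0"
   using a is_idealD(3)[OF Suc] is_idealD(3)[OF is_ideal_col] by (auto simp: u_pow)
  ultimately show "r * a \<in> Is f I (Suc (Suc s))" by auto
 qed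
qed

lemma fpow_sub_col: "fpow p I <= col I" unfolding col_def by (auto intro: is_idealD[OF is_ideal_fpow])

lemma th_mem_Is: "h \<in> Is f I (Suc s) ==> u h = 0 ==> c \<in> col I ==> th f h + c \<in> Is f I (Suc (Suc s))"
 by auto

lemma col_sub_Is: "col I <= Is f I (Suc s)"
proof (cases s)
 case (Suc r)
 show ?thesis
 proof
  fix c assume c: "c \<in> col I"
  show "c \<in> Is f I (Suc s)"
   using th_mem_Is[OF is_idealD(1)[OF is_ideal_Is[of f I r]] u_0 c] Suc by (simp add: th_def)
 qed
qed simp

text \<open>Moves h into the kernel of \<open>u\<close>; the correction lies in I^[p] as soon as
  u(h) lies in I.\<close>

lemma u_ker_adjust: "u (h - u h ^ p * vd e0) = 0" using dual[OF e0(1) e0(1)] e0(2) by (simp add: u_diff u_pow)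

definition gcond :: "'a list => 'a list => nat => bool" where
 "gcond fs gs i \<longleftrightarrow> (\<forall>f\<in>set fs. gs ! i * f + (if Suc i < length gs then u (gs ! Suc i * delta f) else 0)
   \<in> fpow (p ^ Suc i) (igen (set fs)))"

text \<open>Let g' be the next entry and P the value of the later tail at the error. By the next
  condition g' f + P lies in I^[p^(i+2)], so f^(p-1) P is - f^p g' up to that ideal, and u(f^p g') =
  f u(g') = 0. Of \<open>Psi_errw\<close> only u(g' Delta_1(f)) survives, so each condition involves
  two consecutive entries.\<close>

lemma Psi_cond_iff_gcond:
 assumes gs: "\<forall>g\<in>set (tl gs). u g = 0" and i: "i < length gs" and n: "Suc i < length gs ==> Psi_cond fs gs (Suc i) 0"
 shows "Psi_cond fs gs i 0 \<longleftrightarrow> gcond fs gs i"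
proof -
 let ?I = "igen (set fs)"
 have "gs ! i * f + Psi (drop (Suc i) gs) (errw f) \<in> fpow (p ^ Suc i) ?I \<longleftrightarrow>
   gs ! i * f + (if Suc i < length gs then u (gs ! Suc i * delta f) else 0) \<in> fpow (p ^ Suc i) ?I" if f: "f \<in> set fs" for f
 proof (cases "Suc i < length gs")
  case True
  let ?g = "gs ! Suc i" and ?P = "Psi (drop (Suc (Suc i)) gs) (errw f)"
  have "set (drop (Suc i) gs) <= set (tl gs)" by (cases gs) (auto dest: in_set_dropD)
  moreover have d: "drop (Suc i) gs = ?g # drop (Suc (Suc i)) gs" using True by (rule Cons_nth_drop_Suc[symmetric])
  ultimately have k: "\<forall>g\<in>set (drop (Suc (Suc i)) gs). u g = 0" "u ?g = 0" using gs by auto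
  have e: "?g * f + ?P \<in> fpow (p ^ (1 + Suc i)) ?I" using n[OF True] f by (simp add: Psi_cond_def)
  have "f ^ (p - 1) * ?P = f ^ (p - 1) * (?g * f + ?P) - f ^ p * ?g"
   using p_pos' by (simp add: power_eq_if[of f p] algebra_simps)
  hence "u (f ^ (p - 1) * ?P) = u (f ^ (p - 1) * (?g * f + ?P))" by (simp only: u_diff u_pow k) simp
  also have "\<dots> \<in> fpow (p ^ Suc i) ?I"
   using up_fpow_add[OF is_ideal_igen is_idealD(3)[OF is_ideal_fpow e], of "f ^ (p - 1)"] by simp
  finally have e': "u (f ^ (p - 1) * ?P) \<in> fpow (p ^ Suc i) ?I" .
  have P: "gs ! i * f + Psi (drop (Suc i) gs) (errw f) = (gs ! i * f + u (?g * delta f)) + u (f ^ (p - 1) * ?P)"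
   unfolding d Psi_errw[OF k(1)] by simp
  show ?thesis unfolding P using True ideal_add_iff[OF is_ideal_fpow e'] by simp
 qed simp
 thus ?thesis by (simp add: Psi_cond_def gcond_def)
qed

lemma Psi_wideal_iff: assumes gs: "\<forall>g\<in>set (tl gs). u g = 0"
 shows "(\<forall>x\<in>wideal (igen (set fs)). Psi gs x \<in> igen (set fs)) \<longleftrightarrow> (\<forall>i<length gs. gcond fs gs i)"
proof -
 have "(\<forall>x\<in>wideal (igen (set fs)). Psi gs x \<in> igen (set fs)) \<longleftrightarrow> (\<forall>i<length gs. Psi_cond fs gs i 0)"
  using Psi_wideal_imp[OF gs, of fs 0] Psi_wideal[OF gs, of fs 0] by auto
 also have "\<dots> \<longleftrightarrow> (\<forall>i<length gs. gcond fs gs i)"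
 proof
  assume "\<forall>i<length gs. Psi_cond fs gs i 0"
  thus "\<forall>i<length gs. gcond fs gs i" using Psi_cond_iff_gcond[OF gs] by auto
 next
  assume g: "\<forall>i<length gs. gcond fs gs i"
  have "Psi_cond fs gs i 0" if "i < length gs" for i using that
  proof (induction "length gs - i" arbitrary: i rule: less_induct)
   case less
   thus ?case using Psi_cond_iff_gcond[OF gs less.prems, of fs] g by auto
  qed
  thus "\<forall>i<length gs. Psi_cond fs gs i 0" by blast
 qed
 finally show ?thesis .
qed

text \<open>The exponents fit because f^(p^(i+2)-p) is the p-th power of f^(p^(i+1)-1): the factor
  passes through \<open>u\<close> and becomes the generator of the colon ideal one level below. That
  u(hd gs) lies outside M says that the functional can be normalized to send 1 to 1.\<close>

theorem fedder_criterion: assumes reg: "reg_list fs" and I: "I = igen (set fs)" and f: "f = prod_list fs"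
  and M: "is_ideal M" "I <= M" and n: "n \<ge> 1"
 shows "(\<exists>gs. length gs = n & (\<forall>g\<in>set (tl gs). u g = 0) & (\<forall>x\<in>wideal I. Psi gs x \<in> I) & u (hd gs) ~: M)
  \<longleftrightarrow> \<not> Is f I n <= fpow p M"
proof -
 let ?P = "%i. fpow (p ^ Suc i) I" and ?F = "%i. f ^ (p ^ Suc i - p)" and ?G = "%i. f ^ (p ^ Suc i - 1)"
 have idI: "is_ideal I" by (simp add: I)
 have tI: "?G i * b \<in> ?P i" if "b \<in> I" for i b
  using fpow_prod_mult[of b 0 fs "Suc i"] that fpow_1[OF idI] by (simp add: I f)
 have mp: "?F i * x \<in> ?P i" if "x \<in> fpow p I" for i x
  using fpow_prod_mult[of x 1 fs i] that by (simp add: I f)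
 have pl: "p \<le> p ^ Suc i" for i using p_pos' by simp
 have exps: "?F i * f ^ (p - 1) = ?G i" for i using pl[of i] p_pos' by (simp flip: power_add)
 have key: "?F i * (x * th f h) + ?G i * u (delta x * h) \<in> ?P i"
  if x: "x \<in> set fs" and h: "u h = 0" for x h i
 proof -
  obtain g where g: "f = x * g" using prod_list_dvd[OF x] f by (auto elim: dvdE)
  obtain s where s: "x * th f h = x ^ p * s - f ^ (p - 1) * u (delta x * h)" using th_factor[OF h, of x g] g by auto
  have "?F i * (x * th f h) + ?G i * u (delta x * h) = ?F i * (x ^ p * s)"
   unfolding s exps[symmetric] by (simp add: algebra_simps)
  also have "\<dots> \<in> ?P i"
  proof (rule mp)
   have "x ^ p \<in> fpow p I" by (rule fpow_mem) (use x in "auto simp: I intro: igen_superset")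
   thus "x ^ p * s \<in> fpow p I" by (rule is_idealD(4)[OF is_ideal_fpow])
  qed
  finally show ?thesis .
 qed
 have uex: "u (?F (Suc i) * (h :: 'a)) = ?G i * u h" for i h
 proof -
  have "p ^ Suc (Suc i) - p = (p ^ Suc i - 1) * p" by (subst diff_mult_distrib) (simp add: mult_ac)
  hence "?F (Suc i) = (?G i) ^ p" by (simp only: power_mult)
  thus ?thesis by (simp add: u_pow)
 qed
 show ?thesis
 proof
  assume "\<exists>gs. length gs = n & (\<forall>g\<in>set (tl gs). u g = 0) & (\<forall>x\<in>wideal I. Psi gs x \<in> I) & u (hd gs) ~: M"
  then obtain gs where gs: "length gs = n" "\<forall>g\<in>set (tl gs). u g = 0" "\<forall>x\<in>wideal I. Psi gs x \<in> I" "u (hd gs) ~: M" by blast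
  have gc: "gcond fs gs i" if "i < n" for i using Psi_wideal_iff[OF gs(2), of fs] gs that by (simp add: I)
  have ug: "u (gs ! i) = 0" if "0 < i" "i < n" for i
  proof -
   have "gs ! i = tl gs ! (i - 1)" using that gs(1) by (cases gs) auto
   hence "gs ! i \<in> set (tl gs)" using that gs(1) by auto
   thus ?thesis using gs(2) by blast
  qed
  have "\<exists>h\<in>Is f I (n - i). gs ! i - ?F i * h \<in> ?P i & (i > 0 --> u h = 0)" if "i < n" for i using that
  proof (induction "n - i" arbitrary: i rule: less_induct)
   case less
   have "\<exists>h\<in>Is f I (n - i). gs ! i - ?F i * h \<in> ?P i"
   proof -
    have fc: "f ^ (p - 1) * s \<in> col I" for s
    proof -
     have "f ^ (p - 1) * s * b \<in> fpow p I" if "b \<in> I" for b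
      using is_idealD(3)[OF is_ideal_fpow tI[OF that, of 0], of s] by (simp add: mult_ac)
     thus ?thesis by (simp add: col_def)
    qed
    show ?thesis
    proof (cases "Suc i < n")
     case False
     hence "gs ! i * g \<in> fpow (p ^ Suc i) (igen (set fs))" if "g \<in> set fs" for g
      using gc[OF less.prems] that gs(1) by (auto simp: gcond_def)
     from colon_fpow[OF reg this] obtain s where
      s: "gs ! i - s * ?G i \<in> ?P i" by (auto simp: I f)
     have ni: "n - i = Suc 0" using False less.prems by simp
     have "gs ! i - ?F i * (f ^ (p - 1) * s) \<in> ?P i"
      using s by (simp only: mult.assoc[symmetric] exps) (simp add: mult.commute)
     thus ?thesis using fc[of s] unfolding ni by auto
    next
     case True
     have "n - Suc i < n - i" using True by linarith
     from less.hyps[OF this True] obtain h where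
      h: "h \<in> Is f I (n - Suc i)" "gs ! Suc i - ?F (Suc i) * h \<in> ?P (Suc i)" "u h = 0" by auto
     have "(gs ! i - ?F i * th f h) * x \<in> fpow (p ^ Suc i) (igen (set fs))" if x: "x \<in> set fs" for x
     proof -
      have "u ((gs ! Suc i - ?F (Suc i) * h) * delta x) \<in> ?P i"
       using up_fpow_add[OF idI, of _ 1 "Suc i"] is_idealD(4)[OF is_ideal_fpow h(2), of "delta x"] by simp
      also have "(gs ! Suc i - ?F (Suc i) * h) * delta x = gs ! Suc i * delta x - ?F (Suc i) * (delta x * h)"
       by (simp add: algebra_simps)
      finally have 1: "u (gs ! Suc i * delta x) - ?G i * u (delta x * h) \<in> ?P i" by (simp only: u_diff uex)
      have 2: "gs ! i * x + u (gs ! Suc i * delta x) \<in> ?P i"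
       using gc[OF less.prems] True gs(1) x by (simp add: gcond_def I)
      have "(gs ! i - ?F i * th f h) * x =
       (gs ! i * x + u (gs ! Suc i * delta x)) - (u (gs ! Suc i * delta x) - ?G i * u (delta x * h))
       - (?F i * (x * th f h) + ?G i * u (delta x * h))" by (simp add: algebra_simps)
      also have "\<dots> \<in> ?P i" by (intro is_idealD(6)[OF is_ideal_fpow] 1 2 key x h(3))
      finally show ?thesis by (simp add: I)
     qed
     from colon_fpow[OF reg this] obtain s where
      s: "gs ! i - ?F i * th f h - s * ?G i \<in> ?P i" by (auto simp: I f)
     define r where "r = n - Suc (Suc i)"
     have r: "n - Suc i = Suc r" "n - i = Suc (Suc r)" using True by (auto simp: r_def)
     have "gs ! i - ?F i * (th f h + f ^ (p - 1) * s) =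
      gs ! i - ?F i * th f h - s * ?G i"
      unfolding exps[of i, symmetric] by (simp only: distrib_left diff_diff_eq mult_ac)
     with s have "gs ! i - ?F i * (th f h + f ^ (p - 1) * s) \<in> ?P i" by (simp only:)
     moreover have "th f h + f ^ (p - 1) * s \<in> Is f I (n - i)" using th_mem_Is[of h f I r] h fc r by simp
     ultimately show ?thesis by blast
    qed
   qed
   then obtain h where h: "h \<in> Is f I (n - i)" "gs ! i - ?F i * h \<in> ?P i" by blast
   show ?case
   proof (cases i)
    case 0 thus ?thesis using h by auto
   next
    case (Suc j)
    have "u (gs ! i - ?F i * h) \<in> fpow (p ^ i) I" using up_fpow_add[OF idI, of _ 1 i] h(2) by simp
    hence "f ^ (p ^ i - 1) * u h \<in> fpow (p ^ i) I"
     using ug[of i] less.prems Suc is_idealD(5)[OF is_ideal_fpow] uex[of j h] by (fastforce simp: u_diff)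
    hence uh: "u h \<in> I" using colon_fpow_power[OF reg, of "u h" i] by (simp add: I f mult.commute)
    \<comment> \<open>The vanishing of u(gs ! i) only gives u(h) in I. As h matters modulo I^[p], it
      can be corrected into the kernel of \<open>u\<close>.\<close>
    let ?e = "u h ^ p * vd e0"
    have e: "?e \<in> fpow p I" by (intro is_idealD(4)[OF is_ideal_fpow] fpow_mem uh)
    define r where "r = n - Suc i"
    have r: "n - i = Suc r" using less.prems by (auto simp: r_def)
    have "?e \<in> Is f I (n - i)" using e fpow_sub_col col_sub_Is r by fastforce
    hence "h - ?e \<in> Is f I (n - i)" using is_idealD(6)[OF is_ideal_Is h(1)[unfolded r]] r by simp
    moreover have "gs ! i - ?F i * (h - ?e) \<in> ?P i"
     using is_idealD(2)[OF is_ideal_fpow h(2) mp[OF e]] by (simp add: algebra_simps)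
    ultimately show ?thesis using u_ker_adjust by blast
   qed
  qed
  from this[of 0] n obtain h where h: "h \<in> Is f I n" "gs ! 0 - h \<in> fpow p I" by auto
  have "h ~: fpow p M"
  proof
   assume "h \<in> fpow p M"
   moreover have "fpow p I <= fpow p M" unfolding fpow_def using M by (intro igen_mono) auto
   ultimately have "gs ! 0 - h + h \<in> fpow p M" using h by (intro is_idealD(2)[OF is_ideal_fpow]) auto
   hence "u (gs ! 0) \<in> M" using up_fpow[OF M(1), of _ 1] by simp
   thus False using gs n by (cases gs) auto
  qed
  thus "\<not> Is f I n <= fpow p M" using h by blast
 next
  assume "\<not> Is f I n <= fpow p M"
  then obtain h0 where h0: "h0 \<in> Is f I n" "h0 ~: fpow p M" by blast
  \<comment> \<open>u(h0) may lie in M although h0 is not in M^[p]; some multiple of h0 avoids this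
    and stays in the ideal.\<close>
  then obtain a where a: "u (h0 * a) ~: M" using fpow_iff_up[OF M(1), of h0 1] by auto
  have ha: "h0 * a \<in> Is f I n" using is_idealD(4)[OF is_ideal_Is[of f I "n - 1"]] h0 n by simp
  \<comment> \<open>The recursion of \<open>Is\<close> is unrolled: a member of the last ideal heads
    a chain linked by theta modulo I_1, whose later entries are in the kernel of
    \<open>u\<close>.\<close>
  have ch: "\<exists>hs. length hs = Suc k & hd hs = h & (\<forall>g\<in>set (tl hs). u g = 0) &
   (\<forall>i\<le>k. hs ! i - (if i < k then th f (hs ! Suc i) else 0) \<in> col I)" if "h \<in> Is f I (Suc k)" for h k
   using that
  proof (induction k arbitrary: h)
   case 0 thus ?case by (intro exI[of _ "[h]"]) simp
  next
   case (Suc k)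
   then obtain h' c where h': "h = th f h' + c" "h' \<in> Is f I (Suc k)" "u h' = 0" "c \<in> col I" by auto
   from Suc.IH[OF h'(2)] obtain hs where hs: "length hs = Suc k" "hd hs = h'" "\<forall>g\<in>set (tl hs). u g = 0"
    "\<forall>i\<le>k. hs ! i - (if i < k then th f (hs ! Suc i) else 0) \<in> col I" by blast
   have hs0: "hs ! 0 = h'" using hs by (cases hs) auto
   have "(h # hs) ! i - (if i < Suc k then th f ((h # hs) ! Suc i) else 0) \<in> col I" if "i \<le> Suc k" for i
    using that hs(4) hs0 h' by (cases i) auto
   moreover have "\<forall>g\<in>set hs. u g = 0" using hs h' by (cases hs) auto
   ultimately show ?case using hs by (intro exI[of _ "h # hs"]) auto
  qed
  obtain k where k: "n = Suc k" using n by (cases n) auto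
  from ch[of "h0 * a" k] ha k obtain hs where hs: "length hs = n" "hd hs = h0 * a" "\<forall>g\<in>set (tl hs). u g = 0"
   "\<forall>i\<le>k. hs ! i - (if i < k then th f (hs ! Suc i) else 0) \<in> col I" by auto
  have uh: "u (hs ! i) = 0" if "0 < i" "i < n" for i
  proof -
   have "hs ! i = tl hs ! (i - 1)" using that hs(1) by (cases hs) auto
   hence "hs ! i \<in> set (tl hs)" using that hs(1) by auto
   thus ?thesis using hs(3) by blast
  qed
  define gs where "gs = map (%i. ?F i * hs ! i) [0..<n]"
  have gs: "length gs = n" "!!i. i < n ==> gs ! i = ?F i * hs ! i" by (auto simp: gs_def)
  have ug: "\<forall>g\<in>set (tl gs). u g = 0"
  proof
   fix g assume "g \<in> set (tl gs)"
   then obtain i where "i < length (tl gs)" "g = tl gs ! i" by (metis in_set_conv_nth)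
   hence i: "Suc i < n" "g = gs ! Suc i" using gs(1) by (auto simp: nth_tl)
   thus "u g = 0" using gs(2)[OF i(1)] uex[of i "hs ! Suc i"] uh[of "Suc i"] by simp
  qed
  have "gcond fs gs i" if i: "i < n" for i unfolding gcond_def I[symmetric]
  proof
   fix x assume x: "x \<in> set fs"
   let ?c = "hs ! i - (if i < k then th f (hs ! Suc i) else 0)"
   have "x \<in> I" using x by (auto simp: I intro: igen_superset)
   hence "?c * x \<in> fpow p I" using hs(4) i k unfolding col_def by (simp add: less_Suc_eq_le)
   from mp[OF this, of i] have c: "?F i * (?c * x) \<in> ?P i" .
   show "gs ! i * x + (if Suc i < length gs then u (gs ! Suc i * delta x) else 0) \<in> ?P i"
   proof (cases "Suc i < n")
    case False
    thus ?thesis using c i k gs by (simp add: mult.assoc)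
   next
    case True
    have "u (gs ! Suc i * delta x) = ?G i * u (delta x * hs ! Suc i)"
     using uex[of i "hs ! Suc i * delta x"] gs(2)[OF True] by (simp add: mult_ac)
    hence "gs ! i * x + u (gs ! Suc i * delta x) = ?F i * (?c * x)
     + (?F i * (x * th f (hs ! Suc i)) + ?G i * u (delta x * hs ! Suc i))"
     using True k by (simp add: gs(2)[OF i] algebra_simps)
    also have "\<dots> \<in> ?P i" by (rule is_idealD(2)[OF is_ideal_fpow c key[OF x uh]]) (use True in auto)
    finally show ?thesis using True gs by simp
   qed
  qed
  hence "\<forall>x\<in>wideal I. Psi gs x \<in> I" using Psi_wideal_iff[OF ug, of fs] gs by (simp add: I)
  moreover have "hd gs = h0 * a"
  proof -
   have "hd gs = gs ! 0" "hd hs = hs ! 0" by (rule hd_conv_nth, use gs(1) hs(1) k in force)+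
   thus ?thesis using gs(2)[of 0] hs(2) k by simp
  qed
  ultimately show "\<exists>gs. length gs = n & (\<forall>g\<in>set (tl gs). u g = 0) & (\<forall>x\<in>wideal I. Psi gs x \<in> I) & u (hd gs) ~: M"
   using gs(1) ug a by (intro exI[of _ gs]) simp
 qed
qed

end

section \<open>Frobenius on polynomial rings\<close>

lemma CHAR_mpoly: "CHAR('m::monoid_add \<Rightarrow>\<^sub>0 'k::comm_ring_1) = CHAR('k)"
proof (rule CHAR_eqI)
 show "of_nat CHAR('k) = (0 :: 'm \<Rightarrow>\<^sub>0 'k)" by (simp flip: single_of_nat)
 fix x assume "of_nat x = (0 :: 'm \<Rightarrow>\<^sub>0 'k)"
 hence "lookup (of_nat x :: 'm \<Rightarrow>\<^sub>0 'k) 0 = 0" by simp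
 hence "of_nat x = (0::'k)" by (simp add: lookup_of_nat)
 thus "CHAR('k) dvd x" by (simp add: of_nat_eq_0_iff_char_dvd)
qed

definition mfun :: "('n::finite => nat) => ('n \<Rightarrow>\<^sub>0 nat)" where
 "mfun f = Abs_poly_mapping f"

lemma lookup_mfun [simp]: "lookup (mfun f) = f" by (simp add: mfun_def)

definition mtop :: "nat => 'n::finite \<Rightarrow>\<^sub>0 nat" where "mtop p = mfun (%_. p - 1)"
definition mdiv :: "nat => ('n::finite \<Rightarrow>\<^sub>0 nat) => ('n \<Rightarrow>\<^sub>0 nat)" where "mdiv p m = mfun (%i. lookup m i div p)"
definition mmod :: "nat => ('n::finite \<Rightarrow>\<^sub>0 nat) => ('n \<Rightarrow>\<^sub>0 nat)" where "mmod p m = mfun (%i. lookup m i mod p)"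
definition msc :: "nat => ('n::finite \<Rightarrow>\<^sub>0 nat) => ('n \<Rightarrow>\<^sub>0 nat)" where "msc k m = mfun (%i. k * lookup m i)"

lemma lookup_m [simp]:
 "lookup (mtop p) i = p - 1" "lookup (mdiv p m) i = lookup m i div p"
 "lookup (mmod p m) i = lookup m i mod p" "lookup (msc k m) i = k * lookup m i"
 by (simp_all add: mtop_def mdiv_def mmod_def msc_def)

lemma mdiv_mod: "msc p (mdiv p m) + mmod p m = m" by (rule poly_mapping_eqI) (simp add: lookup_add)

lemma mtop_eq: "(\<Sum>i\<in>UNIV. single i (p - 1)) = mtop p"
 by (rule poly_mapping_eqI) (simp add: lookup_sum lookup_single when_def)

lemma single_power: "single (m :: 'n::finite \<Rightarrow>\<^sub>0 nat) (c::'k::comm_ring_1) ^ k = single (msc k m) (c ^ k)"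
proof (induction k)
 case 0
 have "msc 0 m = 0" by (rule poly_mapping_eqI) simp
 thus ?case by simp
next
 case (Suc k)
 have "m + msc k m = msc (Suc k) m" by (rule poly_mapping_eqI) (simp add: lookup_add)
 thus ?case by (simp add: Suc mult_single)
qed

lemma finite_exps: "finite (exps p s)"
 unfolding exps_def by (rule finite_subset[OF _ finite_lists_length_eq[of "{..<p}" s]]) auto

lemma finite_bounded_monomials: "finite {m :: 'n::finite \<Rightarrow>\<^sub>0 nat. \<forall>i. lookup m i < q}"
proof -
 have "finite (PiE (UNIV :: 'n set) (%_. {..<q}))" by (rule finite_PiE) auto
 hence "finite (mfun ` PiE (UNIV :: 'n set) (%_. {..<q}))" by (rule finite_imageI)
 moreover have "{m. \<forall>i. lookup m i < q} <= mfun ` PiE (UNIV :: 'n set) (%_. {..<q})"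
 proof
  fix m :: "'n \<Rightarrow>\<^sub>0 nat" assume "m \<in> {m. \<forall>i. lookup m i < q}"
  hence "m = mfun (lookup m)" "lookup m \<in> PiE UNIV (%_. {..<q})" by (auto intro: poly_mapping_eqI)
  thus "m \<in> mfun ` PiE (UNIV :: 'n set) (%_. {..<q})" by blast
 qed
 ultimately show ?thesis by (rule rev_finite_subset)
qed

lemma finite_frob_index: "finite (frob_index p ys)" by (simp add: frob_index_def finite_exps finite_bounded_monomials)

section \<open>An explicit generator of the dual of Frobenius on the polynomial ring\<close>

locale frob_field =
 fixes p :: nat and ys :: "'k::field list" assumes p: "prime p" and ck: "CHAR('k) = p" and pb: "p_basis p ys"
begin

definition kc :: "'k => nat list => 'k" where
 "kc c = (THE g. (\<forall>j. j ~: exps p (length ys) --> g j = 0) & c = (\<Sum>j\<in>exps p (length ys). g j ^ p * list_mon ys j))"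

lemma kc: "j ~: exps p (length ys) ==> kc c j = 0" "c = (\<Sum>j\<in>exps p (length ys). kc c j ^ p * list_mon ys j)"
 using theI'[OF pb[unfolded p_basis_def, rule_format, of c]] by (auto simp: kc_def)

lemma kc_unique:
 assumes "!!j. j ~: exps p (length ys) ==> g j = 0" "c = (\<Sum>j\<in>exps p (length ys). g j ^ p * list_mon ys j)"
 shows "kc c = g"
 unfolding kc_def by (rule the1_equality[OF pb[unfolded p_basis_def, rule_format, of c]]) (use assms in auto)

lemmas frk = freshman[OF p ck]

lemma p1: "p > 0" "p > 1" using prime_gt_1_nat[OF p] by auto

lemma kc_add: "kc (c + d) j = kc c j + kc d j"
proof -
 have "kc (c + d) = (%j. kc c j + kc d j)"
 proof (rule kc_unique)
  show "c + d = (\<Sum>j\<in>exps p (length ys). (kc c j + kc d j) ^ p * list_mon ys j)"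
   using kc(2)[of c] kc(2)[of d] by (simp add: frk distrib_right sum.distrib)
 qed (simp add: kc(1))
 thus ?thesis by simp
qed

lemma kc_pow: "kc (b ^ p * c) j = b * kc c j"
proof -
 have "kc (b ^ p * c) = (%j. b * kc c j)"
 proof (rule kc_unique)
  have "b ^ p * c = b ^ p * (\<Sum>j\<in>exps p (length ys). kc c j ^ p * list_mon ys j)" using kc(2)[of c] by simp
  thus "b ^ p * c = (\<Sum>j\<in>exps p (length ys). (b * kc c j) ^ p * list_mon ys j)"
   by (simp add: sum_distrib_left power_mult_distrib mult.assoc)
 qed (simp add: kc(1))
 thus ?thesis by simp
qed

lemma kc_0 [simp]: "kc 0 j = 0" using kc_pow[of 0 0 j] by simp

lemma list_mon_div_mod: assumes "length a = length ys"
 shows "list_mon ys a = list_mon ys (map (%x. x div p) a) ^ p * list_mon ys (map (%x. x mod p) a)"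
 unfolding list_mon_def by (simp add: assms prod_power_distrib flip: power_mult power_add prod.distrib)

lemma kc_list_mon: assumes "length a = length ys"
 shows "kc (list_mon ys a) j = (if j = map (%x. x mod p) a then list_mon ys (map (%x. x div p) a) else 0)"
proof -
 let ?m = "map (%x. x mod p) a"
 have m: "?m \<in> exps p (length ys)" using assms p1 by (auto simp: exps_def)
 have "kc (list_mon ys ?m) = (%j. if j = ?m then 1 else 0)"
 proof (rule kc_unique)
  have "(\<Sum>j\<in>exps p (length ys). (if j = ?m then 1 else 0) ^ p * list_mon ys j) =
   (\<Sum>j\<in>exps p (length ys). if j = ?m then list_mon ys ?m else 0)"
   by (rule sum.cong) (use p1 in "auto simp: power_0_left")
  thus "list_mon ys ?m = (\<Sum>j\<in>exps p (length ys). (if j = ?m then 1 else 0) ^ p * list_mon ys j)"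
   using m finite_exps by simp
 qed (use m in auto)
 thus ?thesis unfolding list_mon_div_mod[OF assms] kc_pow by simp
qed

abbreviation tops :: "nat list" where "tops \<equiv> replicate (length ys) (p - 1)"

text \<open>\<open>frob_u\<close> on a single term: nonzero only if all exponents are p - 1 modulo
  p, and then the coefficient is read at the top index of the p-basis.\<close>

definition Us :: "('n::finite \<Rightarrow>\<^sub>0 nat) => 'k => ('n, 'k) mpoly" where
 "Us m c = (if mmod p m = mtop p then single (mdiv p m) (kc c tops) else 0)"

definition U :: "('n::finite, 'k) mpoly => ('n, 'k) mpoly" where
 "U a = (\<Sum>m\<in>keys a. Us m (lookup a m))"

lemma Us_0 [simp]: "Us m 0 = 0" by (simp add: Us_def)
lemma Us_add: "Us m (c + d) = Us m c + Us m d" by (simp add: Us_def kc_add single_add)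

lemma U_superset: "finite A ==> keys a <= A ==> U a = (\<Sum>m\<in>A. Us m (lookup a m))"
 unfolding U_def by (rule sum.mono_neutral_left) (auto simp: in_keys_iff)

lemma U_0 [simp]: "U 0 = 0" by (simp add: U_def)

lemma U_single: "U (single m c) = Us m c" by (cases "c = 0") (auto simp: U_def)

lemma U_add: "U (a + b) = U a + U b"
proof -
 let ?A = "keys a \<union> keys b"
 have "keys (a + b) <= ?A" by (rule keys_add)
 thus ?thesis by (simp add: U_superset[of ?A] lookup_add Us_add sum.distrib)
qed

lemma char_S: "CHAR(('n::finite, 'k) mpoly) = p" by (simp add: CHAR_mpoly ck)

lemmas frS = freshman[OF p char_S]

lemma U_pow: "U (b ^ p * a) = b * U (a :: ('n::finite, 'k) mpoly)"
proof (induction b rule: mpoly_induct)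
 case zero
 thus ?case using p1 by (simp add: power_0_left)
next
 case (add b c)
 thus ?case by (simp add: frS distrib_right U_add)
next
 case (single m c)
 show ?case
 proof (induction a rule: mpoly_induct)
  case (single m' c')
  have "mmod p (msc p m + m') = mmod p m'" "mdiv p (msc p m + m') = m + mdiv p m'"
   using p1 by (auto intro!: poly_mapping_eqI simp: lookup_add)
  thus ?case by (simp add: single_power mult_single U_single Us_def kc_pow)
 qed (auto simp: U_add distrib_left)
qed

text \<open>The basis element with complementary exponents. In its product with a basis element, the
  exponents of the variables and of the p-basis are all p - 1 modulo p only if the indices agree,
  and then the product is exactly the top element.\<close>

definition vd :: "nat list \<times> ('n \<Rightarrow>\<^sub>0 nat) => ('n::finite, 'k) mpoly" where
 "vd = (%(j, m). frob_basis ys (map (%x. p - 1 - x) j, mfun (%i. p - 1 - lookup m i)))"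

lemma list_mon_mult: assumes "length a = length ys" "length b = length ys"
 shows "list_mon ys a * list_mon ys b = list_mon ys (map2 (+) a b)"
 unfolding list_mon_def by (simp add: assms power_add flip: prod.distrib)

lemma list_mon_zeros: "list_mon ys (replicate (length ys) 0) = 1" by (simp add: list_mon_def)

lemma mod_top_iff: "x < p ==> y < p ==> (x + (p - 1 - y)) mod p = p - 1 \<longleftrightarrow> x = y"
proof
 assume xy: "x < p" "y < p" and m: "(x + (p - 1 - y)) mod p = p - 1"
 show "x = y"
 proof (cases "x + (p - 1 - y) < p")
  case False
  hence "(x + (p - 1 - y)) mod p = x + (p - 1 - y) - p" using xy by (simp add: mod_if)
  thus ?thesis using m xy False by linarith
 qed (use m xy in auto)
qed auto

lemma div_top: "x < p ==> (x + (p - Suc x)) div p = 0" by (rule div_less) linarith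

lemma U_dual:
 fixes e e' :: "nat list \<times> ('n::finite \<Rightarrow>\<^sub>0 nat)"
 assumes "e \<in> frob_index p ys" "e' \<in> frob_index p ys"
 shows "U (frob_basis ys e * vd e') = (if e = e' then 1 else 0)"
proof -
 obtain j m j' m' where e: "e = (j, m)" "e' = (j', m')" by fastforce
 have j: "j \<in> exps p (length ys)" "j' \<in> exps p (length ys)" "!!i. lookup m i < p" "!!i. lookup m' i < p"
  using assms by (auto simp: e frob_index_def)
 hence l: "length j = length ys" "length j' = length ys" "!!i. i < length ys ==> j ! i < p" "!!i. i < length ys ==> j' ! i < p"
  by (auto simp: exps_def)
 let ?a = "map2 (+) j (map (%x. p - 1 - x) j')" and ?m = "m + mfun (%i. p - 1 - lookup m' i)"
 have "frob_basis ys e * vd e' = single ?m (list_mon ys ?a)"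
  using l by (simp add: e vd_def frob_basis_def mult_single list_mon_mult)
 hence U: "U (frob_basis ys e * vd e') = Us ?m (list_mon ys ?a)" by (simp add: U_single)
 have "mmod p ?m = mtop p \<longleftrightarrow> (\<forall>i. (lookup m i + (p - 1 - lookup m' i)) mod p = p - 1)"
  by (auto simp: poly_mapping_eq_iff fun_eq_iff lookup_add)
 also have "\<dots> \<longleftrightarrow> m = m'" unfolding mod_top_iff[OF j(3,4)] by (auto simp: poly_mapping_eq_iff fun_eq_iff)
 finally have mm: "mmod p ?m = mtop p \<longleftrightarrow> m = m'" .
 have "tops = map (%x. x mod p) ?a \<longleftrightarrow> (\<forall>i<length ys. (j ! i + (p - 1 - j' ! i)) mod p = p - 1)"
  using l by (auto simp: list_eq_iff_nth_eq)
 also have "\<dots> \<longleftrightarrow> (\<forall>i<length ys. j ! i = j' ! i)" using mod_top_iff[OF l(3,4)] by blast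
 also have "\<dots> \<longleftrightarrow> j = j'" using l by (auto simp: list_eq_iff_nth_eq)
 finally have jj: "tops = map (%x. x mod p) ?a \<longleftrightarrow> j = j'" .
 show ?thesis
 proof (cases "e = e'")
  case True
  hence jm: "j = j'" "m = m'" by (auto simp: e)
  have "mdiv p ?m = 0" by (rule poly_mapping_eqI) (use j in "auto simp: lookup_add jm div_top")
  moreover have "map (%x. x div p) ?a = replicate (length ys) 0"
   by (rule nth_equalityI) (use l in "auto simp: jm div_top")
  ultimately have "Us ?m (list_mon ys ?a) = 1" using mm jj l jm list_mon_zeros by (simp add: Us_def kc_list_mon)
  thus ?thesis using U True by simp
 next
  case False
  thus ?thesis using U mm jj l by (auto simp: Us_def kc_list_mon e)
 qed
qed

lemma expand_ex: "\<exists>c. a = (\<Sum>e\<in>frob_index p ys. c e ^ p * frob_basis ys e)" for a :: "('n::finite, 'k) mpoly"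
proof (induction a rule: mpoly_induct)
 case zero
 show ?case using p1 by (intro exI[of _ "%_. 0"]) (simp add: power_0_left)
next
 case (add a b)
 then obtain c d where "a = (\<Sum>e\<in>frob_index p ys. c e ^ p * frob_basis ys e)" "b = (\<Sum>e\<in>frob_index p ys. d e ^ p * frob_basis ys e)" by blast
 thus ?case by (intro exI[of _ "%e. c e + d e"]) (simp add: frS distrib_right sum.distrib)
next
 case (single m c)
 let ?E = "frob_index p ys" and ?M = "{m :: 'n \<Rightarrow>\<^sub>0 nat. \<forall>i. lookup m i < p}"
 define d where "d = (%(j, m'). if m' = mmod p m then single (mdiv p m) (kc c j) else 0)"
 have M: "mmod p m \<in> ?M" using p1 by simp
 have "(\<Sum>e\<in>?E. d e ^ p * frob_basis ys e) = (\<Sum>j\<in>exps p (length ys). \<Sum>m'\<in>?M. d (j, m') ^ p * frob_basis ys (j, m'))"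
  unfolding frob_index_def by (simp add: sum.cartesian_product case_prod_unfold)
 also have "\<dots> = (\<Sum>j\<in>exps p (length ys). \<Sum>m'\<in>?M. if m' = mmod p m then single m (kc c j ^ p * list_mon ys j) else 0)"
  by (intro sum.cong) (use p1 in "auto simp: d_def frob_basis_def single_power mult_single mdiv_mod power_0_left")
 also have "\<dots> = (\<Sum>j\<in>exps p (length ys). single m (kc c j ^ p * list_mon ys j))"
  using M by (simp add: finite_bounded_monomials)
 also have "\<dots> = single m (\<Sum>j\<in>exps p (length ys). kc c j ^ p * list_mon ys j)"
  by (induction rule: infinite_finite_induct[of _ "exps p (length ys)"]) (auto simp: single_add)
 also have "\<dots> = single m c" using kc(2)[of c] by simp
 finally show ?case by (intro exI[of _ d]) simp
qed

lemma U_sum: "U (sum f A) = (\<Sum>x\<in>A. U (f x))" by (induction A rule: infinite_finite_induct) (auto simp: U_add)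

lemma coord_eq:
 fixes a :: "('n::finite, 'k) mpoly"
 assumes a: "a = (\<Sum>e\<in>frob_index p ys. c e ^ p * frob_basis ys e)" and e: "e \<in> frob_index p ys"
 shows "U (a * vd e) = c e"
proof -
 have "U (a * vd e) = (\<Sum>e'\<in>frob_index p ys. U (c e' ^ p * (frob_basis ys e' * vd e)))"
  by (simp add: a sum_distrib_right U_sum mult.assoc)
 also have "\<dots> = (\<Sum>e'\<in>frob_index p ys. if e' = e then c e else 0)"
  by (rule sum.cong) (use e in "auto simp: U_pow U_dual")
 finally show ?thesis using e by (simp add: finite_frob_index)
qed

lemma U_expand: "a = (\<Sum>e\<in>frob_index p ys. U (a * vd e) ^ p * frob_basis ys e)" for a :: "('n::finite, 'k) mpoly"
proof -
 obtain c where c: "a = (\<Sum>e\<in>frob_index p ys. c e ^ p * frob_basis ys e)" using expand_ex by blast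
 also have "\<dots> = (\<Sum>e\<in>frob_index p ys. U (a * vd e) ^ p * frob_basis ys e)"
  by (rule sum.cong) (auto simp: coord_eq[OF c])
 finally show ?thesis .
qed

lemma frob_u_eq: "frob_u p ys = (U :: ('n::finite, 'k) mpoly => _)"
proof
 fix a :: "('n, 'k) mpoly"
 let ?c = "%e. if e \<in> frob_index p ys then U (a * vd e) else 0"
 have "frob_coord p ys a = ?c" unfolding frob_coord_def
 proof (rule the_equality)
  show "(\<forall>e. e ~: frob_index p ys --> ?c e = 0) & a = (\<Sum>e\<in>frob_index p ys. ?c e ^ p * frob_basis ys e)"
   using U_expand[of a] by simp
 next
  fix c assume c: "(\<forall>e. e ~: frob_index p ys --> c e = 0) & a = (\<Sum>e\<in>frob_index p ys. c e ^ p * frob_basis ys e)"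
  thus "c = ?c" using coord_eq[of a c] by (auto simp: fun_eq_iff)
 qed
 moreover have "(tops, mtop p :: 'n \<Rightarrow>\<^sub>0 nat) \<in> frob_index p ys"
  using p1 by (auto simp: frob_index_def exps_def)
 moreover have "vd (tops, mtop p :: 'n \<Rightarrow>\<^sub>0 nat) = 1"
 proof -
  have "mfun (%i. 0) = (0 :: 'n \<Rightarrow>\<^sub>0 nat)" by (rule poly_mapping_eqI) simp
  thus ?thesis by (simp add: vd_def frob_basis_def list_mon_zeros)
 qed
 ultimately show "frob_u p ys a = U a" unfolding frob_u_def mtop_eq by simp
qed

lemma frob_basis_mult:
 fixes e e' :: "nat list \<times> ('n::finite \<Rightarrow>\<^sub>0 nat)"
 assumes "e \<in> frob_index p ys" "e' \<in> frob_index p ys"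
 shows "\<exists>b. \<exists>e''\<in>frob_index p ys. frob_basis ys e * frob_basis ys e' = b ^ p * frob_basis ys e''"
proof -
 obtain j m j' m' where e: "e = (j, m)" "e' = (j', m')" by fastforce
 have l: "length j = length ys" "length j' = length ys" using assms by (auto simp: e frob_index_def exps_def)
 let ?a = "map2 (+) j j'"
 have la: "length ?a = length ys" using l by simp
 have "frob_basis ys e * frob_basis ys e' = single (m + m') (list_mon ys ?a)"
  using l by (simp add: e frob_basis_def mult_single list_mon_mult)
 also have "\<dots> = single (mdiv p (m + m')) (list_mon ys (map (%x. x div p) ?a)) ^ p *
   frob_basis ys (map (%x. x mod p) ?a, mmod p (m + m'))"
  using list_mon_div_mod[OF la] by (simp add: frob_basis_def single_power mult_single mdiv_mod)
 finally show ?thesis by (intro exI bexI) (use la p1 in "auto simp: frob_index_def exps_def")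
qed

lemma frob_dual_mpoly:
 "frob_dual p (frob_u p ys) (frob_index p ys) (replicate (length ys) 0, 0)
   (frob_basis ys :: _ => ('n::finite, 'k) mpoly) vd"
proof
 show "(replicate (length ys) 0, 0 :: 'n \<Rightarrow>\<^sub>0 nat) \<in> frob_index p ys"
  using p1 by (auto simp: frob_index_def exps_def)
 show "frob_basis ys (replicate (length ys) 0, 0 :: 'n \<Rightarrow>\<^sub>0 nat) = 1"
  by (simp add: frob_basis_def list_mon_zeros)
qed (use p char_S finite_frob_index U_expand frob_basis_mult in "auto simp: frob_u_eq U_add U_pow U_dual")

end

section \<open>Ideals of the polynomial ring\<close>

lemma polyR_simps [simp]:
 "carrier ring_of_type_algebra = (UNIV :: 'a::comm_ring_1 set)"
 "monoid.mult ring_of_type_algebra = ((*) :: 'a => _)" "monoid.one ring_of_type_algebra = (1 :: 'a)"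
 "ring.zero ring_of_type_algebra = (0 :: 'a)" "ring.add ring_of_type_algebra = ((+) :: 'a => _)"
 by (simp_all add: ring_of_type_algebra_def)

lemma ring_polyR: "ring (ring_of_type_algebra :: 'a::comm_ring_1 ring)" by (rule ring_from_type_algebra)

lemma cring_polyR: "cring (ring_of_type_algebra :: 'a::comm_ring_1 ring)" by (rule cring_from_type_algebra)

lemma ideal_iff: "ideal J ring_of_type_algebra \<longleftrightarrow> is_ideal (J :: 'a::comm_ring_1 set)"
proof
 assume "ideal J ring_of_type_algebra"
 then interpret ideal J ring_of_type_algebra .
 show "is_ideal J" unfolding is_ideal_def
  using additive_subgroup.a_closed[OF is_additive_subgroup] additive_subgroup.zero_closed[OF is_additive_subgroup]
   I_l_closed by auto
next
 assume J: "is_ideal J"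
 have inv: "a_inv ring_of_type_algebra a = - (a::'a)" for a
  by (rule abelian_group.minus_equality[OF ring.is_abelian_group[OF ring_polyR]]) auto
 show "ideal J ring_of_type_algebra"
 proof (rule idealI[OF ring_polyR])
  show "subgroup J (add_monoid ring_of_type_algebra)"
   by (rule subgroup.intro) (use J inv in "auto simp: is_idealD a_inv_def")
 qed (use J in "auto intro: is_idealD")
qed

lemma Idl_eq_igen: "Idl\<^bsub>ring_of_type_algebra\<^esub> G = igen (G :: 'a::comm_ring_1 set)"
 unfolding genideal_def ideal_iff using igen_least[of _ G] igen_superset[of _ G] is_ideal_igen[of G] by blast

lemma frob_power_eq: "frob_power q J = fpow q J" by (simp add: frob_power_def fpow_def Idl_eq_igen)

lemma regular_seq_imp: "regular_seq fs ==> reg_list fs & igen (set fs) \<noteq> UNIV"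
 by (simp add: regular_seq_def reg_list_def Idl_eq_igen)

section \<open>Degrees\<close>

lemma mon_deg_0 [simp]: "mon_deg 0 = 0" by (simp add: mon_deg_def)

lemma mon_deg_add: "mon_deg (m + m') = mon_deg m + mon_deg m'" by (simp add: mon_deg_def lookup_add sum.distrib)

lemma mon_deg_eq_0_iff: "mon_deg m = 0 \<longleftrightarrow> m = 0"
 by (auto simp: mon_deg_def poly_mapping_eq_iff fun_eq_iff)

lemma mon_deg_msc [simp]: "mon_deg (msc k m) = k * mon_deg m" by (simp add: mon_deg_def sum_distrib_left)

lemma mon_deg_mtop [simp]: "mon_deg (mtop p :: 'n::finite \<Rightarrow>\<^sub>0 nat) = (p - 1) * CARD('n)"
 by (simp add: mon_deg_def)

definition dge :: "nat => ('n::finite, 'k::field) mpoly set" where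
 "dge k = {a. \<forall>m\<in>keys a. k \<le> mon_deg m}"

lemma dge_add: "a \<in> dge k ==> b \<in> dge k ==> a + b \<in> dge k"
 unfolding dge_def using keys_add[of a b] by blast

lemma dge_mult: "a \<in> dge k ==> b \<in> dge l ==> a * b \<in> dge (k + l)"
 unfolding dge_def using keys_mult[of a b] by (fastforce simp: mon_deg_add intro: add_mono)

lemma dge_0 [simp]: "0 \<in> dge k" "a \<in> dge 0" by (auto simp: dge_def)

lemma dge_mono: "k \<le> l ==> dge l <= dge k" by (auto simp: dge_def)

lemma dge_power: "a \<in> dge k ==> a ^ n \<in> dge (n * k)" by (induction n) (auto dest: dge_mult)

lemma homog_0 [simp]: "0 \<in> homog d" by (simp add: homog_def)

lemma homog_1 [simp]: "1 \<in> homog 0" by (simp add: homog_def)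

lemma homog_single: "mon_deg m = d ==> single m c \<in> homog d" by (simp add: homog_def)

lemma homog_add: "a \<in> homog d ==> b \<in> homog d ==> a + b \<in> homog d"
 unfolding homog_def using keys_add[of a b] by blast

lemma homog_uminus: "a \<in> homog d ==> - a \<in> homog d" unfolding homog_def by (auto simp: in_keys_iff)

lemma homog_diff: "a \<in> homog d ==> b \<in> homog d ==> a - b \<in> homog d"
 using homog_add[of a d "- b"] homog_uminus[of b d] by simp

lemma homog_mult: "a \<in> homog d ==> b \<in> homog e ==> a * b \<in> homog (d + e)"
 unfolding homog_def using keys_mult[of a b] by (fastforce simp: mon_deg_add)

lemma homog_power: "a \<in> homog d ==> a ^ n \<in> homog (n * d)" by (induction n) (auto dest: homog_mult)

lemma homog_sum: "(!!x. x \<in> A ==> f x \<in> homog d) ==> sum f A \<in> homog d"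
 by (induction A rule: infinite_finite_induct) (auto intro: homog_add)

lemma homog_dge: "homog d <= dge d" by (auto simp: homog_def dge_def)

lemma homog_prod_list: "\<forall>g\<in>set fs. \<exists>d. g \<in> homog d ==> \<exists>d. prod_list fs \<in> homog d"
proof (induction fs)
 case Nil
 show ?case by (simp, rule exI[of _ 0], rule homog_1)
next
 case (Cons g fs)
 then obtain d e where "g \<in> homog d" "prod_list fs \<in> homog e" by auto
 from homog_mult[OF this] show ?case by auto
qed

lemma homog_tot_deg: "a \<in> homog d ==> a \<noteq> 0 ==> tot_deg a = d"
proof -
 assume a: "a \<in> homog d" "a \<noteq> 0"
 have "keys a \<noteq> {}"
 proof
  assume "keys a = {}"
  hence "a = 0" by (intro poly_mapping_eqI) (simp add: in_keys_iff set_eq_iff)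
  thus False using a by simp
 qed
 then obtain m where "m \<in> keys a" by blast
 hence "mon_deg ` keys a = {d}" using a(1) by (force simp: homog_def)
 thus ?thesis by (simp add: tot_deg_def)
qed

lemma homog_zero_const: "a \<in> homog 0 ==> a = single 0 (lookup a 0)"
 by (rule poly_mapping_eqI) (auto simp: homog_def lookup_single when_def in_keys_iff mon_deg_eq_0_iff)

section \<open>The irrelevant ideal\<close>

lemma single_mem_max_fpow: assumes "q \<le> lookup m i"
 shows "single m (c::'k::field) \<in> fpow q (igen (range (var :: 'n::finite => _)))"
proof -
 let ?m' = "mfun (%j. lookup m j - (if j = i then q else 0))"
 have "?m' + msc q (single i 1) = m"
  by (rule poly_mapping_eqI) (use assms in "auto simp: lookup_add lookup_single when_def")
 hence "single m c = single ?m' c * var i ^ q" by (simp add: var_def single_power mult_single)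
 moreover have "var i ^ q \<in> fpow q (igen (range (var :: 'n => ('n, 'k) mpoly)))"
  by (rule fpow_mem) (auto intro: igen_superset)
 ultimately show ?thesis using is_idealD(3)[OF is_ideal_fpow] by auto
qed

lemma mpoly_sum_singles: "a = (\<Sum>m\<in>keys a. single m (lookup a m))"
 by (rule poly_mapping_eqI) (auto simp: lookup_sum lookup_single when_def in_keys_iff)

lemma max_ideal_iff: "a \<in> igen (range var) \<longleftrightarrow> lookup a 0 = 0" for a :: "('n::finite, 'k::field) mpoly"
proof
 have m: "lookup (a * var i) 0 = 0" for a :: "('n, 'k) mpoly" and i
 proof -
  have "0 ~: keys (a * var i)"
  proof
   assume "0 \<in> keys (a * var i)"
   then obtain m where "0 = m + single i (1::nat)" using keys_mult[of a "var i"] by (auto simp: var_def)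
   hence "mon_deg (m + single i (1::nat)) = 0" by simp
   hence "single i (1::nat) = 0" by (simp add: mon_deg_eq_0_iff mon_deg_add)
   thus False by (metis lookup_single_eq lookup_zero zero_neq_one)
  qed
  thus ?thesis by (simp add: in_keys_iff)
 qed
 show "a \<in> igen (range var) ==> lookup a 0 = 0" by (induction rule: igen.induct) (auto simp: m lookup_add)
next
 assume a: "lookup a 0 = 0"
 have "single m (lookup a m) \<in> igen (range (var :: 'n => ('n, 'k) mpoly))" if "m \<in> keys a" for m
 proof -
  have "m \<noteq> 0" using that a by (auto simp: in_keys_iff)
  then obtain i where "lookup m i \<noteq> 0" by (metis poly_mapping_eqI lookup_zero)
  thus ?thesis using single_mem_max_fpow[of 1 m i] fpow_1[OF is_ideal_igen] by auto
 qed
 thus "a \<in> igen (range var)" by (subst mpoly_sum_singles[of a]) (rule is_ideal_sum[OF is_ideal_igen])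
qed

text \<open>A monomial of degree above (q-1)N has an exponent at least q.\<close>

lemma dge_max_fpow: assumes "a \<in> dge ((q - 1) * CARD('n) + 1)"
 shows "(a :: ('n::finite, 'k::field) mpoly) \<in> fpow q (igen (range var))"
proof -
 have "single m (lookup a m) \<in> fpow q (igen (range (var :: 'n => ('n, 'k) mpoly)))" if "m \<in> keys a" for m
 proof -
  have d: "(q - 1) * CARD('n) < mon_deg m" using assms that by (auto simp: dge_def)
  have "\<exists>i. q \<le> lookup m i"
  proof (rule ccontr)
   assume "\<not> ?thesis"
   hence lt: "lookup m i < q" for i by (simp add: not_le)
   have "lookup m i \<le> q - 1" for i using lt[of i] by linarith
   hence "mon_deg m \<le> (\<Sum>i\<in>(UNIV :: 'n set). q - 1)" unfolding mon_deg_def by (intro sum_mono)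
   thus False using d by (simp add: mult.commute)
  qed
  thus ?thesis using single_mem_max_fpow by blast
 qed
 thus ?thesis by (subst mpoly_sum_singles[of a]) (rule is_ideal_sum[OF is_ideal_fpow])
qed

section \<open>Complete intersections in projective space\<close>

lemma assumes "p > (0::nat)"
 shows top_mod: "(p * l + (p - 1)) mod p = p - 1" and top_div: "(p * l + (p - 1)) div p = l"
proof -
 have c: "p * l + (p - 1) = (p - 1) + p * l" by simp
 show "(p * l + (p - 1)) mod p = p - 1" unfolding c using assms by (simp only: mod_mult_self2) simp
 have "(p - 1) div p = 0" using assms by (intro div_less) simp
 thus "(p * l + (p - 1)) div p = l" unfolding c using assms by (simp only: div_mult_self2)
qed

context frob_field
begin

lemma lookup_U: "lookup (U a) m = kc (lookup a (msc p m + mtop p)) tops"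
proof (induction a rule: mpoly_induct)
 case (single m' c)
 have "mmod p m' = mtop p & mdiv p m' = m \<longleftrightarrow> m' = msc p m + mtop p"
 proof
  assume "mmod p m' = mtop p & mdiv p m' = m"
  thus "m' = msc p m + mtop p" using mdiv_mod[of p m'] by simp
 next
  assume "m' = msc p m + mtop p"
  thus "mmod p m' = mtop p & mdiv p m' = m"
   by (intro conjI poly_mapping_eqI) (simp_all only: lookup_add lookup_m top_mod[OF p1(1)] top_div[OF p1(1)])
 qed
 thus ?case by (auto simp: U_single Us_def lookup_single when_def)
qed (auto simp: U_add lookup_add kc_add)

lemma keys_U: "m \<in> keys (U a) ==> msc p m + mtop p \<in> keys a" by (metis in_keys_iff kc_0 lookup_U)

lemma U_homog: "a \<in> homog (p * d + (p - 1) * CARD('n)) ==> U (a :: ('n::finite, 'k) mpoly) \<in> homog d"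
 unfolding homog_def using p1 by (auto dest!: keys_U bspec simp: mon_deg_add)

lemma U_dge: "a \<in> dge (p * d + (p - 1) * CARD('n) + 1) ==> U (a :: ('n::finite, 'k) mpoly) \<in> dge (d + 1)"
 unfolding dge_def
proof (intro CollectI ballI)
 fix m assume a: "a \<in> {a. \<forall>m\<in>keys a. p * d + (p - 1) * CARD('n) + 1 \<le> mon_deg m}" and m: "m \<in> keys (U a)"
 from keys_U[OF m] a have "p * d + (p - 1) * CARD('n) + 1 \<le> mon_deg (msc p m + mtop p :: 'n \<Rightarrow>\<^sub>0 nat)" by blast
 hence "p * d + (p - 1) * CARD('n) + 1 \<le> p * mon_deg m + (p - 1) * CARD('n)"
  by (simp only: mon_deg_add mon_deg_msc mon_deg_mtop)
 hence "p * d < p * mon_deg m" by linarith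
 thus "d + 1 \<le> mon_deg m" using p1 by simp
qed

end

section \<open>The criterion for a homogeneous regular sequence\<close>

locale fedder = frob_field p ys for p and ys :: "'k::field list" +
 fixes fs :: "('n::finite, 'k) mpoly list" and f :: "('n, 'k) mpoly" and I :: "('n, 'k) mpoly set"
 assumes hom: "\<forall>g\<in>set fs. \<exists>d. g \<in> homog d" and reg: "reg_list fs" and proper: "igen (set fs) \<noteq> UNIV"
  and I: "I = igen (set fs)" and f: "f = prod_list fs"
begin

sublocale S: frob_dual p "frob_u p ys :: ('n, 'k) mpoly => _" "frob_index p ys" "(replicate (length ys) 0, 0)"
 "frob_basis ys" vd by (rule frob_dual_mpoly)

abbreviation u where "u \<equiv> (frob_u p ys :: ('n, 'k) mpoly => _)"

abbreviation M where "M \<equiv> igen (range (var :: 'n => ('n, 'k) mpoly))"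

lemma is_ideal_I: "is_ideal I" by (simp add: I)

text \<open>A homogeneous generator outside the irrelevant ideal is a nonzero constant, which a
  proper ideal excludes.\<close>

lemma I_sub_M: "I <= M" unfolding I
proof (rule igen_least)
 show "set fs <= M"
 proof
  fix g assume g: "g \<in> set fs"
  then obtain d where d: "g \<in> homog d" using hom by blast
  show "g \<in> M"
  proof (rule ccontr)
   assume "g ~: M"
   hence n: "lookup g 0 \<noteq> 0" by (simp add: max_ideal_iff)
   hence "0 \<in> keys g" by (simp add: in_keys_iff)
   hence "d = 0" using d by (auto simp: homog_def)
   define c where "c = lookup g 0"
   have gc: "g = single 0 c" using d homog_zero_const[of g] `d = 0` by (simp add: c_def)
   have "c \<noteq> 0" using n by (simp add: c_def)
   hence "1 \<in> igen (set fs)" using igen_mult[OF g, of "single 0 (inverse c)"] by (simp add: gc mult_single)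
   hence "a \<in> igen (set fs)" for a using is_idealD(3)[OF is_ideal_igen, of 1 "set fs" a] by simp
   thus False using proper by blast
  qed
 qed
qed simp

lemma p_monomials_eq: "p_monomials p ys = S.pmon" by (simp add: p_monomials_def S.pmon_def)

lemma Delta1_imp: "d \<in> Delta1 p ys a ==> \<exists>c. d = S.delta a + c ^ p"
proof -
 assume "d \<in> Delta1 p ys a"
 then obtain as c where as: "d = delta_sum p as + c ^ p" "set as <= S.pmon" "sum_list as = a"
  by (auto simp: Delta1_def p_monomials_eq)
 from S.dsum_delta[OF as(2)] obtain e where "dsum p as = S.delta a + e ^ p" using as by auto
 hence "d = S.delta a + (e + c) ^ p" by (simp add: as delta_sum_eq S.fr)
 thus ?thesis by blast
qed

lemma delta_Delta1: "S.delta a \<in> Delta1 p ys a"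
proof -
 have "S.delta a = delta_sum p (S.delta_list a) + 0 ^ p" using p1 by (simp add: S.delta_def delta_sum_eq power_0_left)
 thus ?thesis unfolding Delta1_def p_monomials_eq using S.delta_list(1,2)[of a] by blast
qed

lemma u_Delta1: "D \<in> Delta1 p ys (f ^ (p - 1)) ==> u h = 0 ==> u (D * h) = S.th f h"
proof -
 assume D: "D \<in> Delta1 p ys (f ^ (p - 1))" and h: "u h = 0"
 from Delta1_imp[OF D] obtain c where "D = S.delta (f ^ (p - 1)) + c ^ p" by blast
 thus ?thesis using S.u_delta_cong[OF h] by (simp only: S.th_def)
qed

lemma theta_eq: "u h = 0 ==> theta p ys f h = S.th f h"
proof -
 assume h: "u h = 0"
 show ?thesis unfolding theta_def
 proof (rule the_equality)
  show "\<exists>d\<in>Delta1 p ys (f ^ (p - 1)). S.th f h = u (d * h)"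
   by (rule bexI[OF _ delta_Delta1]) (simp only: S.th_def)
  show "c = S.th f h" if "\<exists>d\<in>Delta1 p ys (f ^ (p - 1)). c = u (d * h)" for c
   using that u_Delta1[OF _ h] by blast
 qed
qed

lemma col_eq: "colon (frob_power p I) I = S.col I" by (simp add: colon_def S.col_def frob_power_eq)

lemma I_seq_eq: "I_seq p ys f I n = S.Is f I n"
proof (induction n rule: less_induct)
 case (less n)
 consider "n = 0" | "n = Suc 0" | s where "n = Suc (Suc s)" by (cases n; cases "n - 1"; auto)
 thus ?case
 proof cases
  case 3
  have "theta p ys f ` (S.Is f I (Suc s) \<inter> v_perp p ys) = S.th f ` (S.Is f I (Suc s) \<inter> {h. u h = 0})"
   by (auto simp: v_perp_def theta_eq intro!: image_eqI)
  thus ?thesis using less[of "Suc s"] 3 by (simp add: col_eq)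
 qed (auto simp: col_eq)
qed

lemma fedder_height:
 "n \<ge> 1 ==> (\<exists>gs. length gs = n & (\<forall>g\<in>set (tl gs). u g = 0) & (\<forall>x\<in>wideal I. S.Psi gs x \<in> I) & u (hd gs) ~: M)
  \<longleftrightarrow> \<not> I_seq p ys f I n <= frob_power p max_ideal"
 using S.fedder_criterion[OF reg I f is_ideal_igen I_sub_M, of n]
 by (simp add: I_seq_eq frob_power_eq max_ideal_def Idl_eq_igen)

end

text \<open>The infimum depends only on the first n with A n, so the predicates need to be compared
  only as long as A has failed so far. In the Calabi-Yau case the comparison is available just in
  that range.\<close>

lemma Inf_enat_eq:
 assumes "!!n. n \<ge> 1 ==> (!!l. 1 \<le> l ==> l < n ==> \<not> A l) ==> A n \<longleftrightarrow> B n"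
 shows "Inf {enat n | n. n \<ge> 1 & A n} = Inf {enat n | n. n \<ge> 1 & B n}"
proof -
 have 1: "\<exists>m\<le>n. m \<ge> 1 & B m" if "n \<ge> 1" "A n" for n using that
 proof (induction n rule: less_induct)
  case (less n)
  show ?case
  proof (cases "\<exists>l. 1 \<le> l & l < n & A l")
   case True
   thus ?thesis using less.IH by (meson less_imp_le order_trans)
  next
   case False
   thus ?thesis using assms[of n] less.prems by blast
  qed
 qed
 have 2: "\<exists>m\<le>n. m \<ge> 1 & A m" if "n \<ge> 1" "B n" for n
 proof (cases "\<exists>l. 1 \<le> l & l < n & A l")
  case True
  thus ?thesis by (meson less_imp_le)
 next
  case False
  thus ?thesis using assms[of n] that by blast
 qed
 show ?thesis
 proof (rule antisym; rule Inf_mono)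
  fix b assume "b \<in> {enat n | n. n \<ge> 1 & B n}"
  then obtain n where "b = enat n" "n \<ge> 1" "B n" by blast
  with 2[of n] show "\<exists>a\<in>{enat n | n. n \<ge> 1 & A n}. a \<le> b" by force
 next
  fix b assume "b \<in> {enat n | n. n \<ge> 1 & A n}"
  then obtain n where "b = enat n" "n \<ge> 1" "A n" by blast
  with 1[of n] show "\<exists>a\<in>{enat n | n. n \<ge> 1 & B n}. a \<le> b" by force
 qed
qed

section \<open>The Calabi-Yau case\<close>

context frob_dual
begin

text \<open>A representative of Delta_1(f^(p-1)) read off from the Leibniz rule, for which y u(D b)
  stays in an ideal inside I_1 for every generator y. The inductive step multiplies by x^(p-1),
  which turns g^(p-1) into (x g)^(p-1), and subtracts a term whose factor g^(p-1) contains
  y^(p-1).\<close>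

lemma delta_prod_list_power:
 fixes fs :: "'a list" shows "\<exists>D c. delta (prod_list fs ^ (p - 1)) = D + c ^ p &
  (\<forall>g\<in>set fs. \<forall>b. g * u (D * b) \<in> igen (insert (prod_list fs ^ (p - 1)) ((%x. x ^ p) ` set fs)))"
proof (induction fs)
 case Nil
 show ?case using p_pos' by (intro exI[of _ "delta 1"] exI[of _ 0]) (simp add: power_0_left)
next
 case (Cons x fs)
 define g where "g = prod_list fs"
 from Cons obtain D c where D: "delta (g ^ (p - 1)) = D + c ^ p"
  "!!y b. y \<in> set fs ==> y * u (D * b) \<in> igen (insert (g ^ (p - 1)) ((%x. x ^ p) ` set fs))"
  unfolding g_def by blast
 let ?J = "igen (insert ((x * g) ^ (p - 1)) ((%x. x ^ p) ` set (x # fs)))"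
 have p2: "p \<ge> 2" using prime prime_ge_2_nat by blast
 hence s: "Suc (p - 2) = p - 1" by simp
 obtain e where e: "delta ((x * g) ^ (p - 1)) = (x ^ (p - 1)) ^ p * delta (g ^ (p - 1)) - (g ^ (p - 1) * x ^ (p - 2)) ^ p * delta x + e ^ p"
  using delta_factor by blast
 define D' where "D' = (x ^ (p - 1)) ^ p * D - (g ^ (p - 1) * x ^ (p - 2)) ^ p * delta x"
 have "delta ((x * g) ^ (p - 1)) = D' + (x ^ (p - 1) * c + e) ^ p"
  unfolding e D D'_def by (simp add: fr power_mult_distrib algebra_simps flip: power_mult)
 moreover have "y * u (D' * b) \<in> ?J" if y: "y \<in> set (x # fs)" for y b
 proof -
  have uD: "u (D' * b) = x ^ (p - 1) * u (D * b) - (g ^ (p - 1) * x ^ (p - 2)) * u (delta x * b)"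
   unfolding D'_def by (simp only: left_diff_distrib u_diff mult.assoc[of "_ ^ p"] u_pow)
  have pp: "y ^ p \<in> ?J" using y by (intro igen_superset) auto
  show ?thesis
  proof (cases "y = x")
   case True
   have "x * u (D' * b) = x ^ Suc (p - 1) * u (D * b) - (g ^ (p - 1) * x ^ Suc (p - 2)) * u (delta x * b)"
    unfolding uD by (simp only: right_diff_distrib power_Suc mult_ac)
   also have "\<dots> = x ^ p * u (D * b) - (x * g) ^ (p - 1) * u (delta x * b)"
    using p2 s by (simp add: power_mult_distrib mult.commute)
   also have "\<dots> \<in> ?J"
    by (intro is_idealD(6)[OF is_ideal_igen] is_idealD(4)[OF is_ideal_igen] pp[unfolded True] igen_superset) auto
   finally show ?thesis using True by simp
  next
   case False
   hence yf: "y \<in> set fs" using y by simp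
   have 1: "x ^ (p - 1) * a \<in> ?J" if "a \<in> igen (insert (g ^ (p - 1)) ((%x. x ^ p) ` set fs))" for a using that
   proof induction
    case (igen_mult z r)
    have "x ^ (p - 1) * z \<in> ?J"
    proof (cases "z = g ^ (p - 1)")
     case True
     have "(x * g) ^ (p - 1) \<in> ?J" by (rule igen_superset) simp
     thus ?thesis using True by (simp add: power_mult_distrib)
    next
     case False
     hence "z \<in> ?J" using igen_mult by (intro igen_superset) auto
     thus ?thesis by (rule is_idealD(3)[OF is_ideal_igen])
    qed
    thus ?case using is_idealD(3)[OF is_ideal_igen, of "x ^ (p - 1) * z" _ r] by (simp only: mult.left_commute)
   qed (auto simp: distrib_left intro: is_idealD[OF is_ideal_igen])
   obtain h where h: "g = y * h" using prod_list_dvd[OF yf] unfolding g_def by (auto elim: dvdE)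
   have "y * g ^ (p - 1) = y ^ Suc (p - 1) * h ^ (p - 1)" by (simp add: h power_mult_distrib mult.assoc)
   hence 2: "y * g ^ (p - 1) = y ^ p * h ^ (p - 1)" using p_pos' by simp
   have "y * u (D' * b) = x ^ (p - 1) * (y * u (D * b)) - (y * g ^ (p - 1)) * (x ^ (p - 2) * u (delta x * b))"
    unfolding uD by (simp add: right_diff_distrib mult_ac)
   also have "\<dots> \<in> ?J"
    unfolding 2 by (intro is_idealD(6)[OF is_ideal_igen] 1 D(2) yf is_idealD(4)[OF is_ideal_igen] pp)
   finally show ?thesis .
  qed
 qed
 ultimately show ?case unfolding g_def by (metis prod_list.Cons)
qed

text \<open>For e = y^p r with y a generator, u(D y^p r) = y u(D r), which the representative D of
  \<open>delta_prod_list_power\<close> controls.\<close>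

lemma th_fpow_col: assumes I: "I = igen (set fs)" and f: "f = prod_list fs" and e: "e \<in> fpow p I" "u e = 0"
 shows "th f e \<in> col I"
proof -
 obtain D c where D: "delta (f ^ (p - 1)) = D + c ^ p"
  "!!y b. y \<in> set fs ==> y * u (D * b) \<in> igen (insert (f ^ (p - 1)) ((%x. x ^ p) ` set fs))"
  using delta_prod_list_power[of fs] unfolding f by blast
 let ?J = "igen (insert (f ^ (p - 1)) ((%x. x ^ p) ` set fs))"
 have sub: "?J <= col I"
 proof (rule igen_least[OF is_ideal_col])
  have "f ^ (p - 1) \<in> col I" unfolding col_def using fpow_prod_mult[of _ 0 fs 1] fpow_1[of I] by (auto simp: I f)
  moreover have "x ^ p \<in> col I" if "x \<in> set fs" for x
   using fpow_sub_col[of I] fpow_mem[of x I p] that by (auto simp: I intro: igen_superset)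
  ultimately show "insert (f ^ (p - 1)) ((%x. x ^ p) ` set fs) <= col I" by auto
 qed
 have "e \<in> igen ((%x. x ^ p) ` set fs)" using e(1) fpow_igen[of 1 "set fs"] by (simp add: I)
 hence "u (D * e) \<in> ?J"
 proof induction
  case (igen_mult x r)
  then obtain y where "y \<in> set fs" "x = y ^ p" by auto
  thus ?case using D(2)[of y r] u_pow[of y "D * r"] by (simp add: mult_ac)
 qed (auto simp: distrib_left u_add intro: is_idealD[OF is_ideal_igen])
 moreover have "th f e = u (D * e)" unfolding th_def D(1) by (rule u_delta_cong[OF e(2)])
 ultimately show ?thesis using sub by auto
qed

end

context fedder
begin

lemma fr_dge: "a \<in> dge 1 ==> (a ^ p :: ('n, 'k) mpoly) \<in> dge 1"
 using dge_power[of a 1 p] dge_mono[of 1 p] p1 by auto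

lemma vd_e0_homog: "vd (replicate (length ys) 0, 0) \<in> (homog ((p - 1) * CARD('n)) :: ('n, 'k) mpoly set)"
proof -
 have "mfun (%i. p - 1 - lookup (0 :: 'n \<Rightarrow>\<^sub>0 nat) i) = mtop p" by (rule poly_mapping_eqI) simp
 thus ?thesis by (auto simp: vd_def frob_basis_def intro!: homog_single)
qed

text \<open>Elements of degree above (p-1)N, the top degree of S/m^[p].\<close>

abbreviation H :: "('n, 'k) mpoly set" where "H \<equiv> dge ((p - 1) * CARD('n) + 1)"

abbreviation con :: "'k => ('n, 'k) mpoly" where "con c \<equiv> single 0 c"

lemma H_sub: "H <= fpow p M" using dge_max_fpow[of _ p] by auto

lemma con_homog: "con c \<in> homog 0" by (rule homog_single) simp

lemma fI_sub_fM: "fpow p I <= fpow p M" unfolding fpow_def using I_sub_M by (intro igen_mono) auto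

text \<open>In this degree \<open>u\<close> produces a constant, and a constant in the irrelevant
  ideal is zero.\<close>

lemma homog_ker: "t \<in> homog ((p - 1) * CARD('n)) ==> t \<in> fpow p M ==> u t = 0"
proof -
 assume t: "t \<in> homog ((p - 1) * CARD('n))" "t \<in> fpow p M"
 have "u t \<in> homog 0" unfolding frob_u_eq using t U_homog[of t 0] by simp
 moreover have "u t \<in> M" using S.up_fpow[OF is_ideal_igen, of t 1] t by simp
 ultimately show "u t = 0" using homog_zero_const[of "u t"] by (simp add: max_ideal_iff)
qed

lemma not_const_dge: "lookup a 0 = 0 ==> a \<in> dge 1"
 unfolding dge_def by (auto simp: in_keys_iff Suc_le_eq) (metis mon_deg_eq_0_iff not_gr0)

end

locale fedder_cy = fedder p ys fs f I for p and ys :: "'k::field list" and fs :: "('n::finite, 'k) mpoly list" and f I +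
 fixes D :: "('n, 'k) mpoly"
 assumes deg: "tot_deg f = CARD('n)" and D: "D \<in> Delta1 p ys (f ^ (p - 1))" "D \<in> homog (p * (p - 1) * CARD('n))"
begin

text \<open>\<open>G i\<close> is g_(i+1) of the theorem: the exponent is 1 + p + ... +
  p^(i-1).\<close>

definition G :: "nat => ('n, 'k) mpoly" where "G i = f ^ (p - 1) * D ^ (\<Sum>j<i. p ^ j)"

lemma f_homog: "f \<in> homog CARD('n)"
proof -
 obtain d where d: "f \<in> homog d" using homog_prod_list[OF hom] f by auto
 have "f \<noteq> 0"
 proof
  assume "f = 0"
  hence "tot_deg f = 0" by (simp add: tot_deg_def)
  thus False using deg by simp
 qed
 thus ?thesis using homog_tot_deg[OF d] deg d by simp
qed

lemma G_homog: "G i \<in> homog ((p ^ Suc i - 1) * CARD('n))"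
proof -
 have g: "(p - 1) * (\<Sum>j<i. p ^ j) = p ^ i - 1" by (induction i) (use p1 in "auto simp: algebra_simps")
 have e: "(p - 1) * CARD('n) + (\<Sum>j<i. p ^ j) * (p * (p - 1) * CARD('n)) = (p ^ Suc i - 1) * CARD('n)"
 proof -
  have "q * n + s * (p * q * n) = (q + p * (q * s)) * n" for q n s :: nat by (simp add: algebra_simps)
  hence "(p - 1) * CARD('n) + (\<Sum>j<i. p ^ j) * (p * (p - 1) * CARD('n)) = ((p - 1) + p * ((p - 1) * (\<Sum>j<i. p ^ j))) * CARD('n)" .
  also have "(p - 1) + p * ((p - 1) * (\<Sum>j<i. p ^ j)) = p ^ Suc i - 1"
   unfolding g using p1 by (simp add: diff_mult_distrib2)
  finally show ?thesis .
 qed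
 show ?thesis using homog_mult[OF homog_power[OF f_homog, of "p - 1"] homog_power[OF D(2), of "\<Sum>j<i. p ^ j"]]
  unfolding G_def e .
qed

lemma up_homog: "a \<in> homog ((p ^ (k + l) - 1) * CARD('n)) ==> (u ^^ k) a \<in> homog ((p ^ l - 1) * CARD('n))"
proof (induction k arbitrary: a)
 case (Suc k)
 have "(p ^ (Suc k + l) - 1) * CARD('n) = p * ((p ^ (k + l) - 1) * CARD('n)) + (p - 1) * CARD('n)"
 proof -
  have "p ^ (Suc k + l) - 1 = p * (p ^ (k + l) - 1) + (p - 1)" using p1 by (simp add: diff_mult_distrib2)
  thus ?thesis by (simp only: distrib_right mult.assoc)
 qed
 hence "u a \<in> homog ((p ^ (k + l) - 1) * CARD('n))" unfolding frob_u_eq using U_homog[of a] Suc.prems by simp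
 from Suc.IH[OF this] show ?case by (simp add: funpow_swap1)
qed simp

lemma G_0 [simp]: "G 0 = f ^ (p - 1)" by (simp add: G_def)

text \<open>Represents the part of I_l in degree (p-1)N: g_(i+1) has degree (p^(i+1) - 1)N, which
  u^i lowers to (p-1)N. The constants stay inside u^i because they need not be p-th powers.\<close>

definition Ts :: "nat => ('n, 'k) mpoly set" where
 "Ts l = {\<Sum>i<l. (u ^^ i) (con (c i) * G i) | c. True}"

lemma T_term: "(u ^^ i) (con c * G i) \<in> homog ((p - 1) * CARD('n))"
 using up_homog[of "con c * G i" i 1] homog_mult[OF con_homog[of c] G_homog[of i]] by simp

lemma T_homog: assumes "t \<in> Ts l" shows "t \<in> homog ((p - 1) * CARD('n))"
proof -
 obtain c where "t = (\<Sum>i<l. (u ^^ i) (con (c i) * G i))" using assms by (auto simp: Ts_def)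
 thus ?thesis by (simp only:) (rule homog_sum[OF T_term])
qed

lemma u_D_step: "u (D * (u ^^ i) (con c * G i)) = (u ^^ Suc i) (con c * G (Suc i))"
proof -
 have "D * (u ^^ i) (con c * G i) = (u ^^ i) (D ^ (p ^ i) * (con c * G i))" by (simp add: S.up_pow)
 also have "D ^ (p ^ i) * (con c * G i) = con c * G (Suc i)" by (simp add: G_def power_add mult_ac)
 finally show ?thesis by simp
qed

lemma T_Suc: "t \<in> Ts l ==> u (D * t) + con c * f ^ (p - 1) \<in> Ts (Suc l)"
proof -
 assume "t \<in> Ts l"
 then obtain d where d: "t = (\<Sum>i<l. (u ^^ i) (con (d i) * G i))" by (auto simp: Ts_def)
 have "u (D * t) + con c * f ^ (p - 1) = (\<Sum>i<Suc l. (u ^^ i) (con (case_nat c d i) * G i))"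
  unfolding sum.lessThan_Suc_shift d by (simp add: sum_distrib_left S.u_sum u_D_step add.commute)
 thus ?thesis unfolding Ts_def by blast
qed

lemma T_cases: "x \<in> Ts (Suc l) ==> \<exists>t\<in>Ts l. \<exists>c. x = u (D * t) + con c * f ^ (p - 1)"
proof -
 assume "x \<in> Ts (Suc l)"
 then obtain d where d: "x = (\<Sum>i<Suc l. (u ^^ i) (con (d i) * G i))" by (auto simp: Ts_def)
 let ?t = "\<Sum>i<l. (u ^^ i) (con (d (Suc i)) * G i)"
 have "x = u (D * ?t) + con (d 0) * f ^ (p - 1)"
  unfolding d sum.lessThan_Suc_shift by (simp add: sum_distrib_left S.u_sum u_D_step add.commute)
 moreover have "?t \<in> Ts l" unfolding Ts_def by (rule CollectI, rule exI[of _ "%i. d (Suc i)"]) simp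
 ultimately show ?thesis by blast
qed

lemma f_col: "con c * f ^ (p - 1) \<in> S.col I"
proof -
 have fI: "f ^ (p - 1) * b \<in> fpow p I" if "b \<in> I" for b
  using S.fpow_prod_mult[of b 0 fs 1] that fpow_1[OF is_ideal_I] by (simp add: I f)
 have "con c * f ^ (p - 1) * b \<in> fpow p I" if "b \<in> I" for b
  using is_idealD(3)[OF is_ideal_fpow fI[OF that], of "con c"] by (simp only: mult.assoc)
 thus ?thesis by (simp add: S.col_def)
qed

text \<open>The recursion applies theta only on the kernel of \<open>u\<close>. Elements of degree
  (p-1)N in m^[p] lie there by \<open>homog_ker\<close>, whence the assumption on the earlier
  ideals.\<close>

lemma T_sub_Is: "(!!i. 1 \<le> i ==> i \<le> l ==> S.Is f I i <= fpow p M) ==> Ts (Suc l) <= S.Is f I (Suc l)"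
proof (induction l)
 case 0
 have "Ts 0 = {0}" by (auto simp: Ts_def)
 thus ?case using T_cases[of _ 0] f_col by auto
next
 case (Suc l)
 show ?case
 proof
  fix x assume "x \<in> Ts (Suc (Suc l))"
  from T_cases[OF this] obtain t c where t: "t \<in> Ts (Suc l)" "x = u (D * t) + con c * f ^ (p - 1)" by blast
  have tI: "t \<in> S.Is f I (Suc l)" using Suc t by auto
  hence "t \<in> fpow p M" using Suc.prems[of "Suc l"] by auto
  hence ut: "u t = 0" using homog_ker T_homog[OF t(1)] by blast
  show "x \<in> S.Is f I (Suc (Suc l))" unfolding t(2) u_Delta1[OF D(1) ut] by (rule S.th_mem_Is[OF tI ut f_col])
 qed
qed

text \<open>By the colon formula I_1 consists of multiples of f^(p-1) modulo I^[p]. As f^(p-1)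
  already has degree (p-1)N, every multiplier without constant term lands in
  \<open>H\<close>.\<close>

lemma col_dec: "c \<in> S.col I ==> \<exists>c0 e h. c = con c0 * f ^ (p - 1) + e + h & e \<in> fpow p I & h \<in> H"
proof -
 assume c: "c \<in> S.col I"
 have "c * g \<in> fpow (p ^ 1) (igen (set fs))" if "g \<in> set fs" for g
  using c that by (auto simp: S.col_def I intro: igen_superset)
 from S.colon_fpow[OF reg this] obtain s where s: "c - s * f ^ (p - 1) \<in> fpow p I" by (auto simp: I f)
 let ?s0 = "lookup s 0"
 have "s - con ?s0 \<in> dge 1" by (rule not_const_dge) (simp add: lookup_minus)
 from dge_mult[OF this subsetD[OF homog_dge homog_power[OF f_homog, of "p - 1"]]]
 have "(s - con ?s0) * f ^ (p - 1) \<in> H" by (simp add: add.commute)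
 moreover have "c = con ?s0 * f ^ (p - 1) + (c - s * f ^ (p - 1)) + (s - con ?s0) * f ^ (p - 1)"
  by (simp add: algebra_simps)
 ultimately show ?thesis using s by blast
qed

lemma Is_dec: "(!!i. 1 \<le> i ==> i \<le> l ==> S.Is f I i <= fpow p M) ==> a \<in> S.Is f I (Suc l) ==>
 \<exists>t\<in>Ts (Suc l). \<exists>e h. a = t + e + h & e \<in> fpow p I & h \<in> H"
proof (induction l arbitrary: a)
 case 0
 from col_dec[of a] 0 obtain c0 e h where a: "a = con c0 * f ^ (p - 1) + e + h" "e \<in> fpow p I" "h \<in> H" by auto
 have "0 \<in> Ts 0" by (auto simp: Ts_def)
 from T_Suc[OF this, of c0] have "con c0 * f ^ (p - 1) \<in> Ts (Suc 0)" by simp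
 thus ?case using a by blast
next
 case (Suc l)
 from Suc.prems(2) obtain b c where bc: "a = S.th f b + c" "b \<in> S.Is f I (Suc l)" "u b = 0" "c \<in> S.col I" by auto
 obtain t e h where d: "t \<in> Ts (Suc l)" "b = t + e + h" "e \<in> fpow p I" "h \<in> H"
  using Suc.IH[OF _ bc(2)] Suc.prems(1) by (meson le_SucI)
 have "t \<in> fpow p M" using T_sub_Is[of l] Suc.prems(1)[of "Suc l"] Suc.prems(1) d(1) by auto
 hence ut: "u t = 0" using homog_ker T_homog[OF d(1)] by blast
 let ?v = "vd (replicate (length ys) 0, 0)"
 \<comment> \<open>t is in the kernel of \<open>u\<close>, but e and h need not be so separately.
   Since u(e) = - u(h) lies in I and has no constant term, w lies in I^[p] and in \<open>H\<close>
   at once and corrects both.\<close>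
 define w where "w = u e ^ p * ?v"
 have w: "w \<in> fpow p I"
 proof -
  have "u e \<in> I" using S.up_fpow[OF is_ideal_I, of e 1] d(3) by simp
  thus ?thesis unfolding w_def by (intro is_idealD(4)[OF is_ideal_fpow] fpow_mem)
 qed
 have ueh: "u e = u (- h)" using bc(3) ut d(2) by (simp add: S.u_add S.u_uminus add_eq_0_iff)
 have wH: "w \<in> H"
 proof -
  have "- h \<in> dge (p * 0 + (p - 1) * CARD('n) + 1)" using d(4) by (auto simp: dge_def in_keys_iff)
  from U_dge[OF this] have "u (- h) \<in> dge 1" by (simp only: frob_u_eq add_0)
  hence "u e \<in> dge 1" by (simp only: ueh)
  from dge_mult[OF fr_dge[OF this(1)] subsetD[OF homog_dge vd_e0_homog]] show ?thesis by (simp add: w_def add.commute)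
 qed
 have ue': "u (e - w) = 0" unfolding w_def by (rule S.u_ker_adjust)
 have e': "e - w \<in> fpow p I" using d(3) w by (rule is_idealD(6)[OF is_ideal_fpow])
 have h': "h + w \<in> H" by (rule dge_add[OF d(4) wH])
 have uh': "u (h + w) = 0" using bc(3) ut ue' d(2) by (simp add: S.u_add S.u_diff add.commute)
 have "S.th f b = S.th f t + S.th f (e - w) + S.th f (h + w)"
  unfolding d(2) S.th_add[symmetric] by (simp add: algebra_simps)
 hence a1: "a = u (D * t) + (S.th f (e - w) + c) + u (D * (h + w))"
  by (simp add: bc(1) u_Delta1[OF D(1) ut] u_Delta1[OF D(1) uh'] add_ac)
 have "S.th f (e - w) + c \<in> S.col I" by (intro is_idealD(2)[OF S.is_ideal_col] S.th_fpow_col[OF I f e' ue'] bc(4))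
 from col_dec[OF this] obtain c0 e1 h1 where c: "S.th f (e - w) + c = con c0 * f ^ (p - 1) + e1 + h1" "e1 \<in> fpow p I" "h1 \<in> H" by blast
 have "D * (h + w) \<in> dge (p * (p - 1) * CARD('n) + ((p - 1) * CARD('n) + 1))"
  by (rule dge_mult[OF subsetD[OF homog_dge D(2)] h'])
 hence "D * (h + w) \<in> dge (p * ((p - 1) * CARD('n)) + (p - 1) * CARD('n) + 1)" by (simp only: add.assoc mult.assoc)
 from U_dge[OF this] have hD: "u (D * (h + w)) \<in> H" unfolding frob_u_eq .
 have "a = (u (D * t) + con c0 * f ^ (p - 1)) + e1 + (h1 + u (D * (h + w)))" unfolding a1 c(1) by (simp add: add_ac)
 thus ?case using T_Suc[OF d(1), of c0] c(2) dge_add[OF c(3) hD] by blast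
qed

text \<open>For a without constant term u^n(g_n a) lies in m by degree alone. So g_n is in m^[p^n]
  as soon as the elements u^(n-1)(c g_n), c constant, are in m^[p], and these are the last summands
  in \<open>Ts n\<close>.\<close>

lemma Is_iff_G: assumes n: "n \<ge> 1" and hyp: "!!l. 1 \<le> l ==> l < n ==> S.Is f I l <= fpow p M"
 shows "S.Is f I n <= fpow p M \<longleftrightarrow> G (n - 1) \<in> fpow (p ^ n) M"
proof -
 obtain k where k: "n = Suc k" using n by (cases n) auto
 have hyp': "!!l. 1 \<le> l ==> l \<le> k ==> S.Is f I l <= fpow p M" using hyp k by auto
 note idM = is_ideal_igen[of "range var"]
 show ?thesis
 proof
  assume A: "S.Is f I n <= fpow p M"
  have tm: "(u ^^ k) (con c * G k) \<in> fpow p M" for c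
  proof -
   have "(\<Sum>i<Suc k. (u ^^ i) (con (if i = k then c else 0) * G i)) \<in> Ts (Suc k)" 
    unfolding Ts_def by (rule CollectI, rule exI[of _ "%i. if i = k then c else 0"]) simp
   moreover have "(\<Sum>i<Suc k. (u ^^ i) (con (if i = k then c else 0) * G i)) = (u ^^ k) (con c * G k)" by simp
   ultimately have "(u ^^ k) (con c * G k) \<in> Ts (Suc k)" by simp
   thus ?thesis using T_sub_Is[of k] hyp' A k by auto
  qed
  have "(u ^^ n) (G k * a) \<in> M" for a
  proof (induction a rule: mpoly_induct)
   case (single m c)
   show ?case
   proof (cases "m = 0")
    case True
    have "u ((u ^^ k) (con c * G k)) \<in> M" using S.up_fpow[OF idM, of _ 1] tm by simp
    thus ?thesis using True k by (simp add: mult.commute)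
   next
    case False
    hence "single m c \<in> dge 1" by (auto simp: dge_def Suc_le_eq) (metis mon_deg_eq_0_iff not_gr0)
    from dge_mult[OF subsetD[OF homog_dge G_homog] this] have "G k * single m c \<in> dge ((p ^ n - 1) * CARD('n) + 1)"
     by (simp add: k)
    from S.up_fpow[OF idM dge_max_fpow[OF this]] show ?thesis .
   qed
  qed (auto simp: distrib_left S.up_add max_ideal_iff lookup_add)
  hence "G k \<in> fpow (p ^ n) M" unfolding S.fpow_iff_up[OF idM] by blast
  thus "G (n - 1) \<in> fpow (p ^ n) M" by (simp add: k)
 next
  assume B: "G (n - 1) \<in> fpow (p ^ n) M"
  show "S.Is f I n <= fpow p M"
  proof
   fix a assume "a \<in> S.Is f I n"
   then obtain t e h where d: "t \<in> Ts (Suc k)" "a = t + e + h" "e \<in> fpow p I" "h \<in> H"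
    using Is_dec[of k a] hyp' k by auto
   obtain c where c: "t = (\<Sum>i<Suc k. (u ^^ i) (con (c i) * G i))" using d(1) by (auto simp: Ts_def)
   have "(u ^^ i) (con (c i) * G i) \<in> fpow p M" if i: "i < Suc k" for i
   proof (cases "i = k")
    case True
    have "con (c k) * G k \<in> fpow (p ^ (k + 1)) M" using B k by (auto intro: is_idealD(3)[OF is_ideal_fpow])
    from S.up_fpow_add[OF idM this] show ?thesis using True by simp
   next
    case False
    hence ik: "i < k" using i by simp
    let ?c = "%j. if j = i then c i else 0"
    have "(\<Sum>j<Suc i. (u ^^ j) (con (?c j) * G j)) \<in> Ts (Suc i)"
     unfolding Ts_def by (rule CollectI, rule exI[of _ ?c]) simp
    moreover have "(\<Sum>j<Suc i. (u ^^ j) (con (?c j) * G j)) = (u ^^ i) (con (c i) * G i)" by simp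
    ultimately have "(u ^^ i) (con (c i) * G i) \<in> Ts (Suc i)" by simp
    moreover have "Ts (Suc i) <= S.Is f I (Suc i)" by (rule T_sub_Is) (use hyp' ik in auto)
    ultimately show ?thesis using hyp'[of "Suc i"] ik by auto
   qed
   hence "t \<in> fpow p M" unfolding c by (intro is_ideal_sum is_ideal_fpow) auto
   thus "a \<in> fpow p M" unfolding d(2) using d(3,4) fI_sub_fM H_sub by (intro is_idealD(2)[OF is_ideal_fpow]) auto
  qed
 qed
qed

lemma Inf_I_seq_eq:
 "Inf {enat n | n. n \<ge> 1 & \<not> I_seq p ys f I n <= frob_power p max_ideal} =
  Inf {enat n | n. n \<ge> 1 & f ^ (p - 1) * D ^ (\<Sum>i<n - 1. p ^ i) ~: frob_power (p ^ n) max_ideal}"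
proof (rule Inf_enat_eq)
 fix n :: nat assume "n \<ge> 1" and "!!l. 1 \<le> l ==> l < n ==> \<not> \<not> I_seq p ys f I l <= frob_power p max_ideal"
 thus "\<not> I_seq p ys f I n <= frob_power p max_ideal \<longleftrightarrow>
   f ^ (p - 1) * D ^ (\<Sum>i<n - 1. p ^ i) ~: frob_power (p ^ n) max_ideal"
  using Is_iff_G[of n] by (simp add: I_seq_eq frob_power_eq max_ideal_def Idl_eq_igen G_def)
qed

end

section \<open>Homogeneous components and homogeneous Witt vectors\<close>

definition hcomp :: "nat => ('n::finite, 'k::field) mpoly => ('n, 'k) mpoly" where
 "hcomp d a = (\<Sum>m\<in>keys a. if mon_deg m = d then single m (lookup a m) else 0)"

lemma lookup_hcomp [simp]: "lookup (hcomp d a) m = (if mon_deg m = d then lookup a m else 0)"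
proof -
 have "lookup (hcomp d a) m =
   (\<Sum>m'\<in>keys a. if m' = m then (if mon_deg m = d then lookup a m else 0) else 0)"
  unfolding hcomp_def lookup_sum by (intro sum.cong refl) (auto simp: lookup_single when_def)
 thus ?thesis by (simp add: in_keys_iff)
qed

lemma hcomp_add: "hcomp d (a + b) = hcomp d a + hcomp d b" by (rule poly_mapping_eqI) (simp add: lookup_add)

lemma hcomp_0 [simp]: "hcomp d 0 = 0" by (rule poly_mapping_eqI) simp

lemma hcomp_sum: "hcomp d (sum f A) = (\<Sum>x\<in>A. hcomp d (f x))"
 by (induction A rule: infinite_finite_induct) (auto simp: hcomp_add)

lemma hcomp_homog [simp]: "hcomp d a \<in> homog d" by (auto simp: homog_def in_keys_iff split: if_splits)

lemma hcomp_of_homog: "a \<in> homog e ==> hcomp d a = (if d = e then a else 0)"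
 by (rule poly_mapping_eqI) (auto simp: homog_def in_keys_iff)

lemma hcomp_single: "hcomp d (single m c) = (if mon_deg m = d then single m c else 0)"
 by (rule poly_mapping_eqI) (auto simp: lookup_single when_def)

lemma hcomp_mult: assumes "c \<in> homog e" shows "hcomp k (c * a) = (if e \<le> k then c * hcomp (k - e) a else 0)"
proof (induction a rule: mpoly_induct)
 case (single m r)
 have "c * single m r \<in> homog (e + mon_deg m)" by (rule homog_mult[OF assms homog_single]) simp
 thus ?case by (auto simp: hcomp_of_homog hcomp_single)
qed (auto simp: distrib_left hcomp_add)

lemma mon_deg_le_tot_deg: "m \<in> keys a ==> mon_deg m \<le> tot_deg a" by (auto simp: tot_deg_def intro!: Max_ge)

lemma hcomp_eq_0: "d > tot_deg a ==> hcomp d a = 0"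
 by (rule poly_mapping_eqI) (use mon_deg_le_tot_deg[of _ a] in "force simp: in_keys_iff")

lemma sum_hcomp: "tot_deg a \<le> n ==> (\<Sum>d\<le>n. hcomp d a) = a"
proof (rule poly_mapping_eqI)
 fix m assume "tot_deg a \<le> n"
 thus "lookup (\<Sum>d\<le>n. hcomp d a) m = lookup a m"
  using mon_deg_le_tot_deg[of m a] by (cases "lookup a m = 0") (auto simp: lookup_sum in_keys_iff)
qed

definition hom_set :: "('n::finite, 'k::field) mpoly set => bool" where
 "hom_set J \<longleftrightarrow> (\<forall>a\<in>J. \<forall>d. hcomp d a \<in> J)"

lemma hom_set_igen: assumes "\<forall>g\<in>G. \<exists>d. g \<in> homog d" shows "hom_set (igen G)"
 unfolding hom_set_def
proof (intro ballI allI)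
 fix a d assume "a \<in> igen G" thus "hcomp d a \<in> igen G"
 proof induction
  case (igen_mult x r)
  then obtain e where "x \<in> homog e" using assms by blast
  from hcomp_mult[OF this, of d r] igen.igen_mult[OF igen_mult, of "hcomp (d - e) r"] show ?case
   by (auto simp: mult.commute intro: igen_0)
 qed (auto simp: hcomp_add intro: igen.intros)
qed

lemma isob_ev_homog:
 fixes env :: "'v => ('n::finite, 'k::field) mpoly"
 assumes "isob \<omega> w Q" "!!t. env t \<in> homog (\<omega> t * d)" shows "ev env Q \<in> homog (w * d)"
proof -
 have prod: "finite A ==> (\<Prod>t\<in>A. env t ^ e t) \<in> homog ((\<Sum>t\<in>A. e t * \<omega> t) * d)" for A and e :: "'v => nat"
 proof (induction A rule: finite_induct)
  case (insert t A)
  have "env t ^ e t \<in> homog (e t * (\<omega> t * d))" by (rule homog_power[OF assms(2)])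
  from homog_mult[OF this insert.IH] insert.hyps show ?case by (simp add: algebra_simps)
 qed simp
 have nat: "(of_nat n :: ('n, 'k) mpoly) \<in> homog 0" for n by (induction n) (auto intro: homog_add)
 have "(of_int z :: ('n, 'k) mpoly) \<in> homog 0" for z
  using homog_uminus[OF nat] nat by (cases z rule: int_cases2) auto
 from homog_mult[OF this prod] have "of_int (lookup Q m) * mon_ev env m \<in> homog (w * d)"
  if "m \<in> keys Q" for m using assms(1) that by (auto simp: isob_def mon_ev_def mwt_def)
 thus ?thesis unfolding ev_def by (rule homog_sum)
qed

section \<open>Homogeneous Witt vectors over the polynomial ring\<close>

context frob_field
begin

text \<open>The degrees p^i w are those for which the Witt polynomials, isobaric with weight p^i on
  index i, preserve homogeneity.\<close>

definition whom :: "nat => ('n::finite, 'k) mpoly witt set" where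
 "whom w = {x. \<forall>i. wc x i \<in> homog (p ^ i * w)}"

lemma prime_char_S: "prime CHAR(('n::finite, 'k) mpoly)" using p char_S by metis

lemma whom_add:
 fixes x y :: "('n::finite, 'k) mpoly witt" assumes "x \<in> whom w" "y \<in> whom w" shows "x + y \<in> whom w"
proof -
 have "wadd p (wc x) (wc y) i \<in> homog (p ^ i * w)" for i
  unfolding wadd_def by (rule isob_ev_homog[OF isob_witt_sum[OF p]])
   (use assms in "auto simp: whom_def split: sum.splits")
 thus ?thesis by (simp add: whom_def wc_add[OF prime_char_S] char_S)
qed

lemma whom_uminus:
 fixes x :: "('n::finite, 'k) mpoly witt" assumes "x \<in> whom w" shows "- x \<in> whom w"
proof -
 have "wneg p (wc x) i \<in> homog (p ^ i * w)" for i
  unfolding wneg_def by (rule isob_ev_homog[OF isob_wneg_poly[OF p]])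
   (use assms in "auto simp: whom_def")
 thus ?thesis by (simp add: whom_def wc_uminus[OF prime_char_S] char_S)
qed

lemma whom_0 [simp]: "0 \<in> whom w" by (simp add: whom_def)

lemma whom_diff: "x \<in> whom w ==> y \<in> whom w ==> x - (y :: ('n::finite, 'k) mpoly witt) \<in> whom w"
 using whom_add[of x w "- y"] whom_uminus[of y w] by simp

lemma whom_sum: "(!!k. k \<in> K ==> g k \<in> whom w) ==> sum g K \<in> (whom w :: ('n::finite, 'k) mpoly witt set)"
 by (induction K rule: infinite_finite_induct) (auto intro: whom_add)

lemma whom_teich: "a \<in> homog w ==> teich a \<in> (whom w :: ('n::finite, 'k) mpoly witt set)"
 by (auto simp: whom_def teich_def)

lemma whom_wV:
 fixes x :: "('n::finite, 'k) mpoly witt" shows "x \<in> whom (p * w) ==> wV x \<in> whom w"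
 by (auto simp: whom_def wV_def mult_ac split: nat.splits)

lemma whom_wshift:
 fixes x :: "('n::finite, 'k) mpoly witt" shows "x \<in> whom w ==> wshift x \<in> whom (p * w)"
proof -
 assume "x \<in> whom w"
 hence "wc x (Suc i) \<in> homog (p ^ Suc i * w)" for i unfolding whom_def by blast
 thus ?thesis by (simp add: whom_def mult_ac)
qed

lemma whom_wF:
 fixes x :: "('n::finite, 'k) mpoly witt" shows "x \<in> whom w ==> wF x \<in> whom (p * w)"
proof -
 assume "x \<in> whom w"
 hence "wc x i ^ p \<in> homog (p * (p ^ i * w))" for i by (intro homog_power) (simp add: whom_def)
 thus ?thesis by (simp add: whom_def char_S mult_ac)
qed

lemma whom_wscale:
 fixes x :: "('n::finite, 'k) mpoly witt"
 assumes "c \<in> homog e" "x \<in> whom w" shows "wscale c x \<in> whom (e + w)"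
proof -
 have "c ^ p ^ i * wc x i \<in> homog (p ^ i * e + p ^ i * w)" for i
  using assms(2) by (intro homog_mult homog_power assms(1)) (simp add: whom_def)
 thus ?thesis by (simp add: whom_def char_S distrib_left)
qed

lemma whom_wtimes:
 fixes x y :: "('n::finite, 'k) mpoly witt"
 assumes "x \<in> whom w" "y \<in> whom w" shows "wtimes x y \<in> whom (2 * w)"
proof -
 have "wmul p (wc x) (wc y) i \<in> homog (2 * p ^ i * w)" for i
  unfolding wmul_def by (rule isob_ev_homog[OF isob_witt_prod[OF p]])
   (use assms in "auto simp: whom_def split: sum.splits")
 thus ?thesis by (simp add: whom_def wtimes_def char_S mult_ac)
qed

end

section \<open>Points and germs of the projective scheme\<close>

definition hprime :: "('n::finite, 'k::field) mpoly set => bool" where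
 "hprime Q \<longleftrightarrow> is_ideal Q & hom_set Q & 1 ~: Q & (\<forall>a b. a * b \<in> Q --> a \<in> Q \<or> b \<in> Q)"

locale graded_quot =
 fixes I :: "('n::finite, 'k::field) mpoly set" assumes ideal_I: "is_ideal I" and hom_I: "hom_set I"
begin

abbreviation S :: "('n, 'k) mpoly ring" where "S \<equiv> polyR"
lemmas I_D = is_idealD[OF ideal_I]

definition co where "co a = I +>\<^bsub>S\<^esub> a"
abbreviation A where "A \<equiv> S Quot I"
definition Gr where "Gr d = co ` homog d"

sublocale ID: ideal I S using ideal_I by (simp add: ideal_iff)

lemma cring_S: "cring S" by (rule cring_polyR)

lemma co_eq_iff: "co a = co b \<longleftrightarrow> a - b \<in> I"
proof -
 have "co a = {x + a | x. x \<in> I}" for a by (auto simp: co_def a_r_coset_def')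
 moreover have "a - b \<in> I" if "{x + a | x. x \<in> I} = {x + b | x. x \<in> I}"
 proof -
  have "0 + a \<in> {x + b | x. x \<in> I}" unfolding that[symmetric] using I_D(1) by blast
  thus ?thesis by auto
 qed
 moreover have "{x + a | x. x \<in> I} <= {x + b | x. x \<in> I}" if ab: "a - b \<in> I" for a b
 proof clarify
  fix x assume x: "x \<in> I"
  show "\<exists>xa. x + a = xa + b & xa \<in> I" by (rule exI[of _ "x + (a - b)"]) (use I_D(2)[OF x ab] in simp)
 qed
 ultimately show ?thesis using I_D(5)[of "a - b"] by (metis minus_diff_eq subset_antisym)
qed

lemma co_mem_iff: "co a = co 0 \<longleftrightarrow> a \<in> I" by (simp add: co_eq_iff)

lemma carrier_A: "carrier A = range co" by (auto simp: FactRing_def A_RCOSETS_def' co_def)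

lemma co_in [simp]: "co a \<in> carrier A" by (simp add: carrier_A)

lemma co_mult: "co a \<otimes>\<^bsub>A\<^esub> co b = co (a * b)"
 using ID.rcoset_mult_add[of a b] by (simp add: FactRing_def co_def)

lemma co_add: "co a \<oplus>\<^bsub>A\<^esub> co b = co (a + b)"
 using ID.a_rcos_sum[of a b] by (simp add: FactRing_def co_def)

lemma co_one: "\<one>\<^bsub>A\<^esub> = co 1" by (simp add: FactRing_def co_def)

lemma co_zero: "\<zero>\<^bsub>A\<^esub> = co 0"
 using ID.a_coset_add_zero by (auto simp: FactRing_def co_def a_r_coset_def')

lemma cring_A: "cring A" by (rule ID.quotient_is_cring[OF cring_S])

lemma ring_A: "ring A" using cring_A by (simp add: cring_def)

text \<open>For a point of Proj this is the homogeneous prime of S above it; working with it keeps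
  all representatives in the polynomial ring.\<close>

definition pull where "pull J = {a. co a \<in> J}"

lemma pull_ideal: "ideal J A ==> is_ideal (pull J)"
proof -
 assume "ideal J A"
 then interpret J: ideal J A .
 have "co 0 \<in> J" using additive_subgroup.zero_closed[OF J.additive_subgroup_axioms] unfolding co_zero .
 thus ?thesis unfolding is_ideal_def pull_def using J.a_closed J.I_l_closed by (auto simp flip: co_add co_mult)
qed

lemma pull_sub: "ideal J A ==> I <= pull J"
proof
 fix a assume "ideal J A" "a \<in> I"
 thus "a \<in> pull J"
  using additive_subgroup.zero_closed[of J A] co_mem_iff[of a] by (simp add: pull_def co_zero ideal_def)
qed

lemma co_image_iff: "is_ideal J ==> I <= J ==> co a \<in> co ` J \<longleftrightarrow> a \<in> J"
proof -
 assume J: "is_ideal J" "I <= J"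
 have "a \<in> J" if "co a = co b" "b \<in> J" for b
  using is_idealD(2)[OF J(1), of "a - b" b] that J(2) by (auto simp: co_eq_iff)
 thus ?thesis by auto
qed

lemma co_image_ideal: "is_ideal J ==> ideal (co ` J) A"
proof -
 assume J: "is_ideal J"
 interpret A: cring A by (rule cring_A)
 show ?thesis
 proof (rule idealI[OF A.ring_axioms])
  show "subgroup (co ` J) (add_monoid A)"
  proof (rule group.subgroupI[OF A.add.is_group])
   fix x assume "x \<in> co ` J"
   then obtain a where a: "a \<in> J" "x = co a" by blast
   have "co (- a) \<oplus>\<^bsub>A\<^esub> co a = \<zero>\<^bsub>A\<^esub>" by (simp only: co_add) (simp add: co_zero)
   hence "\<ominus>\<^bsub>A\<^esub> co a = co (- a)" using A.minus_equality[of "co (- a)" "co a"] by simp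
   thus "inv\<^bsub>add_monoid A\<^esub> x \<in> co ` J" using is_idealD(5)[OF J a(1)] a(2) by (simp add: a_inv_def)
  qed (use J in "auto simp: carrier_A co_add is_ideal_def")
 qed (use is_idealD(3,4)[OF J] in "auto simp: carrier_A co_mult")
qed

definition points where "points = proj_points A Gr"

lemma points_pull: assumes P: "P \<in> points" shows "hprime (pull P)" "I <= pull P" "\<exists>i. var i ~: pull P"
proof -
 from P have P1: "primeideal P A" "P = Idl\<^bsub>A\<^esub> (P \<inter> (\<Union>d. Gr d))" "\<not> (\<Union>d\<in>{1..}. Gr d) <= P"
  by (auto simp: points_def proj_points_def)
 interpret P: primeideal P A by (rule P1(1))
 note idP = pull_ideal[OF P.is_ideal]
 show sub: "I <= pull P" by (rule pull_sub[OF P.is_ideal])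
 \<comment> \<open>An ideal that contains the homogeneous elements of P, hence everything they
   generate; so \<open>pull P\<close> lies in J, which means that it is homogeneous.\<close>
 define J where "J = {a. \<forall>d. hcomp d a \<in> pull P}"
 have J: "is_ideal J" unfolding is_ideal_def
 proof (intro conjI ballI allI)
  fix a r assume a: "a \<in> J"
  have "hcomp d (r * a) \<in> pull P" for d
  proof -
   have "r * a = (\<Sum>e\<le>tot_deg r. hcomp e r * a)" by (simp add: sum_hcomp[of r] flip: sum_distrib_right)
   hence "hcomp d (r * a) = (\<Sum>e\<le>tot_deg r. if e \<le> d then hcomp e r * hcomp (d - e) a else 0)"
    by (simp only: hcomp_sum hcomp_mult[OF hcomp_homog])
   also have "\<dots> \<in> pull P" using a by (intro is_ideal_sum[OF idP]) (auto simp: J_def intro: is_idealD(1,3)[OF idP])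
   finally show ?thesis .
  qed
  thus "r * a \<in> J" by (simp add: J_def)
 qed (auto simp: J_def hcomp_add intro: is_idealD(1,2)[OF idP])
 have IJ: "I <= J" using hom_I sub by (auto simp: J_def hom_set_def)
 have "P \<inter> (\<Union>d. Gr d) <= co ` J"
 proof
  fix x assume "x \<in> P \<inter> (\<Union>d. Gr d)"
  then obtain d a where a: "a \<in> homog d" "x = co a" "co a \<in> P" by (auto simp: Gr_def)
  hence "a \<in> J" using is_idealD(1)[OF idP] by (auto simp: J_def hcomp_of_homog pull_def)
  thus "x \<in> co ` J" using a by simp
 qed
 from ring.genideal_minimal[OF ring_A co_image_ideal[OF J] this] P1(2) have "P <= co ` J" by simp
 hence PJ: "pull P <= J" using co_image_iff[OF J IJ] by (auto simp: pull_def)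
 have "hom_set (pull P)" unfolding hom_set_def using PJ by (auto simp: J_def)
 moreover have "1 ~: pull P" using P.I_notcarr P.one_imp_carrier by (auto simp: pull_def co_one)
 moreover have "a \<in> pull P \<or> b \<in> pull P" if "a * b \<in> pull P" for a b
  using P.I_prime[of "co a" "co b"] that by (auto simp: pull_def co_mult)
 ultimately show "hprime (pull P)" using idP by (auto simp: hprime_def)
 show "\<exists>i. var i ~: pull P"
 proof (rule ccontr)
  assume "\<nexists>i. var i ~: pull P"
  hence "igen (range var) <= pull P" by (intro igen_least[OF idP]) auto
  moreover have "a \<in> igen (range var)" if "a \<in> homog d" "d \<ge> 1" for a :: "('n, 'k) mpoly" and d
  proof -
   have "0 ~: keys a" using that by (auto simp: homog_def)
   thus ?thesis by (simp add: max_ideal_iff in_keys_iff)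
  qed
  ultimately have "(\<Union>d\<in>{1..}. Gr d) <= P" by (auto simp: Gr_def pull_def)
  with P1(3) show False by simp
 qed
qed

lemma var_homog: "var i \<in> homog 1"
 unfolding var_def by (rule homog_single) (simp add: mon_deg_def lookup_single when_def)

lemma point_of_hprime: assumes Q: "hprime Q" "I <= Q" "var i ~: Q" shows "co ` Q \<in> points" "pull (co ` Q) = Q"
proof -
 from Q have idQ: "is_ideal Q" by (simp add: hprime_def)
 note iff = co_image_iff[OF idQ Q(2)]
 show "pull (co ` Q) = Q" by (auto simp: pull_def iff)
 interpret A: cring A by (rule cring_A)
 have sub: "co ` Q \<inter> (\<Union>d. Gr d) <= carrier A" by (auto simp: carrier_A)
 let ?J = "Idl\<^bsub>A\<^esub> (co ` Q \<inter> (\<Union>d. Gr d))"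
 have idJ: "ideal ?J A" by (rule A.genideal_ideal[OF sub])
 have "a \<in> pull ?J" if a: "a \<in> Q" for a
 proof -
  have "hcomp d a \<in> pull ?J" for d
  proof -
   have "co (hcomp d a) \<in> co ` Q \<inter> (\<Union>d. Gr d)" 
    using a Q(1) hcomp_homog[of d a] unfolding hprime_def hom_set_def Gr_def by blast
   thus ?thesis using A.genideal_self[OF sub] by (auto simp: pull_def)
  qed
  hence "(\<Sum>d\<le>tot_deg a. hcomp d a) \<in> pull ?J" by (intro is_ideal_sum pull_ideal[OF idJ])
  thus ?thesis by (simp add: sum_hcomp)
 qed
 hence "co ` Q <= ?J" by (auto simp: pull_def)
 moreover have "?J <= co ` Q" by (rule A.genideal_minimal[OF co_image_ideal[OF idQ]]) auto
 moreover have "primeideal (co ` Q) A"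
 proof (rule primeidealI[OF co_image_ideal[OF idQ] cring_A])
  show "carrier A \<noteq> co ` Q" 
  proof
   assume "carrier A = co ` Q"
   hence "co 1 \<in> co ` Q" using co_in by metis
   thus False using iff[of 1] Q(1) by (simp add: hprime_def)
  qed
  show "x \<in> co ` Q \<or> y \<in> co ` Q" if xy: "x \<in> carrier A" "y \<in> carrier A" "x \<otimes>\<^bsub>A\<^esub> y \<in> co ` Q" for x y
  proof -
   obtain a b where "x = co a" "y = co b" using xy by (auto simp: carrier_A)
   hence "a * b \<in> Q" using xy(3) iff[of "a * b"] by (simp only: co_mult)
   hence "a \<in> Q \<or> b \<in> Q" using Q(1) by (simp add: hprime_def)
   thus ?thesis using `x = co a` `y = co b` by blast
  qed
 qed
 moreover have "\<not> (\<Union>d\<in>{1..}. Gr d) <= co ` Q"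
 proof (rule notI)
  assume s: "(\<Union>d\<in>{1..}. Gr d) <= co ` Q"
  have "co (var i) \<in> Gr 1" unfolding Gr_def by (rule imageI[OF var_homog])
  with s have "co (var i) \<in> co ` Q" by blast
  thus False using Q(3) iff by simp
 qed
 ultimately show "co ` Q \<in> points" by (auto simp: points_def proj_points_def)
qed

lemma assumes P: "P \<in> points"
 shows pull_is_ideal: "is_ideal (pull P)" and pull_prime: "a * b \<in> pull P \<longleftrightarrow> a \<in> pull P \<or> b \<in> pull P"
  and pull_one: "1 ~: pull P" and pull_hom: "a \<in> pull P ==> hcomp d a \<in> pull P" and pull_I: "a \<in> I ==> a \<in> pull P"
proof -
 from points_pull[OF P] have h: "is_ideal (pull P)" "hom_set (pull P)" "1 ~: pull P"
  "a * b \<in> pull P ==> a \<in> pull P \<or> b \<in> pull P" "I <= pull P" unfolding hprime_def by blast+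
 show "is_ideal (pull P)" "1 ~: pull P" by fact+
 show "a * b \<in> pull P \<longleftrightarrow> a \<in> pull P \<or> b \<in> pull P"
  using h(4) is_idealD(3,4)[OF h(1)] by blast
 show "a \<in> pull P ==> hcomp d a \<in> pull P" using h(2) by (simp add: hom_set_def)
 show "a \<in> I ==> a \<in> pull P" using h(5) by blast
qed

lemma pull_power: "P \<in> points ==> a ^ k \<in> pull P ==> a \<in> pull P"
 by (induction k) (auto simp: pull_prime pull_one)

lemma pull_prod: "P \<in> points ==> (!!x. x \<in> B ==> g x ~: pull P) ==> prod g B ~: pull P"
 by (induction B rule: infinite_finite_induct) (auto simp: pull_prime pull_one)

definition vf where "vf P a b \<longleftrightarrow> (\<exists>d. a \<in> homog d & b \<in> homog d) & b ~: pull P"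
definition fr where "fr P a b = hfrac_rel A Gr P `` {(co a, co b)}"
abbreviation loc where "loc P \<equiv> hloc A Gr P"

lemma vfI: "a \<in> homog d ==> b \<in> homog d ==> b ~: pull P ==> vf P a b" by (auto simp: vf_def)

lemma hfrac_eq: "hfrac Gr P = {(co a, co b) | a b. vf P a b}" by (force simp: hfrac_def vf_def Gr_def pull_def)

lemma rel_co:
 "vf P a b ==> vf P c d ==> ((co a, co b), (co c, co d)) \<in> hfrac_rel A Gr P \<longleftrightarrow>
  (\<exists>t e. t \<in> homog e & t ~: pull P & t * (a * d - c * b) \<in> I)"
proof -
 assume "vf P a b" "vf P c d"
 hence h: "(co a, co b) \<in> hfrac Gr P" "(co c, co d) \<in> hfrac Gr P" by (auto simp: hfrac_eq)
 have "((co a, co b), (co c, co d)) \<in> hfrac_rel A Gr P \<longleftrightarrow> (\<exists>t e. t \<in> homog e & co t ~: P & co (t * (a * d)) = co (t * (c * b)))"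
 proof (rule iffI)
  assume "((co a, co b), (co c, co d)) \<in> hfrac_rel A Gr P"
  thus "\<exists>t e. t \<in> homog e & co t ~: P & co (t * (a * d)) = co (t * (c * b))"
   by (auto simp: hfrac_rel_def Gr_def co_mult)
 next
  assume "\<exists>t e. t \<in> homog e & co t ~: P & co (t * (a * d)) = co (t * (c * b))"
  then obtain t e where "t \<in> homog e" "co t ~: P" "co (t * (a * d)) = co (t * (c * b))" by blast
  hence "co t \<in> Gr e & co t ~: P & co t \<otimes>\<^bsub>A\<^esub> (co a \<otimes>\<^bsub>A\<^esub> co d) = co t \<otimes>\<^bsub>A\<^esub> (co c \<otimes>\<^bsub>A\<^esub> co b)"
   by (simp add: co_mult Gr_def)
  thus "((co a, co b), (co c, co d)) \<in> hfrac_rel A Gr P" using h unfolding hfrac_rel_def by blast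
 qed
 thus ?thesis by (simp add: co_eq_iff pull_def right_diff_distrib)
qed

lemma equiv_rel: "P \<in> points ==> equiv (hfrac Gr P) (hfrac_rel A Gr P)"
proof (rule equivI)
 assume P: "P \<in> points"
 note pr = pull_prime[OF P] and one = pull_one[OF P]
 show "hfrac_rel A Gr P <= hfrac Gr P \<times> hfrac Gr P" by (auto simp: hfrac_rel_def)
 show "refl_on (hfrac Gr P) (hfrac_rel A Gr P)"
 proof (rule refl_onI)
  fix x assume "x \<in> hfrac Gr P"
  then obtain a b where "x = (co a, co b)" "vf P a b" by (auto simp: hfrac_eq)
  hence "(x, x) \<in> hfrac_rel A Gr P \<longleftrightarrow> (\<exists>t e. t \<in> homog e & t ~: pull P & t * (a * b - a * b) \<in> I)" by (simp only: rel_co)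
  moreover have "1 \<in> homog 0 & 1 ~: pull P & 1 * (a * b - a * b) \<in> I" using one I_D(1) by simp
  ultimately show "(x, x) \<in> hfrac_rel A Gr P" by blast
 qed
 show "sym (hfrac_rel A Gr P)" by (rule symI) (auto simp: hfrac_rel_def)
 show "trans (hfrac_rel A Gr P)"
 proof (rule transI)
  fix x y z assume xy: "(x, y) \<in> hfrac_rel A Gr P" and yz: "(y, z) \<in> hfrac_rel A Gr P"
  from xy have "x \<in> hfrac Gr P" "y \<in> hfrac Gr P" by (auto simp: hfrac_rel_def)
  moreover from yz have "z \<in> hfrac Gr P" by (auto simp: hfrac_rel_def)
  ultimately obtain a b c d e f where r: "x = (co a, co b)" "y = (co c, co d)" "z = (co e, co f)" "vf P a b" "vf P c d" "vf P e f"
   by (auto simp: hfrac_eq)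
  obtain t i s j where t: "t \<in> homog i" "t ~: pull P" "t * (a * d - c * b) \<in> I" and s: "s \<in> homog j" "s ~: pull P" "s * (c * f - e * d) \<in> I"
   using xy yz r by (auto simp: rel_co)
  obtain l where l: "d \<in> homog l" using r(5) by (auto simp: vf_def)
  have "(s * f) * (t * (a * d - c * b)) + (t * b) * (s * (c * f - e * d)) \<in> I" by (intro I_D(2,3) t s)
  also have "(s * f) * (t * (a * d - c * b)) + (t * b) * (s * (c * f - e * d)) = (t * s * d) * (a * f - e * b)"
   by (simp add: algebra_simps)
  finally have "(t * s * d) * (a * f - e * b) \<in> I" .
  moreover have "t * s * d \<in> homog (i + j + l)" by (intro homog_mult t s l)
  moreover have "t * s * d ~: pull P" using t s r(5) by (simp add: pr vf_def)
  ultimately show "(x, z) \<in> hfrac_rel A Gr P" using r by (auto simp: rel_co)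
 qed
qed

lemma fr_eq_iff: assumes "P \<in> points" "vf P a b" "vf P c d"
 shows "fr P a b = fr P c d \<longleftrightarrow> (\<exists>t e. t \<in> homog e & t ~: pull P & t * (a * d - c * b) \<in> I)"
 unfolding fr_def using eq_equiv_class_iff[OF equiv_rel[OF assms(1)], of "(co a, co b)" "(co c, co d)"] assms
 by (auto simp: hfrac_eq rel_co)

lemma fr_eqI: "P \<in> points ==> vf P a b ==> vf P c d ==> a * d - c * b \<in> I ==> fr P a b = fr P c d"
proof -
 assume a: "P \<in> points" "vf P a b" "vf P c d" "a * d - c * b \<in> I"
 hence "1 \<in> homog 0 & 1 ~: pull P & 1 * (a * d - c * b) \<in> I" using pull_one by simp
 thus ?thesis unfolding fr_eq_iff[OF a(1-3)] by blast
qed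

lemma fr_cancel:
 "P \<in> points ==> vf P a b ==> t \<in> homog e ==> t ~: pull P ==> fr P (t * a) (t * b) = fr P a b"
 using I_D(1) by (intro fr_eqI) (auto simp: vf_def pull_prime algebra_simps intro: homog_mult)

lemma carrier_loc: "carrier (loc P) = {fr P a b | a b. vf P a b}"
 by (auto simp: hloc_def hfrac_eq quotient_def fr_def)

lemma fr_in: "vf P a b ==> fr P a b \<in> carrier (loc P)" by (auto simp: carrier_loc)

lemma mem_fr: assumes P: "P \<in> points" "vf P a b" and x: "x \<in> fr P a b"
 obtains a' b' where "x = (co a', co b')" "vf P a' b'" "fr P a' b' = fr P a b"
proof -
 have "x \<in> hfrac Gr P" using x by (auto simp: fr_def hfrac_rel_def)
 then obtain a' b' where x': "x = (co a', co b')" "vf P a' b'" by (auto simp: hfrac_eq)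
 have "fr P a b = fr P a' b'" unfolding fr_def
  using equiv_class_eq[OF equiv_rel[OF P(1)], of "(co a, co b)" "(co a', co b')"] x x' by (auto simp: fr_def)
 thus ?thesis using that x' by metis
qed

lemma fr_self: "P \<in> points ==> vf P a b ==> (co a, co b) \<in> fr P a b"
 unfolding fr_def using equiv_class_self[OF equiv_rel, of P "(co a, co b)"] by (auto simp: hfrac_eq)

lemma vf_mult: "P \<in> points ==> vf P a b ==> vf P c d ==> vf P (a * c) (b * d)"
 unfolding vf_def by (auto simp: pull_prime intro: homog_mult)

lemma vf_add: "P \<in> points ==> vf P a b ==> vf P c d ==> vf P (a * d + c * b) (b * d)"
proof -
 assume a: "P \<in> points" "vf P a b" "vf P c d"
 then obtain i j where h: "a \<in> homog i" "b \<in> homog i" "c \<in> homog j" "d \<in> homog j" by (auto simp: vf_def)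
 have "c * b \<in> homog (i + j)" using homog_mult[OF h(3,2)] by (simp add: add.commute)
 thus ?thesis using a homog_mult[OF h(1,4)] homog_mult[OF h(2,4)]
  by (intro vfI[of _ "i + j"] homog_add) (auto simp: vf_def pull_prime)
qed

text \<open>The operations of \<open>hloc\<close> are unions over all representatives, so every
  choice must give the same class. The two witnesses of equality are multiplied so that one t serves
  both fractions.\<close>

lemma fr_UN2: assumes P: "P \<in> points" and v: "vf P a b" "vf P c d"
  and op: "!!a' b' c' d' t e. vf P a' b' ==> vf P c' d' ==> t \<in> homog e ==> t ~: pull P ==>
   t * (a' * b - a * b') \<in> I ==> t * (c' * d - c * d') \<in> I ==> F (co a') (co b') (co c') (co d') = r"
 shows "(\<Union>(x, x')\<in>fr P a b. \<Union>(y, y')\<in>fr P c d. F x x' y y') = r"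
proof -
 have "F (fst x) (snd x) (fst y) (snd y) = r" if xy: "x \<in> fr P a b" "y \<in> fr P c d" for x y
 proof -
  obtain a' b' where r: "x = (co a', co b')" "vf P a' b'" "fr P a' b' = fr P a b" by (rule mem_fr[OF P v(1) xy(1)])
  obtain c' d' where q: "y = (co c', co d')" "vf P c' d'" "fr P c' d' = fr P c d" by (rule mem_fr[OF P v(2) xy(2)])
  obtain t i s j where t: "t \<in> homog i" "t ~: pull P" "t * (a' * b - a * b') \<in> I" and s: "s \<in> homog j" "s ~: pull P" "s * (c' * d - c * d') \<in> I"
   using r(3) q(3) by (auto simp: fr_eq_iff[OF P r(2) v(1)] fr_eq_iff[OF P q(2) v(2)])
  show ?thesis unfolding r(1) q(1) fst_conv snd_conv
  proof (rule op[OF r(2) q(2) homog_mult[OF t(1) s(1)]])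
   show "t * s * (a' * b - a * b') \<in> I" "t * s * (c' * d - c * d') \<in> I"
    using I_D(3)[OF t(3), of s] I_D(3)[OF s(3), of t] by (simp_all add: mult_ac)
  qed (use t s in "simp add: pull_prime[OF P]")
 qed
 thus ?thesis using fr_self[OF P v(1)] fr_self[OF P v(2)] unfolding case_prod_beta by blast
qed

lemma fr_mult: assumes P: "P \<in> points" and v: "vf P a b" "vf P c d"
 shows "fr P a b \<otimes>\<^bsub>loc P\<^esub> fr P c d = fr P (a * c) (b * d)" unfolding hloc_def monoid.simps
proof (rule fr_UN2[OF P v])
 fix a' b' c' d' t e
 assume h: "vf P a' b'" "vf P c' d'" "t \<in> homog e" "t ~: pull P" and t: "t * (a' * b - a * b') \<in> I" "t * (c' * d - c * d') \<in> I"
 have "c' * d * (t * (a' * b - a * b')) + a * b' * (t * (c' * d - c * d')) \<in> I" by (intro I_D(2,3) t)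
 hence "t * ((a' * c') * (b * d) - (a * c) * (b' * d')) \<in> I" by (simp add: algebra_simps)
 hence "fr P (a' * c') (b' * d') = fr P (a * c) (b * d)"
  unfolding fr_eq_iff[OF P vf_mult[OF P h(1,2)] vf_mult[OF P v]] using h by blast
 thus "hfrac_rel A Gr P `` {(co a' \<otimes>\<^bsub>A\<^esub> co c', co b' \<otimes>\<^bsub>A\<^esub> co d')} = fr P (a * c) (b * d)" by (simp add: co_mult fr_def)
qed

lemma fr_add: assumes P: "P \<in> points" and v: "vf P a b" "vf P c d"
 shows "fr P a b \<oplus>\<^bsub>loc P\<^esub> fr P c d = fr P (a * d + c * b) (b * d)" unfolding hloc_def ring.simps
proof (rule fr_UN2[OF P v])
 fix a' b' c' d' t e
 assume h: "vf P a' b'" "vf P c' d'" "t \<in> homog e" "t ~: pull P" and t: "t * (a' * b - a * b') \<in> I" "t * (c' * d - c * d') \<in> I"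
 have "d * d' * (t * (a' * b - a * b')) + b * b' * (t * (c' * d - c * d')) \<in> I" by (intro I_D(2,3) t)
 hence "t * ((a' * d' + c' * b') * (b * d) - (a * d + c * b) * (b' * d')) \<in> I" by (simp add: algebra_simps)
 hence "fr P (a' * d' + c' * b') (b' * d') = fr P (a * d + c * b) (b * d)"
  unfolding fr_eq_iff[OF P vf_add[OF P h(1,2)] vf_add[OF P v]] using h by blast
 thus "hfrac_rel A Gr P `` {((co a' \<otimes>\<^bsub>A\<^esub> co d') \<oplus>\<^bsub>A\<^esub> (co c' \<otimes>\<^bsub>A\<^esub> co b'), co b' \<otimes>\<^bsub>A\<^esub> co d')} = fr P (a * d + c * b) (b * d)"
  by (simp add: co_mult co_add fr_def)
qed

lemma fr_add_same: assumes "P \<in> points" "a \<in> homog d" "c \<in> homog d" "b \<in> homog d" "b ~: pull P"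
 shows "fr P a b \<oplus>\<^bsub>loc P\<^esub> fr P c b = fr P (a + c) b"
proof -
 have v: "vf P a b" "vf P c b" "vf P (a + c) b" using assms by (auto intro!: vfI homog_add)
 show ?thesis unfolding fr_add[OF assms(1) v(1,2)]
  using fr_cancel[OF assms(1) v(3) assms(4,5)] by (simp add: algebra_simps)
qed

lemma fr_one: "\<one>\<^bsub>loc P\<^esub> = fr P 1 1" by (simp add: hloc_def co_one fr_def)

lemma fr_zero: "\<zero>\<^bsub>loc P\<^esub> = fr P 0 1" by (simp add: hloc_def co_zero co_one fr_def)

lemma vf_one: "P \<in> points ==> vf P 1 1" "P \<in> points ==> vf P 0 1" using pull_one by (auto intro!: vfI[of _ 0])

lemma cring_loc: assumes P: "P \<in> points" shows "cring (loc P)"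
proof (rule cringI)
 note v = vf_mult[OF P] vf_add[OF P] vf_one[OF P]
 have z: "a - b \<in> I" if "a = b" for a b :: "('n, 'k) mpoly" using that I_D(1) by simp
 show "abelian_group (loc P)"
 proof (rule abelian_groupI)
  fix x assume "x \<in> carrier (loc P)"
  then obtain a b where a: "x = fr P a b" "vf P a b" by (auto simp: carrier_loc)
  have v': "vf P (- a) b" using a(2) by (auto simp: vf_def intro: homog_uminus)
  have "fr P (- a) b \<oplus>\<^bsub>loc P\<^esub> x = \<zero>\<^bsub>loc P\<^esub>"
   unfolding fr_zero a(1) fr_add[OF P v' a(2)]
   by (rule fr_eqI[OF P vf_add[OF P v' a(2)] vf_one(2)[OF P]]) (simp add: I_D(1))
  thus "\<exists>y\<in>carrier (loc P). y \<oplus>\<^bsub>loc P\<^esub> x = \<zero>\<^bsub>loc P\<^esub>" using fr_in[OF v'] by blast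
 next
  fix x y assume "x \<in> carrier (loc P)" "y \<in> carrier (loc P)"
  then obtain a b c d where h: "x = fr P a b" "y = fr P c d" "vf P a b" "vf P c d" by (auto simp: carrier_loc)
  show "x \<oplus>\<^bsub>loc P\<^esub> y \<in> carrier (loc P)" unfolding h(1,2) fr_add[OF P h(3,4)] by (intro fr_in v h)
  show "x \<oplus>\<^bsub>loc P\<^esub> y = y \<oplus>\<^bsub>loc P\<^esub> x"
   unfolding h(1,2) fr_add[OF P h(3,4)] fr_add[OF P h(4,3)] by (simp only: mult.commute add.commute)
  fix z' assume "z' \<in> carrier (loc P)"
  then obtain e f where k: "z' = fr P e f" "vf P e f" by (auto simp: carrier_loc)
  show "x \<oplus>\<^bsub>loc P\<^esub> y \<oplus>\<^bsub>loc P\<^esub> z' = x \<oplus>\<^bsub>loc P\<^esub> (y \<oplus>\<^bsub>loc P\<^esub> z')"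
   unfolding h(1,2) k(1) fr_add[OF P h(3,4)] fr_add[OF P h(4) k(2)]
    fr_add[OF P v(2)[OF h(3,4)] k(2)] fr_add[OF P h(3) v(2)[OF h(4) k(2)]] by (simp add: algebra_simps)
 next
  show "\<zero>\<^bsub>loc P\<^esub> \<in> carrier (loc P)" unfolding fr_zero by (intro fr_in v)
  fix x assume "x \<in> carrier (loc P)"
  then obtain a b where a: "x = fr P a b" "vf P a b" by (auto simp: carrier_loc)
  show "\<zero>\<^bsub>loc P\<^esub> \<oplus>\<^bsub>loc P\<^esub> x = x"
   unfolding fr_zero a(1) fr_add[OF P vf_one(2)[OF P] a(2)] by simp
 qed
 show "comm_monoid (loc P)" by (rule comm_monoidI) (auto simp: carrier_loc fr_mult[OF P] fr_one v mult_ac, (metis v)+)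
 show "(x \<oplus>\<^bsub>loc P\<^esub> y) \<otimes>\<^bsub>loc P\<^esub> z = x \<otimes>\<^bsub>loc P\<^esub> z \<oplus>\<^bsub>loc P\<^esub> y \<otimes>\<^bsub>loc P\<^esub> z"
  if xyz: "x \<in> carrier (loc P)" "y \<in> carrier (loc P)" "z \<in> carrier (loc P)" for x y z
 proof -
  obtain a b c d e f where h: "x = fr P a b" "y = fr P c d" "z = fr P e f" "vf P a b" "vf P c d" "vf P e f"
   using xyz unfolding carrier_loc by blast
  show ?thesis unfolding h(1-3) fr_add[OF P h(4,5)] fr_mult[OF P h(4,6)] fr_mult[OF P h(5,6)]
    fr_mult[OF P v(2)[OF h(4,5)] h(6)] fr_add[OF P v(1)[OF h(4,6)] v(1)[OF h(5,6)]]
   by (rule fr_eqI[OF P v(1)[OF v(2)[OF h(4,5)] h(6)] v(2)[OF v(1)[OF h(4,6)] v(1)[OF h(5,6)]]], rule z)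
    (simp add: algebra_simps)
 qed
qed

end

section \<open>Rings of sections of the structure sheaf\<close>

context graded_quot
begin

abbreviation T where "T \<equiv> proj_top A Gr"
abbreviation E where "E \<equiv> Proj A Gr"
abbreviation Sc where "Sc U \<equiv> sec E U"
definition DD where "DD h = {P \<in> points. h ~: pull P}"

lemma basic_eq: "{{P \<in> proj_points A Gr. h ~: P} | h d. h \<in> Gr d} = {DD h | h d. h \<in> homog d}"
 by (force simp: DD_def pull_def Gr_def points_def)

lemma open_DD: "h \<in> homog d ==> openin T (DD h)"
 unfolding proj_top_def basic_eq by (intro topology_generated_by_Basis) auto

lemma DD_mult: "DD (g * h) = DD g \<inter> DD h" by (auto simp: DD_def pull_prime)

lemma open_basis: assumes "openin T V" "P \<in> V" obtains h d where "h \<in> homog d" "P \<in> DD h" "DD h <= V"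
proof -
 have "generate_topology_on {DD h | h d. h \<in> homog d} V"
  using assms(1) unfolding proj_top_def basic_eq by (rule openin_topology_generated_by)
 hence "\<forall>P\<in>V. \<exists>h d. h \<in> homog d & P \<in> DD h & DD h <= V"
 proof induction
  case (Int a b)
  show ?case
  proof
   fix P assume "P \<in> a \<inter> b"
   with Int obtain g d h e where "g \<in> homog d" "P \<in> DD g" "DD g <= a" "h \<in> homog e" "P \<in> DD h" "DD h <= b"
    by (meson IntD1 IntD2)
   thus "\<exists>h d. h \<in> homog d & P \<in> DD h & DD h <= a \<inter> b"
    using homog_mult[of g d h e] by (intro exI[of _ "g * h"] exI[of _ "d + e"]) (auto simp: DD_mult)
  qed
 next
  case (UN K)
  thus ?case by (meson Union_iff Union_upper order_trans)
 qed blast+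
 thus ?thesis using assms(2) that by blast
qed

lemma open_points: "openin T V ==> V <= points" using open_basis[of V] by (force simp: DD_def)

lemma hfrac_co: "(co a, co b) \<in> hfrac Gr Q ==> a \<in> homog d ==> b \<in> homog d ==> vf Q a b"
 by (auto simp: hfrac_def vf_def pull_def)

text \<open>An arbitrary neighbourhood shrinks to a basic open set, and the fraction over S/I lifts
  to homogeneous a and b in S.\<close>

lemma sec_iff: assumes U: "openin T U" shows "s \<in> carrier (Sc U) \<longleftrightarrow> s \<in> extensional U &
  (\<forall>P\<in>U. \<exists>g e a b d. g \<in> homog e & P \<in> DD g & DD g <= U & a \<in> homog d & b \<in> homog d &
    (\<forall>Q\<in>DD g. b ~: pull Q & s Q = fr Q a b))" (is "_ \<longleftrightarrow> ?R")
proof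
 assume "s \<in> carrier (Sc U)"
 hence s: "s \<in> (\<Pi>\<^sub>E P\<in>U. carrier (loc P))"
  and loc: "!!P. P \<in> U ==> \<exists>V a b. openin T V & P \<in> V & V <= U & (\<forall>Q\<in>V. (a, b) \<in> hfrac Gr Q & s Q = hfrac_rel A Gr Q `` {(a, b)})"
  by (auto simp: Proj_def proj_sections_def)
 have "\<exists>g e a b d. g \<in> homog e & P \<in> DD g & DD g <= U & a \<in> homog d & b \<in> homog d &
    (\<forall>Q\<in>DD g. b ~: pull Q & s Q = fr Q a b)" if P: "P \<in> U" for P
 proof -
  obtain V a' b' where V: "openin T V" "P \<in> V" "V <= U" "!!Q. Q \<in> V ==> (a', b') \<in> hfrac Gr Q & s Q = hfrac_rel A Gr Q `` {(a', b')}"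
   using loc[OF P] by blast
  obtain g e where g: "g \<in> homog e" "P \<in> DD g" "DD g <= V" by (rule open_basis[OF V(1,2)])
  from V(4)[OF V(2)] obtain a b where ab: "a' = co a" "b' = co b" "vf P a b" by (auto simp: hfrac_eq)
  then obtain d where d: "a \<in> homog d" "b \<in> homog d" by (auto simp: vf_def)
  have "b ~: pull Q & s Q = fr Q a b" if "Q \<in> DD g" for Q
   using V(4)[of Q] g(3) that hfrac_co[of a b Q, OF _ d] by (auto simp: ab fr_def vf_def)
  thus ?thesis using g V(3) d by blast
 qed
 thus ?R using s by (auto simp: PiE_def)
next
 assume R: ?R
 have "\<exists>V a b. openin T V & P \<in> V & V <= U & (\<forall>Q\<in>V. (a, b) \<in> hfrac Gr Q & s Q = hfrac_rel A Gr Q `` {(a, b)})"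
  and "s P \<in> carrier (loc P)" if P: "P \<in> U" for P
 proof -
  obtain g e a b d where h: "g \<in> homog e" "P \<in> DD g" "DD g <= U" "a \<in> homog d" "b \<in> homog d"
    "!!Q. Q\<in>DD g ==> b ~: pull Q & s Q = fr Q a b" using R P by meson
  have v: "vf Q a b" if "Q \<in> DD g" for Q using h that by (intro vfI) auto
  show "s P \<in> carrier (loc P)" using v[OF h(2)] h(2,6) by (auto simp: fr_in)
  show "\<exists>V a b. openin T V & P \<in> V & V <= U & (\<forall>Q\<in>V. (a, b) \<in> hfrac Gr Q & s Q = hfrac_rel A Gr Q `` {(a, b)})"
  proof (intro exI conjI ballI)
   show "openin T (DD g)" "P \<in> DD g" "DD g <= U" using h open_DD[OF h(1)] by auto
   fix Q assume "Q \<in> DD g"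
   thus "(co a, co b) \<in> hfrac Gr Q" "s Q = hfrac_rel A Gr Q `` {(co a, co b)}"
    using v h(6) unfolding hfrac_eq fr_def by blast+
  qed
 qed
 thus "s \<in> carrier (Sc U)" using R by (auto simp: Proj_def proj_sections_def PiE_def)
qed

lemma sec_ops:
 "x \<oplus>\<^bsub>Sc U\<^esub> y = (\<lambda>P\<in>U. x P \<oplus>\<^bsub>loc P\<^esub> y P)" "x \<otimes>\<^bsub>Sc U\<^esub> y = (\<lambda>P\<in>U. x P \<otimes>\<^bsub>loc P\<^esub> y P)"
 "\<one>\<^bsub>Sc U\<^esub> = (\<lambda>P\<in>U. fr P 1 1)" "\<zero>\<^bsub>Sc U\<^esub> = (\<lambda>P\<in>U. fr P 0 1)"
 by (simp_all add: Proj_def flip: fr_one fr_zero)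

lemma sec_at:
 "P \<in> U ==> (x \<oplus>\<^bsub>Sc U\<^esub> y) P = x P \<oplus>\<^bsub>loc P\<^esub> y P" "P \<in> U ==> (x \<otimes>\<^bsub>Sc U\<^esub> y) P = x P \<otimes>\<^bsub>loc P\<^esub> y P"
 "P \<in> U ==> \<one>\<^bsub>Sc U\<^esub> P = \<one>\<^bsub>loc P\<^esub>" "P \<in> U ==> \<zero>\<^bsub>Sc U\<^esub> P = \<zero>\<^bsub>loc P\<^esub>"
 by (simp_all add: sec_ops fr_one fr_zero)

lemma sec_germ: "openin T U ==> s \<in> carrier (Sc U) ==> P \<in> U ==> s P \<in> carrier (loc P)"
 by (auto simp: Proj_def proj_sections_def)

lemma sec_eqI:
 assumes "openin T U" "s \<in> carrier (Sc U)" "t \<in> carrier (Sc U)" "!!P. P \<in> U ==> s P = t P" shows "s = t"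
 using assms by (auto simp: sec_iff intro: extensionalityI)

lemma sec_closed2: assumes U: "openin T U" and x: "x \<in> carrier (Sc U)" and y: "y \<in> carrier (Sc U)"
  and op: "!!a b c d i j. a \<in> homog i ==> b \<in> homog i ==> c \<in> homog j ==> d \<in> homog j ==>
   \<exists>n. N a b c d \<in> homog n & b * d \<in> homog n & (\<forall>Q\<in>U. vf Q a b --> vf Q c d --> w Q (fr Q a b) (fr Q c d) = fr Q (N a b c d) (b * d))"
 shows "(\<lambda>P\<in>U. w P (x P) (y P)) \<in> carrier (Sc U)" unfolding sec_iff[OF U]
proof (intro conjI ballI)
 fix P assume P: "P \<in> U"
 obtain g e a b i where h: "g \<in> homog e" "P \<in> DD g" "DD g <= U" "a \<in> homog i" "b \<in> homog i"
   "!!Q. Q\<in>DD g ==> b ~: pull Q & x Q = fr Q a b" using x P unfolding sec_iff[OF U] by meson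
 obtain g' e' c d j where k: "g' \<in> homog e'" "P \<in> DD g'" "DD g' <= U" "c \<in> homog j" "d \<in> homog j"
   "!!Q. Q\<in>DD g' ==> d ~: pull Q & y Q = fr Q c d" using y P unfolding sec_iff[OF U] by meson
 obtain n where n: "N a b c d \<in> homog n" "b * d \<in> homog n" "!!Q. Q \<in> U ==> vf Q a b ==> vf Q c d ==> w Q (fr Q a b) (fr Q c d) = fr Q (N a b c d) (b * d)"
  using op[OF h(4,5) k(4,5)] by blast
 have "b * d ~: pull Q & (\<lambda>P\<in>U. w P (x P) (y P)) Q = fr Q (N a b c d) (b * d)" if "Q \<in> DD (g * g')" for Q
 proof -
  have Q: "Q \<in> DD g" "Q \<in> DD g'" "Q \<in> U" "Q \<in> points" 
   using that h(3) DD_mult[of g g'] unfolding DD_def by blast+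
  have "vf Q a b" "vf Q c d" using h k Q by (auto intro: vfI)
  thus ?thesis using h(6)[OF Q(1)] k(6)[OF Q(2)] n(3) Q by (auto simp: pull_prime)
 qed
 moreover have "P \<in> DD (g * g')" "DD (g * g') <= U" using h k by (auto simp: DD_mult)
 ultimately show "\<exists>g e a b d. g \<in> homog e & P \<in> DD g & DD g <= U & a \<in> homog d & b \<in> homog d &
    (\<forall>Q\<in>DD g. b ~: pull Q & (\<lambda>P\<in>U. w P (x P) (y P)) Q = fr Q a b)"
  using homog_mult[OF h(1) k(1)] n(1,2) by blast
qed simp

lemma sec_const: assumes U: "openin T U" and "a \<in> homog d" "b \<in> homog d" "!!Q. Q \<in> U ==> b ~: pull Q"
 shows "(\<lambda>P\<in>U. fr P a b) \<in> carrier (Sc U)" unfolding sec_iff[OF U]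
proof (intro conjI ballI)
 fix P assume P: "P \<in> U"
 obtain g e where g: "g \<in> homog e" "P \<in> DD g" "DD g <= U" by (rule open_basis[OF U P])
 thus "\<exists>g e a' b' d. g \<in> homog e & P \<in> DD g & DD g <= U & a' \<in> homog d & b' \<in> homog d &
    (\<forall>Q\<in>DD g. b' ~: pull Q & (\<lambda>P\<in>U. fr P a b) Q = fr Q a' b')"
  using assms(2-4) by (intro exI[of _ g] exI[of _ e] exI[of _ a] exI[of _ b] exI[of _ d]) auto
qed simp

lemma sec_add_closed: assumes U: "openin T U" and "x \<in> carrier (Sc U)" "y \<in> carrier (Sc U)"
 shows "x \<oplus>\<^bsub>Sc U\<^esub> y \<in> carrier (Sc U)" unfolding sec_ops
proof (rule sec_closed2[OF assms, where N = "%a b c d. a * d + c * b"])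
 fix a b c d :: "('n, 'k) mpoly" and i j assume h: "a \<in> homog i" "b \<in> homog i" "c \<in> homog j" "d \<in> homog j"
 have "a * d + c * b \<in> homog (i + j)" "b * d \<in> homog (i + j)"
  using homog_mult[OF h(1,4)] homog_mult[OF h(3,2)] homog_mult[OF h(2,4)] by (auto simp: add.commute intro: homog_add)
 thus "\<exists>n. a * d + c * b \<in> homog n & b * d \<in> homog n & (\<forall>Q\<in>U. vf Q a b --> vf Q c d --> fr Q a b \<oplus>\<^bsub>loc Q\<^esub> fr Q c d = fr Q (a * d + c * b) (b * d))"
  using open_points[OF U] fr_add by blast
qed

lemma sec_mult_closed: assumes U: "openin T U" and "x \<in> carrier (Sc U)" "y \<in> carrier (Sc U)"
 shows "x \<otimes>\<^bsub>Sc U\<^esub> y \<in> carrier (Sc U)" unfolding sec_ops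
proof (rule sec_closed2[OF assms, where N = "%a b c d. a * c"])
 fix a b c d :: "('n, 'k) mpoly" and i j assume h: "a \<in> homog i" "b \<in> homog i" "c \<in> homog j" "d \<in> homog j"
 show "\<exists>n. a * c \<in> homog n & b * d \<in> homog n & (\<forall>Q\<in>U. vf Q a b --> vf Q c d --> fr Q a b \<otimes>\<^bsub>loc Q\<^esub> fr Q c d = fr Q (a * c) (b * d))"
  using open_points[OF U] fr_mult homog_mult[OF h(1,3)] homog_mult[OF h(2,4)] by blast
qed

lemma sec_neg_closed: assumes U: "openin T U" and x: "x \<in> carrier (Sc U)"
 shows "\<exists>y\<in>carrier (Sc U). y \<oplus>\<^bsub>Sc U\<^esub> x = \<zero>\<^bsub>Sc U\<^esub>"
proof -
 note pts = open_points[OF U]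
 have one: "\<one>\<^bsub>Sc U\<^esub> \<in> carrier (Sc U)" "(\<lambda>P\<in>U. fr P (- 1) 1) \<in> carrier (Sc U)"
  unfolding sec_ops using pts pull_one by (auto intro!: sec_const[OF U, of _ 0] homog_uminus)
 let ?y = "(\<lambda>P\<in>U. fr P (- 1) 1) \<otimes>\<^bsub>Sc U\<^esub> x"
 have "?y \<oplus>\<^bsub>Sc U\<^esub> x = \<zero>\<^bsub>Sc U\<^esub>"
 proof (unfold sec_ops, rule restrict_ext, simp)
  fix P assume P: "P \<in> U"
  hence Pp: "P \<in> points" using pts by blast
  from sec_germ[OF U x P] obtain a b where ab: "x P = fr P a b" "vf P a b" by (auto simp: carrier_loc)
  obtain d where d: "a \<in> homog d" "b \<in> homog d" "b ~: pull P" using ab(2) by (auto simp: vf_def)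
  have v: "vf P (- 1) 1" using pull_one[OF Pp] by (intro vfI[of _ 0]) (auto intro: homog_uminus)
  have "fr P (- 1) 1 \<otimes>\<^bsub>loc P\<^esub> fr P a b \<oplus>\<^bsub>loc P\<^esub> fr P a b = fr P 0 b"
   using fr_add_same[OF Pp homog_uminus[OF d(1)] d] by (simp add: fr_mult[OF Pp v ab(2)])
  also have "\<dots> = fr P 0 1" using d vf_one[OF Pp] by (intro fr_eqI[OF Pp]) (auto simp: I_D(1) intro: vfI)
  finally show "fr P (- 1) 1 \<otimes>\<^bsub>loc P\<^esub> x P \<oplus>\<^bsub>loc P\<^esub> x P = fr P 0 1" unfolding ab(1) .
 qed
 thus ?thesis using sec_mult_closed[OF U one(2) x] by blast
qed

lemma cring_sec: assumes U: "openin T U" shows "cring (Sc U)"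
proof -
 note pts = subsetD[OF open_points[OF U]]
 note germ = sec_germ[OF U]
 have c: "cring (loc P)" if "P \<in> U" for P using cring_loc pts that by blast
 hence r: "ring (loc P)" "comm_monoid (loc P)" "abelian_group (loc P)" "monoid (loc P)" "abelian_monoid (loc P)" if "P \<in> U" for P
  using that cring.axioms ring.is_abelian_group ring.is_monoid abelian_group.axioms by blast+
 have 1: "\<one>\<^bsub>Sc U\<^esub> \<in> carrier (Sc U)" "\<zero>\<^bsub>Sc U\<^esub> \<in> carrier (Sc U)"
  unfolding sec_ops using pts pull_one by (auto intro!: sec_const[OF U, of _ 0])
 note cl = sec_add_closed[OF U] sec_mult_closed[OF U] 1
 show ?thesis
 proof (rule cringI)
  show "abelian_group (Sc U)"
  proof (rule abelian_groupI)
   fix x y z assume h: "x \<in> carrier (Sc U)" "y \<in> carrier (Sc U)" "z \<in> carrier (Sc U)"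
   show "x \<oplus>\<^bsub>Sc U\<^esub> y \<oplus>\<^bsub>Sc U\<^esub> z = x \<oplus>\<^bsub>Sc U\<^esub> (y \<oplus>\<^bsub>Sc U\<^esub> z)"
    by (rule sec_eqI[OF U], intro cl h, intro cl h, simp add: sec_at germ cl h abelian_monoid.a_assoc[OF r(5)])
  next
   fix x y assume h: "x \<in> carrier (Sc U)" "y \<in> carrier (Sc U)"
   show "x \<oplus>\<^bsub>Sc U\<^esub> y = y \<oplus>\<^bsub>Sc U\<^esub> x"
    by (rule sec_eqI[OF U], intro cl h, intro cl h, simp add: sec_at germ cl h abelian_monoid.a_comm[OF r(5)])
  next
   fix x assume h: "x \<in> carrier (Sc U)"
   show "\<zero>\<^bsub>Sc U\<^esub> \<oplus>\<^bsub>Sc U\<^esub> x = x"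
    by (rule sec_eqI[OF U], intro cl h, intro cl h, simp add: sec_at germ cl h abelian_monoid.l_zero[OF r(5)])
  qed (auto intro: cl sec_neg_closed[OF U])
  show "comm_monoid (Sc U)"
  proof (rule comm_monoidI)
   fix x y z assume h: "x \<in> carrier (Sc U)" "y \<in> carrier (Sc U)" "z \<in> carrier (Sc U)"
   show "x \<otimes>\<^bsub>Sc U\<^esub> y \<otimes>\<^bsub>Sc U\<^esub> z = x \<otimes>\<^bsub>Sc U\<^esub> (y \<otimes>\<^bsub>Sc U\<^esub> z)"
    by (rule sec_eqI[OF U], intro cl h, intro cl h, simp add: sec_at germ cl h monoid.m_assoc[OF r(4)])
  next
   fix x y assume h: "x \<in> carrier (Sc U)" "y \<in> carrier (Sc U)"
   show "x \<otimes>\<^bsub>Sc U\<^esub> y = y \<otimes>\<^bsub>Sc U\<^esub> x"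
    by (rule sec_eqI[OF U], intro cl h, intro cl h, simp add: sec_at germ cl h comm_monoid.m_comm[OF r(2)])
  next
   fix x assume h: "x \<in> carrier (Sc U)"
   show "\<one>\<^bsub>Sc U\<^esub> \<otimes>\<^bsub>Sc U\<^esub> x = x"
    by (rule sec_eqI[OF U], intro cl h, intro cl h, simp add: sec_at germ cl h monoid.l_one[OF r(4)])
  qed (auto intro: cl)
  fix x y z assume h: "x \<in> carrier (Sc U)" "y \<in> carrier (Sc U)" "z \<in> carrier (Sc U)"
  show "(x \<oplus>\<^bsub>Sc U\<^esub> y) \<otimes>\<^bsub>Sc U\<^esub> z = x \<otimes>\<^bsub>Sc U\<^esub> z \<oplus>\<^bsub>Sc U\<^esub> y \<otimes>\<^bsub>Sc U\<^esub> z"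
   by (rule sec_eqI[OF U], intro cl h, intro cl h, simp add: sec_at germ cl h ring.ring_simprules(13)[OF r(1)])
 qed
qed

end

section \<open>Integer polynomials evaluated on sections with a common denominator\<close>

context graded_quot
begin

text \<open>The germ of x at P is a / s^k. Sections with the same k add without a new common
  denominator, which is what isobaric polynomials ask for.\<close>

definition rp where
 "rp V P s d k x a \<longleftrightarrow> x \<in> carrier (Sc V) & a \<in> homog (k * d) & x P = fr P a (s ^ k)"

context
 fixes V P s d assumes V: "openin T V" and P: "P \<in> V" and s: "s \<in> homog d" "s ~: pull P"
begin

lemma P': "P \<in> points" using V P open_points by blast

lemma cr: "cring (Sc V)" by (rule cring_sec[OF V])

lemma vf_rp: "a \<in> homog (k * d) ==> vf P a (s ^ k)" using s pull_power[OF P'] by (auto intro!: vfI homog_power)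

lemma rp_mult: "rp V P s d k x a ==> rp V P s d l y b ==> rp V P s d (k + l) (x \<otimes>\<^bsub>Sc V\<^esub> y) (a * b)"
 using fr_mult[OF P' vf_rp vf_rp, of a k b l] homog_mult[of a "k * d" b "l * d"] sec_mult_closed[OF V]
 by (auto simp: rp_def sec_at[OF P] power_add distrib_right)

lemma rp_add: "rp V P s d k x a ==> rp V P s d k y b ==> rp V P s d k (x \<oplus>\<^bsub>Sc V\<^esub> y) (a + b)"
 using fr_add_same[OF P' _ _ homog_power[OF s(1)], of a k b] pull_power[OF P'] s(2) sec_add_closed[OF V]
 by (auto simp: rp_def sec_at[OF P] intro: homog_add)

lemma rp_one: "rp V P s d 0 \<one>\<^bsub>Sc V\<^esub> 1"
 using cring.axioms(1)[OF cr] by (auto simp: rp_def sec_at[OF P] fr_one ring.ring_simprules(6))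

lemma rp_zero: "rp V P s d k \<zero>\<^bsub>Sc V\<^esub> 0"
proof -
 have "fr P 0 1 = fr P 0 (s ^ k)" by (rule fr_eqI[OF P' vf_one(2)[OF P'] vf_rp]) (simp_all add: I_D(1))
 thus ?thesis using cring.axioms(1)[OF cr] by (auto simp: rp_def sec_at[OF P] fr_zero ring.ring_simprules(2))
qed

lemma rp_minus: assumes x: "rp V P s d k x a" shows "rp V P s d k (\<ominus>\<^bsub>Sc V\<^esub> x) (- a)"
proof -
 interpret R: cring "Sc V" by (rule cr)
 interpret L: cring "loc P" by (rule cring_loc[OF P'])
 have xc: "x \<in> carrier (Sc V)" and a: "a \<in> homog (k * d)" and xP: "x P = fr P a (s ^ k)" using x by (auto simp: rp_def)
 have "(\<ominus>\<^bsub>Sc V\<^esub> x) P \<oplus>\<^bsub>loc P\<^esub> x P = \<zero>\<^bsub>loc P\<^esub>"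
  using R.l_neg[OF xc] by (simp flip: sec_at(1)[OF P] add: sec_at(4)[OF P])
 hence "(\<ominus>\<^bsub>Sc V\<^esub> x) P = \<ominus>\<^bsub>loc P\<^esub> (x P)"
  using L.minus_equality sec_germ[OF V _ P] xc R.a_inv_closed[OF xc] by metis
 also have "\<dots> = fr P (- a) (s ^ k)"
 proof (rule L.minus_equality)
  have "fr P (- a) (s ^ k) \<oplus>\<^bsub>loc P\<^esub> fr P a (s ^ k) = fr P (- a + a) (s ^ k)"
   by (rule fr_add_same[OF P' homog_uminus[OF a] a homog_power[OF s(1)]]) (use s(2) pull_power[OF P'] in blast)
  also have "\<dots> = \<zero>\<^bsub>loc P\<^esub>" using rp_zero[of k] by (simp add: rp_def sec_at[OF P])
  finally show "fr P (- a) (s ^ k) \<oplus>\<^bsub>loc P\<^esub> x P = \<zero>\<^bsub>loc P\<^esub>" unfolding xP .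
 qed (use xc sec_germ[OF V _ P] in "auto intro!: fr_in vf_rp homog_uminus a")
 finally show ?thesis using a R.a_inv_closed[OF xc] by (auto simp: rp_def intro: homog_uminus)
qed

lemma rp_power: "rp V P s d k x a ==> rp V P s d (n * k) (x [^]\<^bsub>Sc V\<^esub> (n :: nat)) (a ^ n)"
proof (induction n)
 case 0
 thus ?case using rp_one by (simp add: nat_pow_def)
next
 case (Suc n)
 from rp_mult[OF Suc.IH[OF Suc.prems] Suc.prems] show ?case by (simp add: nat_pow_def mult.commute add.commute)
qed

lemma rp_int: 
 assumes x: "rp V P s d k x a" shows "rp V P s d k ([(z::int)] \<cdot>\<^bsub>Sc V\<^esub> x) (of_int z * a)"
proof -
 have n: "rp V P s d k ([n] \<cdot>\<^bsub>Sc V\<^esub> x) (of_nat n * a)" for n :: nat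
 proof (induction n)
  case 0
  thus ?case using rp_zero by (simp add: add_pow_def nat_pow_def)
 next
  case (Suc n)
  from rp_add[OF Suc.IH x] show ?case by (simp add: add_pow_def nat_pow_def distrib_right add.commute)
 qed
 show ?thesis
 proof (cases "z < 0")
  case True
  have "[z] \<cdot>\<^bsub>Sc V\<^esub> x = \<ominus>\<^bsub>Sc V\<^esub> ([nat (- z)] \<cdot>\<^bsub>Sc V\<^esub> x)" by (rule add_pow_int_lt[OF True])
  moreover have "of_int z * a = - (of_nat (nat (- z)) * a)" using True by simp
  ultimately show ?thesis using rp_minus[OF n[of "nat (- z)"]] by (simp only:)
 next
  case False
  hence "[z] \<cdot>\<^bsub>Sc V\<^esub> x = [nat z] \<cdot>\<^bsub>Sc V\<^esub> x" by (intro add_pow_int_ge) simp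
  moreover have "of_int z * a = of_nat (nat z) * a" using False by simp
  ultimately show ?thesis using n[of "nat z"] by (simp only:)
 qed
qed

lemma rp_finprod: assumes "finite B" "!!t. t \<in> B ==> rp V P s d (k t) (x t) (a t)"
 shows "rp V P s d (\<Sum>t\<in>B. k t) (\<Otimes>\<^bsub>Sc V\<^esub>t\<in>B. x t) (\<Prod>t\<in>B. a t)" using assms
proof (induction B rule: finite_induct)
 case empty
 interpret R: cring "Sc V" by (rule cr)
 show ?case using rp_one by simp
next
 case (insert b B)
 interpret R: cring "Sc V" by (rule cr)
 have "(\<Otimes>\<^bsub>Sc V\<^esub>t\<in>insert b B. x t) = x b \<otimes>\<^bsub>Sc V\<^esub> (\<Otimes>\<^bsub>Sc V\<^esub>t\<in>B. x t)"
  using insert by (intro R.finprod_insert) (auto simp: rp_def)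
 with rp_mult[OF insert.prems[of b] insert.IH] insert show ?case by simp
qed

lemma rp_finsum: assumes "finite B" "!!t. t \<in> B ==> rp V P s d k (x t) (a t)"
 shows "rp V P s d k (\<Oplus>\<^bsub>Sc V\<^esub>t\<in>B. x t) (\<Sum>t\<in>B. a t)" using assms
proof (induction B rule: finite_induct)
 case empty
 interpret R: cring "Sc V" by (rule cr)
 show ?case using rp_zero by simp
next
 case (insert b B)
 interpret R: cring "Sc V" by (rule cr)
 have "(\<Oplus>\<^bsub>Sc V\<^esub>t\<in>insert b B. x t) = x b \<oplus>\<^bsub>Sc V\<^esub> (\<Oplus>\<^bsub>Sc V\<^esub>t\<in>B. x t)"
  using insert by (intro R.finsum_insert) (auto simp: rp_def)
 with rp_add[OF insert.prems[of b] insert.IH] insert show ?case by simp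
qed

text \<open>Every monomial of Q has weight w, so all summands carry the denominator s^w.\<close>

lemma rp_eval: assumes iso: "isob \<omega> w Q"
  and env: "!!m t. m \<in> keys Q ==> t \<in> keys m ==> rp V P s d (\<omega> t) (env t) (env' t)"
 shows "rp V P s d w (eval_int_poly (Sc V) env Q) (ev env' Q)" unfolding eval_int_poly_def ev_def
proof (rule rp_finsum[OF finite_keys])
 fix m assume m: "m \<in> keys Q"
 have "rp V P s d (\<Sum>t\<in>keys m. lookup m t * \<omega> t)
   (\<Otimes>\<^bsub>Sc V\<^esub>t\<in>keys m. env t [^]\<^bsub>Sc V\<^esub> lookup m t) (mon_ev env' m)"
  unfolding mon_ev_def by (intro rp_finprod rp_power env[OF m]) auto
 moreover have "(\<Sum>t\<in>keys m. lookup m t * \<omega> t) = w" using iso m by (simp add: isob_def mwt_def)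
 ultimately show "rp V P s d w ([lookup Q m] \<cdot>\<^bsub>Sc V\<^esub>
   (\<Otimes>\<^bsub>Sc V\<^esub>t\<in>keys m. env t [^]\<^bsub>Sc V\<^esub> lookup m t))
   (of_int (lookup Q m) * mon_ev env' m)" by (intro rp_int) simp
qed

end

end

section \<open>Witt vectors of sections as fractions of homogeneous Witt vectors\<close>

context fedder
begin

sublocale graded_quot I
proof
 show "hom_set I" unfolding I by (rule hom_set_igen[OF hom])
qed (rule is_ideal_I)

abbreviation Wn where "Wn n V \<equiv> witt_ring p n (Sc V)"

text \<open>At P the Witt vector a of sections is x / [s]: division by a Teichmueller element gives
  component i the denominator s^(p^i). Only the components of x below n are tied to a.\<close>

definition wrep where
 "wrep n V P s w x a \<longleftrightarrow> openin T V & P \<in> V & a \<in> carrier (Wn n V) & s \<in> homog w & s ~: pull P & x \<in> whom w &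
  (\<forall>i<n. (a ! i) P = fr P (wc x i) (s ^ (p ^ i)))"

lemma carrier_Wn: "a \<in> carrier (Wn n V) \<longleftrightarrow> length a = n & (\<forall>i<n. a ! i \<in> carrier (Sc V))"
 by (auto simp: witt_ring_def in_set_conv_nth subset_iff)

lemma Wn_add: "a \<oplus>\<^bsub>Wn n V\<^esub> b = map (%i. eval_int_poly (Sc V) (case_sum (nth a) (nth b)) (witt_sum p i)) [0..<n]"
 and Wn_mult: "a \<otimes>\<^bsub>Wn n V\<^esub> b = map (%i. eval_int_poly (Sc V) (case_sum (nth a) (nth b)) (witt_prod p i)) [0..<n]"
 by (simp_all add: witt_ring_def)

lemma wrep_rp: assumes "wrep n V P s w x a" "i < n" shows "rp V P s w (p ^ i) (a ! i) (wc x i)"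
 using assms by (auto simp: wrep_def rp_def carrier_Wn whom_def)

lemma wrep_op: assumes a: "wrep n V P s w x a" and b: "wrep n V P s w y b" and i: "i < n"
  and Q: "isob (%t. p ^ widx t) k Q" "isob (%t. if widx t > i then 1 else 0) 0 Q"
 shows "rp V P s w k (eval_int_poly (Sc V) (case_sum (nth a) (nth b)) Q) (ev (case_sum (wc x) (wc y)) Q)"
proof -
 have h: "openin T V" "P \<in> V" "s \<in> homog w" "s ~: pull P" using a by (auto simp: wrep_def)
 show ?thesis
 proof (rule rp_eval[OF h Q(1)])
  fix m t assume "m \<in> keys Q" "t \<in> keys m"
  from isob_index_imp[OF Q(2) this] have "widx t < n" using i by simp
  thus "rp V P s w (p ^ widx t) (case_sum (nth a) (nth b) t) (case_sum (wc x) (wc y) t)"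
   using wrep_rp[OF a] wrep_rp[OF b] by (cases t) auto
 qed
qed

lemma wrep_add: assumes "wrep n V P s w x a" "wrep n V P s w y b"
 shows "wrep n V P s w (x + y) (a \<oplus>\<^bsub>Wn n V\<^esub> b)"
proof -
 have r: "rp V P s w (p ^ i) ((a \<oplus>\<^bsub>Wn n V\<^esub> b) ! i) (wc (x + y) i)" if "i < n" for i
  using wrep_op[OF assms that isob_witt_sum[OF p] index_witt_sum[OF p]] that
  by (simp add: Wn_add wc_add[OF prime_char_S] char_S wadd_def)
 have "x + y \<in> whom w" using assms by (auto simp: wrep_def intro: whom_add)
 thus ?thesis using assms r by (auto simp: wrep_def carrier_Wn rp_def Wn_add)
qed

lemma wrep_mult: assumes "wrep n V P s w x a" "wrep n V P s w y b"
 shows "wrep n V P (s ^ 2) (2 * w) (wtimes x y) (a \<otimes>\<^bsub>Wn n V\<^esub> b)"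
proof -
 have r: "rp V P s w (2 * p ^ i) ((a \<otimes>\<^bsub>Wn n V\<^esub> b) ! i) (wc (wtimes x y) i)" if "i < n" for i
  using wrep_op[OF assms that isob_witt_prod[OF p] index_witt_prod[OF p]] that
  by (simp add: Wn_mult wtimes_def char_S wmul_def)
 have "wtimes x y \<in> whom (2 * w)" using assms by (auto simp: wrep_def intro: whom_wtimes)
 moreover have "s ^ 2 \<in> homog (2 * w)" using assms by (auto simp: wrep_def intro: homog_power)
 moreover have "s ^ 2 ~: pull P" using assms pull_power[of P s 2] open_points by (auto simp: wrep_def)
 ultimately show ?thesis using assms r by (auto simp: wrep_def carrier_Wn rp_def Wn_mult power_mult)
qed

lemma wrep_frob: assumes "wrep n V P s w x a" shows "wrep n V P (s ^ p) (p * w) (wF x) (witt_frob p (Sc V) a)"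
proof -
 have h: "openin T V" "P \<in> V" "s \<in> homog w" "s ~: pull P" using assms by (auto simp: wrep_def)
 have r: "rp V P s w (p * p ^ i) (witt_frob p (Sc V) a ! i) (wc (wF x) i)" if "i < n" for i
  using rp_power[OF h wrep_rp[OF assms that], of p] assms that by (simp add: witt_frob_def char_S wrep_def carrier_Wn)
 have "wF x \<in> whom (p * w)" using assms by (auto simp: wrep_def intro: whom_wF)
 moreover have "s ^ p \<in> homog (p * w)" using assms by (auto simp: wrep_def intro: homog_power)
 moreover have "s ^ p ~: pull P" using assms pull_power[of P s p] open_points by (auto simp: wrep_def)
 ultimately show ?thesis using assms r by (auto simp: wrep_def carrier_Wn rp_def witt_frob_def power_mult)
qed

lemma wrep_scale: assumes a: "wrep n V P s w x a" and c: "c \<in> homog e" "c ~: pull P"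
 shows "wrep n V P (c * s) (e + w) (wscale c x) a"
proof -
 have P: "P \<in> points" using a open_points by (auto simp: wrep_def)
 have "fr P (wc (wscale c x) i) ((c * s) ^ p ^ i) = fr P (wc x i) (s ^ p ^ i)" if "i < n" for i
 proof -
  have "vf P (wc x i) (s ^ p ^ i)" using a pull_power[OF P] by (auto simp: wrep_def whom_def intro!: vfI homog_power)
  from fr_cancel[OF P this homog_power[OF c(1)], of "p ^ i"] show ?thesis using c(2) pull_power[OF P]
   by (auto simp: char_S power_mult_distrib)
 qed
 thus ?thesis using a c whom_wscale[OF c(1), of x w] homog_mult[OF c(1), of s w] pull_prime[OF P]
  by (auto simp: wrep_def)
qed

text \<open>With s the product of the denominators c_i of the n components, component i is brought
  to the denominator s^(p^i) by the factor (s / c_i) * s^(p^i - 1).\<close>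

lemma wrep_local: assumes V: "openin T V" and a: "a \<in> carrier (Wn n V)" and P: "P \<in> V"
 obtains g e s w x where "g \<in> homog e" "P \<in> DD g" "DD g <= V" "!!Q. Q \<in> DD g ==> wrep n V Q s w x a"
proof -
 have "\<forall>i<n. \<exists>g e b c d. g \<in> homog e & P \<in> DD g & DD g <= V & b \<in> homog d & c \<in> homog d &
    (\<forall>Q\<in>DD g. c ~: pull Q & (a ! i) Q = fr Q b c)" using a P unfolding carrier_Wn sec_iff[OF V] by blast
 then obtain g e b c d where h: "!!i. i < n ==> g i \<in> homog (e i)" "!!i. i < n ==> P \<in> DD (g i)"
  "!!i. i < n ==> b i \<in> homog (d i)" "!!i. i < n ==> c i \<in> homog (d i)"
  "!!i Q. i < n ==> Q \<in> DD (g i) ==> c i ~: pull Q & (a ! i) Q = fr Q (b i) (c i)" by metis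
 obtain g0 e0 where g0: "g0 \<in> homog e0" "P \<in> DD g0" "DD g0 <= V" by (rule open_basis[OF V P])
 define G where "G = g0 * (\<Prod>i<n. g i)"
 define s where "s = (\<Prod>i<n. c i)"
 define w where "w = (\<Sum>i<n. d i)"
 define x where "x = Witt (%i. if i < n then b i * (\<Prod>j\<in>{..<n} - {i}. c j) * s ^ (p ^ i - 1) else 0)"
 have prodh: "(!!i. i \<in> B ==> q i \<in> homog (k i)) ==> finite B ==> (\<Prod>i\<in>B. q i) \<in> homog (\<Sum>i\<in>B. k i)"
  for B :: "nat set" and q :: "nat => ('n, 'k) mpoly" and k
  by (induction B rule: infinite_finite_induct) (auto intro: homog_mult)
 have Pp: "P \<in> points" using V P open_points by blast
 have sw: "s \<in> homog w" unfolding s_def w_def by (rule prodh) (use h in auto)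
 have G: "G \<in> homog (e0 + (\<Sum>i<n. e i))" unfolding G_def by (intro homog_mult g0 prodh) (use h in auto)
 have "(\<Prod>i<n. g i) ~: pull P" by (rule pull_prod[OF Pp]) (use h(2) in "auto simp: DD_def")
 hence PG: "P \<in> DD G" using g0 Pp by (auto simp: G_def DD_def pull_prime)
 have GV1: "DD G <= V" using g0 by (auto simp: G_def DD_mult)
 have GV2: "Q \<in> DD (g i)" if Q: "Q \<in> DD G" and i: "i < n" for Q i
 proof -
  have "(\<Prod>i<n. g i) = g i * (\<Prod>j\<in>{..<n} - {i}. g j)" using i by (intro prod.remove) auto
  thus "Q \<in> DD (g i)" using Q by (simp add: G_def DD_mult)
 qed
 note GV = GV1 GV2
 have xw: "x \<in> whom w" unfolding whom_def
 proof (intro CollectI allI)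
  fix i
  have "b i * (\<Prod>j\<in>{..<n} - {i}. c j) * s ^ (p ^ i - 1) \<in> homog (p ^ i * w)" if i: "i < n"
  proof -
   have "b i * (\<Prod>j\<in>{..<n} - {i}. c j) * s ^ (p ^ i - 1) \<in> homog (d i + (\<Sum>j\<in>{..<n} - {i}. d j) + (p ^ i - 1) * w)"
    by (intro homog_mult prodh homog_power sw) (use h i in auto)
   also have "d i + (\<Sum>j\<in>{..<n} - {i}. d j) + (p ^ i - 1) * w = Suc (p ^ i - 1) * w"
    using sum.remove[of "{..<n}" i d] i by (simp add: w_def)
   finally show ?thesis using p1 by simp
  qed
  thus "wc x i \<in> homog (p ^ i * w)" by (simp add: x_def)
 qed
 have "wrep n V Q s w x a" if Q: "Q \<in> DD G" for Q
 proof -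
  have Qp: "Q \<in> points" using Q by (simp add: DD_def)
  have sQ: "s ~: pull Q" unfolding s_def by (rule pull_prod[OF Qp]) (use h GV Q in auto)
  have "(a ! i) Q = fr Q (wc x i) (s ^ p ^ i)" if i: "i < n" for i
  proof -
   let ?r = "(\<Prod>j\<in>{..<n} - {i}. c j) * s ^ (p ^ i - 1)"
   have 1: "s = c i * (\<Prod>j\<in>{..<n} - {i}. c j)" unfolding s_def using i by (intro prod.remove) auto
   have "s ^ p ^ i = s * s ^ (p ^ i - 1)" using p1 by (simp flip: power_Suc)
   hence 2: "s ^ p ^ i = ?r * c i" by (subst (asm) (2) 1) (simp add: mult_ac)
   have 3: "wc x i = ?r * b i" using i by (simp add: x_def mult_ac)
   have r: "?r \<in> homog ((\<Sum>j\<in>{..<n} - {i}. d j) + (p ^ i - 1) * w)"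
    by (intro homog_mult prodh homog_power sw) (use h i in auto)
   have "?r * c i ~: pull Q" unfolding 2[symmetric] using sQ pull_power[OF Qp] by blast
   hence rQ: "?r ~: pull Q" using pull_prime[OF Qp] by blast
   have v: "vf Q (b i) (c i)" using h(3,4,5) GV(2)[OF Q i] i by (intro vfI) auto
   show ?thesis unfolding 2 3 using fr_cancel[OF Qp v r rQ] h(5)[OF i GV(2)[OF Q i]] by simp
  qed
  thus ?thesis using V Q GV(1) a sw sQ xw by (auto simp: wrep_def)
 qed
 thus ?thesis using that[OF G PG GV(1)] by blast
qed

text \<open>The witnesses for the n components are multiplied into one factor c.\<close>

lemma wrep_unique: assumes a: "wrep n V P s w x a" "wrep n V P s' w' x' a"
 obtains c e where "c \<in> homog e" "c ~: pull P" "!!i. i < n ==> c * (wc x i * s' ^ p ^ i - wc x' i * s ^ p ^ i) \<in> I"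
proof -
 have P: "P \<in> points" using a open_points by (auto simp: wrep_def)
 have "\<exists>t e. t \<in> homog e & t ~: pull P & t * (wc x i * s' ^ p ^ i - wc x' i * s ^ p ^ i) \<in> I" if i: "i < n" for i
 proof -
  have v: "vf P (wc x i) (s ^ p ^ i)" "vf P (wc x' i) (s' ^ p ^ i)"
   using a pull_power[OF P] by (auto simp: wrep_def whom_def intro!: vfI homog_power)
  have "fr P (wc x i) (s ^ p ^ i) = fr P (wc x' i) (s' ^ p ^ i)" using a i by (simp add: wrep_def)
  thus ?thesis unfolding fr_eq_iff[OF P v] .
 qed
 then obtain t e where t: "!!i. i < n ==> t i \<in> homog (e i) & t i ~: pull P & t i * (wc x i * s' ^ p ^ i - wc x' i * s ^ p ^ i) \<in> I"
  by metis
 have "(\<Prod>i<n. t i) * (wc x i * s' ^ p ^ i - wc x' i * s ^ p ^ i) \<in> I" if i: "i < n" for i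
 proof -
  have "(\<Prod>i<n. t i) = (\<Prod>j\<in>{..<n} - {i}. t j) * t i" using i by (subst prod.remove[of _ i]) (auto simp: mult.commute)
  thus ?thesis using I_D(3)[of "t i * (wc x i * s' ^ p ^ i - wc x' i * s ^ p ^ i)"] t[OF i] by (simp only: mult.assoc)
 qed
 moreover have "m \<le> n ==> (\<Prod>i<m. t i) \<in> homog (\<Sum>i<m. e i)" for m
  by (induction m) (use t in "auto intro!: homog_mult")
 moreover have "(\<Prod>i<n. t i) ~: pull P" by (rule pull_prod[OF P]) (use t in auto)
 ultimately show ?thesis using that by blast
qed

end

section \<open>Splittings from graded functionals\<close>

lemma (in frob_dual) Psi_zero: "Psi gs 0 = 0" by (induction gs) auto

lemma (in frob_dual) Psi_trunc: "(!!i. i < length gs ==> wc x i = 0) ==> Psi gs x = 0"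
proof (induction gs arbitrary: x)
 case (Cons g gs)
 have "x = tau 0 + wV (wshift x)" using wV_wshift[of x] Cons.prems[of 0] by simp
 from Psi_eq[OF this, of g gs] have "Psi (g # gs) x = u (Psi gs (wshift x))" by simp
 also have "Psi gs (wshift x) = 0" by (rule Cons.IH) (use Cons.prems in auto)
 finally show ?case by simp
qed simp

lemma witt_diff_trunc:
 fixes x y :: "'a::comm_ring_1 witt" assumes p: "prime CHAR('a)" and "!!j. j \<le> i ==> wc x j = wc y j"
 shows "wc (x - y) i = 0"
proof -
 have "wc (x + - y) i = wc (y + - y) i" unfolding wc_add[OF p] by (rule wadd_cong[OF p]) (use assms in auto)
 thus ?thesis by simp
qed

text \<open>\<open>phi d\<close> is the degree d component of a functional on Witt vectors over S.
  By \<open>phi_cong\<close> it depends, modulo I, only on the Witt vector of length n over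
  S/I.\<close>

locale fedder_split = fedder p ys fs f I for p and ys :: "'k::field list" and fs :: "('n::finite, 'k) mpoly list" and f I +
 fixes n :: nat and phi :: "nat => ('n, 'k) mpoly witt => ('n, 'k) mpoly"
 assumes n: "n \<ge> 1" and phi_homog: "phi d x \<in> homog d" and phi_add: "phi d (x + y) = phi d x + phi d y"
  and phi_scale: "c \<in> homog e ==> phi (e + d) (wscale (c ^ p) x) = c * phi d x"
  and phi_VF: "phi d (wV (wF x)) = 0"
  and phi_cong: "(!!i. i < n ==> wc x i - wc y i \<in> I) ==> phi d x - phi d y \<in> I"
  and phi_1: "phi 0 (teich 1) = 1"
begin

lemma phi_wF: "x \<in> whom d ==> phi d (wF x) = wc x 0"
proof -
 assume "x \<in> whom d"
 hence x0: "wc x 0 \<in> homog d" by (auto simp: whom_def dest: spec[of _ 0])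
 have "wF x = teich (wc x 0 ^ p) + wV (wF (wshift x))"
  using wdecomp[OF p char_S, of "wF x"] by (simp add: char_S wshift_def wF_def)
 also have "teich (wc x 0 ^ p) = wscale (wc x 0 ^ p) (teich 1)" by (simp add: wscale_teich)
 finally have "phi (d + 0) (wF x) = wc x 0 * phi 0 (teich 1)" using phi_scale[OF x0, of 0] by (simp add: phi_add phi_VF)
 thus ?thesis by (simp add: phi_1)
qed

definition val where
 "val V P b = (SOME y. \<exists>t d x. t \<in> homog d & wrep n V P (t ^ p) (p * d) x b & y = fr P (phi d x) t)"

text \<open>The denominator is [t]^p, so that an inverse Frobenius linear functional sends x / [t]^p
  to phi(x) / t.\<close>

definition frep where
 "frep V P t d x b \<longleftrightarrow> t \<in> homog d & wrep n V P (t ^ p) (p * d) x b"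

lemma frep_point: "frep V P t d x b ==> P \<in> points & t ~: pull P"
proof -
 assume h: "frep V P t d x b"
 hence P: "P \<in> points" using open_points by (auto simp: frep_def wrep_def)
 have "t ^ p ~: pull P" using h by (simp add: frep_def wrep_def)
 hence "t ~: pull P" using p1 pull_prime[OF P, of t "t ^ (p - 1)"] by (simp flip: power_Suc)
 thus ?thesis using P by simp
qed

text \<open>Cross multiplication with factors raised to the p-th power, which phi releases; the
  local witness c is absorbed the same way, and \<open>phi_cong\<close> compares the
  results.\<close>

lemma frep_unique: assumes r: "frep V P t d x b" "frep V P t' d' x' b" shows "fr P (phi d x) t = fr P (phi d' x') t'"
proof -
 note P = frep_point[OF r(1)] frep_point[OF r(2)]
 have th: "t \<in> homog d" "t' \<in> homog d'" using r by (auto simp: frep_def)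
 obtain c e where c: "c \<in> homog e" "c ~: pull P" "!!i. i < n ==> c * (wc x i * (t' ^ p) ^ p ^ i - wc x' i * (t ^ p) ^ p ^ i) \<in> I"
  using r unfolding frep_def by (meson wrep_unique)
 have "wc (wscale ((c * t') ^ p) x) i - wc (wscale ((c * t) ^ p) x') i \<in> I" if i: "i < n" for i
 proof -
  have "Suc (p * p ^ i - 1) = p * p ^ i" using p1 by simp
  hence e: "(c ^ p) ^ p ^ i = c ^ (p * p ^ i - 1) * c" by (metis power_Suc2 power_mult)
  have "wc (wscale ((c * t') ^ p) x) i - wc (wscale ((c * t) ^ p) x') i =
    (c ^ p) ^ p ^ i * (wc x i * (t' ^ p) ^ p ^ i - wc x' i * (t ^ p) ^ p ^ i)"
   by (simp add: char_S power_mult_distrib algebra_simps)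
  also have "\<dots> = c ^ (p * p ^ i - 1) * (c * (wc x i * (t' ^ p) ^ p ^ i - wc x' i * (t ^ p) ^ p ^ i))"
   unfolding e by (simp only: mult.assoc)
  finally show ?thesis using I_D(3)[OF c(3)[OF i]] by simp
 qed
 from phi_cong[of "wscale ((c * t') ^ p) x" "wscale ((c * t) ^ p) x'" "e + d' + d", OF this]
 have "phi (e + d' + d) (wscale ((c * t') ^ p) x) - phi (e + d' + d) (wscale ((c * t) ^ p) x') \<in> I" .
 moreover have "phi (e + d' + d) (wscale ((c * t') ^ p) x) = c * t' * phi d x"
  by (rule phi_scale[OF homog_mult[OF c(1) th(2)]])
 moreover have "phi (e + d' + d) (wscale ((c * t) ^ p) x') = c * t * phi d' x'"
  using phi_scale[OF homog_mult[OF c(1) th(1)], of d' x'] by (simp add: add.commute add.left_commute)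
 ultimately have "c * (phi d x * t' - phi d' x' * t) \<in> I" by (simp add: algebra_simps)
 moreover have "vf P (phi d x) t" "vf P (phi d' x') t'" using P th phi_homog by (auto intro: vfI)
 ultimately show ?thesis using c P by (auto simp: fr_eq_iff)
qed

lemma val_eq:  assumes "frep V P t d x b" shows "val V P b = fr P (phi d x) t"
proof -
 have "\<exists>t d x. t \<in> homog d & wrep n V P (t ^ p) (p * d) x b & fr P (phi d x) t = fr P (phi d x) t"
  using assms by (auto simp: frep_def)
 hence "\<exists>t d x. t \<in> homog d & wrep n V P (t ^ p) (p * d) x b & val V P b = fr P (phi d x) t"
  unfolding val_def using assms by (intro someI_ex[of "%y. \<exists>t d x. t \<in> homog d & wrep n V P (t ^ p) (p * d) x b & y = fr P (phi d x) t"]) (auto simp: frep_def)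
 then obtain t' d' x' where "frep V P t' d' x' b" "val V P b = fr P (phi d' x') t'" by (auto simp: frep_def)
 thus ?thesis using frep_unique[OF assms] by simp
qed

text \<open>The fraction x / [s] is expanded by [s^(p-1)].\<close>

lemma wrep_frep: assumes r: "wrep n V P s w x b" shows "frep V P s w (wscale (s ^ (p - 1)) x) b"
proof -
 have P: "P \<in> points" using r open_points by (auto simp: wrep_def)
 have s: "s \<in> homog w" "s ~: pull P" using r by (auto simp: wrep_def)
 have "wrep n V P (s ^ (p - 1) * s) ((p - 1) * w + w) (wscale (s ^ (p - 1)) x) b"
  by (rule wrep_scale[OF r homog_power[OF s(1)]]) (use s(2) pull_power[OF P] in blast)
 moreover have "s ^ (p - 1) * s = s ^ p" "(p - 1) * w + w = p * w"
  using p1 by (simp_all flip: power_Suc2 add: diff_mult_distrib)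
 ultimately show ?thesis using s(1) by (simp add: frep_def)
qed

lemma frep_scale: assumes r: "frep V P t d x b" and c: "c \<in> homog e" "c ~: pull P"
 shows "frep V P (c * t) (e + d) (wscale (c ^ p) x) b"
proof -
 have P: "P \<in> points" using frep_point[OF r] by simp
 have "wrep n V P (c ^ p * t ^ p) (p * e + p * d) (wscale (c ^ p) x) b"
  by (rule wrep_scale) (use r c homog_power[OF c(1)] pull_power[OF P] in "auto simp: frep_def")
 moreover have "c * t \<in> homog (e + d)" using r c by (auto simp: frep_def intro: homog_mult)
 ultimately show ?thesis by (simp add: frep_def power_mult_distrib distrib_left)
qed

lemma frep_add:
 assumes "frep V P t d x b" "frep V P t d y c" shows "frep V P t d (x + y) (b \<oplus>\<^bsub>Wn n V\<^esub> c)"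
 using assms wrep_add by (auto simp: frep_def)

lemma frep_ex: assumes "openin T V" "b \<in> carrier (Wn n V)" "P \<in> V" obtains t d x where "frep V P t d x b"
 using wrep_local[OF assms] wrep_frep by metis

definition psi where "psi V b = (\<lambda>P\<in>V. val V P b)"

lemma psi_closed: assumes V: "openin T V" and b: "b \<in> carrier (Wn n V)" shows "psi V b \<in> carrier (Sc V)"
 unfolding sec_iff[OF V]
proof (intro conjI ballI)
 fix P assume P: "P \<in> V"
 obtain g e s w x where h: "g \<in> homog e" "P \<in> DD g" "DD g <= V" "!!Q. Q \<in> DD g ==> wrep n V Q s w x b"
  using wrep_local[OF V b P] by metis
 let ?a = "phi w (wscale (s ^ (p - 1)) x)"
 have "s ~: pull Q & psi V b Q = fr Q ?a s" if "Q \<in> DD g" for Q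
  using val_eq[OF wrep_frep[OF h(4)[OF that]]] h(4)[OF that] h(3) that by (auto simp: psi_def wrep_def)
 moreover have "s \<in> homog w" using h(4)[OF h(2)] by (simp add: wrep_def)
 ultimately show "\<exists>g e a b' d. g \<in> homog e & P \<in> DD g & DD g <= V & a \<in> homog d & b' \<in> homog d &
    (\<forall>Q\<in>DD g. b' ~: pull Q & psi V b Q = fr Q a b')" using h(1-3) phi_homog by blast
qed (simp add: psi_def)

lemma Wn_closed: assumes V: "openin T V" and bc: "b \<in> carrier (Wn n V)" "c \<in> carrier (Wn n V)"
 shows "b \<oplus>\<^bsub>Wn n V\<^esub> c \<in> carrier (Wn n V)" "b \<otimes>\<^bsub>Wn n V\<^esub> c \<in> carrier (Wn n V)" "witt_frob p (Sc V) b \<in> carrier (Wn n V)"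
proof -
 interpret R: cring "Sc V" by (rule cring_sec[OF V])
 have ev: "eval_int_poly (Sc V) (case_sum (nth b) (nth c)) Q \<in> carrier (Sc V)"
  if Q: "isob (%t. if widx t > i then 1 else 0) 0 Q" and i: "i < n" for Q i
 proof -
  have "case_sum (nth b) (nth c) t \<in> carrier (Sc V)" if "m \<in> keys Q" "t \<in> keys m" for m t
  proof -
   from isob_index_imp[OF Q that] have "widx t < n" using i by simp
   thus ?thesis using bc by (cases t) (auto simp: carrier_Wn)
  qed
  hence "(\<Otimes>\<^bsub>Sc V\<^esub>t\<in>keys m. case_sum (nth b) (nth c) t [^]\<^bsub>Sc V\<^esub> lookup m t) \<in> carrier (Sc V)"
   if "m \<in> keys Q" for m using that by (intro R.finprod_closed) (auto simp: Pi_def)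
  thus ?thesis unfolding eval_int_poly_def
   by (intro R.finsum_closed) (auto simp: Pi_def add_pow_def intro!: R.add.int_pow_closed[simplified])
 qed
 show "b \<oplus>\<^bsub>Wn n V\<^esub> c \<in> carrier (Wn n V)" "b \<otimes>\<^bsub>Wn n V\<^esub> c \<in> carrier (Wn n V)"
  using ev[OF index_witt_sum[OF p]] ev[OF index_witt_prod[OF p]] by (auto simp: carrier_Wn Wn_add Wn_mult)
 show "witt_frob p (Sc V) b \<in> carrier (Wn n V)" using bc by (auto simp: carrier_Wn witt_frob_def)
qed

lemma psi_add: assumes V: "openin T V" and b: "b \<in> carrier (Wn n V)" and c: "c \<in> carrier (Wn n V)"
 shows "psi V (b \<oplus>\<^bsub>Wn n V\<^esub> c) = psi V b \<oplus>\<^bsub>Sc V\<^esub> psi V c"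
proof (rule sec_eqI[OF V])
 fix P assume P: "P \<in> V"
 obtain t d x where r: "frep V P t d x b" by (rule frep_ex[OF V b P])
 obtain t' d' y where r': "frep V P t' d' y c" by (rule frep_ex[OF V c P])
 note Pp = frep_point[OF r] frep_point[OF r']
 have th: "t \<in> homog d" "t' \<in> homog d'" using r r' by (auto simp: frep_def)
 have 1: "frep V P (t' * t) (d' + d) (wscale (t' ^ p) x) b" using frep_scale[OF r th(2)] Pp by simp
 have 2: "frep V P (t' * t) (d' + d) (wscale (t ^ p) y) c"
  using frep_scale[OF r' th(1)] Pp by (simp add: mult.commute add.commute)
 note 3 = frep_add[OF 1 2]
 have "t' * t \<in> homog (d' + d)" "t' * t ~: pull P" using 1 frep_point[OF 1] by (auto simp: frep_def)
 thus "psi V (b \<oplus>\<^bsub>Wn n V\<^esub> c) P = (psi V b \<oplus>\<^bsub>Sc V\<^esub> psi V c) P"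
  using P Pp by (simp add: sec_at psi_def val_eq[OF 1] val_eq[OF 2] val_eq[OF 3] phi_add fr_add_same[OF _ phi_homog phi_homog])
next
 show "psi V (b \<oplus>\<^bsub>Wn n V\<^esub> c) \<in> carrier (Sc V)" by (intro psi_closed Wn_closed V b c)
 show "psi V b \<oplus>\<^bsub>Sc V\<^esub> psi V c \<in> carrier (Sc V)" by (intro sec_add_closed psi_closed V b c)
qed

text \<open>Over a common denominator \<open>wtimes_F\<close> writes F(x) y as [x_0^p] y modulo VF,
  which phi turns into x_0 phi(y).\<close>

lemma psi_linear: assumes V: "openin T V" and a: "a \<in> carrier (Wn n V)" and b: "b \<in> carrier (Wn n V)"
 shows "psi V (witt_frob p (Sc V) a \<otimes>\<^bsub>Wn n V\<^esub> b) = (a ! 0) \<otimes>\<^bsub>Sc V\<^esub> psi V b"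
proof (rule sec_eqI[OF V])
 fix P assume P: "P \<in> V"
 obtain s0 w0 x0 where a0: "wrep n V P s0 w0 x0 a" using wrep_local[OF V a P] by metis
 obtain t0 d0 y0 where b0: "frep V P t0 d0 y0 b" by (rule frep_ex[OF V b P])
 note Pp = frep_point[OF b0]
 have sh: "s0 \<in> homog w0" "s0 ~: pull P" "t0 \<in> homog d0" using a0 b0 by (auto simp: wrep_def frep_def)
 define s where "s = s0 * t0"
 define d where "d = w0 + d0"
 define x where "x = wscale t0 x0"
 define y where "y = wscale (s0 ^ p) y0"
 have a1: "wrep n V P s d x a"
  using wrep_scale[OF a0 sh(3)] Pp by (simp add: s_def d_def x_def mult.commute add.commute)
 have b1: "frep V P s d y b" using frep_scale[OF b0 sh(1,2)] by (simp add: s_def d_def y_def)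
 have sd: "s \<in> homog d" "s ~: pull P" "x \<in> whom d" using a1 by (auto simp: wrep_def)
 hence x0: "wc x 0 \<in> homog d" by (auto simp: whom_def dest: spec[of _ 0])
 have "wrep n V P ((s ^ p) ^ 2) (2 * (p * d)) (wtimes (wF x) y) (witt_frob p (Sc V) a \<otimes>\<^bsub>Wn n V\<^esub> b)"
  using wrep_mult[OF wrep_frob[OF a1]] b1 by (simp add: frep_def)
 hence 2: "frep V P (s * s) (d + d) (wtimes (wF x) y) (witt_frob p (Sc V) a \<otimes>\<^bsub>Wn n V\<^esub> b)"
  using homog_mult[OF sd(1) sd(1)] by (simp add: frep_def power2_eq_square power_mult_distrib mult_2 distrib_left)
 have "phi (d + d) (wtimes (wF x) y) = wc x 0 * phi d y"
  unfolding wtimes_F[OF p char_S] phi_add phi_VF using phi_scale[OF x0] by simp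
 moreover have "(a ! 0) P = fr P (wc x 0) s" using a1 n by (auto simp: wrep_def dest: spec[of _ 0])
 moreover have "vf P (wc x 0) s" "vf P (phi d y) s" using sd x0 phi_homog by (auto intro: vfI)
 ultimately show "psi V (witt_frob p (Sc V) a \<otimes>\<^bsub>Wn n V\<^esub> b) P = ((a ! 0) \<otimes>\<^bsub>Sc V\<^esub> psi V b) P"
  using P Pp by (simp add: sec_at psi_def val_eq[OF 2] val_eq[OF b1] fr_mult)
next
 show "psi V (witt_frob p (Sc V) a \<otimes>\<^bsub>Wn n V\<^esub> b) \<in> carrier (Sc V)" by (intro psi_closed Wn_closed(2)[OF V] Wn_closed(3)[OF V a a] V b)
 show "a ! 0 \<otimes>\<^bsub>Sc V\<^esub> psi V b \<in> carrier (Sc V)" using a n by (intro sec_mult_closed psi_closed V b) (auto simp: carrier_Wn)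
qed

lemma psi_frob: assumes V: "openin T V" and a: "a \<in> carrier (Wn n V)" shows "psi V (witt_frob p (Sc V) a) = a ! 0"
proof (rule sec_eqI[OF V])
 fix P assume P: "P \<in> V"
 obtain s w x where r: "wrep n V P s w x a" using wrep_local[OF V a P] by metis
 have "frep V P s w (wF x) (witt_frob p (Sc V) a)" using wrep_frob[OF r] r by (auto simp: frep_def wrep_def)
 from val_eq[OF this] show "psi V (witt_frob p (Sc V) a) P = (a ! 0) P"
  using P r n by (auto simp: psi_def phi_wF wrep_def dest: spec[of _ 0])
next
 show "psi V (witt_frob p (Sc V) a) \<in> carrier (Sc V)" by (intro psi_closed Wn_closed(3)[OF V a a] V)
 show "a ! 0 \<in> carrier (Sc V)" using a n by (simp add: carrier_Wn)
qed

end

section \<open>Compatibility with restriction\<close>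

context graded_quot
begin

lemma res_eq: "res E V V' s = restrict s V'" by (simp add: Proj_def)

lemma res_closed: assumes V: "openin T V" "openin T V'" "V' <= V" and s: "s \<in> carrier (Sc V)"
 shows "res E V V' s \<in> carrier (Sc V')" unfolding res_eq sec_iff[OF V(2)]
proof (intro conjI ballI)
 fix P assume P: "P \<in> V'"
 then obtain g e a b d where h: "g \<in> homog e" "P \<in> DD g" "a \<in> homog d" "b \<in> homog d"
    "\<forall>Q\<in>DD g. b ~: pull Q & s Q = fr Q a b" using s V(3) unfolding sec_iff[OF V(1)] by (meson subsetD)
 obtain g' e' where g': "g' \<in> homog e'" "P \<in> DD g'" "DD g' <= V'" by (rule open_basis[OF V(2) P])
 have "g * g' \<in> homog (e + e') & P \<in> DD (g * g') & DD (g * g') <= V' & a \<in> homog d & b \<in> homog d &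
    (\<forall>Q\<in>DD (g * g'). b ~: pull Q & restrict s V' Q = fr Q a b)"
  using h g' homog_mult[OF h(1) g'(1)] by (auto simp: DD_mult)
 thus "\<exists>g e a b d. g \<in> homog e & P \<in> DD g & DD g <= V' & a \<in> homog d & b \<in> homog d &
    (\<forall>Q\<in>DD g. b ~: pull Q & restrict s V' Q = fr Q a b)" by blast
qed simp

end

lemma (in fedder) wrep_res: assumes "wrep n V P s w x b" "openin T V'" "V' <= V" "P \<in> V'"
 shows "wrep n V' P s w x (map (res E V V') b)"
 using assms res_closed[of V V'] by (auto simp: wrep_def carrier_Wn) (simp_all add: res_eq)

lemma (in fedder) spc_E: "spc E = T" by (simp add: Proj_def)

lemma (in fedder) proj_subscheme_eq: "proj_subscheme I = E"
proof -
 have "(%d. (%a. I +>\<^bsub>polyR\<^esub> a) ` homog d) = Gr" by (rule ext) (simp add: Gr_def co_def[abs_def])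
 thus ?thesis by (simp add: proj_subscheme_def)
qed

context fedder_split
begin

lemma psi_res: assumes V: "openin T V" "openin T V'" "V' <= V" and b: "b \<in> carrier (Wn n V)"
 shows "psi V' (map (res E V V') b) = res E V V' (psi V b)"
proof -
 have "val V' P (map (res E V V') b) = val V P b" if P: "P \<in> V'" for P
 proof -
  obtain t d x where r: "frep V P t d x b" using frep_ex[OF V(1) b] V(3) P by blast
  hence "frep V' P t d x (map (res E V V') b)" using wrep_res[OF _ V(2,3) P] by (auto simp: frep_def)
  from val_eq[OF this] val_eq[OF r] show ?thesis by simp
 qed
 thus ?thesis unfolding res_eq psi_def using V(3) by (auto simp: fun_eq_iff)
qed

lemma quasi_F_split: "quasi_F_split p n (proj_subscheme I)"
 unfolding quasi_F_split_def witt_module_hom_def proj_subscheme_eq spc_E Let_def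
 by (intro exI[of _ psi]) (auto simp: psi_add psi_linear psi_frob psi_res intro: psi_closed)

end

context fedder
begin

text \<open>The functional is cut into homogeneous components and divided by the constant term of
  u(hd gs). This constant is its value at 1 in degree 0, and is nonzero because u(hd gs) lies
  outside the irrelevant ideal.\<close>

lemma quasi_F_split_if_Psi:
 assumes gs: "length gs = n" "n \<ge> 1" "\<forall>g\<in>set (tl gs). u g = 0" "\<forall>x\<in>wideal I. S.Psi gs x \<in> I" "u (hd gs) ~: M"
 shows "quasi_F_split p n (proj_subscheme I)"
proof -
 define c where "c = lookup (u (hd gs)) 0"
 define phi where "phi d x = con (inverse c) * hcomp d (S.Psi gs x)" for d x
 have c: "c \<noteq> 0" using gs(5) by (simp add: c_def max_ideal_iff)
 note hom = S.Psi_hom[OF gs(3)]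
 note D = S.Psi_homD[OF hom]
 have ch: "con (inverse c) \<in> homog 0" by (rule con_homog)
 interpret fedder_split p ys fs f I n phi
 proof
  show "phi d x \<in> homog d" for d x unfolding phi_def using homog_mult[OF ch hcomp_homog] by simp
  show "phi d (x + y) = phi d x + phi d y" for d x y by (simp add: phi_def D hcomp_add distrib_left)
  show "phi (e + d) (wscale (b ^ p) x) = b * phi d x" if "b \<in> homog e" for b e d x
   using hcomp_mult[OF that, of "e + d"] by (simp add: phi_def D(2) mult.left_commute)
  show "phi d (wV (wF x)) = 0" for d x by (simp add: phi_def D(3))
  show "phi d x - phi d y \<in> I" if xy: "!!i. i < n ==> wc x i - wc y i \<in> I" for d x y
  proof -
   \<comment> \<open>y' agrees with y up to length n, beyond which the functional does not look, and
     with x from there on, so that x - y' lies in W(I).\<close>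
   define y' where "y' = Witt (%i. if i < n then wc y i else wc x i)"
   have "x - y' \<in> wideal I" by (rule wideal_diffI[OF prime_char_S ideal_I]) (use xy I_D(1) in "auto simp: y'_def")
   hence 1: "S.Psi gs (x - y') \<in> I" using gs(4) by blast
   have "S.Psi gs (y' - y) = 0"
    by (rule S.Psi_trunc, rule witt_diff_trunc[OF prime_char_S]) (use gs(1) in "auto simp: y'_def")
   hence 2: "S.Psi gs y' = S.Psi gs y" by (simp add: D(6))
   have "S.Psi gs x - S.Psi gs y \<in> I" using 1 by (simp add: D(6) 2)
   hence "hcomp d (S.Psi gs x - S.Psi gs y) \<in> I" using hom_I by (simp add: hom_set_def)
   moreover have "hcomp d (S.Psi gs x - S.Psi gs y) = hcomp d (S.Psi gs x) - hcomp d (S.Psi gs y)"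
    by (rule poly_mapping_eqI) (simp add: lookup_minus)
   ultimately show ?thesis by (simp add: phi_def I_D(3) flip: right_diff_distrib)
  qed
  show "phi 0 (teich 1) = 1"
  proof -
   obtain g hs where g: "gs = g # hs" using gs(1,2) by (cases gs) auto
   have "teich 1 = S.tau 1 + wV 0" using S.tau_pmon[OF S.pmon_pow_p[of 1]] by simp
   from S.Psi_eq[OF this, of g hs] have "S.Psi gs (teich 1) = u g" by (simp add: g S.Psi_zero)
   moreover have "hcomp 0 (u g) = con c"
    by (rule poly_mapping_eqI) (auto simp: c_def g lookup_single when_def mon_deg_eq_0_iff)
   ultimately show ?thesis using c by (simp add: phi_def mult_single single_one)
  qed
 qed (rule gs(2))
 show ?thesis by (rule quasi_F_split)
qed

end

section \<open>The number of equations of a positive-dimensional complete intersection\<close>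

text \<open>A regular sequence in which the ideal may be enlarged before each step; this allows
  passing from I to vanishing ideals of irreducible closed sets.\<close>

fun nzd_chain :: "'a::comm_ring_1 set => 'a list => 'a set => bool" where
 "nzd_chain J [] K \<longleftrightarrow> J <= K"
| "nzd_chain J (x # xs) K \<longleftrightarrow> (\<exists>L. is_ideal L & J <= L & (\<forall>a. x * a \<in> L --> a \<in> L) & nzd_chain (igen (insert x L)) xs K)"

lemma nzd_chain_ConsI:
 "is_ideal L ==> J <= L ==> (!!a. x * a \<in> L ==> a \<in> L) ==> nzd_chain (igen (insert x L)) xs K ==> nzd_chain J (x # xs) K"
 by auto

fun lmon :: "'a::comm_ring_1 list => nat list => 'a" where
 "lmon (x # xs) (e # es) = x ^ e * lmon xs es"
| "lmon _ _ = 1"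

lemma power_nzd: "\<forall>a. x * a \<in> L --> a \<in> L ==> x ^ k * a \<in> L ==> (a::'a::comm_ring_1) \<in> L"
 by (induction k) (auto simp: mult.assoc)

text \<open>With e the least exponent of the first element x, the power x^e cancels, and modulo x
  only the terms with exponent e remain; the rest of the chain handles these.\<close>

lemma nzd_chain_independent:
 fixes J :: "'a::comm_ring_1 set"
 assumes "nzd_chain J xs K" "finite B" "B \<noteq> {}" "!!\<alpha>. \<alpha> \<in> B ==> length \<alpha> = length xs"
  "!!\<alpha>. \<alpha> \<in> B ==> c \<alpha> ~: K"
 shows "(\<Sum>\<alpha>\<in>B. c \<alpha> * lmon xs \<alpha>) ~: J" using assms
proof (induction xs arbitrary: J B c)
 case Nil
 hence "B = {[]}" by auto
 thus ?case using Nil by auto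
next
 case (Cons x xs)
 from Cons.prems(1) obtain L where L: "is_ideal L" "J <= L" "\<forall>a. x * a \<in> L --> a \<in> L"
  "nzd_chain (igen (insert x L)) xs K" by auto
 define e where "e = Min (hd ` B)"
 define B' where "B' = {\<alpha>. e # \<alpha> \<in> B}"
 have ne: "\<alpha> \<noteq> []" "hd \<alpha> # tl \<alpha> = \<alpha>" if "\<alpha> \<in> B" for \<alpha> using Cons.prems(4)[OF that] by (auto simp: length_Suc_conv)
 have min: "e \<le> hd \<alpha>" if "\<alpha> \<in> B" for \<alpha> using that Cons.prems(2) by (auto simp: e_def)
 have "e \<in> hd ` B" unfolding e_def using Cons.prems(2,3) by (intro Min_in) auto
 then obtain \<alpha> where "\<alpha> \<in> B" "e = hd \<alpha>" by auto
 hence "tl \<alpha> \<in> B'" using ne(2)[of \<alpha>] by (simp add: B'_def)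
 have B'eq: "B' = tl ` {\<alpha>\<in>B. hd \<alpha> = e}"
 proof -
  have "\<beta> \<in> tl ` {\<alpha>\<in>B. hd \<alpha> = e}" if "e # \<beta> \<in> B" for \<beta> using that by (intro image_eqI[of _ _ "e # \<beta>"]) auto
  thus ?thesis using ne(2) by (force simp: B'_def)
 qed
 let ?S = "\<Sum>\<beta>\<in>B'. c (e # \<beta>) * lmon xs \<beta>" and ?E = "{\<alpha>\<in>B. hd \<alpha> = e}" and ?N = "{\<alpha>\<in>B. hd \<alpha> \<noteq> e}"
 let ?T = "\<Sum>\<alpha>\<in>?N. c \<alpha> * (x ^ (hd \<alpha> - e - 1) * lmon xs (tl \<alpha>))"
 have fin': "finite B'" unfolding B'eq using Cons.prems(2) by simp
 have split: "(\<Sum>\<alpha>\<in>B. c \<alpha> * lmon (x # xs) \<alpha>) =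
  x ^ e * (?S + x * ?T)"
 proof -
  have "(\<Sum>\<alpha>\<in>B. c \<alpha> * lmon (x # xs) \<alpha>) = (\<Sum>\<alpha>\<in>?E. c \<alpha> * lmon (x # xs) \<alpha>) + (\<Sum>\<alpha>\<in>?N. c \<alpha> * lmon (x # xs) \<alpha>)"
   using Cons.prems(2) by (subst sum.union_disjoint[symmetric]) (auto intro!: sum.cong)
  also have "(\<Sum>\<alpha>\<in>?E. c \<alpha> * lmon (x # xs) \<alpha>) = (\<Sum>\<beta>\<in>B'. c (e # \<beta>) * (x ^ e * lmon xs \<beta>))"
  proof (rule sum.reindex_cong[of "%\<beta>. e # \<beta>", symmetric, THEN sym])
   show "?E = (%\<beta>. e # \<beta>) ` B'" unfolding B'eq image_image using ne(2) by force
  qed (auto simp: inj_on_def)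
  also have "(\<Sum>\<alpha>\<in>?N. c \<alpha> * lmon (x # xs) \<alpha>) = (\<Sum>\<alpha>\<in>?N. x ^ e * (x * (c \<alpha> * (x ^ (hd \<alpha> - e - 1) * lmon xs (tl \<alpha>)))))"
  proof (rule sum.cong[OF refl])
   fix \<alpha> assume a: "\<alpha> \<in> ?N"
   then obtain h t where ht: "\<alpha> = h # t" using ne by (cases \<alpha>) auto
   have "h > e" using min[of \<alpha>] a ht by auto
   hence "x ^ h = x ^ e * (x * x ^ (h - e - 1))" by (simp flip: power_Suc power_add)
   thus "c \<alpha> * lmon (x # xs) \<alpha> = x ^ e * (x * (c \<alpha> * (x ^ (hd \<alpha> - e - 1) * lmon xs (tl \<alpha>))))"
    by (simp add: ht mult_ac)
  qed
  finally show ?thesis by (simp add: sum_distrib_left distrib_left mult_ac)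
 qed
 show ?case
 proof
  assume "(\<Sum>\<alpha>\<in>B. c \<alpha> * lmon (x # xs) \<alpha>) \<in> J"
  hence "x ^ e * (?S + x * ?T) \<in> L" using L(2) unfolding split by blast
  from power_nzd[OF L(3) this]
  obtain r where r: "?S + x * r \<in> L" by blast
  have "?S + x * r - x * r \<in> igen (insert x L)"
   using r by (intro is_idealD(6)[OF is_ideal_igen] is_idealD(4)[OF is_ideal_igen] igen_superset) auto
  hence "?S \<in> igen (insert x L)" by simp
  moreover have "?S ~: igen (insert x L)"
   by (rule Cons.IH[OF L(4) fin']) (use `tl \<alpha> \<in> B'` Cons.prems(4,5) in "fastforce simp: B'_def")+
  ultimately show False by simp
 qed
qed

lemma reg_list_nzd_chain: assumes "reg_list (ys @ zs)" "igen (set (ys @ zs)) <= J" "nzd_chain J ws K" "is_ideal J"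
  "!!J'. J' <= J ==> nzd_chain J' ws K" shows "nzd_chain (igen (set ys)) (zs @ ws) K" using assms(1,2)
proof (induction zs arbitrary: ys)
 case Nil
 thus ?case using assms(5) by simp
next
 case (Cons z zs)
 have r: "\<forall>a. z * a \<in> igen (set ys) --> a \<in> igen (set ys)"
  using Cons.prems(1) by (auto simp: reg_list_def mult.commute dest!: spec[of _ "length ys"])
 have "igen (insert z (igen (set ys))) = igen (set (ys @ [z]))"
 proof
  show "igen (insert z (igen (set ys))) <= igen (set (ys @ [z]))"
   using igen_mono[of "set ys" "set (ys @ [z])"] by (intro igen_least) (auto intro: igen_superset)
  show "igen (set (ys @ [z])) <= igen (insert z (igen (set ys)))" by (intro igen_least) (auto intro: igen_superset)
 qed
 moreover have "nzd_chain (igen (set (ys @ [z]))) (zs @ ws) K" using Cons.IH[of "ys @ [z]"] Cons.prems by simp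
 ultimately show ?case using r by (auto intro!: exI[of _ "igen (set ys)"])
qed

section \<open>Bounding the length of a chain by counting monomials\<close>

definition bnd :: "nat => ('n::finite, 'k::field) mpoly set" where
 "bnd K = {a. \<forall>m\<in>keys a. mon_deg m \<le> K}"

lemma bnd_mult: "a \<in> bnd K ==> b \<in> bnd L ==> a * b \<in> bnd (K + L)"
 using keys_mult[of a b] by (fastforce simp: bnd_def mon_deg_add intro: add_mono)

lemma bnd_mono: "K \<le> L ==> bnd K <= bnd L" by (force simp: bnd_def)

lemma bnd_power: "a \<in> bnd K ==> a ^ e \<in> bnd (e * K)"
proof (induction e)
 case 0
 thus ?case by (auto simp: bnd_def)
next
 case (Suc e)
 thus ?case using bnd_mult[of a K "a ^ e" "e * K"] by simp
qed

lemma bnd_lmon: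
 assumes "!!x. x \<in> set xs ==> x \<in> bnd D" "!!e. e \<in> set \<alpha> ==> e \<le> L" "length \<alpha> = length xs"
 shows "lmon xs \<alpha> \<in> bnd (length xs * (L * D))" using assms
proof (induction xs \<alpha> rule: lmon.induct)
 case (1 x xs e es)
 have "x ^ e \<in> bnd (e * D)" using 1 by (intro bnd_power) simp
 moreover have "e * D \<le> L * D" using 1 by simp
 ultimately have "x ^ e \<in> bnd (L * D)" by (meson bnd_mono subsetD)
 moreover have "lmon xs es \<in> bnd (length xs * (L * D))" using 1 by simp
 ultimately have "x ^ e * lmon xs es \<in> bnd (L * D + length xs * (L * D))" by (rule bnd_mult)
 thus ?case by simp
qed (auto simp: bnd_def)

lemma card_bounded_monomials: "card {m :: 'n::finite \<Rightarrow>\<^sub>0 nat. \<forall>i. lookup m i < q} = q ^ CARD('n)"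
proof -
 have "bij_betw lookup {m :: 'n \<Rightarrow>\<^sub>0 nat. \<forall>i. lookup m i < q} (UNIV \<rightarrow>\<^sub>E {..<q})"
 proof (rule bij_betwI[where g = mfun])
  show "mfun (lookup x) = x" for x :: "'n \<Rightarrow>\<^sub>0 nat" by (rule poly_mapping_eqI) simp
 qed (auto simp: PiE_def)
 from bij_betw_same_card[OF this] show ?thesis by (simp add: card_funcsetE)
qed

interpretation mp: vector_space "%c (a :: ('n::finite, 'k::field) mpoly). single 0 c * a"
 by unfold_locales (auto simp: distrib_left distrib_right single_add mult_single mult.assoc[symmetric] single_one)

text \<open>Dimension count: the (L+1)^r monomials with exponents up to L in r elements of degree at
  most D are independent and lie in the span of q^N monomials, with q linear in L. For r > N this
  fails when L is large.\<close>

lemma nzd_chain_length: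
 fixes xs :: "('n::finite, 'k::field) mpoly list"
 assumes ch: "nzd_chain J xs K" and J: "0 \<in> J" and K: "!!c. c \<noteq> 0 ==> single 0 c ~: K"
 shows "length xs \<le> CARD('n)"
proof (rule ccontr)
 assume "\<not> length xs \<le> CARD('n)"
 hence big: "Suc CARD('n) \<le> length xs" by simp
 define r where "r = length xs"
 obtain D where D: "!!x. x \<in> set xs ==> x \<in> bnd D"
 proof
  show "x \<in> bnd (Max (tot_deg ` set xs))" if "x \<in> set xs" for x
  proof -
   have "tot_deg x \<le> Max (tot_deg ` set xs)" using that by (intro Max_ge) auto
   thus ?thesis using mon_deg_le_tot_deg[of _ x] by (fastforce simp: bnd_def)
  qed
 qed
 \<comment> \<open>Chosen so that q^N is at most ((r D + 1)(L + 1))^N = L (L + 1)^N, which is less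
   than (L + 1)^(N+1).\<close>
 define L where "L = (r * D + 1) ^ CARD('n)"
 define B where "B = {\<alpha>. set \<alpha> <= {..L} & length \<alpha> = r}"
 have finB: "finite B" and cardB: "card B = (L + 1) ^ r"
  unfolding B_def by (simp_all add: finite_lists_length_eq card_lists_length_eq)
 have ind: "(\<Sum>\<alpha>\<in>C. single 0 (c \<alpha>) * lmon xs \<alpha>) \<noteq> 0" if "C <= B" "C \<noteq> {}" "!!\<alpha>. \<alpha> \<in> C ==> c \<alpha> \<noteq> 0" for C c
 proof -
  have "length \<alpha> = length xs" if "\<alpha> \<in> C" for \<alpha> using that `C <= B` by (auto simp: B_def r_def)
  from nzd_chain_independent[OF ch finite_subset[OF that(1) finB] that(2) this, of "%\<alpha>. single 0 (c \<alpha>)"]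
  have "(\<Sum>\<alpha>\<in>C. single 0 (c \<alpha>) * lmon xs \<alpha>) ~: J" using that(3) K by simp
  thus ?thesis using J by metis
 qed
 have inj: "inj_on (lmon xs) B"
 proof (rule inj_onI, rule ccontr)
  fix \<alpha> \<beta> assume h: "\<alpha> \<in> B" "\<beta> \<in> B" "lmon xs \<alpha> = lmon xs \<beta>" "\<alpha> \<noteq> \<beta>"
  have "single 0 (- 1) = (- 1 :: ('n, 'k) mpoly)" by (simp add: single_uminus single_one)
  moreover have "(\<Sum>\<gamma>\<in>{\<alpha>, \<beta>}. single 0 (if \<gamma> = \<alpha> then 1 else - 1) * lmon xs \<gamma>) \<noteq> 0"
   by (rule ind) (use h in auto)
  ultimately show False using h(3,4) by (simp add: single_one)
 qed
 have "mp.independent (lmon xs ` B)"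
 proof
  assume "mp.dependent (lmon xs ` B)"
  then obtain C v where C: "finite C" "C <= lmon xs ` B" "(\<Sum>a\<in>C. single 0 (v a) * a) = 0" "\<exists>a\<in>C. v a \<noteq> 0"
   unfolding mp.dependent_explicit by auto
  define C' where "C' = {\<alpha>\<in>B. lmon xs \<alpha> \<in> C & v (lmon xs \<alpha>) \<noteq> 0}"
  have "(\<Sum>\<alpha>\<in>C'. single 0 (v (lmon xs \<alpha>)) * lmon xs \<alpha>) = (\<Sum>a\<in>lmon xs ` C'. single 0 (v a) * a)"
   by (rule sum.reindex_cong[symmetric, of "lmon xs"]) (use inj in "auto simp: C'_def inj_on_def")
  also have "\<dots> = (\<Sum>a\<in>C. single 0 (v a) * a)"
   by (rule sum.mono_neutral_left[OF C(1)]) (use C(2) in "auto simp: C'_def")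
  finally have "(\<Sum>\<alpha>\<in>C'. single 0 (v (lmon xs \<alpha>)) * lmon xs \<alpha>) = 0" using C(3) by simp
  moreover have "C' \<noteq> {}" using C(2,4) by (auto simp: C'_def)
  moreover have "C' <= B" "!!\<alpha>. \<alpha> \<in> C' ==> v (lmon xs \<alpha>) \<noteq> 0" by (simp_all add: C'_def)
  ultimately show False using ind[of C' "%\<alpha>. v (lmon xs \<alpha>)"] by blast
 qed
 define q where "q = r * (L * D) + 1"
 let ?T = "(%m. single m (1 :: 'k)) ` {m :: 'n \<Rightarrow>\<^sub>0 nat. \<forall>i. lookup m i < q}"
 have "lmon xs ` B <= mp.span ?T"
 proof clarify
  fix \<alpha> assume "\<alpha> \<in> B"
  hence b: "lmon xs \<alpha> \<in> bnd (r * (L * D))" unfolding r_def by (intro bnd_lmon D) (auto simp: B_def r_def)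
  have "(\<Sum>m\<in>keys (lmon xs \<alpha>). single 0 (lookup (lmon xs \<alpha>) m) * single m 1) \<in> mp.span ?T"
  proof (intro mp.span_sum mp.span_scale mp.span_base imageI CollectI allI)
   fix m i assume "m \<in> keys (lmon xs \<alpha>)"
   hence "mon_deg m < q" using b by (auto simp: bnd_def q_def less_Suc_eq_le)
   moreover have "lookup m i \<le> mon_deg m" unfolding mon_deg_def by (rule member_le_sum) auto
   ultimately show "lookup m i < q" by simp
  qed
  thus "lmon xs \<alpha> \<in> mp.span ?T" by (simp add: mult_single flip: mpoly_sum_singles)
 qed
 from mp.independent_span_bound[OF _ \<open>mp.independent (lmon xs ` B)\<close> this]
 have "card (lmon xs ` B) \<le> card ?T" using finite_bounded_monomials by blast
 also have "card ?T \<le> q ^ CARD('n)"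
  unfolding card_bounded_monomials[where 'n = 'n, symmetric] by (rule card_image_le[OF finite_bounded_monomials])
 finally have "(L + 1) ^ r \<le> q ^ CARD('n)" by (simp add: card_image[OF inj] cardB)
 moreover have "(L + 1) ^ Suc CARD('n) \<le> (L + 1) ^ r" using big unfolding r_def by (intro power_increasing) auto
 moreover have "q ^ CARD('n) \<le> ((r * D + 1) * (L + 1)) ^ CARD('n)" by (intro power_mono) (auto simp: q_def algebra_simps)
 ultimately have "(L + 1) ^ Suc CARD('n) \<le> ((r * D + 1) * (L + 1)) ^ CARD('n)" by (meson order_trans)
 also have "\<dots> = L * (L + 1) ^ CARD('n)" by (simp only: power_mult_distrib flip: L_def)
 finally show False by simp
qed

section \<open>Vanishing ideals of irreducible closed sets\<close>

context fedder
begin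

definition JZ where "JZ Z = (\<Inter>P\<in>Z. pull P)"

lemma closed_points: "closedin T Z ==> Z <= points" using closedin_subset[of T Z] open_points[of "topspace T"] by auto

lemma JZ_ideal: "closedin T Z ==> is_ideal (JZ Z)"
 using closed_points[of Z] pull_is_ideal by (force simp: JZ_def is_ideal_def)

lemma closedin_zero_locus: "h \<in> homog d ==> closedin T Z ==> closedin T {P \<in> Z. h \<in> pull P}"
proof -
 assume h: "h \<in> homog d" "closedin T Z"
 have "{P \<in> Z. h \<in> pull P} = Z - DD h" using closed_points[OF h(2)] by (auto simp: DD_def)
 thus ?thesis using closedin_diff[OF h(2) open_DD[OF h(1)]] by simp
qed

text \<open>If g a vanishes on Z, the zero loci of g and of any component of a cover Z. By
  irreducibility one of them is Z, and it is not that of g.\<close>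

lemma JZ_nzd: assumes Z: "irreducible_closedin T Z" and g: "g \<in> homog e" "g ~: JZ Z" and a: "g * a \<in> JZ Z"
 shows "a \<in> JZ Z"
proof -
 have cl: "closedin T Z" using Z by (simp add: irreducible_closedin_def)
 note pts = subsetD[OF closed_points[OF cl]]
 have "hcomp d a \<in> JZ Z" for d
 proof -
  have ga: "g * hcomp d a \<in> pull P" if "P \<in> Z" for P
  proof -
   have "hcomp (e + d) (g * a) \<in> pull P" using a that by (intro pull_hom pts) (auto simp: JZ_def)
   thus ?thesis by (simp add: hcomp_mult[OF g(1)])
  qed
  have "Z = {P \<in> Z. g \<in> pull P} \<union> {P \<in> Z. hcomp d a \<in> pull P}"
  proof -
   have "g \<in> pull P \<or> hcomp d a \<in> pull P" if "P \<in> Z" for P using ga[OF that] pull_prime[OF pts[OF that]] by simp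
   thus ?thesis by blast
  qed
  moreover have "closedin T {P \<in> Z. g \<in> pull P}" "closedin T {P \<in> Z. hcomp d a \<in> pull P}"
   using closedin_zero_locus[OF g(1) cl] closedin_zero_locus[OF hcomp_homog cl] by auto
  ultimately have "Z = {P \<in> Z. g \<in> pull P} \<or> Z = {P \<in> Z. hcomp d a \<in> pull P}"
   using Z unfolding irreducible_closedin_def by blast
  thus ?thesis using g(2) by (auto simp: JZ_def)
 qed
 hence "(\<Sum>d\<le>tot_deg a. hcomp d a) \<in> JZ Z" by (intro is_ideal_sum JZ_ideal cl)
 thus ?thesis by (simp add: sum_hcomp)
qed

text \<open>Two irreducible closed sets, Z 0 strictly inside Z 1, prolong the regular sequence by
  two: a form vanishing on Z 0 but not on Z 1, then a variable not vanishing on Z 0. The chain ends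
  inside the irrelevant ideal, so its length m + 2 is at most N.\<close>

lemma length_fs: assumes "krull_dim T \<ge> 1" shows "length fs + 2 \<le> CARD('n)"
proof -
 have "\<exists>n Z. n \<ge> 1 & (\<forall>i\<le>n. irreducible_closedin T (Z i)) & (\<forall>i<n. Z i \<subset> Z (Suc i))"
 proof (rule ccontr)
  assume "\<not> ?thesis"
  hence n0: "n = 0" if "\<exists>Z. (\<forall>i\<le>n. irreducible_closedin T (Z i)) & (\<forall>i<n. Z i \<subset> Z (Suc i))" for n
   using that by (metis less_one not_le)
  have "krull_dim T \<le> 0" unfolding krull_dim_def
  proof (rule Sup_least, clarify)
   fix n Z assume "\<forall>i\<le>n. irreducible_closedin T (Z i)" "\<forall>i<n. Z i \<subset> Z (Suc i)"
   hence "n = 0" using n0 by blast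
   thus "enat n \<le> 0" by (simp add: zero_enat_def)
  qed
  thus False using assms by simp
 qed
 then obtain n Z where n: "n \<ge> 1" "\<forall>i\<le>n. irreducible_closedin T (Z i)" "\<forall>i<n. Z i \<subset> Z (Suc i)" by blast
 have Z: "irreducible_closedin T (Z 0)" "irreducible_closedin T (Z 1)" "Z 0 \<subset> Z 1" using n by auto
 hence cl: "closedin T (Z 0)" "closedin T (Z 1)" and ne: "Z 0 \<noteq> {}" by (auto simp: irreducible_closedin_def)
 note pts = subsetD[OF closed_points[OF cl(1)]]
 obtain P where P: "P \<in> Z 1" "P ~: Z 0" using Z(3) by blast
 have "openin T (topspace T - Z 0)" "P \<in> topspace T - Z 0" using cl closedin_subset[OF cl(2)] P by auto
 from open_basis[OF this] obtain g d where g: "g \<in> homog d" "P \<in> DD g" "DD g <= topspace T - Z 0" by metis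
 have g0: "g \<in> JZ (Z 0)" using g(3) pts by (auto simp: JZ_def DD_def)
 have g1: "g ~: JZ (Z 1)" using g(2) P by (auto simp: JZ_def DD_def)
 obtain Q where Q: "Q \<in> Z 0" using ne by blast
 obtain i where i: "var i ~: pull Q" using points_pull(3)[OF pts[OF Q]] by blast
 have i0: "var i ~: JZ (Z 0)" using i Q by (auto simp: JZ_def)
 have IJ: "I <= JZ (Z 1)" using pull_I subsetD[OF closed_points[OF cl(2)]] by (auto simp: JZ_def)
 have J0M: "JZ (Z 0) <= M"
 proof
  fix a assume a: "a \<in> JZ (Z 0)"
  show "a \<in> M"
  proof (rule ccontr)
   assume "a ~: M"
   hence c: "lookup a 0 \<noteq> 0" by (simp add: max_ideal_iff)
   have "hcomp 0 a = con (lookup a 0)" by (rule poly_mapping_eqI) (auto simp: lookup_single when_def mon_deg_eq_0_iff)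
   hence "con (lookup a 0) \<in> pull Q" using pull_hom[OF pts[OF Q], of a 0] a Q by (auto simp: JZ_def)
   from is_idealD(3)[OF pull_is_ideal[OF pts[OF Q]] this, of "con (inverse (lookup a 0))"]
   show False using c pull_one[OF pts[OF Q]] by (simp add: mult_single single_one)
  qed
 qed
 have ch: "nzd_chain J' [g, var i] M" if J': "J' <= JZ (Z 1)" for J'
 proof -
  have 1: "nzd_chain (igen (insert (var i) (JZ (Z 0)))) [] M"
  proof -
   have "igen (insert (var i) (JZ (Z 0))) <= M" using J0M by (intro igen_least) (auto intro: igen_superset)
   thus ?thesis by simp
  qed
  have "JZ (Z 1) <= JZ (Z 0)" using Z(3) by (auto simp: JZ_def)
  hence "insert g (JZ (Z 1)) <= JZ (Z 0)" using g0 by simp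
  from igen_least[OF JZ_ideal[OF cl(1)] this] have "igen (insert g (JZ (Z 1))) <= JZ (Z 0)" .
  from nzd_chain_ConsI[OF JZ_ideal[OF cl(1)] this JZ_nzd[OF Z(1) var_homog i0] 1]
  have 2: "nzd_chain (igen (insert g (JZ (Z 1)))) [var i] M" .
  show ?thesis by (rule nzd_chain_ConsI[OF JZ_ideal[OF cl(2)] J' JZ_nzd[OF Z(2) g(1) g1] 2])
 qed
 have "nzd_chain (igen (set [])) (fs @ [g, var i]) M"
  by (rule reg_list_nzd_chain[of "[]" fs "JZ (Z 1)"]) (use reg IJ ch JZ_ideal[OF cl(2)] in "simp_all add: I")
 from nzd_chain_length[OF this] show ?thesis by (simp add: igen_0 max_ideal_iff)
qed

end

section \<open>Koszul complexes\<close>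

text \<open>A cochain on \<open>r\<close> generators is a function of the subsets of \<open>{0..<r}\<close>, encoded as Boolean
 lists of length \<open>r\<close>. The differential is that of the mapping cone of the first generator.\<close>

fun kd :: "'a::comm_ring_1 list => (bool list => 'a) => bool list => 'a" where
 "kd (a # as) k (False # bs) = kd as (%c. k (False # c)) bs"
| "kd (a # as) k (True # bs) = a * k (False # bs) - kd as (%c. k (True # c)) bs"
| "kd _ _ _ = 0"

text \<open>The degree is an integer so that i - 1 makes sense at i = 0; in degree -1 only the zero
  cochain is left.\<close>

definition kdeg :: "nat => int => (bool list => 'a::comm_ring_1) => bool" where
 "kdeg r i k \<longleftrightarrow> (\<forall>bs. k bs \<noteq> 0 --> length bs = r & int (count_list bs True) = i)"

lemma kd_add: "kd as (%b. k b + l b) bs = kd as k bs + kd as l bs"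
proof (induction as arbitrary: k l bs)
 case (Cons a as)
 show ?case
 proof (cases bs)
  case (Cons b cs)
  show ?thesis by (cases b) (simp_all add: Cons Cons.IH algebra_simps)
 qed simp
qed simp

lemma kd_scale: "kd as (%b. x * k b) bs = x * kd as k bs"
 by (induction as k bs rule: kd.induct) (auto simp: algebra_simps)

lemma kd_diff: "kd as (%b. k b - l b) bs = kd as k bs - kd as l bs"
 using kd_add[of as k "%b. - 1 * l b" bs] unfolding kd_scale by simp

lemma kd_zero [simp]: "kd as (%b. 0) bs = 0" using kd_scale[of as 0 "%b. 0" bs] by simp

lemma kd_ideal: "is_ideal J ==> (!!b. k b \<in> J) ==> kd as k bs \<in> J"
 by (induction as k bs rule: kd.induct) (auto intro: is_idealD)

lemma kd_kd: "kd as (kd as k) bs = 0"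
proof (induction as arbitrary: k bs)
 case (Cons a as)
 show ?case
 proof (cases bs)
  case (Cons b cs)
  show ?thesis
  proof (cases b)
   case True
   have "kd (a # as) (kd (a # as) k) bs =
     a * kd as (%c. k (False # c)) cs - kd as (%c. a * k (False # c) - kd as (%c. k (True # c)) c) cs"
    by (simp add: Cons True)
   thus ?thesis by (simp add: kd_diff kd_scale Cons.IH)
  qed (use Cons.IH[of "%c. k (False # c)" cs] in "simp add: Cons")
 qed simp
qed simp

lemma kdeg_tail: assumes "kdeg (Suc r) i k" shows "kdeg r i (%c. k (False # c))" "kdeg r (i - 1) (%c. k (True # c))"
 using assms by (fastforce simp: kdeg_def)+

lemma kdeg_kd: "kdeg (length as) i k ==> kdeg (length as) (i + 1) (kd as k)"
proof (induction as arbitrary: i k)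
 case (Cons a as)
 have "kdeg (length as) i (%c. k (False # c))" "kdeg (length as) (i - 1) (%c. k (True # c))"
  using kdeg_tail Cons.prems by auto
 note 1 = this(1) Cons.IH[OF this(1)] Cons.IH[OF this(2)]
 have "length bs = Suc (length as) & int (count_list bs True) = i + 1" if nz: "kd (a # as) k bs \<noteq> 0" for bs
 proof (cases bs)
  case (Cons b cs)
  show ?thesis
  proof (cases b)
   case True
   have "a * k (False # cs) \<noteq> 0 \<or> kd as (%c. k (True # c)) cs \<noteq> 0" using nz by (auto simp: Cons True)
   hence "k (False # cs) \<noteq> 0 \<or> kd as (%c. k (True # c)) cs \<noteq> 0" by auto
   thus ?thesis using 1(1,3) by (auto simp: Cons True kdeg_def)
  next
   case False
   thus ?thesis using nz 1(2) by (auto simp: Cons kdeg_def)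
  qed
 qed (use nz in simp)
 thus ?case by (simp add: kdeg_def)
qed (simp add: kdeg_def)

lemma kdeg_diff: "kdeg r i k ==> kdeg r i l ==> kdeg r i (%b. k b - l b)" unfolding kdeg_def by (metis diff_self)

lemma kdeg_scale: "kdeg r i k ==> kdeg r i (%b. x * k b)" unfolding kdeg_def by (metis mult_zero_right)

lemma count_list_True_le: "count_list bs True \<le> length bs" by (induction bs) auto

lemma count_list_True_eq: "count_list bs True = length bs \<longleftrightarrow> bs = replicate (length bs) True"
proof (induction bs)
 case (Cons b bs)
 thus ?case using count_list_True_le[of bs] by auto
qed simp

lemma kdeg_top: "kdeg r (int r) k ==> k bs \<noteq> 0 ==> bs = replicate r True"
 unfolding kdeg_def by (metis count_list_True_eq of_nat_eq_iff)

lemma kdeg_above: "kdeg r i k ==> i > int r ==> k bs = 0" unfolding kdeg_def using count_list_True_le[of bs] by force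

definition kcons :: "(bool list => 'a::comm_ring_1) => (bool list => 'a) => bool list => 'a" where
 "kcons k l bs = (case bs of [] => 0 | b # cs => if b then l cs else k cs)"

lemma kcons_simps [simp]: "kcons k l (False # c) = k c" "kcons k l (True # c) = l c" "kcons k l [] = 0"
 by (simp_all add: kcons_def)

lemma kdeg_kcons: "kdeg r i k ==> kdeg r (i - 1) l ==> kdeg (Suc r) i (kcons k l)"
proof -
 assume h: "kdeg r i k" "kdeg r (i - 1) l"
 have "length bs = Suc r & int (count_list bs True) = i" if nz: "kcons k l bs \<noteq> 0" for bs
 proof (cases bs)
  case (Cons b cs)
  show ?thesis using h nz by (cases b) (auto simp: kdeg_def Cons)
 qed (use nz in simp)
 thus ?thesis by (simp add: kdeg_def)
qed

lemma kd_top_mem: "kdeg (length as) (int (length as) - 1) k ==> kd as k (replicate (length as) True) \<in> igen (set as)"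
proof (induction as arbitrary: k)
 case (Cons a as)
 have "kdeg (length as) (int (length as) - 1) (%c. k (True # c))" using kdeg_tail(2)[of "length as" _ k] Cons.prems by simp
 from Cons.IH[OF this] have "kd as (%c. k (True # c)) (replicate (length as) True) \<in> igen (set (a # as))"
  using igen_mono[of "set as" "set (a # as)"] by auto
 thus ?case by (auto intro!: is_idealD(6)[OF is_ideal_igen] is_idealD(4)[OF is_ideal_igen] intro: igen_superset)
qed (simp add: igen_0)

lemma igen_insert_ideal_iff: "is_ideal J ==> x \<in> igen (insert f J) \<longleftrightarrow> (\<exists>r. x - f * r \<in> J)"
 by (simp add: igen_insert_iff igen_ideal mult.commute)

text \<open>With \<open>kd_top_mem\<close> this identifies the top cohomology as the quotient by the
  ideal of the generators. The multiple of the head is produced by the component without the head,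
  the rest by induction.\<close>

lemma kd_top_ex:
 "kdeg (length as) (int (length as)) k ==> k (replicate (length as) True) \<in> igen (set as) ==>
  \<exists>l. kdeg (length as) (int (length as) - 1) l & (\<forall>bs. k bs = kd as l bs)"
proof (induction as arbitrary: k)
 case Nil
 have "igen {} = {0 :: 'a}" using igen_least[of "{0 :: 'a}" "{}"] igen_0 by (auto simp: is_ideal_def)
 hence "k bs = 0" for bs using kdeg_top[of 0 k bs] Nil by auto
 thus ?case by (intro exI[of _ "%_. 0"]) (simp add: kdeg_def)
next
 case (Cons a as)
 let ?r = "length as" let ?t = "replicate ?r True"
 have "igen (set (a # as)) <= igen (insert a (igen (set as)))" by (intro igen_least) (auto intro: igen_superset)
 then obtain x where x: "k (replicate (length (a # as)) True) - a * x \<in> igen (set as)"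
  using Cons.prems(2) igen_insert_ideal_iff[OF is_ideal_igen] by blast
 define y where "y bs = (if bs = ?t then a * x - k (True # ?t) else 0)" for bs
 have cnt: "count_list (replicate m True) True = m" for m by (induction m) auto
 have "kdeg ?r (int ?r) y" by (auto simp: kdeg_def y_def cnt)
 moreover have "y ?t \<in> igen (set as)" using is_idealD(5)[OF is_ideal_igen x] by (simp add: y_def)
 ultimately obtain l where l: "kdeg ?r (int ?r - 1) l" "!!bs. y bs = kd as l bs" using Cons.IH by blast
 define lF where "lF bs = (if bs = ?t then x else 0)" for bs
 have lF: "kdeg ?r (int ?r) lF" by (auto simp: kdeg_def lF_def cnt)
 have "kd (a # as) (kcons lF l) bs = k bs" for bs
 proof (cases bs)
  case Nil
  thus ?thesis using Cons.prems(1) by (auto simp: kdeg_def)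
 next
  case (Cons b cs)
  show ?thesis
  proof (cases b)
   case True
   have "k (True # cs) = (if cs = ?t then k (True # ?t) else 0)"
    using kdeg_top[of "Suc ?r" k "True # cs"] Cons.prems(1) by auto
   thus ?thesis by (auto simp: Cons True l(2)[symmetric] y_def lF_def)
  next
   case False
   have "kd as lF cs = 0" using kdeg_above[OF kdeg_kd[OF lF]] by simp
   moreover have "k bs = 0" using kdeg_top[of "Suc ?r" k bs] Cons.prems(1) by (auto simp: Cons False)
   ultimately show ?thesis by (simp add: Cons False)
  qed
 qed
 moreover have "kdeg (Suc ?r) (int (Suc ?r) - 1) (kcons lF l)" using kdeg_kcons[OF lF l(1)] by simp
 ultimately show ?case by (intro exI[of _ "kcons lF l"]) auto
qed

text \<open>Regularity is built up from the end of the list, because \<open>kd\<close> peels off its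
  head.\<close>

fun tail_regular :: "'a::comm_ring_1 list => bool" where
 "tail_regular [] \<longleftrightarrow> True"
| "tail_regular (a # as) \<longleftrightarrow> tail_regular as & (\<forall>x. a * x \<in> igen (set as) --> x \<in> igen (set as))"

text \<open>In the mapping cone the component without the head is a cocycle. Below its top degree it
  is a coboundary by induction; in the top degree its multiple by the head is one, and the head is a
  nonzerodivisor on the top cohomology. The other component is then corrected and treated by
  induction.\<close>

lemma kd_exact:
 "tail_regular as ==> i < int (length as) ==> kdeg (length as) i k ==> (!!bs. kd as k bs = 0) ==>
  \<exists>l. kdeg (length as) (i - 1) l & (\<forall>bs. k bs = kd as l bs)"
proof (induction as arbitrary: i k)
 case Nil
 hence "k bs = 0" for bs by (force simp: kdeg_def)
 thus ?case by (intro exI[of _ "%_. 0"]) (simp add: kdeg_def)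
next
 case (Cons a as)
 let ?r = "length as"
 define kF where "kF c = k (False # c)" for c
 define kT where "kT c = k (True # c)" for c
 have dF: "kdeg ?r i kF" and dT: "kdeg ?r (i - 1) kT"
  using kdeg_tail Cons.prems(3) unfolding kF_def[abs_def] kT_def[abs_def] by auto
 have zF: "kd as kF bs = 0" for bs using Cons.prems(4)[of "False # bs"] by (simp add: kF_def[abs_def])
 have zT: "a * kF bs = kd as kT bs" for bs using Cons.prems(4)[of "True # bs"] by (simp add: kF_def kT_def[abs_def])
 have tr: "tail_regular as" using Cons.prems(1) by simp
 obtain lF where lF: "kdeg ?r (i - 1) lF" "!!bs. kF bs = kd as lF bs"
 proof (cases "i < int ?r")
  case True
  thus ?thesis using Cons.IH[OF tr True dF zF] that by blast
 next
  case False
  hence ir: "i = int ?r" using Cons.prems(2) by simp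
  have "a * kF (replicate ?r True) \<in> igen (set as)" unfolding zT using kd_top_mem dT ir by simp
  hence "kF (replicate ?r True) \<in> igen (set as)" using Cons.prems(1) by simp
  thus ?thesis using kd_top_ex[of as kF] dF ir that by blast
 qed
 have "kdeg ?r (i - 1) (%b. kT b - a * lF b)" by (intro kdeg_diff kdeg_scale dT lF)
 moreover have "kd as (%b. kT b - a * lF b) bs = 0" for bs by (simp add: kd_diff kd_scale lF(2)[symmetric] zT[symmetric])
 ultimately obtain m where m: "kdeg ?r (i - 1 - 1) m" "!!bs. kT bs - a * lF bs = kd as m bs"
  using Cons.IH[OF tr, of "i - 1" "%b. kT b - a * lF b"] Cons.prems(2) by auto
 have mm: "kdeg ?r (i - 1 - 1) (%b. - 1 * m b)" by (rule kdeg_scale[OF m(1)])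
 have "k bs = kd (a # as) (kcons lF (%b. - 1 * m b)) bs" for bs
 proof (cases bs)
  case Nil
  thus ?thesis using Cons.prems(3) by (auto simp: kdeg_def)
 next
  case (Cons b cs)
  have "kd as (%b. - 1 * m b) cs = - kd as m cs" unfolding kd_scale by simp
  thus ?thesis using lF(2)[of cs] m(2)[of cs] by (cases b) (auto simp: Cons kF_def kT_def algebra_simps)
 qed
 thus ?case using kdeg_kcons[OF lF(1) mm] by (intro exI[of _ "kcons lF (%b. - 1 * m b)"]) auto
qed

text \<open>Exactness in degree i of the Koszul complex with coefficients in the quotient by J,
  expressed by congruences.\<close>

definition kexact :: "'a::comm_ring_1 set => 'a list => int => bool" where
 "kexact J as i \<longleftrightarrow> (\<forall>k. kdeg (length as) i k --> (\<forall>bs. kd as k bs \<in> J) -->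
   (\<exists>l. kdeg (length as) (i - 1) l & (\<forall>bs. k bs - kd as l bs \<in> J)))"

text \<open>The long exact sequence of multiplication by f: a cocycle modulo (J, f) has coboundary f
  m modulo J, where m is a cocycle. Exactness in degree i + 1 makes m a coboundary, so each equation
  costs one degree.\<close>

lemma kexact_step:
 assumes J: "is_ideal J" and f: "!!a. a * f \<in> J ==> a \<in> J" and e: "kexact J as i" "kexact J as (i + 1)"
 shows "kexact (igen (insert f J)) as i" unfolding kexact_def
proof (intro allI impI)
 fix k assume k: "kdeg (length as) i k" "\<forall>bs. kd as k bs \<in> igen (insert f J)"
 let ?r = "length as"
 from k(2) obtain m0 where m0: "!!bs. kd as k bs - f * m0 bs \<in> J" unfolding igen_insert_ideal_iff[OF J] by metis
 define m where "m bs = (if kd as k bs = 0 then 0 else m0 bs)" for bs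
 have m: "kd as k bs - f * m bs \<in> J" for bs using m0[of bs] is_idealD(1)[OF J] by (simp add: m_def)
 have dm: "kdeg ?r (i + 1) m" using kdeg_kd[OF k(1)] by (auto simp: kdeg_def m_def)
 have "kd as (%b. kd as k b - f * m b) bs \<in> J" for bs by (rule kd_ideal[OF J m])
 hence 1: "kd as (kd as k) bs - f * kd as m bs \<in> J" for bs unfolding kd_diff kd_scale .
 have "kd as m bs \<in> J" for bs
 proof (rule f)
  have "- (f * kd as m bs) \<in> J" using 1[of bs] by (simp add: kd_kd)
  from is_idealD(5)[OF J this] show "kd as m bs * f \<in> J" by (simp add: mult.commute)
 qed
 hence "\<exists>n. kdeg ?r (i + 1 - 1) n & (\<forall>bs. m bs - kd as n bs \<in> J)" using e(2) dm unfolding kexact_def by blast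
 then obtain n where n: "kdeg ?r i n" "!!bs. m bs - kd as n bs \<in> J" by auto
 have "kd as (%b. k b - f * n b) bs \<in> J" for bs
 proof -
  have "(kd as k bs - f * m bs) + f * (m bs - kd as n bs) \<in> J" by (intro is_idealD(2,3)[OF J] m n)
  moreover have "kd as (%b. k b - f * n b) bs = (kd as k bs - f * m bs) + f * (m bs - kd as n bs)"
   unfolding kd_diff kd_scale by (simp add: algebra_simps)
  ultimately show ?thesis by simp
 qed
 moreover have "kdeg ?r i (%b. k b - f * n b)" by (intro kdeg_diff kdeg_scale k n)
 ultimately obtain l where l: "kdeg ?r (i - 1) l" "!!bs. k bs - f * n bs - kd as l bs \<in> J" using e(1) unfolding kexact_def by blast
 have "k bs - kd as l bs \<in> igen (insert f J)" for bs
 proof -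
  have "k bs - kd as l bs - f * n bs = k bs - f * n bs - kd as l bs" by simp
  thus ?thesis using l(2)[of bs] unfolding igen_insert_ideal_iff[OF J] by metis
 qed
 thus "\<exists>l. kdeg ?r (i - 1) l & (\<forall>bs. k bs - kd as l bs \<in> igen (insert f J))" using l(1) by blast
qed

lemma kexact_regular:
 assumes tr: "tail_regular as" and reg: "reg_list fs" and i: "i + int (length fs) < int (length as)"
 shows "kexact (igen (set fs)) as i"
proof -
 have "j \<le> length fs ==> i + int j < int (length as) ==> kexact (igen (set (take j fs))) as i" for i j
 proof (induction j arbitrary: i)
  case 0
  have z: "igen {} = {0 :: 'a}" using igen_least[of "{0 :: 'a}" "{}"] igen_0 by (auto simp: is_ideal_def)
  show ?case unfolding kexact_def using kd_exact[OF tr, of i] 0 by (simp add: z)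
 next
  case (Suc j)
  let ?J = "igen (set (take j fs))"
  have s: "set (take (Suc j) fs) = insert (fs ! j) (set (take j fs))" using Suc.prems by (simp add: take_Suc_conv_app_nth)
  have eq: "igen (set (take (Suc j) fs)) = igen (insert (fs ! j) ?J)"
  proof
   show "igen (set (take (Suc j) fs)) <= igen (insert (fs ! j) ?J)"
    unfolding s by (intro igen_least) (auto intro: igen_superset)
   show "igen (insert (fs ! j) ?J) <= igen (set (take (Suc j) fs))"
    unfolding s using igen_mono[of "set (take j fs)" "insert (fs ! j) (set (take j fs))"]
    by (intro igen_least) (auto intro: igen_superset)
  qed
  show ?case unfolding eq by (rule kexact_step) (use Suc reg in "auto simp: reg_list_def")
 qed
 from this[of "length fs" i] i show ?thesis by simp
qed

definition kdelta :: "nat => 'a::comm_ring_1 => bool list => 'a" where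
 "kdelta r w bs = (if bs = replicate r False then w else 0)"

lemma kdelta_simps [simp]:
 "kdelta (Suc r) w (False # c) = kdelta r w c" "kdelta (Suc r) w (True # c) = 0" "kdelta (Suc r) w [] = 0"
 by (auto simp: kdelta_def)

lemma kdeg_kdelta: "kdeg r 0 (kdelta r w)"
proof -
 have "count_list (replicate r False) True = 0" by (induction r) auto
 thus ?thesis by (auto simp: kdeg_def kdelta_def)
qed

lemma kdeg_0_eq: assumes "kdeg r 0 k" shows "k = kdelta r (k (replicate r False))"
proof
 fix bs
 have "bs = replicate (length bs) False" if "count_list bs True = 0"
  using that by (induction bs) (auto split: if_splits)
 thus "k bs = kdelta r (k (replicate r False)) bs"
  using assms unfolding kdeg_def kdelta_def by (metis of_nat_eq_0_iff)
qed

lemma kd_kdelta_mem: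
 "is_ideal J ==> (!!a. a \<in> set as ==> a * w \<in> J) ==> kd as (kdelta (length as) w) bs \<in> J"
proof (induction as arbitrary: bs)
 case (Cons a as)
 show ?case
 proof (cases bs)
  case (Cons b cs)
  thus ?thesis using Cons.IH[of cs] Cons.prems is_idealD(1)[OF Cons.prems(1)] by (cases b) (auto simp: kdelta_def)
 qed (use is_idealD(1)[OF Cons.prems(1)] in simp)
qed (use is_idealD(1) in auto)

text \<open>The cochain of degree 1 with values \<open>ws\<close> on the singletons, as
  \<open>kdelta\<close> is the one of degree 0.\<close>

fun kone :: "'a::comm_ring_1 list => bool list => 'a" where
 "kone (w # ws) (True # bs) = kdelta (length ws) w bs"
| "kone (w # ws) (False # bs) = kone ws bs"
| "kone _ _ = 0"

lemma kdeg_kone: "kdeg (length ws) 1 (kone ws)"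
proof -
 have "kone ws bs \<noteq> 0 ==> length bs = length ws & count_list bs True = 1" for bs
 proof (induction ws bs rule: kone.induct)
  case (1 w ws bs)
  thus ?case using kdeg_kdelta[of "length ws" w] by (auto simp: kdeg_def)
 qed auto
 thus ?thesis by (auto simp: kdeg_def)
qed

lemma kone_step:
 "is_ideal J ==> length ws = length as ==> (!!k. k < length as ==> a * ws ! k - as ! k * w \<in> J) ==>
  a * kone ws bs - kd as (kdelta (length as) w) bs \<in> J"
proof (induction as arbitrary: ws bs)
 case (Cons a0 as)
 then obtain w0 ws' where ws: "ws = w0 # ws'" "length ws' = length as" by (cases ws) auto
 note J0 = is_idealD(1)[OF Cons.prems(1)]
 show ?case
 proof (cases bs)
  case (Cons b cs)
  show ?thesis
  proof (cases b)
   case True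
   thus ?thesis using Cons.prems(3)[of 0] J0 by (simp add: Cons ws kdelta_def)
  next
   case False
   have "a * kone ws' cs - kd as (kdelta (length as) w) cs \<in> J" by (rule Cons.IH) (use Cons.prems ws in "force+")
   thus ?thesis by (simp add: Cons False ws)
  qed
 qed (use J0 in "simp add: ws")
qed (use is_idealD(1) in auto)

lemma kd_kone_mem:
 "is_ideal J ==> length ws = length as ==> (!!k l. k < length as ==> l < length as ==> as ! k * ws ! l - as ! l * ws ! k \<in> J) ==>
  kd as (kone ws) bs \<in> J"
proof (induction as arbitrary: ws bs)
 case (Cons a as)
 then obtain w ws' where ws: "ws = w # ws'" "length ws' = length as" by (cases ws) auto
 note J0 = is_idealD(1)[OF Cons.prems(1)]
 show ?case
 proof (cases bs)
  case (Cons b cs)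
  show ?thesis
  proof (cases b)
   case True
   have "a * kone ws' cs - kd as (kdelta (length as) w) cs \<in> J"
    by (rule kone_step) (use Cons.prems(1) Cons.prems(3)[of 0 "Suc _"] ws in force)+
   moreover have "kd (a # as) (kone ws) bs = a * kone ws' cs - kd as (kdelta (length as) w) cs"
    by (simp add: Cons True ws)
   ultimately show ?thesis by simp
  next
   case False
   have "kd as (kone ws') cs \<in> J"
    by (rule Cons.IH) (use Cons.prems(1) Cons.prems(3)[of "Suc _" "Suc _"] ws in force)+
   thus ?thesis by (simp add: Cons False ws)
  qed
 qed (use J0 in simp)
qed (use is_idealD(1) in auto)

lemma kone_kdelta_nth:
 "length ws = length as ==> (!!bs. kone ws bs - kd as (kdelta (length as) y) bs \<in> J) ==> k < length as ==>
  ws ! k - as ! k * y \<in> J"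
proof (induction as arbitrary: ws k)
 case (Cons a as)
 then obtain w ws' where ws: "ws = w # ws'" "length ws' = length as" by (cases ws) auto
 show ?case
 proof (cases k)
  case 0
  thus ?thesis using Cons.prems(2)[of "True # replicate (length as) False"] by (simp add: ws kdelta_def)
 next
  case (Suc k')
  have "ws' ! k' - as ! k' * y \<in> J"
   by (rule Cons.IH) (use Cons.prems(2)[of "False # _"] Cons.prems(3) Suc ws in auto)
  thus ?thesis by (simp add: Suc ws)
 qed
qed simp

lemma kexact_0: "kexact J as 0 ==> is_ideal J ==> (!!a. a \<in> set as ==> a * w \<in> J) ==> w \<in> J"
proof -
 assume e: "kexact J as 0" and J: "is_ideal J" and w: "!!a. a \<in> set as ==> a * w \<in> J"
 have "\<forall>bs. kd as (kdelta (length as) w) bs \<in> J" using kd_kdelta_mem[OF J w] by blast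
 then obtain l where l: "kdeg (length as) (0 - 1) l" "!!bs. kdelta (length as) w bs - kd as l bs \<in> J"
  using e kdeg_kdelta unfolding kexact_def by blast
 have "l = (%_. 0)" using l(1) by (force simp: kdeg_def)
 thus "w \<in> J" using l(2)[of "replicate (length as) False"] by (simp add: kdelta_def)
qed

text \<open>The hypothesis says that the cochain \<open>kone ws\<close> is closed modulo J; a
  primitive has degree 0 and is given by a single element y.\<close>

lemma kexact_1: assumes e: "kexact J as 1" and J: "is_ideal J" and ws: "length ws = length as"
  "!!k l. k < length as ==> l < length as ==> as ! k * ws ! l - as ! l * ws ! k \<in> J"
 shows "\<exists>y. \<forall>k<length as. ws ! k - as ! k * y \<in> J"
proof -
 have "\<forall>bs. kd as (kone ws) bs \<in> J" using kd_kone_mem[OF J ws] by blast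
 then obtain l where l: "kdeg (length as) (1 - 1) l" "!!bs. kone ws bs - kd as l bs \<in> J"
  using e kdeg_kone[of ws] ws(1) unfolding kexact_def by fastforce
 obtain y where "l = kdelta (length as) y" using kdeg_0_eq l(1) by fastforce
 thus ?thesis using kone_kdelta_nth[OF ws(1)] l(2) by blast
qed

section \<open>Powers of the variables and the depth of the cone\<close>

lemma var_power: "var i ^ k = single (single i k) (1 :: 'k::field)" for i :: "'n::finite"
proof -
 have "msc k (single i 1) = single i k" by (rule poly_mapping_eqI) (simp add: lookup_single when_def)
 thus ?thesis by (simp add: var_def single_power)
qed

lemma lookup_single_mult: "lookup (single t 1 * a) (t + m) = lookup a m"
 for a :: "('n::finite, 'k::field) mpoly"
proof (induction a rule: mpoly_induct)
 case (single m' c)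
 thus ?case by (simp add: mult_single lookup_single when_def)
qed (auto simp: distrib_left lookup_add)

lemma igen_var_powers:
 fixes B :: "'n::finite set"
 shows "igen ((%j. var j ^ k) ` B) = {a :: ('n, 'k::field) mpoly. \<forall>m\<in>keys a. \<exists>j\<in>B. k \<le> lookup m j}"
proof (intro equalityI subsetI CollectI)
 fix a :: "('n, 'k) mpoly" assume "a \<in> igen ((%j. var j ^ k) ` B)"
 thus "\<forall>m\<in>keys a. \<exists>j\<in>B. k \<le> lookup m j"
 proof induction
  case (igen_mult x r)
  then obtain j where j: "j \<in> B" "x = single (single j k) 1" by (auto simp: var_power)
  show ?case
  proof
   fix m assume "m \<in> keys (r * x)"
   then obtain m' where "m = m' + single j k" using keys_mult[of r x] j(2) by (auto split: if_splits)
   thus "\<exists>j\<in>B. k \<le> lookup m j" using j(1) by (intro bexI[of _ j]) (auto simp: lookup_add)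
  qed
 next
  case (igen_add a b)
  thus ?case using Poly_Mapping.keys_add[of a b] by blast
 qed simp
next
 fix a :: "('n, 'k) mpoly" assume "a \<in> {a. \<forall>m\<in>keys a. \<exists>j\<in>B. k \<le> lookup m j}"
 hence a: "\<forall>m\<in>keys a. \<exists>j\<in>B. k \<le> lookup m j" by simp
 have "(\<Sum>m\<in>keys a. single m (lookup a m)) \<in> igen ((%j. var j ^ k) ` B)"
 proof (rule is_ideal_sum[OF is_ideal_igen])
  fix m assume "m \<in> keys a"
  then obtain j where j: "j \<in> B" "k \<le> lookup m j" using a by blast
  have "m = (m - single j k) + single j k"
   by (rule poly_mapping_eqI) (use j(2) in "auto simp: lookup_add lookup_minus lookup_single when_def")
  hence "single m (lookup a m) = single (m - single j k) (lookup a m) * var j ^ k"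
   by (simp add: var_power mult_single)
  thus "single m (lookup a m) \<in> igen ((%j. var j ^ k) ` B)"
   using igen_mult[of "var j ^ k" "(%j. var j ^ k) ` B"] j(1) by simp
 qed
 thus "a \<in> igen ((%j. var j ^ k) ` B)" by (simp flip: mpoly_sum_singles)
qed

lemma tail_regular_var_powers:
 "distinct xs ==> tail_regular (map (%i. var i ^ k :: ('n::finite, 'k::field) mpoly) xs)"
proof (induction xs)
 case (Cons i xs)
 have "a \<in> igen ((%j. var j ^ k) ` set xs)" if "var i ^ k * a \<in> igen ((%j. var j ^ k) ` set xs)" for a :: "('n, 'k) mpoly"
 proof -
  have "\<exists>j\<in>set xs. k \<le> lookup m j" if m: "m \<in> keys a" for m
  proof -
   have "single i k + m \<in> keys (var i ^ k * a)" using m by (simp add: in_keys_iff var_power lookup_single_mult)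
   then obtain j where "j \<in> set xs" "k \<le> lookup (single i k + m) j"
    using `var i ^ k * a \<in> _` unfolding igen_var_powers by blast
   moreover have "j \<noteq> i" using Cons.prems `j \<in> set xs` by auto
   ultimately show ?thesis by (auto simp: lookup_add lookup_single when_def)
  qed
  thus ?thesis by (simp add: igen_var_powers)
 qed
 thus ?case using Cons by simp
qed simp

text \<open>The powers of the N variables form a regular sequence, and each of the m equations costs
  one degree of exactness, so m + 2 <= N leaves exactness in degrees 0 and 1. This is depth 2 of the
  cone.\<close>

lemma
 fixes fs :: "('n::finite, 'k::field) mpoly list"
 assumes reg: "reg_list fs" and len: "length fs + 2 \<le> CARD('n)" and I: "I = igen (set fs)"
 shows depth_one: "(!!i. var i ^ k * w \<in> I) ==> w \<in> I"
  and depth_two: "(!!i j. var i ^ k * W j - var j ^ k * W i \<in> I) ==> \<exists>y. \<forall>i. W i - var i ^ k * y \<in> I"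
proof -
 obtain xs :: "'n list" where xs: "set xs = UNIV" "distinct xs" using finite_distinct_list[of "UNIV :: 'n set"] by auto
 hence l: "length xs = CARD('n)" using distinct_card[of xs] by simp
 let ?as = "map (%i. var i ^ k :: ('n, 'k) mpoly) xs"
 have e: "kexact I ?as i" if "i \<le> 1" for i
  unfolding I by (rule kexact_regular[OF tail_regular_var_powers[OF xs(2)] reg]) (use len l that in auto)
 have J: "is_ideal I" by (simp add: I)
 show "w \<in> I" if "!!i. var i ^ k * w \<in> I" by (rule kexact_0[OF e J]) (use that in auto)
 show "\<exists>y. \<forall>i. W i - var i ^ k * y \<in> I" if "!!i j. var i ^ k * W j - var j ^ k * W i \<in> I"
 proof -
  have "\<exists>y. \<forall>j<length ?as. map W xs ! j - ?as ! j * y \<in> I"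
   by (rule kexact_1[OF e J]) (use that in auto)
  then obtain y where y: "!!j. j < length xs ==> W (xs ! j) - var (xs ! j) ^ k * y \<in> I" by auto
  have "W i - var i ^ k * y \<in> I" for i using y xs(1) by (metis UNIV_I in_set_conv_nth)
  thus ?thesis by blast
 qed
qed

section \<open>Global sections of twists\<close>

lemma hom_set_igen_insert: assumes "is_ideal J" "hom_set J" "a \<in> homog e" shows "hom_set (igen (insert a J))"
 unfolding hom_set_def
proof (intro ballI allI)
 fix x d assume "x \<in> igen (insert a J)"
 then obtain r where r: "x - a * r \<in> J" using igen_insert_ideal_iff[OF assms(1)] by blast
 have "hcomp d (x - a * r) = hcomp d x - hcomp d (a * r)" by (rule poly_mapping_eqI) (simp add: lookup_minus)
 moreover have "hcomp d (x - a * r) \<in> J" using r assms(2) by (simp add: hom_set_def)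
 ultimately have "\<exists>s. hcomp d x - a * s \<in> J" unfolding hcomp_mult[OF assms(3)] by (metis mult_zero_right)
 thus "hcomp d x \<in> igen (insert a J)" using igen_insert_ideal_iff[OF assms(1)] by blast
qed

text \<open>Both elements are reduced modulo Q until their lowest components lie outside Q; the
  lowest component of the product is then the product of these.\<close>

lemma hprime_if_homog_prime:
 fixes Q :: "('n::finite, 'k::field) mpoly set" assumes Q: "is_ideal Q" "hom_set Q" "1 ~: Q"
  and pr: "!!a b d e. a \<in> homog d ==> b \<in> homog e ==> a * b \<in> Q ==> a \<in> Q \<or> b \<in> Q"
 shows "hprime Q" unfolding hprime_def
proof (intro conjI allI impI, rule Q, rule Q, rule Q, rule ccontr)
 fix a b :: "('n, 'k) mpoly" assume ab: "a * b \<in> Q" "\<not> (a \<in> Q \<or> b \<in> Q)"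
 have ex: "\<exists>i a'. a - a' \<in> Q & (\<forall>j<i. hcomp j a' = 0) & hcomp i a' ~: Q" if a: "a ~: Q" for a
 proof -
  have "\<exists>i. hcomp i a ~: Q" using is_ideal_sum[OF Q(1), of "{..tot_deg a}" "%d. hcomp d a"] a sum_hcomp[of a "tot_deg a"] by auto
  then obtain i where i: "hcomp i a ~: Q" "!!j. j < i ==> hcomp j a \<in> Q" using exists_least_iff[of "%i. hcomp i a ~: Q"] by blast
  let ?a = "a - (\<Sum>j<i. hcomp j a)"
  have "hcomp l ?a = (if l < i then 0 else hcomp l a)" for l
   by (rule poly_mapping_eqI) (auto simp: lookup_minus lookup_sum)
  moreover have "a - ?a \<in> Q" using is_ideal_sum[OF Q(1), of "{..<i}" "%d. hcomp d a"] i(2) by simp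
  ultimately show ?thesis using i(1) by (intro exI[of _ i] exI[of _ ?a]) auto
 qed
 obtain i a' j b' where a': "a - a' \<in> Q" "!!l. l < i ==> hcomp l a' = 0" "hcomp i a' ~: Q"
  and b': "b - b' \<in> Q" "!!l. l < j ==> hcomp l b' = 0" "hcomp j b' ~: Q" using ex ab(2) by metis
 have "a * b - (a - a') * b - a' * (b - b') \<in> Q" by (intro is_idealD[OF Q(1)] a' b' ab)
 hence "a' * b' \<in> Q" by (simp add: algebra_simps)
 hence "hcomp (i + j) (a' * b') \<in> Q" using Q(2) by (simp add: hom_set_def)
 also have "hcomp (i + j) (a' * b') = hcomp i a' * hcomp j b'"
 proof -
  define N where "N = max (tot_deg a') (i + j)"
  have "a' * b' = (\<Sum>l\<le>N. hcomp l a' * b')" by (simp add: sum_hcomp N_def flip: sum_distrib_right)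
  hence "hcomp (i + j) (a' * b') = (\<Sum>l\<le>N. if l \<le> i + j then hcomp l a' * hcomp (i + j - l) b' else 0)"
   by (simp add: hcomp_sum hcomp_mult[OF hcomp_homog])
  also have "\<dots> = (\<Sum>l\<le>N. if l = i then hcomp i a' * hcomp j b' else 0)"
  proof (rule sum.cong[OF refl])
   fix l
   have "i + j - l < j" if "l > i" "l \<le> i + j" using that by simp
   thus "(if l \<le> i + j then hcomp l a' * hcomp (i + j - l) b' else 0) = (if l = i then hcomp i a' * hcomp j b' else 0)"
    using a'(2)[of l] b'(2)[of "i + j - l"] by (cases l i rule: linorder_cases) auto
  qed
  also have "\<dots> = hcomp i a' * hcomp j b'" by (simp add: N_def)
  finally show ?thesis .
 qed
 finally show False using pr[OF hcomp_homog hcomp_homog] a'(3) b'(3) by blast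
qed

text \<open>Zorn's lemma gives a homogeneous ideal maximal among those containing no power of s.
  Maximality is tested with homogeneous elements, since adjoining one keeps the ideal
  homogeneous.\<close>

lemma hprime_avoiding:
 fixes J :: "('n::finite, 'k::field) mpoly set" assumes J: "is_ideal J" "hom_set J" and s: "!!n. s ^ n ~: J"
 obtains Q where "hprime Q" "J <= Q" "s ~: Q"
proof -
 define \<A> where "\<A> = {Q. is_ideal Q & hom_set Q & J <= Q & (\<forall>n. s ^ n ~: Q)}"
 have "\<exists>Q\<in>\<A>. \<forall>X'\<in>\<A>. Q <= X' --> X' = Q"
 proof (rule subset_Zorn_nonempty)
  show "\<A> \<noteq> {}" using J s by (auto simp: \<A>_def)
  fix C assume C: "C \<noteq> {}" "subset.chain \<A> C"
  hence sub: "!!Q. Q \<in> C ==> Q \<in> \<A>" and lin: "!!Q Q'. Q \<in> C ==> Q' \<in> C ==> Q <= Q' \<or> Q' <= Q"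
   by (auto simp: subset.chain_def)
  have "is_ideal (\<Union>C)" unfolding is_ideal_def
  proof (intro conjI ballI allI)
   show "0 \<in> \<Union>C" using C(1) sub by (auto simp: \<A>_def is_ideal_def)
   fix a assume "a \<in> \<Union>C"
   then obtain Q where Q: "Q \<in> C" "a \<in> Q" by blast
   hence idQ: "is_ideal Q" using sub by (auto simp: \<A>_def)
   show "r * a \<in> \<Union>C" for r using is_idealD(3)[OF idQ Q(2)] Q(1) by blast
   fix b assume "b \<in> \<Union>C"
   then obtain Q' where Q': "Q' \<in> C" "b \<in> Q'" by blast
   hence idQ': "is_ideal Q'" using sub by (auto simp: \<A>_def)
   show "a + b \<in> \<Union>C" using lin[OF Q(1) Q'(1)] Q Q' is_idealD(2)[OF idQ] is_idealD(2)[OF idQ'] by blast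
  qed
  thus "\<Union>C \<in> \<A>" using C(1) sub by (auto simp: \<A>_def hom_set_def) blast+
 qed
 then obtain Q where Q: "Q \<in> \<A>" and max: "!!K. K \<in> \<A> ==> Q <= K ==> K = Q" by blast
 hence Q': "is_ideal Q" "hom_set Q" "J <= Q" "!!n. s ^ n ~: Q" by (auto simp: \<A>_def)
 have pw: "\<exists>n r. s ^ n - a * r \<in> Q" if a: "a \<in> homog d" "a ~: Q" for a d
 proof (rule ccontr)
  assume no: "\<not> (\<exists>n r. s ^ n - a * r \<in> Q)"
  have "Q <= igen (insert a Q)" by (auto intro: igen_superset)
  moreover have "igen (insert a Q) \<in> \<A>"
   using no Q'(3) `Q <= _` hom_set_igen_insert[OF Q'(1,2) a(1)] by (auto simp: \<A>_def igen_insert_ideal_iff[OF Q'(1)])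
  ultimately have "igen (insert a Q) = Q" using max by blast
  thus False using a(2) igen_superset[of a "insert a Q"] by simp
 qed
 have "hprime Q"
 proof (rule hprime_if_homog_prime[OF Q'(1,2)])
  show "1 ~: Q" using Q'(4)[of 0] by simp
  fix a b d e assume ab: "a \<in> homog d" "b \<in> homog e" "a * b \<in> Q"
  show "a \<in> Q \<or> b \<in> Q"
  proof (rule ccontr)
   assume "\<not> (a \<in> Q \<or> b \<in> Q)"
   then obtain n r m t where h: "s ^ n - a * r \<in> Q" "s ^ m - b * t \<in> Q" using pw ab by meson
   have "(s ^ n - a * r) * s ^ m + a * r * (s ^ m - b * t) + r * t * (a * b) \<in> Q"
    by (intro is_idealD[OF Q'(1)] h ab)
   hence "s ^ (n + m) \<in> Q" by (simp add: algebra_simps power_add)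
   thus False using Q'(4) by blast
  qed
 qed
 moreover have "s ~: Q" using Q'(4)[of 1] by simp
 ultimately show ?thesis using that Q'(3) by blast
qed

section \<open>Local vanishing and finite covers of Proj\<close>

context graded_quot
begin

lemma power_mem_mono: "is_ideal J ==> a ^ m \<in> J ==> m \<le> n ==> (a :: ('n, 'k) mpoly) ^ n \<in> J"
 using is_idealD(3)[of J "a ^ m" "a ^ (n - m)"] by (simp flip: power_add)

text \<open>If no power of var i * s killed w modulo I, a homogeneous prime over the annihilator
  would avoid var i * s and give a point where w is not locally zero. The factor var i keeps this
  prime away from the irrelevant ideal.\<close>

lemma locally_zero: assumes s: "s \<in> homog k" and w: "w \<in> homog e"
  and loc: "!!Q. Q \<in> points ==> s ~: pull Q ==> \<exists>t. t ~: pull Q & t * w \<in> I"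
 shows "\<exists>m. \<forall>i. (var i * s) ^ m * w \<in> I"
proof -
 define J where "J = {t. t * w \<in> I}"
 have J: "is_ideal J" unfolding is_ideal_def J_def
  using is_idealD[OF ideal_I] by (auto simp: distrib_right mult.assoc)
 have hJ: "hom_set J" unfolding hom_set_def
 proof (intro ballI allI)
  fix t d assume "t \<in> J"
  hence "hcomp (e + d) (w * t) \<in> I" using hom_I by (auto simp: J_def hom_set_def mult.commute)
  moreover have "hcomp (e + d) (w * t) = w * hcomp d t" using hcomp_mult[OF w, of "e + d" t] by simp
  ultimately show "hcomp d t \<in> J" by (simp add: J_def mult.commute)
 qed
 have IJ: "I <= J" using I_D(4) by (auto simp: J_def)
 have "\<exists>m. (var i * s) ^ m \<in> J" for i
 proof (rule ccontr)
  assume "\<nexists>m. (var i * s) ^ m \<in> J"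
  then obtain Q where Q: "hprime Q" "J <= Q" "var i * s ~: Q" using hprime_avoiding[OF J hJ] by metis
  have idQ: "is_ideal Q" using Q(1) by (simp add: hprime_def)
  have v: "var i ~: Q" "s ~: Q" 
   using Q(3) is_idealD(4)[OF idQ, of "var i" s] is_idealD(3)[OF idQ, of s "var i"] by blast+
  note pt = point_of_hprime[OF Q(1) order_trans[OF IJ Q(2)] v(1)]
  obtain t where "t ~: Q" "t * w \<in> I" using loc[OF pt(1)] v(2) unfolding pt(2) by blast
  thus False using Q(2) by (auto simp: J_def)
 qed
 then obtain m where m: "!!i. (var i * s) ^ m i \<in> J" by metis
 have "(var i * s) ^ (Max (range m)) \<in> J" for i by (rule power_mem_mono[OF J m]) simp
 thus ?thesis by (auto simp: J_def)
qed

text \<open>A homogeneous prime containing G and I but not var i would be a point where all of G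
  vanishes.\<close>

lemma covering:
 assumes "!!g. g \<in> G ==> \<exists>d. g \<in> homog d" and "!!P. P \<in> points ==> \<exists>g\<in>G. g ~: pull P"
 shows "\<exists>m. \<forall>i. var i ^ m \<in> igen (G \<union> I)"
proof -
 let ?J = "igen (G \<union> I)"
 have "hom_set ?J" unfolding hom_set_def
 proof (intro ballI allI)
  fix a d assume "a \<in> ?J"
  thus "hcomp d a \<in> ?J"
  proof induction
   case (igen_mult x r)
   have r: "r * x = (\<Sum>e\<le>tot_deg r. hcomp e r * x)" by (simp add: sum_hcomp flip: sum_distrib_right)
   have "hcomp d x \<in> ?J" for d
   proof (cases "x \<in> I")
    case True
    thus ?thesis using hom_I by (intro igen_superset) (simp add: hom_set_def)
   next
    case False
    hence xG: "x \<in> G" using igen_mult by simp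
    then obtain e where "x \<in> homog e" using assms(1) by blast
    thus ?thesis using igen_superset[of x "G \<union> I"] xG by (simp add: hcomp_of_homog igen_0)
   qed
   thus ?case unfolding r hcomp_sum hcomp_mult[OF hcomp_homog]
    by (intro is_ideal_sum[OF is_ideal_igen]) (auto intro: is_idealD(3)[OF is_ideal_igen] igen_0)
  qed (auto simp: hcomp_add intro: igen.intros)
 qed
 hence J: "is_ideal ?J" "hom_set ?J" by auto
 have IJ: "I <= ?J" by (auto intro: igen_superset)
 have "\<exists>m. var i ^ m \<in> ?J" for i
 proof (rule ccontr)
  assume "\<nexists>m. var i ^ m \<in> ?J"
  then obtain Q where Q: "hprime Q" "?J <= Q" "var i ~: Q" using hprime_avoiding[OF J] by metis
  note pt = point_of_hprime[OF Q(1) order_trans[OF IJ Q(2)] Q(3)]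
  obtain g where "g \<in> G" "g ~: Q" using assms(2)[OF pt(1)] unfolding pt(2) by blast
  moreover have "G <= ?J" by (auto intro: igen_superset)
  ultimately show False using Q(2) by blast
 qed
 then obtain m where m: "!!i. var i ^ m i \<in> ?J" by metis
 have "var i ^ (Max (range m)) \<in> ?J" for i by (rule power_mem_mono[OF J(1) m]) simp
 thus ?thesis by blast
qed

lemma igen_finite_sum: assumes "a \<in> igen (h ` B \<union> I)"
 shows "\<exists>F r. finite F & F <= B & a - (\<Sum>P\<in>F. r P * h P) \<in> I" using assms
proof induction
 case igen_0
 thus ?case using I_D(1) by (intro exI[of _ "{}"]) auto
next
 case (igen_mult x r)
 show ?case
 proof (cases "x \<in> I")
  case True
  hence "r * x - (\<Sum>P\<in>{}. 0 * h P) \<in> I" using I_D(3) by simp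
  thus ?thesis by (intro exI[of _ "{}"] exI[of _ "%_. 0"]) auto
 next
  case False
  then obtain P where "P \<in> B" "x = h P" using igen_mult by auto
  thus ?thesis using I_D(1) by (intro exI[of _ "{P}"] exI[of _ "%_. r"]) auto
 qed
next
 case (igen_add a b)
 then obtain F r G s where h: "finite F" "F <= B" "a - (\<Sum>P\<in>F. r P * h P) \<in> I" "finite G" "G <= B" "b - (\<Sum>P\<in>G. s P * h P) \<in> I" by blast
 define q where "q P = (if P \<in> F then r P else 0) + (if P \<in> G then s P else 0)" for P
 have "(\<Sum>P\<in>F. r P * h P) = (\<Sum>P\<in>F \<union> G. (if P \<in> F then r P else 0) * h P)"
  using h by (intro sum.mono_neutral_cong_left) auto
 moreover have "(\<Sum>P\<in>G. s P * h P) = (\<Sum>P\<in>F \<union> G. (if P \<in> G then s P else 0) * h P)"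
  using h by (intro sum.mono_neutral_cong_left) auto
 ultimately have "(\<Sum>P\<in>F \<union> G. q P * h P) = (\<Sum>P\<in>F. r P * h P) + (\<Sum>P\<in>G. s P * h P)"
  by (simp add: q_def distrib_right sum.distrib)
 hence "(a + b) - (\<Sum>P\<in>F \<union> G. q P * h P) \<in> I" using I_D(2)[OF h(3,6)] by (simp add: algebra_simps)
 thus ?case using h by (intro exI[of _ "F \<union> G"] exI[of _ q]) auto
qed

end

context fedder
begin

text \<open>The local fractions c P / h P of degree d glue to an element of S/I: sections of the
  twisted sheaf come from the cone because its depth is at least 2. The gluing uses a partition of
  powers of the variables in place of a partition of unity.\<close>

lemma global_section: assumes len: "length fs + 2 \<le> CARD('n)"
  and h: "!!P. P \<in> points ==> h P \<in> homog (e P)" "!!P. P \<in> points ==> h P ~: pull P"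
  and c: "!!P. P \<in> points ==> c P \<in> homog (e P + d)"
  and compat: "!!P P' Q. P \<in> points ==> P' \<in> points ==> Q \<in> points ==> h P ~: pull Q ==> h P' ~: pull Q ==>
   \<exists>t. t ~: pull Q & t * (h P' * c P - h P * c P') \<in> I"
 shows "\<exists>y\<in>homog d. \<forall>P\<in>points. \<exists>t. t ~: pull P & t * (h P * y - c P) \<in> I"
proof -
 note d1 = depth_one[OF reg len I] and d2 = depth_two[OF reg len I]
 have "\<exists>m. \<forall>i. var i ^ m \<in> igen (h ` points \<union> I)" by (rule covering) (use h in auto)
 then obtain m0 where m0: "!!i. var i ^ m0 \<in> igen (h ` points \<union> I)" by blast
 have "\<forall>i. \<exists>F r. finite F & F <= points & var i ^ m0 - (\<Sum>P\<in>F. r P * h P) \<in> I"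
  using igen_finite_sum[OF m0] by blast
 from choice[OF this] obtain F0 where "\<forall>i. \<exists>r. finite (F0 i) & F0 i <= points & var i ^ m0 - (\<Sum>P\<in>F0 i. r P * h P) \<in> I" by blast
 from choice[OF this] obtain r0 where F0: "!!i. finite (F0 i)" "!!i. F0 i <= points" "!!i. var i ^ m0 - (\<Sum>P\<in>F0 i. r0 i P * h P) \<in> I" by blast
 define F where "F = (\<Union>i. F0 i)"
 have F: "finite F" "F <= points" using F0 by (auto simp: F_def)
 have cov: "\<exists>P'\<in>F. h P' ~: pull Q" if Q: "Q \<in> points" for Q
 proof (rule ccontr)
  assume no: "\<not> ?thesis"
  obtain i where i: "var i ~: pull Q" using points_pull(3)[OF Q] by blast
  note idQ = pull_is_ideal[OF Q]
  have "(\<Sum>P\<in>F0 i. r0 i P * h P) \<in> pull Q" using no by (intro is_ideal_sum[OF idQ] is_idealD(3)[OF idQ]) (auto simp: F_def)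
  from is_idealD(2)[OF idQ pull_I[OF Q F0(3)[of i]] this] have "var i ^ m0 \<in> pull Q" by simp
  thus False using i pull_power[OF Q] by blast
 qed
 have "\<exists>m. \<forall>i. (var i * (h P * h P')) ^ m * (h P' * c P - h P * c P') \<in> I" if P: "P \<in> points" "P' \<in> points" for P P'
 proof (rule locally_zero)
  show "h P * h P' \<in> homog (e P + e P')" by (intro homog_mult h P)
  show "h P' * c P - h P * c P' \<in> homog (e P + e P' + d)"
   using homog_mult[OF h(1)[OF P(2)] c[OF P(1)]] homog_mult[OF h(1)[OF P(1)] c[OF P(2)]]
   by (intro homog_diff) (simp_all add: ac_simps)
  show "\<exists>t. t ~: pull Q & t * (h P' * c P - h P * c P') \<in> I" if "Q \<in> points" "h P * h P' ~: pull Q" for Q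
   using compat[OF P that(1)] that by (auto simp: pull_prime)
 qed
 then obtain mm where mm: "!!P P' i. P \<in> points ==> P' \<in> points ==>
   (var i * (h P * h P')) ^ mm P P' * (h P' * c P - h P * c P') \<in> I" by metis
 \<comment> \<open>Large enough for all pairs in the finite cover: after expanding each fraction by
   h^L, the compatibilities hold modulo I up to powers of the variables, which
   \<open>depth_one\<close> removes.\<close>
 define L where "L = Max (insert 0 ((%(P, P'). mm P P') ` (F \<times> F)))"
 define H where "H P = h P ^ Suc L" for P
 define C where "C P = h P ^ L * c P" for P
 have HC: "H P' * C P - H P * C P' \<in> I" if P: "P \<in> F" "P' \<in> F" for P P'
 proof (rule d1)
  fix i
  have "mm P P' \<le> L" unfolding L_def using P F by (intro Max_ge) auto
  moreover have "P \<in> points" "P' \<in> points" using P F by auto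
  ultimately have "(var i * (h P * h P')) ^ (L - mm P P') * ((var i * (h P * h P')) ^ mm P P' * (h P' * c P - h P * c P')) \<in> I"
   by (intro I_D(3) mm)
  hence "(var i * (h P * h P')) ^ L * (h P' * c P - h P * c P') \<in> I"
   using `mm P P' \<le> L` by (simp flip: mult.assoc power_add)
  thus "var i ^ L * (H P' * C P - H P * C P') \<in> I" by (simp add: H_def C_def power_mult_distrib algebra_simps)
 qed
 have "\<exists>m. \<forall>i. var i ^ m \<in> igen (H ` F \<union> I)"
 proof (rule covering)
  show "\<exists>d. g \<in> homog d" if g: "g \<in> H ` F" for g
  proof -
   obtain P where "P \<in> points" "g = h P ^ Suc L" using g F by (auto simp: H_def)
   thus ?thesis using homog_power[OF h(1), of P "Suc L"] by metis
  qed
  show "\<exists>g\<in>H ` F. g ~: pull P" if "P \<in> points" for P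
   using cov[OF that] pull_power[OF that] unfolding H_def by blast
 qed
 then obtain k where k: "!!i. var i ^ k \<in> igen (H ` F \<union> I)" by blast
 have "\<exists>r. var i ^ k - (\<Sum>P\<in>F. r P * H P) \<in> I" for i
 proof -
  obtain F' r where r: "finite F'" "F' <= F" "var i ^ k - (\<Sum>P\<in>F'. r P * H P) \<in> I" using igen_finite_sum[OF k] by blast
  have "(\<Sum>P\<in>F'. r P * H P) = (\<Sum>P\<in>F. (if P \<in> F' then r P else 0) * H P)"
   using r F(1) by (intro sum.mono_neutral_cong_left) auto
  thus ?thesis using r(3) by (intro exI[of _ "%P. if P \<in> F' then r P else 0"]) simp
 qed
 then obtain r where r: "!!i. var i ^ k - (\<Sum>P\<in>F. r i P * H P) \<in> I" by metis
 \<comment> \<open>As var i^k is the sum of the r i P * H P modulo I, the section times var i^k is W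
   i. The quotients W i / var i^k agree pairwise, which is the hypothesis of
   \<open>depth_two\<close>.\<close>
 define W where "W i = (\<Sum>P\<in>F. r i P * C P)" for i
 have HW: "H P' * W i - var i ^ k * C P' \<in> I" if P': "P' \<in> F" for P' i
 proof -
  have "(\<Sum>P\<in>F. r i P * (H P' * C P - H P * C P')) - (var i ^ k - (\<Sum>P\<in>F. r i P * H P)) * C P' \<in> I"
   by (intro I_D(6) is_ideal_sum[OF ideal_I] I_D(3) I_D(4)[OF r] HC P')
  thus ?thesis by (simp add: W_def algebra_simps sum_distrib_left sum_distrib_right sum_subtractf)
 qed
 have "\<exists>y. \<forall>i. W i - var i ^ k * y \<in> I"
 proof (rule d2)
  fix i j
  have "(var i ^ k - (\<Sum>P\<in>F. r i P * H P)) * W j + (\<Sum>P\<in>F. r i P * (H P * W j - var j ^ k * C P)) \<in> I"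
   by (intro I_D(2) is_ideal_sum[OF ideal_I] I_D(3) I_D(4)[OF r] HW)
  moreover have "(var i ^ k - (\<Sum>P\<in>F. r i P * H P)) * W j + (\<Sum>P\<in>F. r i P * (H P * W j - var j ^ k * C P)) =
    var i ^ k * W j - var j ^ k * W i"
   by (simp add: W_def algebra_simps sum_distrib_left sum_distrib_right sum_subtractf)
  ultimately show "var i ^ k * W j - var j ^ k * W i \<in> I" by simp
 qed
 then obtain y0 where y0: "!!i. W i - var i ^ k * y0 \<in> I" by blast
 have Hy0: "H P * y0 - C P \<in> I" if P: "P \<in> F" for P
 proof (rule d1)
  fix i
  have "(H P * W i - var i ^ k * C P) - H P * (W i - var i ^ k * y0) \<in> I" by (intro I_D(6) I_D(3) HW P y0)
  thus "var i ^ k * (H P * y0 - C P) \<in> I" by (simp add: algebra_simps)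
 qed
 \<comment> \<open>y0 need not be homogeneous; its component of degree d satisfies the same
   relations because H P, C P and I are homogeneous.\<close>
 define y where "y = hcomp d y0"
 have Hy: "h P ^ L * (h P * y - c P) \<in> I" if P: "P \<in> F" for P
 proof -
  have Pp: "P \<in> points" using P F by auto
  have Hh: "H P \<in> homog (Suc L * e P)" unfolding H_def by (rule homog_power[OF h(1)[OF Pp]])
  have Ch: "C P \<in> homog (Suc L * e P + d)"
   unfolding C_def using homog_mult[OF homog_power[OF h(1)[OF Pp], of L] c[OF Pp]] by (simp add: ac_simps)
  have "hcomp (Suc L * e P + d) (H P * y0 - C P) = hcomp (Suc L * e P + d) (H P * y0) - hcomp (Suc L * e P + d) (C P)"
   by (rule poly_mapping_eqI) (simp add: lookup_minus)
  also have "\<dots> = H P * y - C P" by (simp add: hcomp_mult[OF Hh] hcomp_of_homog[OF Ch] y_def)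
  finally have "H P * y - C P \<in> I" using Hy0[OF P] hom_I unfolding hom_set_def by metis
  thus ?thesis by (simp add: H_def C_def algebra_simps)
 qed
 have "\<exists>t. t ~: pull P & t * (h P * y - c P) \<in> I" if P: "P \<in> points" for P
 proof -
  obtain P' where P': "P' \<in> F" "h P' ~: pull P" using cov[OF P] by blast
  hence P'p: "P' \<in> points" using F by auto
  obtain t where t: "t ~: pull P" "t * (h P' * c P - h P * c P') \<in> I"
   using compat[OF P P'p P h(2)[OF P] P'(2)] by blast
  have "t * h P * (h P' ^ L * (h P' * y - c P')) - h P' ^ L * (t * (h P' * c P - h P * c P')) \<in> I"
   by (intro I_D(6) I_D(3) Hy P' t)
  hence "(t * h P' ^ Suc L) * (h P * y - c P) \<in> I" by (simp add: algebra_simps)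
  moreover have "t * h P' ^ Suc L ~: pull P" using t P'(2) pull_prime[OF P] pull_power[OF P] by blast
  ultimately show ?thesis by blast
 qed
 moreover have "y \<in> homog d" by (simp add: y_def)
 ultimately show ?thesis by blast
qed

end

section \<open>Graded functionals from splittings\<close>

lemma (in graded_quot) homog_witness:
 assumes P: "P \<in> points" and w: "w \<in> homog e" and t: "t ~: pull P" "t * w \<in> I"
 shows "\<exists>t k. t \<in> homog k & t ~: pull P & t * w \<in> I"
proof -
 have "\<exists>k. hcomp k t ~: pull P"
  using is_ideal_sum[OF pull_is_ideal[OF P], of "{..tot_deg t}" "%d. hcomp d t"] t(1) sum_hcomp[of t "tot_deg t"] by auto
 then obtain k where k: "hcomp k t ~: pull P" by blast
 have "hcomp (e + k) (w * t) \<in> I" using t(2) hom_I by (auto simp: hom_set_def mult.commute)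
 hence "hcomp k t * w \<in> I" using hcomp_mult[OF w, of "e + k" t] by (simp add: mult.commute)
 thus ?thesis using k hcomp_homog by blast
qed

context fedder
begin

text \<open>The product satisfies Z = VF Z, which forces its components to vanish one after the
  other.\<close>

lemma wtimes_0: "wtimes 0 y = (0 :: ('n, 'k) mpoly witt)"
proof -
 define Z where "Z = wtimes (0 :: ('n, 'k) mpoly witt) y"
 have "wF (0 :: ('n, 'k) mpoly witt) = 0" "wshift (0 :: ('n, 'k) mpoly witt) = 0" "wscale (0 ^ p) y = 0"
  using p1 by (auto intro!: witt_eqI simp: wF_def wscale_def char_S power_0_left)
 hence Z: "Z = wV (wF Z)" using wtimes_F[OF p char_S, of 0 y] by (simp add: Z_def)
 have "wc Z i = 0" for i
 proof (induction i)
  case 0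
  show ?case by (subst Z) simp
 next
  case (Suc i)
  show ?case using p1 by (subst Z) (simp add: Suc.IH char_S power_0_left)
 qed
 thus ?thesis unfolding Z_def[symmetric] by (intro witt_eqI) simp
qed

lemma wtimes_teich_F: "wtimes (wF (teich c)) y = wscale (c ^ p) (y :: ('n, 'k) mpoly witt)"
proof -
 have "wshift (teich c) = (0 :: ('n, 'k) mpoly witt)" by (rule witt_eqI) simp
 thus ?thesis unfolding wtimes_F[OF p char_S] by (simp add: wtimes_0 wF_0[OF p char_S])
qed

text \<open>The section x / [s] over V.\<close>

definition wsec where "wsec n V s x = map (%i. \<lambda>P\<in>V. fr P (wc x i) (s ^ (p ^ i))) [0..<n]"

lemma wsec_carrier: assumes V: "openin T V" "V <= DD s" and s: "s \<in> homog w" and x: "x \<in> whom w"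
 shows "wsec n V s x \<in> carrier (Wn n V)"
proof -
 have "(\<lambda>P\<in>V. fr P (wc x i) (s ^ (p ^ i))) \<in> carrier (Sc V)" for i
 proof (rule sec_const[OF V(1)])
  show "wc x i \<in> homog (p ^ i * w)" using x by (simp add: whom_def)
  show "s ^ p ^ i \<in> homog (p ^ i * w)" by (rule homog_power[OF s])
  show "s ^ p ^ i ~: pull Q" if "Q \<in> V" for Q using V(2) that pull_power by (auto simp: DD_def)
 qed
 thus ?thesis by (simp add: carrier_Wn wsec_def)
qed

lemma wsec_wrep: assumes "openin T V" "V <= DD s" "s \<in> homog w" "x \<in> whom w" "P \<in> V"
 shows "wrep n V P s w x (wsec n V s x)"
 using wsec_carrier[OF assms(1-4)] assms by (auto simp: wrep_def wsec_def DD_def)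

lemma wrep_eqI: assumes V: "openin T V" and ab: "a \<in> carrier (Wn n V)" "b \<in> carrier (Wn n V)"
  and r: "!!P. P \<in> V ==> wrep n V P s w x a" "!!P. P \<in> V ==> wrep n V P s w x b" shows "a = b"
proof (rule nth_equalityI)
 show "length a = length b" using ab by (simp add: carrier_Wn)
 fix i assume "i < length a"
 hence i: "i < n" using ab by (simp add: carrier_Wn)
 show "a ! i = b ! i" by (rule sec_eqI[OF V]) (use ab i r in "auto simp: carrier_Wn wrep_def")
qed

lemma wsec_cong: assumes V: "openin T V" "V <= DD s" and s: "s \<in> homog w" and x: "x \<in> whom w" "y \<in> whom w"
  and c: "!!i. i < n ==> wc x i - wc y i \<in> I" shows "wsec n V s x = wsec n V s y"
proof -
 have "fr P (wc x i) (s ^ p ^ i) = fr P (wc y i) (s ^ p ^ i)" if P: "P \<in> V" and i: "i < n" for P i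
 proof (rule fr_eqI)
  show Pp: "P \<in> points" using V(1) P open_points by blast
  have "s ^ p ^ i ~: pull P" using V(2) P pull_power by (auto simp: DD_def)
  thus "vf P (wc x i) (s ^ p ^ i)" "vf P (wc y i) (s ^ p ^ i)"
   using x homog_power[OF s, of "p ^ i"] by (auto simp: whom_def intro: vfI)
  show "wc x i * s ^ p ^ i - wc y i * s ^ p ^ i \<in> I" using I_D(4)[OF c[OF i]] by (simp flip: left_diff_distrib)
 qed
 thus ?thesis by (simp add: wsec_def restrict_def fun_eq_iff)
qed

lemma wsec_scale:
 assumes V: "openin T V" "V <= DD s" "V <= DD c" and s: "s \<in> homog w" and x: "x \<in> whom w" and c: "c \<in> homog e"
 shows "wsec n V (c * s) (wscale c x) = wsec n V s x"
proof -
 have V': "V <= DD (c * s)" using V by (auto simp: DD_mult)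
 have m: "c * s \<in> homog (e + w)" "wscale c x \<in> whom (e + w)" by (intro homog_mult whom_wscale c s x)+
 show ?thesis
 proof (rule wrep_eqI[OF V(1)])
  show "wrep n V P (c * s) (e + w) (wscale c x) (wsec n V (c * s) (wscale c x))" if "P \<in> V" for P
   by (rule wsec_wrep[OF V(1) V' m that])
  show "wrep n V P (c * s) (e + w) (wscale c x) (wsec n V s x)" if "P \<in> V" for P
   by (rule wrep_scale[OF wsec_wrep[OF V(1,2) s x that] c]) (use V(3) that in "auto simp: DD_def")
 qed (rule wsec_carrier[OF V(1) V' m], rule wsec_carrier[OF V(1,2) s x])
qed

lemma wsec_res:
 assumes V: "openin T V" "V <= DD s" "openin T V'" "V' <= V" and s: "s \<in> homog w" and x: "x \<in> whom w"
 shows "map (res E V V') (wsec n V s x) = wsec n V' s x"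
proof -
 have "restrict (\<lambda>P\<in>V. fr P (wc x i) (s ^ p ^ i)) V' = (\<lambda>P\<in>V'. fr P (wc x i) (s ^ p ^ i))" for i
  using V(4) by (auto simp: fun_eq_iff)
 thus ?thesis by (simp add: wsec_def res_eq)
qed

end

locale fedder_hom = fedder p ys fs f I for p and ys :: "'k::field list" and fs :: "('n::finite, 'k) mpoly list" and f I +
 fixes n :: nat and psi assumes n: "n \<ge> 1" and len: "length fs + 2 \<le> CARD('n)"
  and psi_closed: "openin T V ==> b \<in> carrier (Wn n V) ==> psi V b \<in> carrier (Sc V)"
  and psi_add: "openin T V ==> b \<in> carrier (Wn n V) ==> c \<in> carrier (Wn n V) ==> psi V (b \<oplus>\<^bsub>Wn n V\<^esub> c) = psi V b \<oplus>\<^bsub>Sc V\<^esub> psi V c"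
  and psi_lin: "openin T V ==> a \<in> carrier (Wn n V) ==> b \<in> carrier (Wn n V) ==>
   psi V (witt_frob p (Sc V) a \<otimes>\<^bsub>Wn n V\<^esub> b) = (a ! 0) \<otimes>\<^bsub>Sc V\<^esub> psi V b"
  and psi_res: "openin T V ==> openin T V' ==> V' <= V ==> b \<in> carrier (Wn n V) ==> psi V' (map (res E V V') b) = res E V V' (psi V b)"
  and psi_frob: "openin T V ==> a \<in> carrier (Wn n V) ==> psi V (witt_frob p (Sc V) a) = a ! 0"
begin

text \<open>The argument on the left is F([c / s]) times y / [r^p], so linearity moves c / s out. To
  multiply over a common denominator, [c / s] is written as [c r] / [s r].\<close>

lemma psi_twist:
 assumes V: "openin T V" "V <= DD s" "V <= DD r" and h: "s \<in> homog e" "c \<in> homog e" "r \<in> homog d" "y \<in> whom (p * d)" and P: "P \<in> V"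
 shows "psi V (wsec n V ((s * r) ^ p) (wscale (c ^ p) y)) P = fr P c s \<otimes>\<^bsub>loc P\<^esub> psi V (wsec n V (r ^ p) y) P"
proof -
 define q where "q = s * r"
 define w where "w = teich (c * r)"
 have DDp: "DD a <= DD (a ^ p)" for a using pull_power by (auto simp: DD_def)
 have Vq: "V <= DD q" using V by (auto simp: q_def DD_mult)
 hence Vqp: "V <= DD (q ^ p)" "V <= DD (s ^ p)" "V <= DD (r ^ p)" using V DDp by blast+
 have q: "q \<in> homog (e + d)" "q ^ p \<in> homog (p * (e + d))" "w \<in> whom (e + d)"
  unfolding q_def w_def by (intro homog_mult homog_power whom_teich h)+
 have rp: "r ^ p \<in> homog (p * d)" "s ^ p \<in> homog (p * e)" "c ^ p \<in> homog (p * e)" by (intro homog_power h)+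
 define y' where "y' = wscale (s ^ p) y"
 have y': "y' \<in> whom (p * (e + d))" unfolding y'_def distrib_left by (intro whom_wscale rp h)
 have eq1: "wsec n V (q ^ p) y' = wsec n V (r ^ p) y"
  using wsec_scale[OF V(1) Vqp(3,2) rp(1) h(4) rp(2)] by (simp add: q_def y'_def power_mult_distrib)
 let ?a = "wsec n V q w"
 have ca: "?a \<in> carrier (Wn n V)" by (rule wsec_carrier[OF V(1) Vq q(1,3)])
 have cb: "wsec n V (q ^ p) y' \<in> carrier (Wn n V)" by (rule wsec_carrier[OF V(1) Vqp(1) q(2) y'])
 have z: "wscale (c ^ p) y \<in> whom (p * (e + d))" unfolding distrib_left by (intro whom_wscale rp h)
 have qq: "(q ^ p) ^ 2 = q ^ p * (s * r) ^ p" "wscale ((c * r) ^ p) y' = wscale (q ^ p) (wscale (c ^ p) y)"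
  by (simp_all add: q_def y'_def power2_eq_square wscale_wscale power_mult_distrib mult_ac)
 have R: "wrep n V Q (q ^ p * (s * r) ^ p) (2 * (p * (e + d))) (wscale (q ^ p) (wscale (c ^ p) y)) (witt_frob p (Sc V) ?a \<otimes>\<^bsub>Wn n V\<^esub> wsec n V (q ^ p) y')" if "Q \<in> V" for Q
  using wrep_mult[OF wrep_frob[OF wsec_wrep[OF V(1) Vq q(1,3) that]] wsec_wrep[OF V(1) Vqp(1) q(2) y' that]]
  unfolding w_def wtimes_teich_F qq .
 have V2: "V <= DD (q ^ p * (s * r) ^ p)" "V <= DD ((s * r) ^ p)" using Vqp(1) by (auto simp: DD_mult simp flip: q_def)
 have q2: "q ^ p * (s * r) ^ p \<in> homog (2 * (p * (e + d)))" "wscale (q ^ p) (wscale (c ^ p) y) \<in> whom (2 * (p * (e + d)))"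
  unfolding mult_2 q_def[symmetric] by (intro homog_mult q whom_wscale z)+
 have eq2: "witt_frob p (Sc V) ?a \<otimes>\<^bsub>Wn n V\<^esub> wsec n V (q ^ p) y' = wsec n V (q ^ p * (s * r) ^ p) (wscale (q ^ p) (wscale (c ^ p) y))"
 proof (rule wrep_eqI[OF V(1) _ _ R wsec_wrep[OF V(1) V2(1) q2]])
  show "witt_frob p (Sc V) ?a \<otimes>\<^bsub>Wn n V\<^esub> wsec n V (q ^ p) y' \<in> carrier (Wn n V)"
   using R[OF P] by (simp add: wrep_def)
 qed (rule wsec_carrier[OF V(1) V2(1) q2])
 have "wsec n V (q ^ p * (s * r) ^ p) (wscale (q ^ p) (wscale (c ^ p) y)) = wsec n V ((s * r) ^ p) (wscale (c ^ p) y)"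
  using wsec_scale[OF V(1) V2(2) Vqp(1) _ z q(2)] q(2) by (simp flip: q_def)
 with eq2 psi_lin[OF V(1) ca cb] have "psi V (wsec n V ((s * r) ^ p) (wscale (c ^ p) y)) = (?a ! 0) \<otimes>\<^bsub>Sc V\<^esub> psi V (wsec n V (r ^ p) y)"
  by (simp add: eq1)
 moreover have "(?a ! 0) P = fr P c s"
 proof -
  have Pp: "P \<in> points" using V(1) P open_points by blast
  have "s ~: pull P" "r ~: pull P" using V P by (auto simp: DD_def)
  with fr_cancel[OF Pp vfI[OF h(2,1)] h(3)] have "fr P (r * c) (r * s) = fr P c s" by blast
  thus ?thesis using n P by (simp add: wsec_def w_def q_def mult.commute)
 qed
 ultimately show ?thesis by (simp add: sec_at[OF P])
qed

text \<open>The germ at P of psi(x / [b^p]); by \<open>pval_cocycle\<close> it varies with b like y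
  / b for a fixed y.\<close>

definition pval where "pval b x P = psi (DD b) (wsec n (DD b) (b ^ p) x) P"

lemma DD_pow: "DD b <= DD (b ^ p)" using pull_power by (auto simp: DD_def)

lemma pval_res: assumes "openin T V" "V <= DD b" "b \<in> homog d" "x \<in> whom (p * d)" "P \<in> V"
 shows "psi V (wsec n V (b ^ p) x) P = pval b x P"
proof -
 have "map (res E (DD b) V) (wsec n (DD b) (b ^ p) x) = wsec n V (b ^ p) x"
  by (rule wsec_res[OF open_DD DD_pow assms(1,2) homog_power]) (use assms in auto)
 moreover have "wsec n (DD b) (b ^ p) x \<in> carrier (Wn n (DD b))"
  by (rule wsec_carrier[OF open_DD[OF assms(3)] DD_pow homog_power[OF assms(3)] assms(4)])
 note psi_res[OF open_DD[OF assms(3)] assms(1,2) this]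
 ultimately have "psi V (wsec n V (b ^ p) x) = res E (DD b) V (psi (DD b) (wsec n (DD b) (b ^ p) x))" by simp
 thus ?thesis using assms(5) by (simp add: pval_def res_eq)
qed

lemma pval_cocycle:
 assumes b: "b \<in> homog d" "b' \<in> homog d" and x: "x \<in> whom (p * d)" and P: "P \<in> DD b" "P \<in> DD b'"
 shows "pval b' x P = fr P b b' \<otimes>\<^bsub>loc P\<^esub> pval b x P"
proof -
 let ?V = "DD (b' * b)"
 have V: "openin T ?V" "?V <= DD b'" "?V <= DD b" "P \<in> ?V"
  using open_DD[OF homog_mult[OF b(2,1)]] P by (auto simp: DD_mult)
 have "wsec n ?V (b ^ p * b' ^ p) (wscale (b ^ p) x) = wsec n ?V (b' ^ p) x"
  by (rule wsec_scale[OF V(1) _ _ homog_power[OF b(2)] x homog_power[OF b(1)]]) (use V(2,3) DD_pow in blast)+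
 hence "wsec n ?V ((b' * b) ^ p) (wscale (b ^ p) x) = wsec n ?V (b' ^ p) x"
  by (simp add: power_mult_distrib mult.commute)
 with psi_twist[OF V(1,2,3) b(2,1) b(1) x V(4)] show ?thesis
  by (simp add: pval_res[OF V(1,2) b(2) x V(4)] pval_res[OF V(1,3) b(1) x V(4)])
qed

definition isphi where
 "isphi d x y \<longleftrightarrow> y \<in> homog d & (\<forall>P\<in>points. \<forall>b\<in>homog d. b ~: pull P --> pval b x P = fr P y b)"

lemma isphiI: assumes y: "y \<in> homog d" and x: "x \<in> whom (p * d)"
  and ex: "!!P. P \<in> points ==> \<exists>b\<in>homog d. b ~: pull P & pval b x P = fr P y b" shows "isphi d x y"
 unfolding isphi_def
proof (intro conjI y ballI impI)
 fix P b' assume P: "P \<in> points" and b': "b' \<in> homog d" "b' ~: pull P"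
 obtain b where b: "b \<in> homog d" "b ~: pull P" "pval b x P = fr P y b" using ex[OF P] by blast
 have "pval b' x P = fr P b b' \<otimes>\<^bsub>loc P\<^esub> fr P y b"
  using pval_cocycle[OF b(1) b'(1) x] P b b' by (simp add: DD_def)
 also have "\<dots> = fr P (b * y) (b' * b)" by (rule fr_mult[OF P]) (use b b' y in "auto intro: vfI")
 also have "\<dots> = fr P y b'" using fr_cancel[OF P vfI[OF y b'] b(1,2)] by (simp add: mult.commute)
 finally show "pval b' x P = fr P y b'" .
qed

abbreviation xp :: "'n => nat => ('n, 'k) mpoly" where "xp i d \<equiv> var i ^ d"

lemma point_power: "P \<in> points ==> \<exists>i. xp i d \<in> homog d & xp i d ~: pull P"
proof -
 assume P: "P \<in> points"
 then obtain i where "var i ~: pull P" using points_pull(3) by blast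
 thus ?thesis using pull_power[OF P] homog_power[OF var_homog, of i d] by (auto intro!: exI[of _ i])
qed

lemma isphi_ex: assumes x: "x \<in> whom (p * d)" shows "\<exists>y. isphi d x y"
proof -
 define loc where "loc P i g h a e k \<longleftrightarrow> xp i d ~: pull P & g \<in> homog e & g ~: pull P & DD g <= DD (xp i d) & a \<in> homog k & h \<in> homog k &
   (\<forall>Q\<in>DD g. h ~: pull Q & pval (xp i d) x Q = fr Q a h)" for P i g h a e k
 have "\<exists>i g h a e k. loc P i g h a e k" if P: "P \<in> points" for P
 proof -
  obtain i where i: "xp i d \<in> homog d" "xp i d ~: pull P" using point_power[OF P] by blast
  have o: "openin T (DD (xp i d))" by (rule open_DD[OF i(1)])
  have "psi (DD (xp i d)) (wsec n (DD (xp i d)) ((xp i d) ^ p) x) \<in> carrier (Sc (DD (xp i d)))"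
   by (rule psi_closed[OF o wsec_carrier[OF o DD_pow homog_power[OF i(1)] x]])
  moreover have "P \<in> DD (xp i d)" using P i by (simp add: DD_def)
  ultimately obtain g e a h k where "g \<in> homog e" "P \<in> DD g" "DD g <= DD (xp i d)" "a \<in> homog k" "h \<in> homog k"
   "\<forall>Q\<in>DD g. h ~: pull Q & psi (DD (xp i d)) (wsec n (DD (xp i d)) ((xp i d) ^ p) x) Q = fr Q a h"
   unfolding sec_iff[OF o] by meson
  hence "loc P i g h a e k" using i(2) unfolding loc_def pval_def by (simp add: DD_def)
  thus ?thesis by blast
 qed
 then obtain i g h a e k where loc: "!!P. P \<in> points ==> loc P (i P) (g P) (h P) (a P) (e P) (k P)" by metis
 have A: "!!P. P \<in> points ==> xp (i P) d ~: pull P" "!!P. P \<in> points ==> g P \<in> homog (e P)"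
  "!!P. P \<in> points ==> g P ~: pull P" "!!P. P \<in> points ==> DD (g P) <= DD (xp (i P) d)"
  "!!P. P \<in> points ==> a P \<in> homog (k P)" "!!P. P \<in> points ==> h P \<in> homog (k P)"
  "!!P Q. P \<in> points ==> Q \<in> DD (g P) ==> h P ~: pull Q & pval (xp (i P) d) x Q = fr Q (a P) (h P)"
  using loc unfolding loc_def by blast+
 define b where "b P = xp (i P) d" for P
 have b: "b P \<in> homog d" for P unfolding b_def using homog_power[OF var_homog, of "i P" d] by simp
 have gP: "P \<in> DD (g P)" if "P \<in> points" for P using A(3)[OF that] that by (simp add: DD_def)
 note val = A(7)[folded b_def] and gb = A(4)[folded b_def]
 \<comment> \<open>The extra factor g P in numerator and denominator makes the denominator vanish
   outside \<open>DD (g P)\<close>, the set on which the local fraction is valid.\<close>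
 have "\<exists>y\<in>homog d. \<forall>P\<in>points. \<exists>t. t ~: pull P & t * (g P * h P * y - b P * (g P * a P)) \<in> I"
 proof (rule global_section[OF len, where e = "%P. e P + k P"])
  fix P assume P: "P \<in> points"
  show "g P * h P \<in> homog (e P + k P)" by (intro homog_mult A P)
  show "g P * h P ~: pull P" using A(3)[OF P] val[OF P gP[OF P]] by (simp add: pull_prime[OF P])
  show "b P * (g P * a P) \<in> homog (e P + k P + d)"
   using homog_mult[OF b homog_mult[OF A(2)[OF P] A(5)[OF P]], of P] by (simp add: ac_simps)
 next
  fix P P' Q assume P: "P \<in> points" "P' \<in> points" and Q: "Q \<in> points" "g P * h P ~: pull Q" "g P' * h P' ~: pull Q"
  have QD: "Q \<in> DD (g P)" "Q \<in> DD (g P')" using Q by (auto simp: DD_def pull_prime)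
  have Qb: "Q \<in> DD (b P)" "Q \<in> DD (b P')" using QD gb P by blast+
  hence bQ: "b P' ~: pull Q" by (simp add: DD_def)
  have v: "vf Q (a P) (h P)" "vf Q (a P') (h P')" "vf Q (b P) (b P')"
   using val[OF P(1) QD(1)] val[OF P(2) QD(2)] A(5,6) P b bQ by (auto intro: vfI)
  have "fr Q (a P') (h P') = fr Q (b P * a P) (b P' * h P)"
   using pval_cocycle[OF b b x Qb] val[OF P(1) QD(1)] val[OF P(2) QD(2)] fr_mult[OF Q(1) v(3,1)] by simp
  then obtain t where t: "t ~: pull Q" "t * (a P' * (b P' * h P) - b P * a P * h P') \<in> I"
   unfolding fr_eq_iff[OF Q(1) v(2) vf_mult[OF Q(1) v(3,1)]] by blast
  have "- (g P * g P') * (t * (a P' * (b P' * h P) - b P * a P * h P')) \<in> I" by (rule I_D(3)[OF t(2)])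
  also have "- (g P * g P') * (t * (a P' * (b P' * h P) - b P * a P * h P')) =
    t * (g P' * h P' * (b P * (g P * a P)) - g P * h P * (b P' * (g P' * a P')))" by (simp add: algebra_simps)
  finally show "\<exists>t. t ~: pull Q & t * (g P' * h P' * (b P * (g P * a P)) - g P * h P * (b P' * (g P' * a P'))) \<in> I"
   using t(1) by blast
 qed
 then obtain y where y: "y \<in> homog d" "!!P. P \<in> points ==> \<exists>t. t ~: pull P & t * (g P * h P * y - b P * (g P * a P)) \<in> I" by blast
 have "isphi d x y"
 proof (rule isphiI[OF y(1) x])
  fix P assume P: "P \<in> points"
  have "g P * h P * y - b P * (g P * a P) \<in> homog (d + (e P + k P))"
   using homog_mult[OF homog_mult[OF A(2)[OF P] A(6)[OF P]] y(1)] homog_mult[OF b homog_mult[OF A(2)[OF P] A(5)[OF P]], of P]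
   by (intro homog_diff) (simp_all add: ac_simps)
  with y(2)[OF P] obtain t l where t: "t \<in> homog l" "t ~: pull P" "t * (g P * h P * y - b P * (g P * a P)) \<in> I"
   using homog_witness[OF P] by blast
  have hb: "h P ~: pull P" "pval (b P) x P = fr P (a P) (h P)" "b P ~: pull P"
   using val[OF P gP[OF P]] A(1)[OF P] by (auto simp: b_def)
  have v: "vf P (a P) (h P)" "vf P y (b P)" using hb A(5,6)[OF P] y(1) b by (auto intro: vfI)
  have "fr P (a P) (h P) = fr P y (b P)" unfolding fr_eq_iff[OF P v]
  proof (intro exI conjI)
   show "t * g P \<in> homog (l + e P)" by (intro homog_mult t A P)
   show "t * g P ~: pull P" using t A(3)[OF P] by (simp add: pull_prime[OF P])
   have "- (t * (g P * h P * y - b P * (g P * a P))) \<in> I" by (rule I_D(5)[OF t(3)])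
   thus "t * g P * (a P * b P - y * h P) \<in> I" by (simp add: algebra_simps)
  qed
  thus "\<exists>b\<in>homog d. b ~: pull P & pval b x P = fr P y b" using hb b by (intro bexI[of _ "b P"]) auto
 qed
 thus ?thesis by blast
qed

text \<open>Two values agree locally, so a power of every variable kills the difference modulo I,
  and \<open>depth_one\<close> applies.\<close>

lemma isphi_unique: assumes "isphi d x y" "isphi d x y'" shows "y - y' \<in> I"
proof -
 have h: "y \<in> homog d" "y' \<in> homog d" using assms by (auto simp: isphi_def)
 have "\<exists>m. \<forall>i. (var i * 1) ^ m * (y - y') \<in> I"
 proof (rule locally_zero[of 1 0])
  show "y - y' \<in> homog d" by (intro homog_diff h)
  fix P assume P: "P \<in> points"
  obtain i where i: "xp i d \<in> homog d" "xp i d ~: pull P" using point_power[OF P] by blast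
  have v: "vf P y (xp i d)" "vf P y' (xp i d)" using h i by (auto intro: vfI)
  have "fr P y (xp i d) = fr P y' (xp i d)" using assms P i by (metis isphi_def)
  then obtain t where t: "t ~: pull P" "t * (y * xp i d - y' * xp i d) \<in> I" unfolding fr_eq_iff[OF P v] by blast
  hence "t * xp i d ~: pull P" "(t * xp i d) * (y - y') \<in> I"
   using i by (auto simp: pull_prime[OF P] algebra_simps)
  thus "\<exists>t. t ~: pull P & t * (y - y') \<in> I" by blast
 qed simp
 thus ?thesis using depth_one[OF reg len I] by auto
qed

lemma isphi_add: assumes x: "x \<in> whom (p * d)" "x' \<in> whom (p * d)" and "isphi d x y" "isphi d x' y'"
 shows "isphi d (x + x') (y + y')"
proof (rule isphiI)
 show "y + y' \<in> homog d" using assms by (auto simp: isphi_def intro: homog_add)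
 show "x + x' \<in> whom (p * d)" by (intro whom_add x)
 fix P assume P: "P \<in> points"
 obtain i where i: "xp i d \<in> homog d" "xp i d ~: pull P" using point_power[OF P] by blast
 let ?b = "xp i d" let ?V = "DD ?b"
 have V: "openin T ?V" "?V <= DD (?b ^ p)" and PV: "P \<in> ?V" using open_DD[OF i(1)] DD_pow P i by (auto simp: DD_def)
 note bp = homog_power[OF i(1), of p]
 have "wsec n ?V (?b ^ p) (x + x') = wsec n ?V (?b ^ p) x \<oplus>\<^bsub>Wn n ?V\<^esub> wsec n ?V (?b ^ p) x'"
 proof (rule wrep_eqI[OF V(1)])
  show "wrep n ?V Q (?b ^ p) (p * d) (x + x') (wsec n ?V (?b ^ p) (x + x'))" if "Q \<in> ?V" for Q
   by (rule wsec_wrep[OF V bp whom_add[OF x] that])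
  show R: "wrep n ?V Q (?b ^ p) (p * d) (x + x') (wsec n ?V (?b ^ p) x \<oplus>\<^bsub>Wn n ?V\<^esub> wsec n ?V (?b ^ p) x')" if "Q \<in> ?V" for Q
   by (rule wrep_add[OF wsec_wrep[OF V bp x(1) that] wsec_wrep[OF V bp x(2) that]])
  show "wsec n ?V (?b ^ p) x \<oplus>\<^bsub>Wn n ?V\<^esub> wsec n ?V (?b ^ p) x' \<in> carrier (Wn n ?V)"
   using R[OF PV] by (simp add: wrep_def)
 qed (rule wsec_carrier[OF V bp whom_add[OF x]])
 hence "pval ?b (x + x') P = pval ?b x P \<oplus>\<^bsub>loc P\<^esub> pval ?b x' P"
  unfolding pval_def using psi_add[OF V(1) wsec_carrier[OF V bp x(1)] wsec_carrier[OF V bp x(2)]] by (simp add: sec_at[OF PV])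
 also have "\<dots> = fr P y ?b \<oplus>\<^bsub>loc P\<^esub> fr P y' ?b" using assms P i by (simp add: isphi_def)
 also have "\<dots> = fr P (y + y') ?b" using assms by (intro fr_add_same[OF P _ _ i]) (auto simp: isphi_def)
 finally show "\<exists>b\<in>homog d. b ~: pull P & pval b (x + x') P = fr P (y + y') b" using i by blast
qed

lemma isphi_scale: assumes x: "x \<in> whom (p * d)" and y: "isphi d x y" and c: "c \<in> homog e"
 shows "isphi (e + d) (wscale (c ^ p) x) (c * y)"
proof (rule isphiI)
 have yh: "y \<in> homog d" using y by (simp add: isphi_def)
 show "c * y \<in> homog (e + d)" by (intro homog_mult c yh)
 show "wscale (c ^ p) x \<in> whom (p * (e + d))" unfolding distrib_left by (intro whom_wscale homog_power c x)
 fix P assume P: "P \<in> points"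
 obtain i where i: "xp i d \<in> homog d" "xp i d ~: pull P" using point_power[OF P] by blast
 obtain j where j: "xp j e \<in> homog e" "xp j e ~: pull P" using point_power[OF P] by blast
 let ?s = "xp j e" let ?r = "xp i d" let ?V = "DD (?s * ?r)"
 have sr: "?s * ?r \<in> homog (e + d)" "?s * ?r ~: pull P" using i j by (auto simp: pull_prime[OF P] intro: homog_mult)
 have V: "openin T ?V" "?V <= DD ?s" "?V <= DD ?r" and PV: "P \<in> ?V"
  using open_DD[OF sr(1)] P sr(2) by (auto simp: DD_def pull_prime)
 have "pval (?s * ?r) (wscale (c ^ p) x) P = fr P c ?s \<otimes>\<^bsub>loc P\<^esub> fr P y ?r"
  using psi_twist[OF V j(1) c i(1) x PV] pval_res[OF V(1,3) i(1) x PV] y P i by (simp add: pval_def isphi_def)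
 also have "\<dots> = fr P (c * y) (?s * ?r)" by (rule fr_mult[OF P]) (use c j yh i in "auto intro: vfI")
 finally show "\<exists>b\<in>homog (e + d). b ~: pull P & pval b (wscale (c ^ p) x) P = fr P (c * y) b" using sr by blast
qed

lemma isphi_wF: assumes w: "w \<in> whom d" shows "isphi d (wF w) (wc w 0)"
proof (rule isphiI)
 show "wc w 0 \<in> homog d" using w by (auto simp: whom_def dest: spec[of _ 0])
 show "wF w \<in> whom (p * d)" by (rule whom_wF[OF w])
 fix P assume P: "P \<in> points"
 obtain i where i: "xp i d \<in> homog d" "xp i d ~: pull P" using point_power[OF P] by blast
 let ?b = "xp i d" let ?V = "DD ?b"
 have V: "openin T ?V" "?V <= DD (?b ^ p)" and PV: "P \<in> ?V" using open_DD[OF i(1)] DD_pow P i by (auto simp: DD_def)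
 have ca: "wsec n ?V ?b w \<in> carrier (Wn n ?V)" by (rule wsec_carrier[OF V(1) _ i(1) w]) simp
 have "witt_frob p (Sc ?V) (wsec n ?V ?b w) = wsec n ?V (?b ^ p) (wF w)"
 proof (rule wrep_eqI[OF V(1)])
  show R: "wrep n ?V Q (?b ^ p) (p * d) (wF w) (witt_frob p (Sc ?V) (wsec n ?V ?b w))" if "Q \<in> ?V" for Q
   by (rule wrep_frob[OF wsec_wrep[OF V(1) _ i(1) w that]]) simp
  show "wrep n ?V Q (?b ^ p) (p * d) (wF w) (wsec n ?V (?b ^ p) (wF w))" if "Q \<in> ?V" for Q
   by (rule wsec_wrep[OF V homog_power[OF i(1)] whom_wF[OF w] that])
  show "witt_frob p (Sc ?V) (wsec n ?V ?b w) \<in> carrier (Wn n ?V)" using R[OF PV] by (simp add: wrep_def)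
 qed (rule wsec_carrier[OF V homog_power[OF i(1)] whom_wF[OF w]])
 hence "pval ?b (wF w) P = (wsec n ?V ?b w ! 0) P" unfolding pval_def using psi_frob[OF V(1) ca] by simp
 also have "\<dots> = fr P (wc w 0) ?b" using n PV by (simp add: wsec_def)
 finally show "\<exists>b\<in>homog d. b ~: pull P & pval b (wF w) P = fr P (wc w 0) b" using i by blast
qed

lemma isphi_cong:
 assumes x: "x \<in> whom (p * d)" "x' \<in> whom (p * d)" and y: "isphi d x y" and c: "!!i. i < n ==> wc x i - wc x' i \<in> I"
 shows "isphi d x' y"
proof -
 have "pval b x' P = pval b x P" if "b \<in> homog d" for b P
  unfolding pval_def using wsec_cong[OF open_DD[OF that] DD_pow homog_power[OF that] x c] by simp
 thus ?thesis using y by (simp add: isphi_def)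
qed

end

section \<open>Inverse Frobenius linear maps modulo an ideal\<close>

context frob_dual
begin

text \<open>For fixed e, the map sending a to chi(a^p v_e) is of the same kind with k lowered by
  one, hence given by some g_e. With G the sum of the g_e^p vd_e, u(G a) is the sum of the g_e times
  the coordinates of a.\<close>

lemma representable: assumes J: "is_ideal J" and add: "!!a b. chi (a + b) - (chi a + chi b) \<in> J"
  and sc: "!!c a. chi (c ^ (p ^ k) * a) - c * chi a \<in> J"
 shows "\<exists>g. \<forall>a. (u ^^ k) (g * a) - chi a \<in> J" using add sc
proof (induction k arbitrary: chi)
 case 0
 have "(u ^^ 0) (chi 1 * a) - chi a \<in> J" for a using is_idealD(5)[OF J 0(2)[of a 1]] by (simp add: mult.commute)
 thus ?case by blast
next
 case (Suc k)
 have "\<exists>g. \<forall>a. (u ^^ k) (g * a) - chi (a ^ p * v e) \<in> J" for e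
 proof (rule Suc.IH)
  show "chi ((a + b) ^ p * v e) - (chi (a ^ p * v e) + chi (b ^ p * v e)) \<in> J" for a b
   using Suc.prems(1)[of "a ^ p * v e" "b ^ p * v e"] by (simp add: fr distrib_right)
  show "chi ((c ^ p ^ k * a) ^ p * v e) - c * chi (a ^ p * v e) \<in> J" for c a
   using Suc.prems(2)[of c "a ^ p * v e"] by (simp add: power_mult_distrib mult_ac flip: power_mult)
 qed
 hence "\<forall>e. \<exists>g. \<forall>a. (u ^^ k) (g * a) - chi (a ^ p * v e) \<in> J" by blast
 from choice[OF this] obtain g where g: "!!e a. (u ^^ k) (g e * a) - chi (a ^ p * v e) \<in> J" by blast
 have chi0: "chi 0 \<in> J" using is_idealD(5)[OF J Suc.prems(1)[of 0 0]] by simp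
 have chi_sum: "chi (sum f B) - (\<Sum>x\<in>B. chi (f x)) \<in> J" if "finite B" for f :: "'e => 'a" and B using that
 proof (induction B rule: finite_induct)
  case (insert x B)
  from is_idealD(2)[OF J Suc.prems(1)[of "f x" "sum f B"] insert.IH] show ?case
   using insert.hyps by (simp add: algebra_simps)
 qed (use chi0 in simp)
 define G where "G = (\<Sum>e\<in>E. g e ^ p * vd e)"
 have "(u ^^ Suc k) (G * a) - chi a \<in> J" for a
 proof -
  let ?c = "%e. u (a * vd e)"
  have "u (G * a) = (\<Sum>e\<in>E. g e * ?c e)"
   by (simp add: G_def sum_distrib_right u_sum mult.assoc u_pow) (simp add: mult.commute)
  hence "(u ^^ Suc k) (G * a) = (\<Sum>e\<in>E. (u ^^ k) (g e * ?c e))"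
   by (simp only: funpow_Suc_right o_apply up_sum)
  moreover have "(\<Sum>e\<in>E. (u ^^ k) (g e * ?c e) - chi (?c e ^ p * v e)) - (chi (\<Sum>e\<in>E. ?c e ^ p * v e) - (\<Sum>e\<in>E. chi (?c e ^ p * v e))) \<in> J"
   by (intro is_idealD(6)[OF J] is_ideal_sum[OF J] g chi_sum fin)
  ultimately show ?thesis by (simp add: sum_subtractf flip: expand[of a])
 qed
 thus ?case by blast
qed

end

context fedder
begin

lemma u_vd_e0: "u (vd (replicate (length ys) 0, 0)) = 1" using S.dual[OF S.e0(1) S.e0(1)] by (simp add: S.e0(2))

text \<open>\<open>u\<close> extracts the root from the product of a^p with the dual basis element
  of 1, and preserves homogeneity.\<close>

lemma homog_root: assumes "a ^ p \<in> homog (p * k)" shows "(a :: ('n, 'k) mpoly) \<in> homog k"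
proof -
 have "u (a ^ p * vd (replicate (length ys) 0, 0)) \<in> homog k"
  unfolding frob_u_eq using U_homog[OF homog_mult[OF assms vd_e0_homog]] .
 thus ?thesis by (simp add: S.u_pow u_vd_e0)
qed

lemma whom_wF_iff: "wF x \<in> whom (p * w) ==> x \<in> (whom w :: ('n, 'k) mpoly witt set)"
proof -
 assume "wF x \<in> whom (p * w)"
 hence "wc x i ^ p \<in> homog (p * (p ^ i * w))" for i unfolding whom_def by (simp add: char_S mult.left_commute)
 thus ?thesis unfolding whom_def using homog_root by blast
qed

lemma whom_tau: assumes a: "a \<in> homog w" shows "S.tau a \<in> (whom w :: ('n, 'k) mpoly witt set)"
 unfolding S.tau_def
proof (intro whom_sum whom_teich)
 fix e :: "nat list \<times> ('n \<Rightarrow>\<^sub>0 nat)" assume e: "e \<in> frob_index p ys"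
 obtain j m where jm: "e = (j, m)" by (cases e)
 have m: "!!i. lookup m i < p" using e jm by (auto simp: frob_index_def)
 let ?c = "u (a * vd e)"
 have bh: "frob_basis ys e \<in> (homog (mon_deg m) :: ('n, 'k) mpoly set)" by (auto simp: jm frob_basis_def intro: homog_single)
 have vh: "vd e \<in> (homog (mon_deg (mfun (%i. p - 1 - lookup m i))) :: ('n, 'k) mpoly set)"
  by (auto simp: jm vd_def frob_basis_def intro: homog_single)
 have sum: "mon_deg (mfun (%i. p - 1 - lookup m i)) + mon_deg m = (p - 1) * CARD('n)"
 proof -
  have "mfun (%i. p - 1 - lookup m i) + m = mtop p"
   by (rule poly_mapping_eqI) (use m in "simp add: lookup_add Suc_le_eq le_diff_conv2 p1 flip: less_Suc_eq_le")
  from arg_cong[OF this, of mon_deg] show ?thesis by (simp only: mon_deg_add mon_deg_mtop)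
 qed
 have key: "p * mon_deg m' + mon_deg m = w" if "m' \<in> keys ?c" for m'
 proof -
  have "msc p m' + mtop p \<in> keys (a * vd e)" using keys_U[of m' "a * vd e"] that unfolding frob_u_eq .
  hence "mon_deg (msc p m' + mtop p) = w + mon_deg (mfun (%i. p - 1 - lookup m i))"
   using homog_mult[OF a vh] unfolding homog_def by blast
  thus ?thesis using sum by (simp add: mon_deg_add)
 qed
 show "?c ^ p * frob_basis ys e \<in> homog w"
 proof (cases "keys ?c = {}")
  case True
  thus ?thesis using p1 by (simp add: power_0_left)
 next
  case False
  then obtain m0 where m0: "m0 \<in> keys ?c" by blast
  have "mon_deg m' = mon_deg m0" if "m' \<in> keys ?c" for m'
  proof -
   have "p * mon_deg m' = p * mon_deg m0" using key[OF that] key[OF m0] by linarith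
   thus ?thesis using p1 by simp
  qed
  hence "?c \<in> homog (mon_deg m0)" by (simp add: homog_def)
  from homog_mult[OF homog_power[OF this, of p] bh] show ?thesis using key[OF m0] by simp
 qed
qed

lemma whom_wVi: "x \<in> whom (p ^ i * w) ==> (wV ^^ i) x \<in> (whom w :: ('n, 'k) mpoly witt set)"
proof (induction i arbitrary: w)
 case (Suc i)
 have "(wV ^^ i) x \<in> whom (p * w)" using Suc by (simp add: mult_ac)
 thus ?case by (simp add: whom_wV)
qed simp

lemma wVi_add: "(wV ^^ i) (x + y) = (wV ^^ i) x + (wV ^^ i) (y :: ('n, 'k) mpoly witt)"
 by (induction i) (auto simp: wV_add[OF p char_S])

lemma wVi_wF: "(wV ^^ i) (wF x) = wF ((wV ^^ i) (x :: ('n, 'k) mpoly witt))"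
 by (induction i) (auto simp: wF_V[OF p char_S])

lemma wVi_wscale: "(wV ^^ i) (wscale (c ^ p ^ i) x) = wscale c ((wV ^^ i) (x :: ('n, 'k) mpoly witt))"
proof (induction i arbitrary: c)
 case (Suc i)
 have "(wV ^^ Suc i) (wscale (c ^ p ^ Suc i) x) = wV ((wV ^^ i) (wscale ((c ^ p) ^ p ^ i) x))" by (simp add: power_mult)
 thus ?case by (simp add: Suc.IH wscale_V char_S)
qed simp

lemma wc_wVi: "wc ((wV ^^ i) (x :: ('n, 'k) mpoly witt)) j = (if j < i then 0 else wc x (j - i))"
proof (induction i arbitrary: j)
 case (Suc i)
 thus ?case by (cases j) auto
qed simp

lemma wVi_0 [simp]: "(wV ^^ i) (0 :: ('n, 'k) mpoly witt) = 0" by (induction i) auto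

end

section \<open>The list of multipliers attached to a splitting\<close>

context fedder_hom
begin

text \<open>A choice of value, determined only modulo I; hence the laws for it are congruences
  modulo I.\<close>

definition ph where "ph d x = (SOME y. isphi d x y)"
definition Vt :: "nat => ('n, 'k) mpoly => ('n, 'k) mpoly witt" where "Vt i a = (wV ^^ i) (S.tau a)"

lemma ph: "x \<in> whom (p * d) ==> isphi d x (ph d x)" unfolding ph_def by (rule someI_ex[OF isphi_ex])

lemma ph_eq: "x \<in> whom (p * d) ==> isphi d x y ==> ph d x - y \<in> I" using isphi_unique ph by blast

lemma isphi_0: "isphi d 0 0"
proof -
 have "wF (0 :: ('n, 'k) mpoly witt) = 0" by (rule wF_0[OF p char_S])
 thus ?thesis using isphi_wF[of 0 d] by simp
qed

lemma ph_0: "ph d 0 \<in> I" using ph_eq[OF _ isphi_0, of d] by simp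

lemma Vt_0 [simp]: "Vt i 0 = 0" by (simp add: Vt_def)

lemma Vt_whom: "a \<in> homog (p ^ Suc i * d) ==> Vt i a \<in> whom (p * d)"
 unfolding Vt_def by (rule whom_wVi) (use whom_tau[of a "p ^ Suc i * d"] in "simp add: mult_ac")

text \<open>The defect of tau is VF z, so that of V^i tau is F w with w = V^(i+1) z. The functional
  sends F w to the zeroth component of w, which is 0; w is homogeneous because F w is.\<close>

lemma ph_Vt_add: assumes a: "a \<in> homog (p ^ Suc i * d)" "b \<in> homog (p ^ Suc i * d)"
 shows "ph d (Vt i (a + b)) - (ph d (Vt i a) + ph d (Vt i b)) \<in> I"
proof -
 obtain z where z: "S.tau a + S.tau b = S.tau (a + b) + wV (wF z)" using S.tau_add by blast
 define w where "w = (wV ^^ Suc i) z"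
 have ab: "a + b \<in> homog (p ^ Suc i * d)" by (rule homog_add[OF a])
 have eq: "Vt i a + Vt i b = Vt i (a + b) + wF w" using arg_cong[OF z, of "wV ^^ i"]
  by (simp add: Vt_def w_def wVi_add wVi_wF funpow_Suc_right wF_V[OF p char_S, symmetric] del: funpow.simps)
 have "Vt i a + Vt i b - Vt i (a + b) \<in> whom (p * d)" by (intro whom_diff whom_add Vt_whom a ab)
 hence Fw: "wF w \<in> whom (p * d)" by (simp add: eq)
 hence "isphi d (wF w) 0" using isphi_wF[OF whom_wF_iff[OF Fw]] by (simp add: w_def)
 from isphi_add[OF Vt_whom[OF ab] Fw ph[OF Vt_whom[OF ab]] this]
 have "isphi d (Vt i a + Vt i b) (ph d (Vt i (a + b)))" by (simp add: eq)
 from isphi_unique[OF this isphi_add[OF Vt_whom[OF a(1)] Vt_whom[OF a(2)] ph[OF Vt_whom[OF a(1)]] ph[OF Vt_whom[OF a(2)]]]]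
 show ?thesis .
qed

lemma ph_Vt_scale: assumes c: "c \<in> homog e" and a: "a \<in> homog (p ^ Suc i * d)"
 shows "ph (e + d) (Vt i (c ^ (p ^ Suc i) * a)) - c * ph d (Vt i a) \<in> I"
proof (rule ph_eq)
 have "c ^ (p ^ Suc i) * a \<in> homog (p ^ Suc i * e + p ^ Suc i * d)" by (intro homog_mult homog_power c a)
 thus "Vt i (c ^ (p ^ Suc i) * a) \<in> whom (p * (e + d))" by (intro Vt_whom) (simp add: distrib_left)
 have "S.tau ((c ^ p ^ i) ^ p * a) = wscale ((c ^ p) ^ p ^ i) (S.tau a)"
  unfolding S.tau_scale by (simp add: mult.commute flip: power_mult)
 moreover have "(c ^ p ^ i) ^ p = c ^ p ^ Suc i" by (simp add: mult.commute flip: power_mult)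
 ultimately have "S.tau (c ^ p ^ Suc i * a) = wscale ((c ^ p) ^ p ^ i) (S.tau a)" by simp
 hence "Vt i (c ^ (p ^ Suc i) * a) = wscale (c ^ p) (Vt i a)" unfolding Vt_def by (simp only: wVi_wscale)
 thus "isphi (e + d) (Vt i (c ^ (p ^ Suc i) * a)) (c * ph d (Vt i a))"
  using isphi_scale[OF Vt_whom[OF a] ph[OF Vt_whom[OF a]] c] by simp
qed

lemma ph_Vt_pow: assumes i: "i \<ge> 1" and b: "b \<in> homog (p ^ i * d)" shows "ph d (Vt i (b ^ p)) \<in> I"
proof -
 define w where "w = (wV ^^ i) (teich b)"
 have w: "w \<in> whom d" unfolding w_def by (intro whom_wVi whom_teich b)
 have "Vt i (b ^ p) = wF w" by (simp add: Vt_def w_def S.tau_pmon[OF S.pmon_pow_p] flip: wVi_wF S.wF_teich)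
 moreover have "wc w 0 = 0" using i by (simp add: w_def wc_wVi)
 ultimately show ?thesis using ph_eq[OF whom_wF[OF w] isphi_wF[OF w]] by simp
qed

text \<open>Only degrees divisible by p^(i+1) contribute: \<open>ph d\<close> takes Witt vectors of
  degree p d, and V^i tau(a) has degree deg(a) / p^i. The bound B is a parameter so that several
  elements can share one; beyond the total degree it does not matter modulo I.\<close>

definition chi where "chi i B a = (\<Sum>d\<le>B. ph d (Vt i (hcomp (p ^ Suc i * d) a)))"
abbreviation Chi where "Chi i a \<equiv> chi i (tot_deg a) a"

lemma diff_trans: "a - b \<in> I ==> b - c \<in> I ==> a - c \<in> I" using I_D(2)[of "a - b" "b - c"] by simp

lemma diff_sym: "a - b \<in> I ==> b - a \<in> I" using I_D(5)[of "a - b"] by simp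

lemma chi_B: assumes "tot_deg a \<le> B" shows "chi i B a - Chi i a \<in> I"
proof -
 have "(\<Sum>d\<in>{..B} - {..tot_deg a}. ph d (Vt i (hcomp (p ^ Suc i * d) a))) \<in> I"
 proof (rule is_ideal_sum[OF ideal_I])
  fix d assume "d \<in> {..B} - {..tot_deg a}"
  hence "tot_deg a < d" by auto
  also have "d \<le> p ^ Suc i * d" using p1 by simp
  finally have "hcomp (p ^ Suc i * d) a = 0" by (rule hcomp_eq_0)
  thus "ph d (Vt i (hcomp (p ^ Suc i * d) a)) \<in> I" by (simp add: ph_0)
 qed
 thus ?thesis unfolding chi_def using assms by (subst (asm) sum_diff) auto
qed

lemma Chi_add: "Chi i (a + b) - (Chi i a + Chi i b) \<in> I"
proof -
 define B where "B = Max {tot_deg a, tot_deg b, tot_deg (a + b)}"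
 have B: "tot_deg a \<le> B" "tot_deg b \<le> B" "tot_deg (a + b) \<le> B" by (auto simp: B_def)
 have "(\<Sum>d\<le>B. ph d (Vt i (hcomp (p ^ Suc i * d) a + hcomp (p ^ Suc i * d) b)) -
   (ph d (Vt i (hcomp (p ^ Suc i * d) a)) + ph d (Vt i (hcomp (p ^ Suc i * d) b)))) \<in> I"
  by (intro is_ideal_sum[OF ideal_I] ph_Vt_add hcomp_homog)
 hence "chi i B (a + b) - (chi i B a + chi i B b) \<in> I" by (simp add: chi_def hcomp_add sum_subtractf sum.distrib)
 from I_D(2)[OF I_D(6)[OF this chi_B[OF B(3), of i]] I_D(2)[OF chi_B[OF B(1), of i] chi_B[OF B(2), of i]]]
 show ?thesis by (simp add: algebra_simps)
qed

lemma Chi_scale_homog: assumes c: "c \<in> homog e" shows "Chi i (c ^ (p ^ Suc i) * a) - c * Chi i a \<in> I"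
proof -
 let ?q = "p ^ Suc i"
 define B where "B = Max {tot_deg a, tot_deg (c ^ ?q * a)}"
 have B: "tot_deg a \<le> B" "tot_deg (c ^ ?q * a) \<le> B + e" by (auto simp: B_def)
 have q0: "?q > 0" using p1 by simp
 let ?F = "%d. ph d (Vt i (hcomp (?q * d) (c ^ ?q * a)))"
 have cq: "c ^ ?q \<in> homog (?q * e)" by (rule homog_power[OF c])
 have hc: "hcomp (?q * d) (c ^ ?q * a) = (if e \<le> d then c ^ ?q * hcomp (?q * (d - e)) a else 0)" for d
  unfolding hcomp_mult[OF cq] using q0 by (simp add: diff_mult_distrib2 del: power_Suc)
 have split: "(\<Sum>d\<le>B + e. G d) = (\<Sum>d<e. G d) + (\<Sum>d\<le>B. G (e + d))" for G :: "nat => ('n, 'k) mpoly"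
  by (induction B) (auto simp: lessThan_Suc_atMost[symmetric] algebra_simps)
 have 1: "(\<Sum>d<e. ?F d) \<in> I" by (intro is_ideal_sum[OF ideal_I]) (simp add: hc ph_0 del: power_Suc)
 have 2: "(\<Sum>d\<le>B. ?F (e + d) - c * ph d (Vt i (hcomp (?q * d) a))) \<in> I"
 proof (rule is_ideal_sum[OF ideal_I])
  fix d
  have "hcomp (?q * (e + d)) (c ^ ?q * a) = c ^ ?q * hcomp (?q * d) a" unfolding hc by simp
  thus "?F (e + d) - c * ph d (Vt i (hcomp (?q * d) a)) \<in> I" using ph_Vt_scale[OF c hcomp_homog] by metis
 qed
 have "chi i (B + e) (c ^ ?q * a) - c * chi i B a \<in> I"
  using I_D(2)[OF 1 2] unfolding chi_def split by (simp add: sum_subtractf sum_distrib_left algebra_simps)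
 from I_D(2)[OF I_D(6)[OF this chi_B[OF B(2), of i]] I_D(3)[OF chi_B[OF B(1), of i], of c]]
 show ?thesis by (simp add: algebra_simps del: power_Suc)
qed

text \<open>c is built up from its homogeneous components, whose p^(i+1)-th powers add.\<close>

lemma Chi_scale: "Chi i (c ^ (p ^ Suc i) * a) - c * Chi i a \<in> I"
proof -
 let ?q = "p ^ Suc i"
 have "Chi i ((\<Sum>e\<in>B. hcomp e c) ^ ?q * a) - (\<Sum>e\<in>B. hcomp e c) * Chi i a \<in> I" if "finite B" for B
  using that
 proof (induction B rule: finite_induct)
  case empty
  thus ?case using Chi_scale_homog[of 0 0 i a] by simp
 next
  case (insert x B)
  let ?s = "\<Sum>e\<in>B. hcomp e c"
  have eq: "(\<Sum>e\<in>insert x B. hcomp e c) ^ ?q * a = hcomp x c ^ ?q * a + ?s ^ ?q * a"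
   by (simp only: sum.insert[OF insert.hyps] S.fr_pow distrib_right)
  have "(Chi i (hcomp x c ^ ?q * a + ?s ^ ?q * a) - (Chi i (hcomp x c ^ ?q * a) + Chi i (?s ^ ?q * a))) +
    ((Chi i (hcomp x c ^ ?q * a) - hcomp x c * Chi i a) + (Chi i (?s ^ ?q * a) - ?s * Chi i a)) \<in> I"
   by (intro I_D(2) Chi_add Chi_scale_homog[OF hcomp_homog] insert.IH)
  thus ?case unfolding eq using insert.hyps by (simp add: algebra_simps del: power_Suc)
 qed
 from this[of "{..tot_deg c}"] show ?thesis by (simp add: sum_hcomp del: power_Suc)
qed

lemma Chi_homog: assumes a: "a \<in> homog (p ^ Suc i * d)" shows "Chi i a - ph d (Vt i a) \<in> I"
proof -
 define B where "B = max (tot_deg a) d"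
 have q0: "p ^ Suc i > 0" using p1 by simp
 have t: "ph e (Vt i (hcomp (p ^ Suc i * e) a)) - (if e = d then ph d (Vt i a) else 0) \<in> I" for e
  using q0 ph_0 I_D(1) by (simp add: hcomp_of_homog[OF a] del: power_Suc)
 have "(\<Sum>e\<le>B. ph e (Vt i (hcomp (p ^ Suc i * e) a)) - (if e = d then ph d (Vt i a) else 0)) \<in> I"
  by (intro is_ideal_sum[OF ideal_I] t)
 hence "chi i B a - ph d (Vt i a) \<in> I" by (simp add: chi_def sum_subtractf B_def del: power_Suc)
 moreover have "tot_deg a \<le> B" by (simp add: B_def)
 ultimately show ?thesis using diff_trans[OF diff_sym[OF chi_B]] by blast
qed

lemma Chi_not_dvd: assumes a: "a \<in> homog w" and w: "\<not> p ^ Suc i dvd w" shows "Chi i a \<in> I"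
 unfolding chi_def
proof (rule is_ideal_sum[OF ideal_I])
 fix d
 have "hcomp (p ^ Suc i * d) a = 0" using w by (auto simp: hcomp_of_homog[OF a])
 thus "ph d (Vt i (hcomp (p ^ Suc i * d) a)) \<in> I" by (simp add: ph_0)
qed

lemma hcomp_pow: "hcomp (p * k) (c ^ p) = hcomp k (c :: ('n, 'k) mpoly) ^ p"
proof -
 define B where "B = max (tot_deg c) k"
 have "c ^ p = (\<Sum>e\<le>B. hcomp e c) ^ p" by (simp add: sum_hcomp B_def)
 also have "\<dots> = (\<Sum>e\<le>B. hcomp e c ^ p)" by (rule S.fr_sum)
 finally have "hcomp (p * k) (c ^ p) = (\<Sum>e\<le>B. if e = k then hcomp k c ^ p else 0)"
  using p1 by (auto simp: hcomp_sum hcomp_of_homog[OF homog_power[OF hcomp_homog]] intro!: sum.cong)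
 thus ?thesis by (simp add: B_def)
qed

lemma Chi_pow: "i \<ge> 1 ==> Chi i (c ^ p) \<in> I" unfolding chi_def
proof (rule is_ideal_sum[OF ideal_I])
 fix d assume i: "i \<ge> 1"
 have "hcomp (p ^ Suc i * d) (c ^ p) = hcomp (p ^ i * d) c ^ p" using hcomp_pow[of "p ^ i * d" c] by (simp add: mult.assoc)
 thus "ph d (Vt i (hcomp (p ^ Suc i * d) (c ^ p))) \<in> I" using ph_Vt_pow[OF i hcomp_homog] by simp
qed

text \<open>For i >= 1 the map kills p-th powers modulo I, so u(g) lies in I^[p^i]. Subtracting
  u(g)^p times the dual basis element of 1, which lies in I^[p^(i+1)], makes u(g) = 0 without
  changing the map modulo I.\<close>

lemma represented:
 "\<exists>g. (\<forall>a. (u ^^ Suc i) (g * a) - Chi i a \<in> I) & (i \<ge> 1 --> u g = 0)"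
proof -
 obtain g where g: "!!a. (u ^^ Suc i) (g * a) - Chi i a \<in> I"
  using S.representable[OF ideal_I Chi_add Chi_scale] by blast
 show ?thesis
 proof (cases "i \<ge> 1")
  case True
  let ?v = "vd (replicate (length ys) 0, 0)"
  have "(u ^^ i) (u g * c) \<in> I" for c
  proof -
   have "(u ^^ i) (u g * c) = (u ^^ Suc i) (g * c ^ p)" by (simp only: S.u_pow' funpow_Suc_right o_apply)
   moreover have "(u ^^ Suc i) (g * c ^ p) - Chi i (c ^ p) + Chi i (c ^ p) \<in> I"
    by (rule I_D(2)[OF g Chi_pow[OF True]])
   ultimately show ?thesis by (simp only: diff_add_cancel)
  qed
  hence "u g \<in> fpow (p ^ i) I" using S.fpow_iff_up[OF ideal_I] by blast
  from S.fpow_pow[OF this] have ug: "u g ^ p \<in> fpow (p ^ Suc i) I" by (simp add: mult.commute)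
  have "(u ^^ Suc i) ((g - u g ^ p * ?v) * a) - Chi i a \<in> I" for a
  proof -
   have "(u ^^ Suc i) (u g ^ p * ?v * a) \<in> I"
    by (rule S.up_fpow[OF ideal_I]) (intro is_idealD(4)[OF is_ideal_fpow] ug)
   from I_D(6)[OF g[of a] this] show ?thesis
    by (simp add: left_diff_distrib S.up_diff algebra_simps del: funpow.simps)
  qed
  moreover have "u (g - u g ^ p * ?v) = 0" by (rule S.u_ker_adjust)
  ultimately show ?thesis by blast
 qed (use g in blast)
qed

definition gg where "gg i = (SOME g. (\<forall>a. (u ^^ Suc i) (g * a) - Chi i a \<in> I) & (i \<ge> 1 --> u g = 0))"

lemma gg: "(u ^^ Suc i) (gg i * a) - Chi i a \<in> I" "i \<ge> 1 ==> u (gg i) = 0"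
 using someI_ex[OF represented[of i]] unfolding gg_def by blast+

definition gs where "gs = map gg [0..<n]"

lemma drop_gs: "i < n ==> drop i gs = gg i # drop (Suc i) gs"
 unfolding gs_def by (metis Cons_nth_drop_Suc length_map length_upt minus_nat.diff_0 nth_map_upt plus_nat.add_0)

text \<open>Downward induction on i: the list reproduces \<open>ph\<close> on V^i of homogeneous
  Witt vectors, and at i = n truncation makes both sides zero modulo I. In degrees not divisible by
  p^(i+1) there is no value of \<open>ph\<close> to compare with, and the list gives an element of
  I.\<close>

lemma Psi_drop: assumes "i \<le> n" "y \<in> whom w"
 shows "(\<forall>d. w = p ^ Suc i * d --> (u ^^ i) (S.Psi (drop i gs) y) - ph d ((wV ^^ i) y) \<in> I) &
  (\<not> p ^ Suc i dvd w --> (u ^^ i) (S.Psi (drop i gs) y) \<in> I)" using assms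
proof (induction "n - i" arbitrary: i y w)
 case 0
 hence i: "i = n" by simp
 have "ph d ((wV ^^ i) y) \<in> I" if w: "w = p ^ Suc i * d" for d
 proof -
  have V: "(wV ^^ i) y \<in> whom (p * d)" by (rule whom_wVi) (use 0 w in "simp add: mult_ac")
  have "isphi d ((wV ^^ i) y) 0" by (rule isphi_cong[OF whom_0 V isphi_0]) (simp add: wc_wVi i I_D(1))
  from ph_eq[OF V this] show ?thesis by simp
 qed
 thus ?case using i I_D(5) I_D(1) by (simp add: gs_def)
next
 case (Suc k)
 hence i: "i < n" by simp
 define y0 where "y0 = wc y 0"
 define y1 where "y1 = wshift (y - S.tau y0)"
 have y0: "y0 \<in> homog w" using Suc.prems(2) unfolding whom_def y0_def by (auto dest: spec[of _ 0])
 have y: "y = S.tau y0 + wV y1"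
 proof -
  have "wc (y - S.tau y0) 0 = 0" by (simp add: wc_0_diff[OF p char_S] y0_def)
  from wV_wshift[OF this] show ?thesis by (simp add: y1_def)
 qed
 have y1: "y1 \<in> whom (p * w)" unfolding y1_def by (intro whom_wshift whom_diff Suc.prems whom_tau y0)
 let ?R = "(u ^^ Suc i) (S.Psi (drop (Suc i) gs) y1)" and ?W = "(wV ^^ Suc i) y1" and ?G = "(u ^^ Suc i) (gg i * y0)"
 have eq: "(u ^^ i) (S.Psi (drop i gs) y) = ?G + ?R"
  unfolding drop_gs[OF i] S.Psi_eq[OF y] by (simp add: S.up_add funpow_Suc_right del: funpow.simps)
 have IH: "(\<forall>d. p * w = p ^ Suc (Suc i) * d --> ?R - ph d (?W) \<in> I) &
  (\<not> p ^ Suc (Suc i) dvd p * w --> ?R \<in> I)" by (rule Suc.hyps(1)) (use Suc.hyps(2) i y1 in auto)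
 show ?case
 proof (intro conjI allI impI)
  fix d assume w: "w = p ^ Suc i * d"
  have Vt: "Vt i y0 \<in> whom (p * d)" by (rule Vt_whom) (use y0 w in simp)
  have V1: "?W \<in> whom (p * d)" by (rule whom_wVi) (use y1 w in "simp add: mult_ac")
  have sum: "(wV ^^ i) y = Vt i y0 + ?W" by (subst y) (simp add: wVi_add Vt_def funpow_Suc_right del: funpow.simps)
  have "ph d ((wV ^^ i) y) - (ph d (Vt i y0) + ph d (?W)) \<in> I"
   unfolding sum by (rule ph_eq[OF whom_add[OF Vt V1] isphi_add[OF Vt V1 ph[OF Vt] ph[OF V1]]])
  moreover have "?G - ph d (Vt i y0) \<in> I" by (rule diff_trans[OF gg(1) Chi_homog]) (use y0 w in simp)
  moreover have "?R - ph d (?W) \<in> I" using IH w by (simp add: mult.assoc del: funpow.simps)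
  ultimately have "(?G - ph d (Vt i y0)) + (?R - ph d (?W)) -
   (ph d ((wV ^^ i) y) - (ph d (Vt i y0) + ph d (?W))) \<in> I" by (metis I_D(2,6))
  thus "(u ^^ i) (S.Psi (drop i gs) y) - ph d ((wV ^^ i) y) \<in> I" unfolding eq by (simp add: algebra_simps del: funpow.simps)
 next
  assume w: "\<not> p ^ Suc i dvd w"
  hence "\<not> p ^ Suc (Suc i) dvd p * w" using p1 by simp
  hence 1: "?R \<in> I" by (rule mp[OF conjunct2[OF IH]])
  have "?G \<in> I" using I_D(2)[OF gg(1)[of i y0] Chi_not_dvd[OF y0 w]] by (simp only: diff_add_cancel)
  thus "(u ^^ i) (S.Psi (drop i gs) y) \<in> I" unfolding eq by (rule I_D(2)[OF _ 1])
 qed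
qed

lemma Psi_drop_wideal_homog: assumes i: "i \<le> n" and y: "y \<in> whom w" "y \<in> wideal I"
 shows "(u ^^ i) (S.Psi (drop i gs) y) \<in> I"
proof (cases "p ^ Suc i dvd w")
 case True
 then obtain d where d: "w = p ^ Suc i * d" by blast
 have V: "(wV ^^ i) y \<in> whom (p * d)" by (rule whom_wVi) (use y d in "simp add: mult_ac")
 have "isphi d ((wV ^^ i) y) 0"
  by (rule isphi_cong[OF whom_0 V isphi_0]) (use y(2) I_D(1,5) in "simp add: wc_wVi wideal_def")
 from ph_eq[OF V this] have "ph d ((wV ^^ i) y) \<in> I" by simp
 moreover have "(u ^^ i) (S.Psi (drop i gs) y) - ph d ((wV ^^ i) y) \<in> I" using conjunct1[OF Psi_drop[OF i y(1)], THEN spec[of _ d]] d by (rule mp)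
 from I_D(2)[OF this `ph d ((wV ^^ i) y) \<in> I`] show ?thesis by simp
next
 case False
 with Psi_drop[OF i y(1)] show ?thesis by (rule mp[OF conjunct2])
qed

lemma length_gs: "length gs = n" by (simp add: gs_def)

lemma gs_tl: "\<forall>g\<in>set (tl (drop i gs)). u g = 0"
 by (auto simp: gs_def drop_map tl_upt gg(2) simp flip: map_tl)

text \<open>For an inhomogeneous element of W(I), the Teichmueller elements of the homogeneous
  components of its zeroth component are subtracted; the remainder is V of an element of W(I), left
  to the next tail.\<close>

lemma Psi_drop_wideal: "i \<le> n ==> y \<in> wideal I ==> (u ^^ i) (S.Psi (drop i gs) y) \<in> I"
proof (induction "n - i" arbitrary: i y)
 case 0
 hence "length gs \<le> i" using length_gs by linarith
 thus ?case using I_D(1) by simp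
next
 case (Suc k)
 hence i: "i < n" by simp
 note hom = S.Psi_homD[OF S.Psi_hom[OF gs_tl[of i]]]
 define y0 where "y0 = wc y 0"
 have y0: "y0 \<in> I" using Suc.prems(2) by (simp add: y0_def wideal_def)
 have hI: "hcomp e y0 \<in> I" for e using hom_I y0 by (simp add: hom_set_def)
 have tI: "teich a \<in> wideal I" if "a \<in> I" for a using that I_D(1) by (simp add: wideal_def teich_def)
 define D where "D = y - (\<Sum>e\<le>tot_deg y0. teich (hcomp e y0))"
 have DI: "D \<in> wideal I" unfolding D_def
  by (intro wideal_diff[OF prime_char_S ideal_I] wideal_sum[OF prime_char_S ideal_I] Suc.prems tI hI)
 have "wc D 0 = 0" by (simp add: D_def wc_0_diff[OF p char_S] wc_0_sum[OF p char_S] sum_hcomp y0_def)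
 hence D: "D = wV (wshift D)" by (simp add: wV_wshift)
 have "y = (\<Sum>e\<le>tot_deg y0. teich (hcomp e y0)) + wV (wshift D)" unfolding D[symmetric] by (simp add: D_def)
 hence "S.Psi (drop i gs) y = (\<Sum>e\<le>tot_deg y0. S.Psi (drop i gs) (teich (hcomp e y0))) + u (S.Psi (drop (Suc i) gs) (wshift D))"
  by (simp add: hom) (simp add: drop_gs[OF i] S.Psi_V)
 hence "(u ^^ i) (S.Psi (drop i gs) y) = (\<Sum>e\<le>tot_deg y0. (u ^^ i) (S.Psi (drop i gs) (teich (hcomp e y0)))) + (u ^^ Suc i) (S.Psi (drop (Suc i) gs) (wshift D))"
  by (simp add: S.up_add S.up_sum funpow_Suc_right del: funpow.simps)
 moreover have "(\<Sum>e\<le>tot_deg y0. (u ^^ i) (S.Psi (drop i gs) (teich (hcomp e y0)))) \<in> I"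
  by (rule is_ideal_sum[OF ideal_I], rule Psi_drop_wideal_homog[OF Suc.prems(1) whom_teich[OF hcomp_homog] tI[OF hI]])
 moreover have "(u ^^ Suc i) (S.Psi (drop (Suc i) gs) (wshift D)) \<in> I"
  by (rule Suc.hyps(1)) (use Suc.hyps(2) i DI in "auto simp: wideal_def")
 ultimately show ?case by (simp only: I_D(2))
qed

text \<open>The functional sends 1 = F(1) to 1, so u(gg 0) is 1 modulo I, and I lies in the
  irrelevant ideal.\<close>

lemma u_hd_gs: "u (hd gs) ~: M"
proof
 assume "u (hd gs) \<in> M"
 moreover have "hd gs = gg 0" using n by (simp add: gs_def hd_map)
 ultimately have M: "u (gg 0) \<in> M" by simp
 have one: "(1 :: ('n, 'k) mpoly) \<in> homog (p ^ Suc 0 * 0)" by simp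
 have "Vt 0 1 = wF (teich 1)" using S.tau_pmon[OF S.pmon_pow_p[of 1]] by (simp add: Vt_def S.wF_teich)
 hence "ph 0 (Vt 0 1) - 1 \<in> I" using ph_eq[OF Vt_whom[OF one]] isphi_wF[OF whom_teich[of 1 0]] by simp
 moreover have "u (gg 0) - ph 0 (Vt 0 1) \<in> I" using diff_trans[OF gg(1)[of 0 1] Chi_homog[OF one]] by simp
 ultimately have "u (gg 0) - 1 \<in> I" by (rule diff_trans[rotated])
 hence "u (gg 0) - (u (gg 0) - 1) \<in> M"  by (rule is_idealD(6)[OF is_ideal_igen M subsetD[OF I_sub_M]])
 thus False by (simp add: max_ideal_iff lookup_one)
qed

lemma Psi_exists:
 "\<exists>gs. length gs = n & (\<forall>g\<in>set (tl gs). u g = 0) & (\<forall>x\<in>wideal I. S.Psi gs x \<in> I) & u (hd gs) ~: M"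
 using gs_tl[of 0] Psi_drop_wideal[of 0] u_hd_gs by (intro exI[of _ gs]) (auto simp: gs_def)

end

section \<open>The equivalence for each n\<close>

context fedder
begin

lemma quasi_F_split_iff: assumes n: "n \<ge> 1" and len: "length fs + 2 \<le> CARD('n)"
 shows "quasi_F_split p n (proj_subscheme I) \<longleftrightarrow> \<not> I_seq p ys f I n <= frob_power p max_ideal"
proof
 assume "quasi_F_split p n (proj_subscheme I)"
 then obtain psi where psi: "witt_module_hom p n E psi"
  "!!V a. openin T V ==> a \<in> carrier (Wn n V) ==> psi V (witt_frob p (Sc V) a) = a ! 0"
  unfolding quasi_F_split_def proj_subscheme_eq spc_E by blast
 note hom = psi(1)[unfolded witt_module_hom_def spc_E Let_def, rule_format]
 interpret fedder_hom p ys fs f I n psi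
 proof
  fix V assume V: "openin T V"
  note h = hom[OF V]
  show "psi V b \<in> carrier (Sc V)" if "b \<in> carrier (Wn n V)" for b
   using conjunct1[OF h] that by (rule funcset_mem)
  show "psi V (b \<oplus>\<^bsub>Wn n V\<^esub> c) = psi V b \<oplus>\<^bsub>Sc V\<^esub> psi V c"
   if "b \<in> carrier (Wn n V)" "c \<in> carrier (Wn n V)" for b c using conjunct1[OF conjunct2[OF h]] that by blast
  show "psi V (witt_frob p (Sc V) a \<otimes>\<^bsub>Wn n V\<^esub> b) = (a ! 0) \<otimes>\<^bsub>Sc V\<^esub> psi V b"
   if "a \<in> carrier (Wn n V)" "b \<in> carrier (Wn n V)" for a b
   using conjunct1[OF conjunct2[OF conjunct2[OF h]]] that by blast
  show "psi V' (map (res E V V') b) = res E V V' (psi V b)"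
   if "openin T V'" "V' <= V" "b \<in> carrier (Wn n V)" for V' b
   using conjunct2[OF conjunct2[OF conjunct2[OF h]]] that by blast
 qed (rule n, rule len, rule psi(2))
 show "\<not> I_seq p ys f I n <= frob_power p max_ideal"
  unfolding fedder_height[OF n, symmetric] by (rule Psi_exists)
next
 assume "\<not> I_seq p ys f I n <= frob_power p max_ideal"
 then obtain gs where "length gs = n" "\<forall>g\<in>set (tl gs). u g = 0" "\<forall>x\<in>wideal I. S.Psi gs x \<in> I" "u (hd gs) ~: M"
  unfolding fedder_height[OF n, symmetric] by (elim exE conjE)
 thus "quasi_F_split p n (proj_subscheme I)" using n by (intro quasi_F_split_if_Psi)
qed

end

theorem theorem5p16:
  fixes p :: nat
    and ys :: "'k::field list"
    and fs :: "('n::finite, 'k) mpoly list"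
    and f :: "('n, 'k) mpoly"
    and I :: "('n, 'k) mpoly set"
  assumes "CHAR('k) = p" and "p > 0"
    and "F_finite p TYPE('k)" and "p_basis p ys"
    and "\<forall>g\<in>set fs. \<exists>d. g \<in> homog d"
    and "regular_seq fs"
    and "I = Idl\<^bsub>polyR\<^esub> (set fs)"
    and "f = prod_list fs"
    and "krull_dim (spc (proj_subscheme I)) \<ge> 1"
  shows "qfs_height p (proj_subscheme I) =
           Inf {enat n | n. n \<ge> 1 \<and> \<not> I_seq p ys f I n \<subseteq> frob_power p max_ideal}
    \<and> (tot_deg f = CARD('n) \<longrightarrow>
        (\<forall>D \<in> Delta1 p ys (f ^ (p - 1)) \<inter> homog (p * (p - 1) * CARD('n)).
          qfs_height p (proj_subscheme I) =
            Inf {enat n | n. n \<ge> 1 \<and>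
              f ^ (p - 1) * D ^ (\<Sum>i<n - 1. p ^ i) \<notin> frob_power (p ^ n) max_ideal}))"
proof -
 have pr: "prime p" using prime_CHAR_semidom[where 'a = 'k] assms(1,2) by simp
 interpret fedder p ys fs f I
 proof
  show "prime p" "CHAR('k) = p" "p_basis p ys" "\<forall>g\<in>set fs. \<exists>d. g \<in> homog d" "f = prod_list fs" by fact+
  show "reg_list fs" "igen (set fs) \<noteq> UNIV" using regular_seq_imp[OF assms(6)] by simp_all
  show "I = igen (set fs)" using assms(7) by (simp only: Idl_eq_igen)
 qed
 \<comment> \<open>Positive dimension enters here, in the form m + 2 <= N.\<close>
 have len: "length fs + 2 \<le> CARD('n)" using length_fs assms(9) by (simp add: proj_subscheme_eq spc_E)
 have 1: "qfs_height p (proj_subscheme I) =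
   Inf {enat n | n. n \<ge> 1 & \<not> I_seq p ys f I n <= frob_power p max_ideal}" unfolding qfs_height_def
  by (intro arg_cong[of _ _ Inf] Collect_cong ex_cong1 conj_cong refl quasi_F_split_iff len)
 have 2: "qfs_height p (proj_subscheme I) =
      Inf {enat n | n. n \<ge> 1 &
       f ^ (p - 1) * D ^ (\<Sum>i<n - 1. p ^ i) ~: frob_power (p ^ n) max_ideal}"
  if "tot_deg f = CARD('n)" "D \<in> Delta1 p ys (f ^ (p - 1))" "D \<in> homog (p * (p - 1) * CARD('n))" for D
 proof -
  interpret fedder_cy p ys fs f I D by unfold_locales (fact that)+
  show ?thesis unfolding 1 by (rule Inf_I_seq_eq)
 qed
 show ?thesis using 1 2 by blast
qed

end
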